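(* Let $F$ be a field of characteristic $0$, let $T$ be a finite abelian semigroup and let $L=\bigoplus_{t\in T}L^{(t)}$ be a finite dimensional $T$-graded Lie algebra over $F$. Then there exist a finite dimensional $T$-graded associative $F$-algebra $A=\bigoplus_{t\in T}A^{(t)}$ and a Lie monomorphism $\rho^{gr}:L\to A$ (i.e. an injective homomorphism of Lie algebras into $A$ with bracket $[a,b]=ab-ba$) such that $\rho^{gr}(L^{(t)})\subseteq A^{(t)}$ for all $t\in T$.
   Context: For a semigroup $T$ written multiplicatively, a $T$-grading on a Lie algebra $L$ (respectively an associative algebra $A$) is a vector space decomposition $L=\bigoplus_{t\in T}L^{(t)}$ with $[L^{(s)},L^{(t)}]\subseteq L^{(st)}$ (respectively $A=\bigoplus_{t\in T}A^{(t)}$ with $A^{(s)}A^{(t)}\subseteq A^{(st)}$) for all $s,t\in T$. *)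

theory Defs
  imports Complex_Main "HOL-Library.Function_Algebras"
begin

text \<open>
  Algebras live on a subspace \<open>V\<close> of an ambient vector space type. Nothing is assumed about
  the value of the product outside \<open>V\<close>, and no unit is required.
\<close>

locale algebra_on = vector_space scale
  for scale :: "'f::field \<Rightarrow> 'v::ab_group_add \<Rightarrow> 'v"
    and V :: "'v set"
    and prd :: "'v \<Rightarrow> 'v \<Rightarrow> 'v" +
  assumes subspace_carrier: "subspace V"
    and prd_closed: "x \<in> V \<Longrightarrow> y \<in> V \<Longrightarrow> prd x y \<in> V"
    and prd_add_left: "x \<in> V \<Longrightarrow> y \<in> V \<Longrightarrow> z \<in> V \<Longrightarrow> prd (x + y) z = prd x z + prd y z"
    and prd_add_right: "x \<in> V \<Longrightarrow> y \<in> V \<Longrightarrow> z \<in> V \<Longrightarrow> prd x (y + z) = prd x y + prd x z"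
    and prd_scale_left: "x \<in> V \<Longrightarrow> y \<in> V \<Longrightarrow> prd (scale c x) y = scale c (prd x y)"
    and prd_scale_right: "x \<in> V \<Longrightarrow> y \<in> V \<Longrightarrow> prd x (scale c y) = scale c (prd x y)"

locale assoc_algebra_on = algebra_on +
  assumes prd_assoc: "x \<in> V \<Longrightarrow> y \<in> V \<Longrightarrow> z \<in> V \<Longrightarrow> prd (prd x y) z = prd x (prd y z)"

locale lie_algebra_on = algebra_on +
  assumes alternating: "x \<in> V \<Longrightarrow> prd x x = 0"
    and jacobi: "x \<in> V \<Longrightarrow> y \<in> V \<Longrightarrow> z \<in> V \<Longrightarrow>
      prd x (prd y z) + prd y (prd z x) + prd z (prd x y) = 0"

definition finite_dimensional_on :: "('f::field \<Rightarrow> 'v::ab_group_add \<Rightarrow> 'v) \<Rightarrow> 'v set \<Rightarrow> bool" where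
  "finite_dimensional_on scale V \<longleftrightarrow> (\<exists>B. finite B \<and> module.span scale B = V)"

text \<open>The semigroup is a finite type, so the direct sum needs no finite-support condition.\<close>

locale graded_algebra_on = algebra_on scale V prd
  for scale :: "'f::field \<Rightarrow> 'v::ab_group_add \<Rightarrow> 'v"
    and V :: "'v set"
    and prd :: "'v \<Rightarrow> 'v \<Rightarrow> 'v"
    and G :: "'t::{finite,semigroup_mult} \<Rightarrow> 'v set" +
  assumes subspace_component: "subspace (G t)"
    and component_subset: "G t \<subseteq> V"
    and direct_sum: "v \<in> V \<Longrightarrow> \<exists>!x. (\<forall>t. x t \<in> G t) \<and> v = (\<Sum>t\<in>UNIV. x t)"
    and prd_component: "x \<in> G s \<Longrightarrow> y \<in> G t \<Longrightarrow> prd x y \<in> G (s * t)"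

locale lie_algebra_hom_on =
  dom: lie_algebra_on scale\<^sub>1 V\<^sub>1 br\<^sub>1 + cod: lie_algebra_on scale\<^sub>2 V\<^sub>2 br\<^sub>2
  for scale\<^sub>1 :: "'f::field \<Rightarrow> 'v::ab_group_add \<Rightarrow> 'v" and V\<^sub>1 br\<^sub>1
    and scale\<^sub>2 :: "'f \<Rightarrow> 'w::ab_group_add \<Rightarrow> 'w" and V\<^sub>2 br\<^sub>2
    and \<rho> :: "'v \<Rightarrow> 'w" +
  assumes hom_closed: "x \<in> V\<^sub>1 \<Longrightarrow> \<rho> x \<in> V\<^sub>2"
    and hom_add: "x \<in> V\<^sub>1 \<Longrightarrow> y \<in> V\<^sub>1 \<Longrightarrow> \<rho> (x + y) = \<rho> x + \<rho> y"
    and hom_scale: "x \<in> V\<^sub>1 \<Longrightarrow> \<rho> (scale\<^sub>1 c x) = scale\<^sub>2 c (\<rho> x)"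
    and hom_bracket: "x \<in> V\<^sub>1 \<Longrightarrow> y \<in> V\<^sub>1 \<Longrightarrow> \<rho> (br\<^sub>1 x y) = br\<^sub>2 (\<rho> x) (\<rho> y)"

definition commutator :: "('v::ab_group_add \<Rightarrow> 'v \<Rightarrow> 'v) \<Rightarrow> 'v \<Rightarrow> 'v \<Rightarrow> 'v" where
  "commutator prd x y = prd x y - prd y x"

lemma (in assoc_algebra_on) lie_algebra_commutator:
  "lie_algebra_on scale V (commutator prd)"
proof -
  have diff: "x - y \<in> V" if "x \<in> V" "y \<in> V" for x y
    using that subspace_carrier subspace_diff by blast
  have dl: "prd (x - y) z = prd x z - prd y z" if "x \<in> V" "y \<in> V" "z \<in> V" for x y z
    using prd_add_left[OF diff[OF that(1,2)] that(2,3)] by simp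
  have dr: "prd z (x - y) = prd z x - prd z y" if "x \<in> V" "y \<in> V" "z \<in> V" for x y z
    using prd_add_right[OF that(3) diff[OF that(1,2)] that(2)] by simp
  show ?thesis
    by unfold_locales
      (simp_all add: commutator_def subspace_carrier diff dl dr prd_closed prd_add_left
        prd_add_right prd_scale_left prd_scale_right prd_assoc scale_right_diff_distrib)
qed

text \<open>
  Existence of an algebra cannot quantify over types. Subspaces of \<open>nat \<Rightarrow> 'f\<close> with the pointwise
  operations represent all finite dimensional vector spaces over \<open>'f\<close> up to isomorphism; the
  product of an algebra on such a subspace is arbitrary and unrelated to the pointwise product.
\<close>

definition fun_scale :: "'f::field \<Rightarrow> (nat \<Rightarrow> 'f) \<Rightarrow> nat \<Rightarrow> 'f" where
  "fun_scale c f = (\<lambda>i. c * f i)"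

lemma vector_space_fun_scale: "vector_space fun_scale"
  by unfold_locales (auto simp: fun_scale_def algebra_simps)

end

theory Submission
  imports Defs "HOL-Algebra.Algebraic_Closure_Type"
begin

text \<open>
  The graded statement follows from Ado's theorem: if the representations in a finite family \<open>F\<close>
  have zero common kernel on \<open>L\<close>, then \<open>x = \<Sum>x\<^sub>t\<close> is sent to the function \<open>(t, r) \<mapsto> r x\<^sub>t\<close> on
  \<open>T \<times> F\<close> under the convolution product of the semigroup algebra. This is injective and graded; it
  respects brackets because \<open>T\<close> is commutative.

  For Ado's theorem in characteristic zero it suffices, the adjoint representation having the
  centre as its kernel, to find for each central \<open>z \<noteq> 0\<close> a representation that does not kill \<open>z\<close>.
  Let \<open>R\<close> be the radical and \<open>N = [L, R] + Fz\<close>, an ideal acting nilpotently on \<open>L\<close>. Start with a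
  nilpotent representation of the line \<open>Fz\<close> and enlarge its domain one dimension at a time through
  \<open>N\<close> up to \<open>R\<close>, and then by a Levi complement. If \<open>M = S + K\<close> is a semidirect sum with
  \<open>[S, K] \<subseteq> I \<subseteq> K\<close> and \<open>\<rho>\<close> is a representation of \<open>K\<close> that is nilpotent on \<open>I\<close>, each enlargement finds
  a finite dimensional \<open>M\<close>-submodule in the representation coinduced from \<open>\<rho>\<close>; nilpotency on \<open>I\<close> is what
  makes it finite dimensional. The Levi complement rests on Cartan's criterion and the Casimir element.
\<close>

text \<open>An operator on a graded space has no degree of its own when the semigroup lacks
  cancellation, so a grading of L cannot simply be carried over to End W. The representations
  therefore ignore the grading, and the degree travels in a separate semigroup coordinate.

  In Ado's theorem the obstacle is that linear maps on the enveloping algebra of S form an infinite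
  dimensional module. Nilpotency of \<rho> on I gives the values a finite filtration. Because [S, K]
  and [K, I] lie in I, an element k acts, modulo the next level, as pointwise multiplication by
  \<rho>(k). The errors come from finitely many parameters and sit one level lower, so repeating the
  correction stops after as many rounds as there are levels.

  The line Fz is put into N so that the chain of enlargements can start from z with a representation
  that is nonzero and still nilpotent on the part inside N.

  F need not contain eigenvalues. Lie's theorem is replaced by trace arguments, and only Cartan's
  criterion passes to the algebraic closure.\<close>

section \<open>Finite dimensional subspaces\<close>

text \<open>Containment in a finite span, not equality with one, so that subspaces inherit the
  property by transitivity alone. \<open>fd_iff\<close> recovers the notion of the
  statement.\<close>

definition fd :: "('f::field \<Rightarrow> 'v::ab_group_add \<Rightarrow> 'v) \<Rightarrow> 'v set \<Rightarrow> bool" where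
  "fd s V \<longleftrightarrow> module.subspace s V \<and> (\<exists>B. finite B \<and> V \<subseteq> module.span s B)"

context vector_space
begin

lemma fdI: "subspace V \<Longrightarrow> finite B \<Longrightarrow> V \<subseteq> span B \<Longrightarrow> fd scale V"
  by (auto simp: fd_def)

lemma fd_iff: "fd scale V \<longleftrightarrow> finite_dimensional_on scale V"
proof
  assume "fd scale V"
  then obtain B where B: "subspace V" "finite B" "V \<subseteq> span B"
    by (auto simp: fd_def)
  obtain C where C: "C \<subseteq> V" "independent C" "V \<subseteq> span C" "card C = dim V"
    by (rule basis_exists)
  have "finite C"
    using independent_span_bound[OF B(2) C(2)] C(1) B(3) by blast
  moreover have "span C = V"
    using C B(1) span_subspace by blast
  ultimately show "finite_dimensional_on scale V"
    by (auto simp: finite_dimensional_on_def)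
next
  assume "finite_dimensional_on scale V"
  then obtain B where "finite B" "span B = V"
    by (auto simp: finite_dimensional_on_def)
  then show "fd scale V"
    by (auto simp: fd_def)
qed

lemma fd_subspaceD: "fd scale V \<Longrightarrow> subspace V"
  by (simp add: fd_def)

lemma fd_subset: "fd scale V \<Longrightarrow> subspace U \<Longrightarrow> U \<subseteq> V \<Longrightarrow> fd scale U"
  unfolding fd_def by blast

lemma fd_span: "finite B \<Longrightarrow> fd scale (span B)"
  by (auto simp: fd_def)

lemma fd_zero: "fd scale {0}"
  using fd_span[of "{}"] by simp

lemma fd_basis:
  assumes "fd scale V"
  obtains B where "finite B" "independent B" "B \<subseteq> V" "span B = V" "card B = dim V"
proof -
  obtain A where A: "subspace V" "finite A" "V \<subseteq> span A"
    using assms by (auto simp: fd_def)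
  obtain C where C: "C \<subseteq> V" "independent C" "V \<subseteq> span C" "card C = dim V"
    by (rule basis_exists)
  have "finite C"
    using independent_span_bound[OF A(2) C(2)] C(1) A(3) by blast
  moreover have "span C = V"
    using C A(1) span_subspace by blast
  ultimately show thesis using that C by blast
qed

lemma fd_dim_mono:
  assumes "fd scale V" "U \<subseteq> V"
  shows "dim U \<le> dim V"
proof -
  obtain B where B: "finite B" "independent B" "B \<subseteq> V" "span B = V" "card B = dim V"
    using fd_basis[OF assms(1)] .
  show ?thesis
    using dim_le_card[of U B] B assms(2) by simp
qed

lemma fd_dim_eq:
  assumes "fd scale V" "subspace U" "U \<subseteq> V" "dim V \<le> dim U"
  shows "U = V"
proof (rule ccontr)
  assume "U \<noteq> V"
  then obtain v where v: "v \<in> V" "v \<notin> U" using assms(3) by blast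
  obtain B where B: "finite B" "independent B" "B \<subseteq> U" "span B = U" "card B = dim U"
    using fd_basis[OF fd_subset[OF assms(1-3)]] .
  obtain C where C: "finite C" "independent C" "C \<subseteq> V" "span C = V" "card C = dim V"
    using fd_basis[OF assms(1)] .
  have ind: "independent (insert v B)"
    using B v by (intro independent_insertI) auto
  have "insert v B \<subseteq> span C"
    using B C v assms(3) by auto
  from independent_span_bound[OF C(1) ind this] have "card (insert v B) \<le> card C" by simp
  moreover have "v \<notin> B" using B v by auto
  ultimately show False using B C assms(4) by simp
qed

lemma fd_dim_less: "fd scale V \<Longrightarrow> subspace U \<Longrightarrow> U \<subseteq> V \<Longrightarrow> U \<noteq> V \<Longrightarrow> dim U < dim V"
  using fd_dim_eq[of V U] by force

lemma fd_sum:
  assumes "fd scale U" "fd scale V"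
  shows "fd scale {u + v | u v. u \<in> U \<and> v \<in> V}"
proof -
  obtain A B where "finite A" "span A = U" "finite B" "span B = V"
    using fd_basis assms by metis
  then show ?thesis
    using fd_span[of "A \<union> B"] span_Un[of A B] by simp
qed

lemma fd_maximal:
  assumes "fd scale V" "P U0" "\<And>U. P U \<Longrightarrow> subspace U \<and> U \<subseteq> V"
  obtains U where "P U" "\<And>U'. P U' \<Longrightarrow> U \<subseteq> U' \<Longrightarrow> U' = U"
proof -
  obtain U where U: "P U" "\<forall>U'. P U' \<longrightarrow> dim U' \<le> dim U"
    using ex_has_greatest_nat[of P U0 dim "Suc (dim V)"] assms(2,3) fd_dim_mono[OF assms(1)]
    by (auto simp: less_Suc_eq_le)
  have "U' = U" if "P U'" "U \<subseteq> U'" for U'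
    using fd_dim_eq[of U' U] U that assms(3)[OF U(1)] fd_subset[OF assms(1)] assms(3)[OF that(1)] by auto
  with U(1) show thesis by (rule that)
qed

lemma fd_minimal:
  assumes "fd scale V" "P U0" "\<And>U. P U \<Longrightarrow> subspace U \<and> U \<subseteq> V"
  obtains U where "P U" "\<And>U'. P U' \<Longrightarrow> U' \<subseteq> U \<Longrightarrow> U' = U"
proof -
  obtain U where U: "P U" "\<forall>U'. P U' \<longrightarrow> dim U \<le> dim U'"
    using ex_has_least_nat[of P U0 dim] assms(2) by blast
  have "U' = U" if "P U'" "U' \<subseteq> U" for U'
    using fd_dim_eq[of U U'] U that assms(3)[OF U(1)] fd_subset[OF assms(1)] assms(3)[OF that(1)] by auto
  with U(1) show thesis by (rule that)
qed

text \<open>Applied to spans of high powers and to images of powers, stabilisation does the work of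
  minimal polynomials and of Fitting's lemma below.\<close>

lemma fd_chain:
  fixes S :: "nat \<Rightarrow> 'b set"
  assumes "fd scale V" "\<And>n. subspace (S n)" "\<And>n. S n \<subseteq> V" "\<And>n. S (Suc n) \<subseteq> S n"
  obtains n where "\<And>m. n \<le> m \<Longrightarrow> S m = S n"
proof -
  obtain U where U: "\<exists>n. U = S n" "\<And>U'. \<exists>n. U' = S n \<Longrightarrow> U' \<subseteq> U \<Longrightarrow> U' = U"
    using fd_minimal[OF assms(1), of "\<lambda>U. \<exists>n. U = S n" "S 0"] assms by blast
  then obtain n where n: "U = S n" by blast
  have "S m \<subseteq> S n" if "n \<le> m" for m
    using lift_Suc_antimono_le[of S] assms(4) that by blast
  then have "S m = S n" if "n \<le> m" for m
    using U(2)[of "S m"] n that by auto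
  then show thesis by (rule that)
qed

lemma dim_zero_iff: "fd scale V \<Longrightarrow> dim V = 0 \<longleftrightarrow> V = {0}"
proof
  assume "fd scale V" "dim V = 0"
  then show "V = {0}" using fd_dim_eq[of V "{0}"] by (auto dest: fd_subspaceD simp: subspace_0)
next
  assume "V = {0}"
  then show "dim V = 0" using dim_le_card[of V "{}"] by simp
qed

lemma linear_self_iff: "Vector_Spaces.linear scale scale f \<longleftrightarrow>
    (\<forall>x y. f (x + y) = f x + f y) \<and> (\<forall>c x. f (scale c x) = scale c (f x))"
  using vector_space_axioms by (auto simp: Vector_Spaces.linear_iff)

text \<open>The image of \<open>V\<close> under \<open>p\<close> is a model of V / I inside the same
  type, so quotients of Lie algebras and of modules need no quotient type.\<close>

lemma projection_exists:
  assumes "subspace V" "subspace I" "I \<subseteq> V"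
  obtains p where "Vector_Spaces.linear scale scale p" "p ` V \<subseteq> V"
    "\<And>x. x \<in> I \<Longrightarrow> p x = 0" "\<And>x. x \<in> V \<Longrightarrow> x - p x \<in> I" "\<And>x. x \<in> V \<Longrightarrow> p (p x) = p x"
proof -
  have vp: "vector_space_pair scale scale"
    using vector_space_axioms by (simp add: vector_space_pair_def)
  obtain B where B: "B \<subseteq> I" "independent B" "I \<subseteq> span B" "card B = dim I"
    by (rule basis_exists)
  obtain C where C: "B \<subseteq> C" "C \<subseteq> V" "independent C" "V \<subseteq> span C"
    by (rule maximal_independent_subset_extend[OF order_trans[OF B(1) assms(3)] B(2)])
  obtain p where p: "Vector_Spaces.linear scale scale p" "\<forall>x\<in>C. p x = (if x \<in> B then 0 else x)"
    using vector_space_pair.linear_independent_extend[OF vp C(3), of "\<lambda>x. if x \<in> B then 0 else x"] by blast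
  have pl: "p (x + y) = p x + p y" "p (scale c x) = scale c (p x)" for x y c
    using p(1) linear_self_iff by auto
  have p0: "p 0 = 0" using pl(1)[of 0 0] by simp
  have I0: "p x = 0" if "x \<in> I" for x
  proof -
    have "x \<in> span B" using that B by blast
    then show ?thesis
    proof (induction rule: span_induct)
      case base
      show ?case using p0 pl by (auto intro!: subspaceI)
    next
      case (step x) then show ?case using p(2) C by auto
    qed
  qed
  have d: "x - p x \<in> I" if "x \<in> V" for x
  proof -
    have "x \<in> span C" using that C by blast
    then show ?thesis
    proof (induction rule: span_induct)
      case base
      show ?case
        using p0 assms(2)
        by (auto intro!: subspaceI
            simp: pl add_diff_add subspace_0 subspace_add subspace_scale simp flip: scale_right_diff_distrib)
    next
      case (step x) then show ?case using p(2) C B assms(2) by (auto simp: subspace_0)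
    qed
  qed
  have V: "p x \<in> V" if "x \<in> V" for x
    using subspace_diff[OF assms(1) that, of "x - p x"] d[OF that] assms(3) by auto
  have pp: "p (p x) = p x" if "x \<in> V" for x
  proof -
    have "p (p x + (x - p x)) = p (p x) + p (x - p x)" by (rule pl)
    then show ?thesis using I0[OF d[OF that]] by simp
  qed
  show thesis
    by (rule that[OF p(1) _ I0 d pp]) (use V in auto)
qed

text \<open>Surjectivity of the map from \<open>V\<close> to the dual of \<open>V\<close> that \<open>\<beta>\<close> induces.\<close>

lemma dual_vector_exists:
  assumes B: "finite B" "independent B" "b \<in> B"
    and add: "\<And>x y z. x \<in> span B \<Longrightarrow> y \<in> span B \<Longrightarrow> z \<in> span B \<Longrightarrow> \<beta> x (y + z) = \<beta> x y + \<beta> x z"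
    and sc: "\<And>x y c. x \<in> span B \<Longrightarrow> y \<in> span B \<Longrightarrow> \<beta> x (scale c y) = c * \<beta> x y"
    and nd: "\<And>y. y \<in> span B \<Longrightarrow> (\<And>x. x \<in> B \<Longrightarrow> \<beta> x y = 0) \<Longrightarrow> y = 0"
  shows "\<exists>y\<in>span B. \<forall>x\<in>B. \<beta> x y = (if x = b then 1 else 0)"
proof -
  text \<open>Otherwise a nonzero vector is orthogonal to every \<open>x\<close> in a smaller set: eliminate one functional at a time.\<close>
  have key: "\<exists>W. subspace W \<and> W \<subseteq> span B \<and> (\<forall>x\<in>A. \<forall>w\<in>W. \<beta> x w = 0) \<and> dim W + card A \<ge> card B" if "A \<subseteq> B" for A
    using finite_subset[OF that B(1)] that
  proof (induction A rule: finite_induct)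
    case empty
    then show ?case using dim_span_eq_card_independent[OF B(2)] by (intro exI[of _ "span B"]) auto
  next
    case (insert a A)
    then obtain W where W: "subspace W" "W \<subseteq> span B" "\<forall>x\<in>A. \<forall>w\<in>W. \<beta> x w = 0" "dim W + card A \<ge> card B" by auto
    have a: "a \<in> span B" using insert by (auto intro: span_base)
    define W' where "W' = {w\<in>W. \<beta> a w = 0}"
    have lin: "\<beta> a (x + y) = \<beta> a x + \<beta> a y" "\<beta> a (scale c x) = c * \<beta> a x" if "x \<in> W" "y \<in> W" for x y c
      using add sc a that W(2) by blast+
    have W0: "0 \<in> W" using W(1) subspace_0 by blast
    have z: "\<beta> a 0 = 0" using lin(2)[OF W0 W0, of 0] by simp
    have W': "subspace W'" unfolding W'_def
      using W(1) z by (auto intro!: subspaceI simp: lin subspace_add subspace_scale subspace_0)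
    have fdW: "fd scale W" using fd_subset[OF fd_span[OF B(1)] W(1,2)] .
    have "dim W \<le> dim W' + 1"
    proof (cases "W' = W")
      case False
      then obtain w where w: "w \<in> W" "\<beta> a w \<noteq> 0" unfolding W'_def by auto
      have "fd scale W'" using fd_subset[OF fdW W'] by (auto simp: W'_def)
      then obtain C where C: "finite C" "span C = W'" "card C = dim W'" using fd_basis by metis
      have "W \<subseteq> span (insert w C)"
      proof
        fix v assume v: "v \<in> W"
        have sw: "scale (\<beta> a v / \<beta> a w) w \<in> W" for v using w W(1) subspace_scale by blast
        have "v - scale (\<beta> a v / \<beta> a w) w \<in> W'"
        proof -
          have "v + scale (- (\<beta> a v / \<beta> a w)) w \<in> W"
            using v w W(1) subspace_scale subspace_add by blast
          moreover have "\<beta> a (v + scale (- (\<beta> a v / \<beta> a w)) w) = 0"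
            using lin(1)[OF v subspace_scale[OF W(1) w(1)]] lin(2)[OF w(1) w(1)] w(2)
            by (simp del: scale_minus_left)
          ultimately show ?thesis by (simp add: W'_def)
        qed
        then show "v \<in> span (insert w C)" using span_breakdown_eq C(2) by blast
      qed
      then have "dim W \<le> card (insert w C)" using dim_le_card C(1) by blast
      moreover have "card (insert w C) \<le> card C + 1" by (simp add: C(1) card_insert_if)
      ultimately show ?thesis using C(3) by linarith
    qed simp
    moreover have "card (insert a A) = card A + 1" using insert by simp
    ultimately have "dim W' + card (insert a A) \<ge> card B" using W(4) by linarith
    moreover have "\<forall>x\<in>insert a A. \<forall>w\<in>W'. \<beta> x w = 0" using W(3) by (auto simp: W'_def)
    moreover have "W' \<subseteq> span B" using W(2) by (auto simp: W'_def)
    ultimately show ?case using W' by blast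
  qed
  obtain W where W: "subspace W" "W \<subseteq> span B" "\<forall>x\<in>B-{b}. \<forall>w\<in>W. \<beta> x w = 0" "dim W + card (B-{b}) \<ge> card B"
    using key[of "B - {b}"] by blast
  have "card (B - {b}) < card B" by (rule card_Diff1_less[OF B(1,3)])
  then have "dim W \<noteq> 0" using W(4) by linarith
  then have "W \<noteq> {0}" using dim_zero_iff[OF fd_zero] by auto
  then obtain w where w: "w \<in> W" "w \<noteq> 0" using W(1) subspace_0 by blast
  have "\<beta> b w \<noteq> 0"
    using nd[of w] w W(2,3) by blast
  moreover have wB: "w \<in> span B" using w W by blast
  ultimately show ?thesis using W(3) w(1) B
    by (intro bexI[of _ "scale (1 / \<beta> b w) w"]) (auto simp: sc span_base span_scale)
qed

end

section \<open>Row-finite matrices\<close>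

text \<open>One type holds the matrices of every size: the size is a value, bounded by
  \<open>Mat d\<close>, and may change inside a proof. Rows are finite so that products are finite
  sums; infinitely many rows are allowed so that a unit exists and \<open>ring_1\<close> with its
  powers applies.\<close>

typedef (overloaded) 'a rmat = "{A :: nat \<Rightarrow> nat \<Rightarrow> 'a::zero. \<forall>i. finite {j. A i j \<noteq> 0}}"
  morphisms ent Abs_rmat
  by (rule exI[of _ "\<lambda>i j. 0"]) simp

setup_lifting type_definition_rmat

lemma finite_row: "finite {j. ent A i j \<noteq> 0}"
  using ent[of A] by simp

lemma rmat_eqI: "(\<And>i j. ent A i j = ent B i j) \<Longrightarrow> A = B"
  by (auto simp: ent_inject[symmetric] fun_eq_iff)

instantiation rmat :: (field) ring_1
begin

lift_definition zero_rmat :: "'a rmat" is "\<lambda>i j. 0" by simp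

lift_definition one_rmat :: "'a rmat" is "\<lambda>i j. if i = j then 1 else 0"
proof -
  fix i :: nat
  have "{j. (if i = j then 1 else 0 :: 'a) \<noteq> 0} \<subseteq> {i}" by auto
  then show "finite {j. (if i = j then 1 else 0 :: 'a) \<noteq> 0}"
    by (rule finite_subset) simp
qed

lift_definition plus_rmat :: "'a rmat \<Rightarrow> 'a rmat \<Rightarrow> 'a rmat" is "\<lambda>A B i j. A i j + B i j"
proof -
  fix A B :: "nat \<Rightarrow> nat \<Rightarrow> 'a" and i
  assume *: "\<And>i. finite {j. A i j \<noteq> 0}" "\<And>i. finite {j. B i j \<noteq> 0}"
  have "{j. A i j + B i j \<noteq> 0} \<subseteq> {j. A i j \<noteq> 0} \<union> {j. B i j \<noteq> 0}" by auto
  then show "finite {j. A i j + B i j \<noteq> 0}"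
    by (rule finite_subset) (use * in auto)
qed

lift_definition uminus_rmat :: "'a rmat \<Rightarrow> 'a rmat" is "\<lambda>A i j. - A i j" by simp

lift_definition minus_rmat :: "'a rmat \<Rightarrow> 'a rmat \<Rightarrow> 'a rmat" is "\<lambda>A B i j. A i j - B i j"
proof -
  fix A B :: "nat \<Rightarrow> nat \<Rightarrow> 'a" and i
  assume *: "\<And>i. finite {j. A i j \<noteq> 0}" "\<And>i. finite {j. B i j \<noteq> 0}"
  have "{j. A i j - B i j \<noteq> 0} \<subseteq> {j. A i j \<noteq> 0} \<union> {j. B i j \<noteq> 0}" by auto
  then show "finite {j. A i j - B i j \<noteq> 0}"
    by (rule finite_subset) (use * in auto)
qed

lift_definition times_rmat :: "'a rmat \<Rightarrow> 'a rmat \<Rightarrow> 'a rmat"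
  is "\<lambda>A B i j. \<Sum>k | A i k \<noteq> 0. A i k * B k j"
proof -
  fix A B :: "nat \<Rightarrow> nat \<Rightarrow> 'a" and i
  assume *: "\<And>i. finite {j. A i j \<noteq> 0}" "\<And>i. finite {j. B i j \<noteq> 0}"
  have "{j. (\<Sum>k | A i k \<noteq> 0. A i k * B k j) \<noteq> 0} \<subseteq> (\<Union>k\<in>{k. A i k \<noteq> 0}. {j. B k j \<noteq> 0})"
    by (auto intro: ccontr elim!: sum.not_neutral_contains_not_neutral)
  then show "finite {j. (\<Sum>k | A i k \<noteq> 0. A i k * B k j) \<noteq> 0}"
    by (rule finite_subset) (use * in auto)
qed

text \<open>The free choice of a finite index set around the support lets several products be summed
  over a common range.\<close>

lemma ent_times:
  assumes "finite S" "{k. ent A i k \<noteq> 0} \<subseteq> S"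
  shows "ent (A * B) i j = (\<Sum>k\<in>S. ent A i k * ent B k j)"
  unfolding times_rmat.rep_eq using assms by (intro sum.mono_neutral_left) auto

instance
proof
  fix A B C :: "'a rmat"
  show "A + B + C = A + (B + C)" by (rule rmat_eqI) (simp add: plus_rmat.rep_eq)
  show "A + B = B + A" by (rule rmat_eqI) (simp add: plus_rmat.rep_eq)
  show "0 + A = A" by (rule rmat_eqI) (simp add: plus_rmat.rep_eq zero_rmat.rep_eq)
  show "- A + A = 0" by (rule rmat_eqI) (simp add: plus_rmat.rep_eq zero_rmat.rep_eq uminus_rmat.rep_eq)
  show "A - B = A + - B" by (rule rmat_eqI) (simp add: plus_rmat.rep_eq minus_rmat.rep_eq uminus_rmat.rep_eq)
  show "A * B * C = A * (B * C)"
  proof (rule rmat_eqI)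
    fix i j
    let ?S = "{k. ent A i k \<noteq> 0}"
    let ?T = "(\<Union>k\<in>?S. {l. ent B k l \<noteq> 0})"
    have f: "finite ?S" "finite ?T" using finite_row by auto
    have AB: "ent (A * B) i l = (\<Sum>k\<in>?S. ent A i k * ent B k l)" for l
      by (rule ent_times) (use f in auto)
    have "{l. ent (A * B) i l \<noteq> 0} \<subseteq> ?T"
      unfolding AB by (auto intro: ccontr elim!: sum.not_neutral_contains_not_neutral)
    then have "ent (A * B * C) i j = (\<Sum>l\<in>?T. (\<Sum>k\<in>?S. ent A i k * ent B k l) * ent C l j)"
      by (subst ent_times[OF f(2)]) (simp_all add: AB)
    also have "\<dots> = (\<Sum>k\<in>?S. \<Sum>l\<in>?T. ent A i k * ent B k l * ent C l j)"
      by (simp add: sum_distrib_right) (rule sum.swap)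
    also have "\<dots> = (\<Sum>k\<in>?S. ent A i k * ent (B * C) k j)"
    proof (rule sum.cong[OF refl])
      fix k assume "k \<in> ?S"
      then have "ent (B * C) k j = (\<Sum>l\<in>?T. ent B k l * ent C l j)"
        by (intro ent_times[OF f(2)]) auto
      then show "(\<Sum>l\<in>?T. ent A i k * ent B k l * ent C l j) = ent A i k * ent (B * C) k j"
        by (simp add: sum_distrib_left mult.assoc)
    qed
    also have "\<dots> = ent (A * (B * C)) i j" by (rule ent_times[symmetric]) (use f in auto)
    finally show "ent (A * B * C) i j = ent (A * (B * C)) i j" .
  qed
  show "1 * A = A"
  proof (rule rmat_eqI)
    fix i j
    show "ent (1 * A) i j = ent A i j"
      by (subst ent_times[of "{i}"]) (auto simp: one_rmat.rep_eq)
  qed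
  show "A * 1 = A"
  proof (rule rmat_eqI)
    fix i j
    show "ent (A * 1) i j = ent A i j"
      by (subst ent_times[of "insert j {k. ent A i k \<noteq> 0}"])
        (auto simp: one_rmat.rep_eq finite_row if_distrib cong: if_cong)
  qed
  show "(A + B) * C = A * C + B * C"
  proof (rule rmat_eqI)
    fix i j
    let ?S = "{k. ent A i k \<noteq> 0} \<union> {k. ent B i k \<noteq> 0}"
    have f: "finite ?S" using finite_row by auto
    show "ent ((A + B) * C) i j = ent (A * C + B * C) i j"
      unfolding plus_rmat.rep_eq
      by (subst (1 2 3) ent_times[OF f]) (auto simp: plus_rmat.rep_eq sum.distrib distrib_right)
  qed
  show "A * (B + C) = A * B + A * C"
  proof (rule rmat_eqI)
    fix i j
    show "ent (A * (B + C)) i j = ent (A * B + A * C) i j"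
      by (simp add: times_rmat.rep_eq plus_rmat.rep_eq sum.distrib distrib_left)
  qed
  have "ent (0 :: 'a rmat) 0 0 \<noteq> ent 1 0 0" by (simp add: zero_rmat.rep_eq one_rmat.rep_eq)
  then show "(0 :: 'a rmat) \<noteq> 1" by metis
qed

end

lift_definition smul :: "'a::field \<Rightarrow> 'a rmat \<Rightarrow> 'a rmat" is "\<lambda>c A i j. c * A i j"
proof -
  fix c :: 'a and A :: "nat \<Rightarrow> nat \<Rightarrow> 'a" and i
  assume *: "\<And>i. finite {j. A i j \<noteq> 0}"
  have "{j. c * A i j \<noteq> 0} \<subseteq> {j. A i j \<noteq> 0}" by auto
  then show "finite {j. c * A i j \<noteq> 0}"
    by (rule finite_subset) (rule *)
qed

lemmas ent_simps = zero_rmat.rep_eq plus_rmat.rep_eq minus_rmat.rep_eq uminus_rmat.rep_eq smul.rep_eq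

global_interpretation rm: vector_space smul
  by unfold_locales (rule rmat_eqI, simp add: ent_simps algebra_simps)+

lemma smul_mult_left: "smul c A * B = smul c (A * B)"
proof (rule rmat_eqI)
  fix i j
  have "ent (smul c A * B) i j = (\<Sum>k\<in>{k. ent A i k \<noteq> 0}. ent (smul c A) i k * ent B k j)"
    by (rule ent_times) (auto simp: finite_row ent_simps)
  then show "ent (smul c A * B) i j = ent (smul c (A * B)) i j"
    by (simp add: ent_simps times_rmat.rep_eq sum_distrib_left mult.assoc)
qed

lemma smul_mult_right: "A * smul c B = smul c (A * B)"
  by (rule rmat_eqI) (simp add: ent_simps times_rmat.rep_eq sum_distrib_left mult.left_commute)

lemma ent_sum: "ent (\<Sum>x\<in>S. f x) i j = (\<Sum>x\<in>S. ent (f x) i j)"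
  by (induction S rule: infinite_finite_induct) (auto simp: ent_simps)

subsection \<open>Matrices of finite size, trace\<close>

definition Mat :: "nat \<Rightarrow> 'a::field rmat set" where
  "Mat d = {A. \<forall>i j. \<not> (i < d \<and> j < d) \<longrightarrow> ent A i j = 0}"

text \<open>Free of the size, so the trace does not change when a matrix is regarded as a member of
  a larger \<open>Mat d\<close>. \<open>tr_Mat\<close> is the intended case; with infinitely many
  nonzero diagonal entries the sum is 0 by convention.\<close>

definition tr :: "'a::field rmat \<Rightarrow> 'a" where
  "tr A = (\<Sum>i | ent A i i \<noteq> 0. ent A i i)"

lift_definition Eu :: "nat \<Rightarrow> nat \<Rightarrow> 'a::field rmat" is "\<lambda>a b i j. if i = a \<and> j = b then 1 else 0"
  by simp

text \<open>The unit of \<open>Mat d\<close>. It differs from the \<open>1\<close> of the type,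
  which lies in no \<open>Mat d\<close>; this is why powers below often carry a factor
  \<open>Pd d\<close>.\<close>

lift_definition Pd :: "nat \<Rightarrow> 'a::field rmat" is "\<lambda>d i j. if i = j \<and> i < d then 1 else 0"
proof -
  fix i d :: nat
  have "{j. (if i = j \<and> i < d then 1 else 0 :: 'a) \<noteq> 0} \<subseteq> {i}" by auto
  then show "finite {j. (if i = j \<and> i < d then 1 else 0 :: 'a) \<noteq> 0}"
    by (rule finite_subset) simp
qed

lemma Mat_ent: "A \<in> Mat d \<Longrightarrow> \<not> (i < d \<and> j < d) \<Longrightarrow> ent A i j = 0"
  unfolding Mat_def by blast

lemma MatI: "(\<And>i j. \<not> (i < d \<and> j < d) \<Longrightarrow> ent A i j = 0) \<Longrightarrow> A \<in> Mat d"
  unfolding Mat_def by blast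

lemma Mat_times_ent: "A \<in> Mat d \<Longrightarrow> ent (A * B) i j = (\<Sum>k<d. ent A i k * ent B k j)"
  by (rule ent_times) (auto simp: Mat_def)

lemma Mat_times: "A \<in> Mat d \<Longrightarrow> B \<in> Mat d \<Longrightarrow> A * B \<in> Mat d"
  by (rule MatI) (simp add: Mat_times_ent, rule sum.neutral, auto simp: Mat_ent)

lemma Mat_subspace: "rm.subspace (Mat d)"
  by (rule rm.subspaceI) (auto simp: Mat_def ent_simps)

lemmas Mat_closed = rm.subspace_0[OF Mat_subspace] rm.subspace_add[OF Mat_subspace]
  rm.subspace_diff[OF Mat_subspace] rm.subspace_neg[OF Mat_subspace]
  rm.subspace_scale[OF Mat_subspace] rm.subspace_sum[OF Mat_subspace] Mat_times

lemma Mat_mono: "d \<le> d' \<Longrightarrow> Mat d \<subseteq> Mat d'"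
  by (intro subsetI MatI, erule Mat_ent) auto

lemma Pd_Mat: "Pd d \<in> Mat d"
  by (auto simp: Mat_def Pd.rep_eq)

lemma Pd_left:
  assumes "A \<in> Mat d"
  shows "Pd d * A = A"
proof (rule rmat_eqI)
  fix i j
  show "ent (Pd d * A) i j = ent A i j"
    by (subst ent_times[of "{i}"]) (auto simp: Pd.rep_eq Mat_ent[OF assms])
qed

lemma Pd_right:
  assumes "A \<in> Mat d"
  shows "A * Pd d = A"
proof (rule rmat_eqI)
  fix i j
  have "ent (A * Pd d) i j = (\<Sum>k<d. if k = j then ent A i j else 0)"
    unfolding Mat_times_ent[OF assms] by (rule sum.cong) (auto simp: Pd.rep_eq)
  then show "ent (A * Pd d) i j = ent A i j"
    using Mat_ent[OF assms] by auto
qed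

lemma Eu_Mat: "i < d \<Longrightarrow> j < d \<Longrightarrow> Eu i j \<in> Mat d"
  by (auto simp: Mat_def Eu.rep_eq)

lemma Mat_fd: "fd smul (Mat d :: 'a::field rmat set)"
proof (rule rm.fdI[OF Mat_subspace, of "\<Union>i<d. Eu i ` {..<d}"])
  show "(Mat d :: 'a rmat set) \<subseteq> rm.span (\<Union>i<d. Eu i ` {..<d})"
  proof
    fix A :: "'a rmat" assume A: "A \<in> Mat d"
    have "A = (\<Sum>(i, j)\<in>{..<d} \<times> {..<d}. smul (ent A i j) (Eu i j))"
    proof (rule rmat_eqI)
      fix a b
      have "ent (\<Sum>(i, j)\<in>{..<d} \<times> {..<d}. smul (ent A i j) (Eu i j)) a b
          = (\<Sum>p\<in>{..<d} \<times> {..<d}. if p = (a, b) then ent A a b else 0)"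
        unfolding ent_sum by (rule sum.cong) (auto simp: ent_simps Eu.rep_eq split: if_splits)
      then show "ent A a b = ent (\<Sum>(i, j)\<in>{..<d} \<times> {..<d}. smul (ent A i j) (Eu i j)) a b"
        using A by (auto simp: Mat_ent)
    qed
    also have "\<dots> \<in> rm.span (\<Union>i<d. Eu i ` {..<d})"
      by (rule rm.span_sum) (clarsimp, rule rm.span_scale, rule rm.span_base, auto)
    finally show "A \<in> rm.span (\<Union>i<d. Eu i ` {..<d})" .
  qed
qed simp

lemma tr_Mat: "A \<in> Mat d \<Longrightarrow> tr A = (\<Sum>i<d. ent A i i)"
  unfolding tr_def by (rule sum.mono_neutral_left) (auto simp: Mat_def)

lemma tr_add: "A \<in> Mat d \<Longrightarrow> B \<in> Mat d \<Longrightarrow> tr (A + B) = tr A + tr B"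
  by (simp add: tr_Mat[of _ d] Mat_closed ent_simps sum.distrib)

lemma tr_diff: "A \<in> Mat d \<Longrightarrow> B \<in> Mat d \<Longrightarrow> tr (A - B) = tr A - tr B"
  by (simp add: tr_Mat[of _ d] Mat_closed ent_simps sum_subtractf)

lemma tr_smul: "A \<in> Mat d \<Longrightarrow> tr (smul c A) = c * tr A"
  by (simp add: tr_Mat[of _ d] Mat_closed ent_simps sum_distrib_left)

lemma tr_zero [simp]: "tr 0 = 0"
  by (simp add: tr_def zero_rmat.rep_eq)

lemma tr_sum: "(\<And>x. x \<in> S \<Longrightarrow> f x \<in> Mat d) \<Longrightarrow> tr (\<Sum>x\<in>S. f x) = (\<Sum>x\<in>S. tr (f x))"
  by (induction S rule: infinite_finite_induct) (auto simp: tr_add[of _ d] Mat_closed)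

lemma tr_comm: "A \<in> Mat d \<Longrightarrow> B \<in> Mat d \<Longrightarrow> tr (A * B) = tr (B * A)"
  by (simp add: tr_Mat[of _ d] Mat_closed Mat_times_ent)
    (subst sum.swap, simp add: mult.commute)

text \<open>Two matrix units cut out a single entry; this determines the scaling of the idempotents
  of trace 1 in the next two proofs.\<close>

lemma Eu_sandwich: "A \<in> Mat d \<Longrightarrow> i < d \<Longrightarrow> j < d \<Longrightarrow> Eu a i * A * Eu j b = smul (ent A i j) (Eu a b)"
proof (rule rmat_eqI)
  fix p q assume A: "A \<in> Mat d" "i < d" "j < d"
  have 1: "ent (Eu a i * A) p k = (if p = a then ent A i k else 0)" for k
    by (subst ent_times[of "{i}"]) (auto simp: Eu.rep_eq)
  show "ent (Eu a i * A * Eu j b) p q = ent (smul (ent A i j) (Eu a b)) p q"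
    by (subst ent_times[of "{..<d}"])
      (use A in \<open>auto simp: 1 Mat_ent Eu.rep_eq ent_simps if_distrib intro: ccontr cong: if_cong\<close>)
qed

lemma tr_Eu_mult: "A \<in> Mat d \<Longrightarrow> i < d \<Longrightarrow> j < d \<Longrightarrow> tr (Eu j i * A) = ent A i j"
proof -
  assume A: "A \<in> Mat d" "i < d" "j < d"
  have 1: "ent (Eu j i * A) p k = (if p = j then ent A i k else 0)" for p k
    by (subst ent_times[of "{i}"]) (auto simp: Eu.rep_eq)
  show ?thesis
    using A by (subst tr_Mat[of _ d]) (auto simp: Mat_closed Eu_Mat 1 cong: if_cong)
qed

subsection \<open>Nilpotent and idempotent matrices\<close>

text \<open>Rank without eigenvectors: a nonzero entry of \<open>e\<close> yields an idempotent
  \<open>g\<close> of trace 1 with e g = g e = g, and \<open>e - g\<close> is an idempotent that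
  fixes a strictly smaller right ideal of \<open>Mat d\<close> under left multiplication. The trace
  counts the steps.\<close>

lemma idempotent_trace:
  fixes e :: "'a::field rmat"
  assumes "e \<in> Mat d" "e * e = e"
  shows "\<exists>r. tr e = of_nat r \<and> (r = 0 \<longrightarrow> e = 0)"
  using assms
proof (induction "rm.dim {a \<in> Mat d. e * a = a}" arbitrary: e rule: less_induct)
  case less
  show ?case
  proof (cases "e = 0")
    case True
    then show ?thesis by (intro exI[of _ 0]) simp
  next
    case False
    then obtain i j where ij: "ent e i j \<noteq> 0" by (metis rmat_eqI zero_rmat.rep_eq)
    then have d: "i < d" "j < d" using Mat_ent[OF less(2)] by blast+
    \<comment> \<open>\<open>Eu j i * e * Eu j i\<close> is \<open>ent e i j\<close> times
      \<open>Eu j i\<close>, so this factor makes \<open>g\<close> idempotent.\<close>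
    define c where "c = 1 / ent e i j"
    define g where "g = smul c (e * Eu j i * e)"
    have gM: "g \<in> Mat d" unfolding g_def by (intro Mat_closed less(2) Eu_Mat d)
    have eg: "e * g = g"
      using less(3) by (simp add: g_def smul_mult_right mult.assoc[symmetric])
    have ge: "g * e = g"
      using less(3) by (simp add: g_def smul_mult_left mult.assoc)
    have "g * g = smul (c * c) (e * (Eu j i * (e * e) * Eu j i) * e)"
      by (simp add: g_def smul_mult_left smul_mult_right mult.assoc)
    also have "\<dots> = smul (c * c * ent e i j) (e * Eu j i * e)"
      using Eu_sandwich[OF less(2) d] by (simp add: less(3) smul_mult_left smul_mult_right)
    also have "\<dots> = g" using ij by (simp add: g_def c_def)
    finally have gg: "g * g = g" .
    have "tr g = c * tr (e * (Eu j i * e))"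
      unfolding g_def by (subst tr_smul[of _ d]) (auto intro!: Mat_closed less(2) Eu_Mat d simp: mult.assoc)
    also have "\<dots> = c * tr (Eu j i * e * e)"
      by (subst tr_comm[of _ d]) (auto intro!: Mat_closed less(2) Eu_Mat d)
    also have "\<dots> = 1" using ij tr_Eu_mult[OF less(2) d] by (simp add: mult.assoc less(3) c_def)
    finally have tg: "tr g = 1" .
    let ?e = "e - g"
    have M: "?e \<in> Mat d" by (intro Mat_closed less(2) gM)
    have idem: "?e * ?e = ?e" by (simp add: algebra_simps less(3) eg ge gg)
    have sub: "rm.subspace {a \<in> Mat d. e * a = a}" "rm.subspace {a \<in> Mat d. ?e * a = a}"
      by (auto intro!: rm.subspaceI simp: Mat_closed algebra_simps smul_mult_right smul_mult_left)
    have fdE: "fd smul {a \<in> Mat d. e * a = a}"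
      by (rule rm.fd_subset[OF Mat_fd sub(1)]) auto
    have inc: "e * a = a" if "?e * a = a" for a
    proof -
      have "e * (?e * a) = ?e * a" by (simp add: mult.assoc[symmetric] right_diff_distrib less(3) eg)
      then show ?thesis using that by simp
    qed
    have "g \<noteq> 0" using tg by auto
    moreover have "?e * g = 0" by (simp add: left_diff_distrib eg gg)
    ultimately have "g \<in> {a \<in> Mat d. e * a = a}" "g \<notin> {a \<in> Mat d. ?e * a = a}" using eg gM by auto
    then have "rm.dim {a \<in> Mat d. ?e * a = a} < rm.dim {a \<in> Mat d. e * a = a}"
      by (intro rm.fd_dim_less[OF fdE sub(2)]) (use inc in auto)
    from less(1)[OF this M idem] obtain r where "tr ?e = of_nat r" by blast
    then have "tr e = of_nat (Suc r)" using tr_diff[OF less(2) gM] tg by (simp add: algebra_simps)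
    then show ?thesis by blast
  qed
qed

text \<open>Induction on the rank \<open>r\<close> of an idempotent \<open>f\<close> whose corner
  contains \<open>x\<close>. The last nonzero power \<open>a\<close> of \<open>x\<close> satisfies x
  a = 0, so an idempotent \<open>g\<close> of trace 1 built from \<open>a\<close> satisfies x g = 0.
  Then (1 - g) x is nilpotent, lies in the corner of \<open>f - g\<close>, and has the trace of
  \<open>x\<close> because tr (g x) = tr (x g) = 0. Characteristic zero settles
  \<open>r = 0\<close>, where \<open>f\<close> itself vanishes.\<close>

lemma nilpotent_trace_aux:
  fixes x :: "'a::field_char_0 rmat"
  assumes "f \<in> Mat d" "f * f = f" "tr f = of_nat r" "x \<in> Mat d" "f * x = x" "x * f = x" "x ^ m = 0"
  shows "tr x = 0"
  using assms
proof (induction r arbitrary: f x m)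
  case 0
  then have "f = 0" using idempotent_trace[of f d] by auto
  then show ?case using 0 by simp
next
  case (Suc r)
  show ?case
  proof (cases "x = 0")
    case False
    define n where "n = (LEAST n. x ^ n = 0)"
    have n: "x ^ n = 0" "\<And>k. k < n \<Longrightarrow> x ^ k \<noteq> 0"
      using LeastI[of "\<lambda>n. x ^ n = 0", OF Suc.prems(7)] not_less_Least unfolding n_def by blast+
    have "n \<noteq> 0" by (rule notI) (use n(1) in simp)
    moreover have "n \<noteq> 1" by (rule notI) (use n(1) False in simp)
    ultimately
    obtain k where k: "n = Suc (Suc k)" by (cases n rule: nat.exhaust; cases "n - 1") auto
    define a where "a = x * x ^ k"
    have a0: "a \<noteq> 0" using n(2)[of "Suc k"] k by (simp add: a_def)
    have xa: "x * a = 0" using n(1) k by (simp add: a_def)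
    have fa: "f * a = a" using Suc.prems(5) by (simp add: a_def mult.assoc[symmetric])
    have pM: "x ^ Suc i \<in> Mat d" for i by (induction i) (auto intro: Mat_closed Suc.prems(4))
    have aM: "a \<in> Mat d" using pM[of k] by (simp add: a_def)
    obtain i j where ij: "ent a i j \<noteq> 0" using a0 by (metis rmat_eqI zero_rmat.rep_eq)
    then have d: "i < d" "j < d" using Mat_ent[OF aM] by blast+
    define c where "c = 1 / ent a i j"
    define g where "g = smul c (a * Eu j i * f)"
    have gM: "g \<in> Mat d" unfolding g_def by (intro Mat_closed Suc.prems(1) aM Eu_Mat d)
    have fg: "f * g = g"
      using fa by (simp add: g_def smul_mult_right mult.assoc[symmetric])
    have gf: "g * f = g"
      using Suc.prems(2) by (simp add: g_def smul_mult_left mult.assoc)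
    have xg: "x * g = 0"
      using xa by (simp add: g_def smul_mult_right mult.assoc[symmetric])
    have "g * g = smul (c * c) (a * (Eu j i * (f * a) * Eu j i) * f)"
      by (simp add: g_def smul_mult_left smul_mult_right mult.assoc)
    also have "\<dots> = smul (c * c * ent a i j) (a * Eu j i * f)"
      using Eu_sandwich[OF aM d] by (simp add: fa smul_mult_left smul_mult_right)
    also have "\<dots> = g" using ij by (simp add: g_def c_def)
    finally have gg: "g * g = g" .
    have "tr g = c * tr (a * (Eu j i * f))"
      unfolding g_def by (subst tr_smul[of _ d]) (auto intro!: Mat_closed Suc.prems(1) aM Eu_Mat d simp: mult.assoc)
    also have "\<dots> = c * tr (Eu j i * f * a)"
      by (subst tr_comm[of _ d]) (auto intro!: Mat_closed Suc.prems(1) aM Eu_Mat d)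
    also have "\<dots> = 1" using ij tr_Eu_mult[OF aM d] by (simp add: mult.assoc fa c_def)
    finally have tg: "tr g = 1" .
    define y where "y = (1 - g) * x"
    have yM: "y \<in> Mat d" unfolding y_def left_diff_distrib by (simp add: Mat_closed gM Suc.prems)
    have "y ^ Suc m = (1 - g) * x ^ Suc m" for m
    proof (induction m)
      case (Suc m)
      have "y ^ Suc (Suc m) = (1 - g) * (x * (1 - g)) * x ^ Suc m"
        using Suc by (simp add: y_def mult.assoc)
      also have "x * (1 - g) = x" by (simp add: right_diff_distrib xg)
      finally show ?case by (simp add: mult.assoc)
    qed (simp add: y_def)
    from this[of m] have nil: "y ^ Suc m = 0" using Suc.prems(7) by simp
    have "tr (f - g) = of_nat r" using tr_diff[OF Suc.prems(1) gM] tg Suc.prems(3) by simp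
    moreover have "(f - g) * (f - g) = f - g" by (simp add: algebra_simps Suc.prems fg gf gg)
    moreover have "(f - g) * y = y"
    proof -
      have "(f - g) * y = f * x - f * g * x - g * x + g * g * x" by (simp add: y_def algebra_simps)
      then show ?thesis by (simp add: y_def Suc.prems fg gg left_diff_distrib)
    qed
    moreover have "y * (f - g) = y"
    proof -
      have "y * (f - g) = (1 - g) * (x * f - x * g)" by (simp add: y_def algebra_simps)
      then show ?thesis by (simp add: y_def xg Suc.prems)
    qed
    ultimately have "tr y = 0"
      using Suc.IH[of "f - g" y "Suc m"] yM nil gM Suc.prems by (auto intro!: Mat_closed)
    moreover have "tr y = tr x - tr (g * x)"
      unfolding y_def left_diff_distrib by (simp add: tr_diff[of _ d] Mat_closed gM Suc.prems)
    moreover have "tr (g * x) = 0" by (simp add: tr_comm[OF gM Suc.prems(4)] xg)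
    ultimately show ?thesis by simp
  qed simp
qed

lemma tr_Pd: "tr (Pd d :: 'a::field rmat) = of_nat d"
  by (simp add: tr_Mat[OF Pd_Mat] Pd.rep_eq)

lemma nilpotent_trace:
  fixes x :: "'a::field_char_0 rmat"
  assumes "x \<in> Mat d" "x ^ m = 0"
  shows "tr x = 0"
  using nilpotent_trace_aux[of "Pd d" d d x m] assms
  by (simp add: Pd_Mat Pd_left Pd_right tr_Pd)

text \<open>A Fitting argument without eigenvalues. The spans of x^(i+1) for i >= n stabilise, so
  x^(n+1) = x^(n+1) y with y = x s and \<open>s\<close> a polynomial in \<open>x\<close>. Then e =
  y^(n+1) is an idempotent in the span of the positive powers of \<open>x\<close>, so its trace is 0
  and e = 0; but x^(n+1) e = x^(n+1).\<close>

lemma nilpotent_if_trace_powers_zero: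
  fixes x :: "'a::field_char_0 rmat"
  assumes x: "x \<in> Mat d" and t: "\<And>n. tr (x ^ Suc n) = 0"
  shows "\<exists>m. x ^ m = 0"
proof -
  have pM: "x ^ Suc i \<in> Mat d" for i by (induction i) (auto intro: Mat_closed x)
  define S where "S n = rm.span {x ^ Suc i | i. n \<le> i}" for n
  have SM: "S n \<subseteq> Mat d" for n
    unfolding S_def by (rule rm.span_minimal[OF _ Mat_subspace]) (use pM in auto)
  obtain n where n: "\<And>m. n \<le> m \<Longrightarrow> S m = S n"
  proof (rule rm.fd_chain[OF Mat_fd, of S])
    show "rm.subspace (S n)" for n by (simp add: S_def)
    show "S (Suc n) \<subseteq> S n" for n unfolding S_def by (rule rm.span_mono) auto
  qed (use SM in blast)+
  have k: "x ^ Suc n \<in> S (Suc n)" using n[of "Suc n"] unfolding S_def by (auto intro: rm.span_base)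
  let ?Q = "rm.span {x ^ i | i. True}"
  have "\<exists>s\<in>?Q. z = x ^ Suc n * (x * s)" if "z \<in> S (Suc n)" for z
    using that unfolding S_def
  proof (induction rule: rm.span_induct)
    case base
    show ?case
    proof (rule rm.subspaceI)
      show "0 \<in> {z. \<exists>s\<in>?Q. z = x ^ Suc n * (x * s)}" using rm.span_zero by (auto intro!: bexI[of _ 0])
      show "a + b \<in> {z. \<exists>s\<in>?Q. z = x ^ Suc n * (x * s)}"
        if ab: "a \<in> {z. \<exists>s\<in>?Q. z = x ^ Suc n * (x * s)}" "b \<in> {z. \<exists>s\<in>?Q. z = x ^ Suc n * (x * s)}" for a b
      proof -
        obtain s s' where "s \<in> ?Q" "a = x ^ Suc n * (x * s)" "s' \<in> ?Q" "b = x ^ Suc n * (x * s')"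
          using ab by blast
        then show ?thesis by (auto simp: distrib_left rm.span_add intro!: bexI[of _ "s + s'"])
      qed
      show "smul c a \<in> {z. \<exists>s\<in>?Q. z = x ^ Suc n * (x * s)}"
        if a: "a \<in> {z. \<exists>s\<in>?Q. z = x ^ Suc n * (x * s)}" for a c
      proof -
        obtain s where "s \<in> ?Q" "a = x ^ Suc n * (x * s)"
          using a by blast
        then show ?thesis by (auto simp: smul_mult_right rm.span_scale intro!: bexI[of _ "smul c s"])
      qed
    qed
  next
    case (step z)
    then obtain i where i: "z = x ^ Suc i" "Suc n \<le> i" by blast
    then have "Suc i = Suc n + Suc (i - Suc n)" by simp
    then have "z = x ^ Suc n * (x * x ^ (i - Suc n))" unfolding i(1) by (metis power_Suc power_add)
    then show ?case by (intro bexI[of _ "x ^ (i - Suc n)"] rm.span_base) auto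
  qed
  from this[OF k] obtain s where s: "s \<in> ?Q" and xs: "x ^ Suc n = x ^ Suc n * (x * s)" by blast
  have sx: "s * x = x * s"
    using s
  proof (induction rule: rm.span_induct)
    case base
    show ?case by (rule rm.subspaceI) (auto simp: algebra_simps smul_mult_left smul_mult_right)
  next
    case (step z) then show ?case using power_commutes by auto
  qed
  define y where "y = x * s"
  have yp: "y ^ i = x ^ i * s ^ i" for i
  proof (induction i)
    case (Suc i)
    have "y ^ Suc i = x * (s * x ^ i) * s ^ i" using Suc by (simp add: y_def mult.assoc)
    also have "s * x ^ i = x ^ i * s" using power_commuting_commutes[of x s i] sx by simp
    finally show ?case by (simp add: mult.assoc)
  qed simp
  have comm: "x ^ i * s ^ i = s ^ i * x ^ i" for i
    using power_commuting_commutes[of x "s ^ i" i] power_commuting_commutes[of s x i] sx by simp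
  define e where "e = y ^ Suc n"
  \<comment> \<open>As \<open>s\<close> commutes with \<open>x\<close>, \<open>e\<close> is s^(n+1)
    x^(n+1), which absorbs \<open>y\<close> on the right.\<close>
  have ey: "e * y = e" using xs unfolding e_def yp comm by (simp only: mult.assoc y_def[symmetric])
  have "e * y ^ i = e" for i by (induction i) (simp_all add: ey mult.assoc[symmetric])
  then have ee: "e * e = e" unfolding e_def by blast
  have "x ^ Suc n * y ^ i = x ^ Suc n" for i
    using xs unfolding y_def[symmetric] by (induction i) (simp_all only: power_Suc mult.assoc[symmetric] power_0 mult_1_right)
  then have xe: "x ^ Suc n * e = x ^ Suc n" unfolding e_def by blast
  have mul: "p * q \<in> S 0" if p: "p \<in> S 0" and q: "q \<in> ?Q" for p q
  proof -
    have "x ^ Suc i * q \<in> S 0" for i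
      using q
    proof (induction rule: rm.span_induct)
      case base
      show ?case by (rule rm.subspaceI)
          (auto simp: S_def distrib_left smul_mult_right rm.span_add rm.span_scale rm.span_zero simp del: power_Suc)
    next
      case (step z)
      then obtain k where "z = x ^ k" by blast
      then have "x ^ Suc i * z = x ^ Suc (i + k)" by (simp add: power_add mult.assoc)
      then show ?case unfolding S_def by (auto intro!: rm.span_base)
    qed
    note xq = this
    show ?thesis
      using p unfolding S_def
    proof (induction rule: rm.span_induct)
      case base
      show ?case by (rule rm.subspaceI)
          (auto simp: distrib_right smul_mult_left rm.span_add rm.span_scale rm.span_zero)
    next
      case (step z)
      then show ?case using xq unfolding S_def by blast
    qed
  qed
  have "x \<in> S 0" unfolding S_def by (rule rm.span_base) (auto intro!: exI[of _ 0])
  from mul[OF this s] have yS: "y \<in> S 0" by (simp add: y_def)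
  have "S 0 \<subseteq> ?Q" unfolding S_def by (rule rm.span_mono) (auto simp del: power_Suc)
  then have "y ^ Suc i \<in> S 0" for i by (induction i) (use yS mul in \<open>auto\<close>)
  then have eS: "e \<in> S 0" unfolding e_def by blast
  have "e \<in> Mat d \<and> tr e = 0"
    using eS unfolding S_def
  proof (induction rule: rm.span_induct)
    case base
    show ?case by (rule rm.subspaceI) (auto simp: Mat_closed tr_add[of _ d] tr_smul[of _ d])
  next
    case (step z) then show ?case using pM t by (auto simp del: power_Suc)
  qed
  then have "e = 0" using idempotent_trace[of e d] ee by auto
  then show ?thesis using xe by (intro exI[of _ "Suc n"]) simp
qed

subsection \<open>Sets of matrices with vanishing products\<close>

text \<open>The ring acts on itself by left multiplication, and these right ideals take the place of
  the flag of subspaces on which a nilpotent set \<open>G\<close> acts strictly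
  triangularly.\<close>

primrec lann :: "'r::ring_1 set \<Rightarrow> nat \<Rightarrow> 'r set" where
  "lann G 0 = {0}"
| "lann G (Suc q) = {a. \<forall>g\<in>G. g * a \<in> lann G q}"

text \<open>Equivalently, all products of \<open>q\<close> elements of \<open>G\<close> vanish for some \<open>q\<close>.\<close>

definition nilset :: "'r::ring_1 set \<Rightarrow> bool" where
  "nilset G \<longleftrightarrow> (\<exists>q. 1 \<in> lann G q)"

lemma lann_zero: "0 \<in> lann G q"
  by (induction q) auto

lemma lann_add: "a \<in> lann G q \<Longrightarrow> b \<in> lann G q \<Longrightarrow> a + b \<in> lann G q"
  by (induction q arbitrary: a b) (auto simp: distrib_left)

lemma lann_diff: "a \<in> lann G q \<Longrightarrow> b \<in> lann G q \<Longrightarrow> a - b \<in> lann G q"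
  by (induction q arbitrary: a b) (auto simp: right_diff_distrib)

lemma lann_smul: "a \<in> lann G q \<Longrightarrow> smul c a \<in> lann G q"
  by (induction q arbitrary: a) (auto simp: smul_mult_right)

lemma lann_mult: "a \<in> lann G q \<Longrightarrow> a * b \<in> lann G q"
  by (induction q arbitrary: a) (auto simp: mult.assoc[symmetric])

lemma lann_Suc: "a \<in> lann G q \<Longrightarrow> a \<in> lann G (Suc q)"
  by (induction q arbitrary: a) auto

lemma lann_mono: "q \<le> q' \<Longrightarrow> a \<in> lann G q \<Longrightarrow> a \<in> lann G q'"
  by (induction q' rule: dec_induct) (auto intro: lann_Suc simp del: lann.simps)

lemma lann_anti: "G' \<subseteq> G \<Longrightarrow> lann G q \<subseteq> lann G' q"
  by (induction q) auto

lemma nilset_subset: "nilset G \<Longrightarrow> G' \<subseteq> G \<Longrightarrow> nilset G'"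
  unfolding nilset_def using lann_anti by blast

lemma lann_one: "1 \<in> lann G q \<Longrightarrow> a \<in> lann G q"
  using lann_mult[of 1 G q a] by simp

text \<open>An element that normalises \<open>H\<close> respects the filtration attached to
  \<open>H\<close>, because h x a = x h a + [h, x] a.\<close>

lemma lann_stable:
  assumes "\<And>h. h \<in> H \<Longrightarrow> h * x - x * h \<in> H" "a \<in> lann H k"
  shows "x * a \<in> lann H k"
  using assms(2)
proof (induction k arbitrary: a)
  case (Suc k)
  have "h * (x * a) \<in> lann H k" if h: "h \<in> H" for h
  proof -
    have "h * (x * a) = x * (h * a) + (h * x - x * h) * a" by (simp add: algebra_simps)
    moreover have "x * (h * a) \<in> lann H k" using Suc h by auto
    moreover have "(h * x - x * h) * a \<in> lann H k" using Suc.prems assms(1)[OF h] by auto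
    ultimately show ?thesis using lann_add by metis
  qed
  then show ?case by simp
qed simp

text \<open>On \<open>lann H (Suc k)\<close> the elements of \<open>H\<close> fall into
  \<open>lann H k\<close>, while \<open>x\<close> stays inside and is exhausted after
  \<open>m\<close> applications. Each level for \<open>H\<close> thus costs \<open>m\<close> levels
  for the enlarged set.\<close>

lemma nilset_extend:
  fixes x :: "'a::field rmat"
  assumes st: "\<And>h. h \<in> H \<Longrightarrow> h * x - x * h \<in> H" and "nilset H" "x ^ m = 0"
  shows "nilset {h + smul c x | h c. h \<in> H}"
proof -
  let ?G = "{h + smul c x | h c. h \<in> H}"
  have "lann H k \<subseteq> lann ?G (k * m)" for k
  proof (induction k)
    case (Suc k)
    have claim: "a \<in> lann ?G (k * m + j)" if "a \<in> lann H (Suc k)" "x ^ j * a \<in> lann H k" for j a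
      using that
    proof (induction j arbitrary: a)
      case 0
      then show ?case using Suc.IH by auto
    next
      case (Suc j)
      have xa: "x * a \<in> lann H (Suc k)" by (rule lann_stable[OF st Suc.prems(1)])
      have "x ^ j * (x * a) \<in> lann H k" using Suc.prems(2) by (simp add: mult.assoc[symmetric] power_commutes)
      from Suc.IH[OF xa this] have 1: "x * a \<in> lann ?G (k * m + j)" .
      have 2: "h * a \<in> lann ?G (k * m + j)" if "h \<in> H" for h
      proof -
        have "h * a \<in> lann H k" using Suc.prems(1) that by simp
        then have "h * a \<in> lann ?G (k * m)" using \<open>lann H k \<subseteq> lann ?G (k * m)\<close> by blast
        then show ?thesis by (rule lann_mono[rotated]) simp
      qed
      have "g * a \<in> lann ?G (k * m + j)" if "g \<in> ?G" for g
        using that 1 2 by (auto simp: distrib_right smul_mult_left simp del: lann.simps intro!: lann_add lann_smul)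
      then show ?case by simp
    qed
    have "a \<in> lann ?G (k * m + m)" if "a \<in> lann H (Suc k)" for a
      by (rule claim[OF that]) (simp add: assms(3) lann_zero)
    then show ?case by (auto simp: add.commute simp del: lann.simps)
  qed simp
  then show ?thesis using assms(2) unfolding nilset_def by blast
qed

text \<open>Engel's theorem: a maximal subalgebra with vanishing products would be normalised by a further element.\<close>

theorem engel:
  fixes \<g> :: "'a::field rmat set"
  assumes g: "rm.subspace \<g>" "\<g> \<subseteq> Mat d"
    and br: "\<And>a b. a \<in> \<g> \<Longrightarrow> b \<in> \<g> \<Longrightarrow> a * b - b * a \<in> \<g>"
    and nil: "\<And>a. a \<in> \<g> \<Longrightarrow> \<exists>m. a ^ m = 0"
  shows "nilset \<g>"
proof -
  define P where "P \<h> \<longleftrightarrow> rm.subspace \<h> \<and> \<h> \<subseteq> \<g> \<and> (\<forall>a\<in>\<h>. \<forall>b\<in>\<h>. a * b - b * a \<in> \<h>) \<and> nilset \<h>" for \<h>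
  have P0: "P {0}" unfolding P_def nilset_def using rm.subspace_0[OF g(1)]
    by (auto intro!: exI[of _ 1])
  obtain \<h> where h: "P \<h>" "\<And>\<h>'. P \<h>' \<Longrightarrow> \<h> \<subseteq> \<h>' \<Longrightarrow> \<h>' = \<h>"
    by (rule rm.fd_maximal[where P = P, OF rm.fd_subset[OF Mat_fd g] P0]) (auto simp: P_def)
  have hs: "rm.subspace \<h>" "\<h> \<subseteq> \<g>" "\<And>a b. a \<in> \<h> \<Longrightarrow> b \<in> \<h> \<Longrightarrow> a * b - b * a \<in> \<h>" "nilset \<h>"
    using h(1) by (auto simp: P_def)
  obtain p where p: "1 \<in> lann \<h> p" using hs(4) by (auto simp: nilset_def)
  have "\<h> = \<g>"
  proof (rule ccontr)
    assume "\<h> \<noteq> \<g>"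
    then obtain x0 where x0: "x0 \<in> \<g>" "x0 \<notin> \<h>" using hs(2) by blast
    \<comment> \<open>Elements of \<open>E t\<close> raise the level by at most \<open>t - p\<close>.\<close>
    define E where "E t = {a. \<forall>k. \<forall>v\<in>lann \<h> k. a * v \<in> lann \<h> (k + t - p)}" for t
    \<comment> \<open>Level \<open>p\<close> is already everything, so no element raises a level by
      more than p = 2 p - p.\<close>
    have all: "a \<in> E (2 * p)" for a
      unfolding E_def using lann_one[OF p] lann_mono[of p _ _ \<h>] by auto
    have E0: "a = 0" if "a \<in> E 0" for a
      using that p unfolding E_def by (auto dest!: spec[of _ p])
    have step: "h * a - a * h \<in> E t" if h: "h \<in> \<h>" and a: "a \<in> E (Suc t)" for h a t
      unfolding E_def
    proof (intro CollectI allI ballI)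
      fix k v assume v: "v \<in> lann \<h> k"
      have av: "a * v \<in> lann \<h> (k + Suc t - p)" using a v unfolding E_def by blast
      have 1: "h * (a * v) \<in> lann \<h> (k + t - p)"
      proof (cases "k + Suc t - p")
        case 0
        then show ?thesis using av lann_zero by simp
      next
        case (Suc q)
        then have "h * (a * v) \<in> lann \<h> q" using av h by simp
        moreover have "q = k + t - p" using Suc by simp
        ultimately show ?thesis by simp
      qed
      have 2: "a * (h * v) \<in> lann \<h> (k + t - p)"
      proof (cases k)
        case 0
        then show ?thesis using v lann_zero by simp
      next
        case (Suc k')
        then have "h * v \<in> lann \<h> k'" using v h by simp
        then have "a * (h * v) \<in> lann \<h> (k' + Suc t - p)" using a unfolding E_def by blast
        then show ?thesis using Suc by simp
      qed
      show "(h * a - a * h) * v \<in> lann \<h> (k + t - p)"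
        using lann_diff[OF 1 2] by (simp add: left_diff_distrib mult.assoc)
    qed
    \<comment> \<open>Bracketing with the subalgebra lowers \<open>t\<close> by one. For an outside
      element with least \<open>t\<close> all these brackets must fall into the subalgebra, so the
      element normalises it.\<close>
    define t where "t = (LEAST t. \<exists>x. x \<in> \<g> \<and> x \<notin> \<h> \<and> x \<in> E t)"
    have ex: "\<exists>x. x \<in> \<g> \<and> x \<notin> \<h> \<and> x \<in> E (2 * p)" using x0 all by blast
    obtain x where x: "x \<in> \<g>" "x \<notin> \<h>" "x \<in> E t"
      using LeastI[of "\<lambda>t. \<exists>x. x \<in> \<g> \<and> x \<notin> \<h> \<and> x \<in> E t", OF ex] unfolding t_def by blast
    have "t \<noteq> 0" by (rule notI) (use x E0[of x] rm.subspace_0[OF hs(1)] in auto)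
    then obtain t' where t': "t = Suc t'" by (cases t) auto
    have nrm: "h * x - x * h \<in> \<h>" if "h \<in> \<h>" for h
    proof -
      have "h * x - x * h \<in> E t'" using step that x t' by simp
      moreover have "h * x - x * h \<in> \<g>" using br that hs(2) x by blast
      moreover have "\<not> (\<exists>x. x \<in> \<g> \<and> x \<notin> \<h> \<and> x \<in> E t')"
        by (rule not_less_Least) (use t' in \<open>simp add: t_def[symmetric]\<close>)
      ultimately show ?thesis by blast
    qed
    let ?h = "{h + smul c x | h c. h \<in> \<h>}"
    have inh: "h + smul c x \<in> ?h" if "h \<in> \<h>" for h c using that by blast
    have sub: "\<h> \<subseteq> ?h" using inh[of _ 0] by auto
    obtain m where "x ^ m = 0" using nil x(1) by blast
    then have "nilset ?h" using nilset_extend[OF nrm hs(4)] by blast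
    moreover have "rm.subspace ?h"
    proof (rule rm.subspaceI)
      show "0 \<in> ?h" using sub rm.subspace_0[OF hs(1)] by blast
      show "a + b \<in> ?h" if ab: "a \<in> ?h" "b \<in> ?h" for a b
      proof -
        obtain h c h' c' where "a = h + smul c x" "b = h' + smul c' x" "h \<in> \<h>" "h' \<in> \<h>" using ab by blast
        then show ?thesis using inh[OF rm.subspace_add[OF hs(1)], of h h' "c + c'"]
          by (simp add: rm.scale_left_distrib algebra_simps)
      qed
      show "smul b a \<in> ?h" if a: "a \<in> ?h" for a b
      proof -
        obtain h c where "a = h + smul c x" "h \<in> \<h>" using a by blast
        then show ?thesis using inh[OF rm.subspace_scale[OF hs(1)], of h b "b * c"]
          by (simp add: rm.scale_right_distrib)
      qed
    qed
    moreover have "?h \<subseteq> \<g>"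
      using hs(2) x rm.subspace_add[OF g(1)] rm.subspace_scale[OF g(1)] by blast
    moreover have "a * b - b * a \<in> ?h" if ab: "a \<in> ?h" "b \<in> ?h" for a b
    proof -
      obtain h c h' c' where e: "a = h + smul c x" "b = h' + smul c' x" "h \<in> \<h>" "h' \<in> \<h>" using ab by blast
      have "a * b - b * a = (h * h' - h' * h) + smul c' (h * x - x * h) - smul c (h' * x - x * h')"
        unfolding e by (simp add: algebra_simps smul_mult_left smul_mult_right)
      also have "\<dots> \<in> \<h>"
        using rm.subspace_diff[OF hs(1) rm.subspace_add[OF hs(1) hs(3)[OF e(3,4)]
              rm.subspace_scale[OF hs(1) nrm[OF e(3)]]] rm.subspace_scale[OF hs(1) nrm[OF e(4)]]] .
      finally show ?thesis using sub by blast
    qed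
    ultimately have "P ?h" unfolding P_def by blast
    then have "?h = \<h>" using h(2) sub by blast
    moreover have "x \<in> ?h" using inh[OF rm.subspace_0[OF hs(1)], of 1] by simp
    ultimately show False using x by blast
  qed
  then show ?thesis using hs by simp
qed

section \<open>Cartan's criterion\<close>

subsection \<open>Generalised eigenspaces\<close>

definition shift :: "('a::field rmat \<Rightarrow> 'a rmat) \<Rightarrow> 'a \<Rightarrow> 'a rmat \<Rightarrow> 'a rmat" where
  "shift T l v = T v - smul l v"

definition gev :: "('a::field rmat \<Rightarrow> 'a rmat) \<Rightarrow> 'a \<Rightarrow> 'a rmat set" where
  "gev T l = {v. \<exists>m. (shift T l ^^ m) v = 0}"

text \<open>The instances are left and right multiplication by a matrix \<open>x\<close>, and
  \<open>ad x\<close>. Acting on matrices instead of vectors lets the eigencomponents of the unit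
  serve as spectral projections.\<close>

locale rmat_op =
  fixes T :: "'a::field rmat \<Rightarrow> 'a rmat"
  assumes T_add: "T (v + w) = T v + T w" and T_smul: "T (smul c v) = smul c (T v)"
begin

lemma T_zero: "T 0 = 0"
  using T_smul[of 0 0] by simp

lemma T_diff: "T (v - w) = T v - T w"
  using T_add[of "v - w" w] by (simp add: algebra_simps)

lemma shift_add: "(shift T l ^^ m) (v + w) = (shift T l ^^ m) v + (shift T l ^^ m) w"
  by (induction m) (auto simp: shift_def T_add rm.scale_right_distrib)

lemma shift_smul: "(shift T l ^^ m) (smul c v) = smul c ((shift T l ^^ m) v)"
  by (induction m) (auto simp: shift_def T_smul rm.scale_right_diff_distrib mult.commute)

lemma shift_zero: "(shift T l ^^ m) 0 = 0"
  using shift_smul[of m l 0 0] by simp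

lemma shift_sum: "(shift T l ^^ m) (\<Sum>x\<in>A. f x) = (\<Sum>x\<in>A. (shift T l ^^ m) (f x))"
  by (induction A rule: infinite_finite_induct) (auto simp: shift_add shift_zero)

lemma shift_shift: "shift T k (shift T l v) = shift T l (shift T k v)"
  by (simp add: shift_def T_diff T_smul rm.scale_right_diff_distrib mult.commute algebra_simps)

lemma shift_comm: "(shift T l ^^ m) (shift T k v) = shift T k ((shift T l ^^ m) v)"
  by (induction m) (auto simp: shift_shift)

lemma shift_comm2: "(shift T l ^^ m) ((shift T k ^^ n) v) = (shift T k ^^ n) ((shift T l ^^ m) v)"
  by (induction n) (auto simp: shift_comm)

lemma shift_mono: "m \<le> n \<Longrightarrow> (shift T l ^^ m) v = 0 \<Longrightarrow> (shift T l ^^ n) v = 0"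
  by (metis shift_zero le_add_diff_inverse2 funpow_add o_apply)

lemma gev_subspace: "rm.subspace (gev T l)"
proof (rule rm.subspaceI)
  fix v w c
  assume "v \<in> gev T l" "w \<in> gev T l"
  then obtain m n where "(shift T l ^^ m) v = 0" "(shift T l ^^ n) w = 0" by (auto simp: gev_def)
  then have "(shift T l ^^ max m n) v = 0" "(shift T l ^^ max m n) w = 0"
    using shift_mono by (metis max.cobounded1, metis max.cobounded2)
  then show "v + w \<in> gev T l" by (auto simp: gev_def shift_add intro!: exI[of _ "max m n"])
qed (auto simp: gev_def shift_smul shift_zero)

lemma gev_shift:
  assumes "v \<in> gev T l"
  shows "(shift T k ^^ m) v \<in> gev T l"
proof -
  obtain n where "(shift T l ^^ n) v = 0" using assms by (auto simp: gev_def)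
  then have "(shift T l ^^ n) ((shift T k ^^ m) v) = 0"
    using shift_comm2[of n l m k v] by (simp add: shift_zero)
  then show ?thesis by (auto simp: gev_def)
qed

lemma gev_shiftI:
  assumes "shift T l v \<in> gev T l"
  shows "v \<in> gev T l"
proof -
  obtain n where "(shift T l ^^ n) (shift T l v) = 0" using assms by (auto simp: gev_def)
  then have "(shift T l ^^ Suc n) v = 0" by (simp add: funpow_swap1)
  then show ?thesis unfolding gev_def by blast
qed

text \<open>On a generalised eigenspace for \<open>l\<close>, T - k is the nonzero scalar l - k plus
  a locally nilpotent operator; induction on the exponent solves for the preimage.\<close>

lemma gev_surj:
  assumes "v \<in> gev T l" "k \<noteq> l"
  shows "\<exists>w\<in>gev T l. shift T k w = v"
proof -
  from assms(1) obtain m where "(shift T l ^^ m) v = 0" by (auto simp: gev_def)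
  then show ?thesis
  proof (induction m arbitrary: v)
    case 0
    then show ?case using rm.subspace_0[OF gev_subspace] shift_zero[of 1]
      by (intro bexI[of _ 0]) auto
  next
    case (Suc m)
    then have "(shift T l ^^ m) (shift T l v) = 0" by (simp add: funpow_swap1)
    from Suc.IH[OF this] obtain h where h: "h \<in> gev T l" "shift T k h = shift T l v" by blast
    have v: "v \<in> gev T l" using Suc.prems unfolding gev_def by blast
    have "shift T k (v - h) = smul (l - k) v"
      using h(2) by (simp add: shift_def T_diff rm.scale_right_diff_distrib rm.scale_left_diff_distrib algebra_simps)
    then have "shift T k (smul (1 / (l - k)) (v - h)) = v"
      using shift_smul[of 1 k "1 / (l - k)"] assms(2) by simp
    moreover have "smul (1 / (l - k)) (v - h) \<in> gev T l"
      using v h(1) rm.subspace_diff[OF gev_subspace] rm.subspace_scale[OF gev_subspace] by blast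
    ultimately show ?case by blast
  qed
qed

text \<open>(t - k)^m and (t - l)^n are coprime. Induction on m + n replaces Bezout: (T - k) v and
  (T - l) v both lie in \<open>S\<close>, and their difference is a nonzero multiple of
  \<open>v\<close>.\<close>

lemma shift_coprime:
  assumes S: "rm.subspace S" "\<And>v. v \<in> S \<Longrightarrow> T v \<in> S" and kl: "k \<noteq> l"
    and "(shift T k ^^ m) v \<in> S" "(shift T l ^^ n) v \<in> S"
  shows "v \<in> S"
  using assms(4,5)
proof (induction "m + n" arbitrary: m n v)
  case 0
  then show ?case by simp
next
  case (Suc p)
  show ?case
  proof (cases "m = 0 \<or> n = 0")
    case True
    then show ?thesis using Suc by auto
  next
    case False
    then obtain m' n' where mn: "m = Suc m'" "n = Suc n'" by (metis not0_implies_Suc)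
    have shS: "shift T j w \<in> S" if "w \<in> S" for j w
      using that S rm.subspace_diff rm.subspace_scale unfolding shift_def by blast
    have e: "p = m' + n" "p = m + n'" using Suc.hyps(2) mn by simp_all
    have 1: "(shift T k ^^ m') (shift T k v) \<in> S" "(shift T l ^^ n') (shift T l v) \<in> S"
      using Suc.prems mn by (simp_all add: funpow_swap1)
    have 2: "(shift T l ^^ n) (shift T k v) \<in> S" "(shift T k ^^ m) (shift T l v) \<in> S"
      using Suc.prems shS by (simp_all add: shift_comm)
    have "shift T k v \<in> S" "shift T l v \<in> S"
      by (rule Suc.hyps(1)[OF e(1) 1(1) 2(1)], rule Suc.hyps(1)[OF e(2) 2(2) 1(2)])
    then have "shift T k v - shift T l v \<in> S" using rm.subspace_diff[OF S(1)] by blast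
    then have "smul (l - k) v \<in> S" by (simp add: shift_def rm.scale_left_diff_distrib)
    then have "smul (1 / (l - k)) (smul (l - k) v) \<in> S" using rm.subspace_scale[OF S(1)] by blast
    then show ?thesis using kl by simp
  qed
qed

text \<open>A power of T - b removes the component for \<open>b\<close>. By induction the images of
  the other components under that power lie in \<open>S\<close>, and \<open>shift_coprime\<close>
  recovers the components themselves because a power of T - a kills \<open>v a\<close>.\<close>

lemma gev_components:
  assumes S: "rm.subspace S" "\<And>v. v \<in> S \<Longrightarrow> T v \<in> S"
    and "finite A" "\<And>a. a \<in> A \<Longrightarrow> v a \<in> gev T a" "(\<Sum>a\<in>A. v a) \<in> S"
  shows "\<forall>a\<in>A. v a \<in> S"
  using assms(3-5)
proof (induction A arbitrary: v rule: finite_induct)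
  case (insert b A)
  from insert.prems(1)[of b] obtain m where m: "(shift T b ^^ m) (v b) = 0" by (auto simp: gev_def)
  have shS: "(shift T b ^^ m) w \<in> S" if "w \<in> S" for w
    using that by (induction m)
      (auto simp: shift_def intro!: rm.subspace_diff[OF S(1)] rm.subspace_scale[OF S(1)] S(2))
  have "(\<Sum>a\<in>A. (shift T b ^^ m) (v a)) = (shift T b ^^ m) (\<Sum>a\<in>insert b A. v a)"
    using insert.hyps m by (simp add: shift_sum shift_add)
  also have "\<dots> \<in> S" using shS insert.prems(2) by blast
  finally have "\<forall>a\<in>A. (shift T b ^^ m) (v a) \<in> S"
    by (intro insert.IH) (use gev_shift insert.prems(1) in auto)
  then have A: "v a \<in> S" if "a \<in> A" for a
  proof -
    obtain n where "(shift T a ^^ n) (v a) = 0" using insert.prems(1)[of a] \<open>a \<in> A\<close> by (auto simp: gev_def)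
    then have "(shift T a ^^ n) (v a) \<in> S" using rm.subspace_0[OF S(1)] by simp
    moreover have "a \<noteq> b" using \<open>a \<in> A\<close> insert.hyps by blast
    ultimately show ?thesis
      using shift_coprime[OF S, of a b n "v a" m] \<open>\<forall>a\<in>A. (shift T b ^^ m) (v a) \<in> S\<close> \<open>a \<in> A\<close> by blast
  qed
  then have "(\<Sum>a\<in>A. v a) \<in> S" by (rule rm.subspace_sum[OF S(1)])
  then have "(\<Sum>a\<in>insert b A. v a) - (\<Sum>a\<in>A. v a) \<in> S" using rm.subspace_diff[OF S(1)] insert.prems(2) by blast
  then show ?case using A insert.hyps by auto
qed simp

section \<open>Polynomials in an operator and the primary decomposition\<close>

definition pev :: "'a poly \<Rightarrow> 'a rmat \<Rightarrow> 'a rmat" where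
  "pev p v = (\<Sum>i\<le>degree p. smul (coeff p i) ((T ^^ i) v))"

lemma pev_eq: "degree p \<le> n \<Longrightarrow> pev p v = (\<Sum>i\<le>n. smul (coeff p i) ((T ^^ i) v))"
  unfolding pev_def by (rule sum.mono_neutral_left) (auto simp: coeff_eq_0)

lemma pev_factor: "pev ([:- a, 1:] * q) v = pev q (shift T a v)"
proof -
  define n where "n = degree q"
  have Tp: "(T ^^ i) (shift T a v) = (T ^^ Suc i) v - smul a ((T ^^ i) v)" for i
    by (induction i) (auto simp: shift_def T_diff T_smul)
  have c: "coeff ([:- a, 1:] * q) i = coeff (pCons 0 q) i - a * coeff q i" for i
    by simp
  have "degree ([:- a, 1:] * q) \<le> Suc n"
    using degree_mult_le[of "[:- a, 1:]" q] by (simp add: n_def)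
  then have "pev ([:- a, 1:] * q) v = (\<Sum>i\<le>Suc n. smul (coeff ([:- a, 1:] * q) i) ((T ^^ i) v))"
    by (rule pev_eq)
  also have "\<dots> = (\<Sum>i\<le>Suc n. smul (coeff (pCons 0 q) i) ((T ^^ i) v))
      - (\<Sum>i\<le>Suc n. smul (a * coeff q i) ((T ^^ i) v))"
    unfolding c rm.scale_left_diff_distrib by (rule sum_subtractf)
  also have "(\<Sum>i\<le>Suc n. smul (coeff (pCons 0 q) i) ((T ^^ i) v))
      = (\<Sum>i\<le>n. smul (coeff q i) ((T ^^ Suc i) v))"
    by (subst sum.atMost_Suc_shift) simp
  also have "(\<Sum>i\<le>Suc n. smul (a * coeff q i) ((T ^^ i) v)) = (\<Sum>i\<le>n. smul (coeff q i) (smul a ((T ^^ i) v)))"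
    by (simp add: n_def coeff_eq_0 mult.commute)
  finally show ?thesis
    unfolding pev_eq[of q n "shift T a v", OF eq_refl[OF n_def[symmetric]]] Tp
    by (simp add: rm.scale_right_diff_distrib sum_subtractf)
qed

lemma pev_monom: "pev (monom 1 n) v = (T ^^ n) v"
proof -
  have "pev (monom 1 n) v = (\<Sum>i\<le>n. smul (coeff (monom 1 n) i) ((T ^^ i) v))"
    by (rule pev_eq) (simp add: degree_monom_le)
  also have "\<dots> = (\<Sum>i\<le>n. if i = n then (T ^^ n) v else 0)"
    by (rule sum.cong) auto
  finally show ?thesis by simp
qed

lemma pev_span:
  assumes "z \<in> rm.span {(T ^^ i) v | i. n \<le> i}"
  shows "\<exists>q. pev q v = z \<and> (\<forall>i<n. coeff q i = 0)"
  using assms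
proof (induction rule: rm.span_induct)
  case base
  show ?case
  proof (rule rm.subspaceI; clarsimp)
    show "\<exists>q. pev q v = 0 \<and> (\<forall>i<n. coeff q i = 0)" by (rule exI[of _ 0]) (simp add: pev_def)
  next
    fix p q :: "'a poly" assume "\<forall>i<n. coeff p i = 0" "\<forall>i<n. coeff q i = 0"
    moreover have "pev (p + q) v = pev p v + pev q v"
    proof -
      let ?m = "max (degree p) (degree q)"
      show ?thesis using pev_eq[of p ?m v] pev_eq[of q ?m v] pev_eq[of "p + q" ?m v] degree_add_le_max[of p q]
        by (simp add: rm.scale_left_distrib sum.distrib)
    qed
    ultimately show "\<exists>r. pev r v = pev p v + pev q v \<and> (\<forall>i<n. coeff r i = 0)"
      by (intro exI[of _ "p + q"]) auto
  next
    fix c and q :: "'a poly" assume "\<forall>i<n. coeff q i = 0"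
    moreover have "pev (Polynomial.smult c q) v = smul c (pev q v)"
      using pev_eq[of "Polynomial.smult c q" "degree q" v] pev_eq[of q "degree q" v]
      by (simp add: rm.scale_sum_right)
    ultimately show "\<exists>r. pev r v = smul c (pev q v) \<and> (\<forall>i<n. coeff r i = 0)"
      by (intro exI[of _ "Polynomial.smult c q"]) auto
  qed
next
  case (step z)
  then obtain i where i: "z = (T ^^ i) v" "n \<le> i" by blast
  then show ?case using pev_monom[of i v] by (intro exI[of _ "monom 1 i"]) auto
qed

text \<open>Once the spans of T^i v for i >= n are constant, T^n v is a combination \<open>q\<close>
  of higher iterates. The polynomial t^n - q is nonzero because its coefficient at n is 1.\<close>

lemma pev_exists:
  assumes "fd smul V" "v \<in> V" "\<And>w. w \<in> V \<Longrightarrow> T w \<in> V"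
  shows "\<exists>p. p \<noteq> 0 \<and> pev p v = 0"
proof -
  define S where "S n = rm.span {(T ^^ i) v | i. n \<le> i}" for n
  have TV: "(T ^^ i) v \<in> V" for i by (induction i) (use assms in auto)
  have SV: "S n \<subseteq> V" for n
    unfolding S_def by (rule rm.span_minimal) (use TV assms(1) rm.fd_subspaceD in auto)
  obtain n where n: "\<And>m. n \<le> m \<Longrightarrow> S m = S n"
  proof (rule rm.fd_chain[OF assms(1), of S])
    show "rm.subspace (S n)" for n by (simp add: S_def)
    show "S (Suc n) \<subseteq> S n" for n unfolding S_def by (rule rm.span_mono) auto
  qed (use SV in blast)+
  have "(T ^^ n) v \<in> S (Suc n)" using n[of "Suc n"] unfolding S_def by (auto intro: rm.span_base)
  then obtain q where q: "pev q v = (T ^^ n) v" "\<forall>i<Suc n. coeff q i = 0"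
    using pev_span unfolding S_def by blast
  let ?d = "max (degree q) n"
  have "pev (monom 1 n - q) v = pev (monom 1 n) v - pev q v"
    using pev_eq[of q ?d v] pev_eq[of "monom 1 n" ?d v] pev_eq[of "monom 1 n - q" ?d v]
      degree_diff_le[of "monom 1 n" ?d q] degree_monom_le[of "1::'a" n]
    by (simp add: rm.scale_left_diff_distrib sum_subtractf max.coboundedI2)
  moreover have "coeff (monom 1 n - q) n = 1" using q(2) by simp
  then have "monom 1 n - q \<noteq> 0" by (metis coeff_0 zero_neq_one)
  ultimately show ?thesis using q pev_monom[of n v] by (intro exI[of _ "monom 1 n - q"]) auto
qed

end

text \<open>Induction on the degree of the annihilating polynomial. For a root \<open>a\<close>, (T
  - a) v is a sum of eigencomponents; those for other eigenvalues lift through T - a by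
  \<open>gev_surj\<close>, and what remains of \<open>v\<close> belongs to \<open>a\<close>.\<close>

lemma gev_decomposition:
  fixes T :: "'a::alg_closed_field rmat \<Rightarrow> 'a rmat"
  assumes "rmat_op T" "p \<noteq> 0" "rmat_op.pev T p v = 0"
  shows "v \<in> rm.span (\<Union>l. gev T l)"
  using assms(2,3)
proof (induction "degree p" arbitrary: p v)
  case 0
  interpret rmat_op T by fact
  obtain c where "p = [:c:]" "c \<noteq> 0" using 0 by (metis degree_eq_zeroE pCons_0_0)
  then show ?case using 0 by (simp add: pev_def rm.span_zero)
next
  case (Suc n)
  interpret rmat_op T by fact
  obtain a where "poly p a = 0" using alg_closed_imp_poly_has_root[of p] Suc by auto
  then obtain q where q: "p = [:- a, 1:] * q" by (auto simp: poly_eq_0_iff_dvd)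
  have q0: "q \<noteq> 0" using q Suc by auto
  then have "degree q = n" using Suc(2) q degree_mult_eq[of "[:- a, 1:]" q] by simp
  then have "shift T a v \<in> rm.span (\<Union>l. gev T l)"
    using Suc(1)[of q "shift T a v"] q0 Suc.prems(2) pev_factor q by simp
  then have "\<exists>s\<in>rm.span (\<Union>l. gev T l). shift T a v - shift T a s \<in> gev T a"
  proof (induction rule: rm.span_induct)
    case base
    have sh: "shift T a (x + y) = shift T a x + shift T a y" "shift T a (smul c x) = smul c (shift T a x)" for x y c
      using shift_add[of 1 a] shift_smul[of 1 a] by auto
    show ?case
    proof (rule rm.subspaceI; clarsimp)
      show "\<exists>s\<in>rm.span (\<Union>l. gev T l). - shift T a s \<in> gev T a"
        using rm.span_zero shift_zero[of 1 a] rm.subspace_0[OF gev_subspace] by (auto intro!: bexI[of _ 0])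
    next
      fix x y s t
      assume *: "s \<in> rm.span (\<Union>l. gev T l)" "x - shift T a s \<in> gev T a"
        "t \<in> rm.span (\<Union>l. gev T l)" "y - shift T a t \<in> gev T a"
      have "x + y - shift T a (s + t) = (x - shift T a s) + (y - shift T a t)" by (simp add: sh)
      then show "\<exists>s\<in>rm.span (\<Union>l. gev T l). x + y - shift T a s \<in> gev T a"
        using * rm.subspace_add[OF gev_subspace] rm.span_add by (metis (no_types))
    next
      fix c x s
      assume *: "s \<in> rm.span (\<Union>l. gev T l)" "x - shift T a s \<in> gev T a"
      have "smul c x - shift T a (smul c s) = smul c (x - shift T a s)" by (simp add: sh rm.scale_right_diff_distrib)
      then show "\<exists>s\<in>rm.span (\<Union>l. gev T l). smul c x - shift T a s \<in> gev T a"
        using * rm.subspace_scale[OF gev_subspace] rm.span_scale by (metis (no_types))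
    qed
  next
    case (step x)
    then obtain l where l: "x \<in> gev T l" by blast
    show ?case
    proof (cases "l = a")
      case True
      then show ?thesis using l rm.span_zero shift_zero[of 1 a] by (auto intro!: bexI[of _ 0])
    next
      case False
      then obtain w where "w \<in> gev T l" "shift T a w = x" using gev_surj[OF l, of a] by metis
      then show ?thesis using rm.subspace_0[OF gev_subspace]
        by (intro bexI[of _ w]) (auto intro!: rm.span_base)
    qed
  qed
  then obtain s where s: "s \<in> rm.span (\<Union>l. gev T l)" "shift T a v - shift T a s \<in> gev T a" by blast
  then have "shift T a (v - s) \<in> gev T a" by (simp add: shift_def T_diff rm.scale_right_diff_distrib algebra_simps)
  then have "v - s \<in> rm.span (\<Union>l. gev T l)" using gev_shiftI by (blast intro: rm.span_base)
  then show ?case using rm.span_add[OF _ s(1), of "v - s"] by simp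
qed

lemma span_UN_subspaces:
  assumes "\<And>l. rm.subspace (G l)" "v \<in> rm.span (\<Union>l. G l)"
  shows "\<exists>L u. finite L \<and> (\<forall>l. u l \<in> G l) \<and> (\<forall>l. l \<notin> L \<longrightarrow> u l = 0) \<and> v = (\<Sum>l\<in>L. u l)"
proof -
  define Q where "Q v \<longleftrightarrow> (\<exists>L u. finite L \<and> (\<forall>l. u l \<in> G l) \<and> (\<forall>l. l \<notin> L \<longrightarrow> u l = 0) \<and> v = (\<Sum>l\<in>L. u l))" for v
  have QI: "Q v" if "finite L" "\<And>l. u l \<in> G l" "\<And>l. l \<notin> L \<Longrightarrow> u l = 0" "v = (\<Sum>l\<in>L. u l)" for L u v
    unfolding Q_def using that by blast
  have "Q v"
    using assms(2)
  proof (induction rule: rm.span_induct)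
    case base
    have "Q 0" by (rule QI[of "{}" "\<lambda>_. 0"]) (auto simp: rm.subspace_0[OF assms(1)])
    moreover have "Q (v + w)" if "Q v" "Q w" for v w
    proof -
      obtain L u where *: "finite L" "\<And>l. u l \<in> G l" "\<And>l. l \<notin> L \<Longrightarrow> u l = 0" "v = (\<Sum>l\<in>L. u l)"
        using \<open>Q v\<close> unfolding Q_def by blast
      obtain L' u' where **: "finite L'" "\<And>l. u' l \<in> G l" "\<And>l. l \<notin> L' \<Longrightarrow> u' l = 0" "w = (\<Sum>l\<in>L'. u' l)"
        using \<open>Q w\<close> unfolding Q_def by blast
      have "sum u L = sum u (L \<union> L')" "sum u' L' = sum u' (L \<union> L')"
        by (rule sum.mono_neutral_left; use * ** in auto)+
      then show ?thesis
        using * ** by (intro QI[of "L \<union> L'" "\<lambda>l. u l + u' l"]) (auto simp: sum.distrib rm.subspace_add[OF assms(1)])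
    qed
    moreover have "Q (smul c v)" if "Q v" for c v
    proof -
      obtain L u where *: "finite L" "\<And>l. u l \<in> G l" "\<And>l. l \<notin> L \<Longrightarrow> u l = 0" "v = (\<Sum>l\<in>L. u l)"
        using \<open>Q v\<close> unfolding Q_def by blast
      then show ?thesis
        by (intro QI[of L "\<lambda>l. smul c (u l)"]) (auto simp: rm.scale_sum_right rm.subspace_scale[OF assms(1)])
    qed
    ultimately show ?case by (auto intro!: rm.subspaceI)
  next
    case (step x)
    then obtain l where "x \<in> G l" by blast
    then show ?case using rm.subspace_0[OF assms(1)]
      by (intro QI[of "{l}" "\<lambda>k. if k = l then x else 0"]) auto
  qed
  then show ?thesis unfolding Q_def .
qed

subsection \<open>The criterion\<close>

text \<open>Eigenvalues in a field without an order are made rational, so that a vanishing sum of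
  squares forces every term to vanish.\<close>

lemma rational_functional:
  fixes l :: "'a::field_char_0"
  assumes "l \<noteq> 0"
  obtains f :: "'a \<Rightarrow> rat" where "f l = 1" "\<And>x y. f (x + y) = f x + f y" "\<And>q x. f (of_rat q * x) = q * f x"
proof -
  have v1: "vector_space (\<lambda>q x. of_rat q * x :: 'a)"
    by unfold_locales (auto simp: algebra_simps of_rat_add of_rat_mult)
  have v2: "vector_space ((*) :: rat \<Rightarrow> rat \<Rightarrow> rat)"
    by unfold_locales (auto simp: algebra_simps)
  have vp: "vector_space_pair (\<lambda>q x. of_rat q * x :: 'a) ((*) :: rat \<Rightarrow> rat \<Rightarrow> rat)"
    using v1 v2 by (simp add: vector_space_pair_def)
  interpret v: vector_space "\<lambda>q x. of_rat q * x :: 'a" by (rule v1)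
  have ind: "v.independent {l}" using assms by simp
  obtain f where f: "Vector_Spaces.linear (\<lambda>q x. of_rat q * x :: 'a) (*) f" "\<forall>x\<in>{l}. f x = 1"
    using vector_space_pair.linear_independent_extend[OF vp ind, of "\<lambda>_. 1"] by blast
  show thesis
    by (rule that[of f]) (use f in \<open>auto simp: Vector_Spaces.linear_iff\<close>)
qed

text \<open>\<open>ad x\<close> minus k - l is the difference of the commuting operators L - k and R
  - l, where L and R multiply by \<open>x\<close> on the left and on the right. Both are nilpotent
  at \<open>c\<close>, and induction on m + n avoids the binomial formula.\<close>

lemma gev_ad:
  fixes x :: "'a::field rmat"
  assumes "(shift (\<lambda>a. x * a) k ^^ m) c = 0" "(shift (\<lambda>a. a * x) l ^^ n) c = 0"
  shows "c \<in> gev (\<lambda>a. x * a - a * x) (k - l)"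
proof -
  interpret L: rmat_op "\<lambda>a. x * a" by unfold_locales (auto simp: distrib_left smul_mult_right)
  interpret R: rmat_op "\<lambda>a. a * x" by unfold_locales (auto simp: distrib_right smul_mult_left)
  interpret A: rmat_op "\<lambda>a. x * a - a * x"
    by unfold_locales (auto simp: algebra_simps smul_mult_left smul_mult_right)
  have LR: "shift (\<lambda>a. x * a) k (shift (\<lambda>a. a * x) l v) = shift (\<lambda>a. a * x) l (shift (\<lambda>a. x * a) k v)" for v
    by (simp add: shift_def algebra_simps smul_mult_left smul_mult_right)
  have LRn: "(shift (\<lambda>a. x * a) k ^^ m) (shift (\<lambda>a. a * x) l v) = shift (\<lambda>a. a * x) l ((shift (\<lambda>a. x * a) k ^^ m) v)" for v m
    by (induction m) (auto simp: LR)
  have RLn: "(shift (\<lambda>a. a * x) l ^^ m) (shift (\<lambda>a. x * a) k v) = shift (\<lambda>a. x * a) k ((shift (\<lambda>a. a * x) l ^^ m) v)" for v m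
    by (induction m) (auto simp: LR)
  show ?thesis
    using assms
  proof (induction "m + n" arbitrary: m n c)
    case 0
    then show ?case using rm.subspace_0[OF A.gev_subspace] by simp
  next
    case (Suc p)
    show ?case
    proof (cases "m = 0 \<or> n = 0")
      case True
      then show ?thesis using Suc.prems rm.subspace_0[OF A.gev_subspace] by auto
    next
      case False
      then obtain m' n' where mn: "m = Suc m'" "n = Suc n'" by (metis not0_implies_Suc)
      have e: "p = m' + n" "p = m + n'" using Suc.hyps(2) mn by simp_all
      have 1: "(shift (\<lambda>a. x * a) k ^^ m') (shift (\<lambda>a. x * a) k c) = 0"
        "(shift (\<lambda>a. a * x) l ^^ n') (shift (\<lambda>a. a * x) l c) = 0"
        using Suc.prems mn by (simp_all add: funpow_swap1)
      have 2: "(shift (\<lambda>a. a * x) l ^^ n) (shift (\<lambda>a. x * a) k c) = 0"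
        "(shift (\<lambda>a. x * a) k ^^ m) (shift (\<lambda>a. a * x) l c) = 0"
        using Suc.prems by (simp_all add: LRn RLn) (simp_all add: shift_def)
      have "shift (\<lambda>a. x * a) k c - shift (\<lambda>a. a * x) l c \<in> gev (\<lambda>a. x * a - a * x) (k - l)"
        by (rule rm.subspace_diff[OF A.gev_subspace Suc.hyps(1)[OF e(1) 1(1) 2(1)] Suc.hyps(1)[OF e(2) 2(2) 1(2)]])
      moreover have "shift (\<lambda>a. x * a) k c - shift (\<lambda>a. a * x) l c = shift (\<lambda>a. x * a - a * x) (k - l) c"
        by (simp add: shift_def rm.scale_left_diff_distrib)
      ultimately show ?thesis
        using A.gev_shiftI[of "k - l" c] by simp
    qed
  qed
qed

text \<open>With \<open>x = s + n\<close> the Jordan decomposition and \<open>f\<close> a rational functional, the trace form pairs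
  \<open>x\<close> with \<open>f(s)\<close> to zero, because \<open>ad f(s)\<close> preserves every subspace that \<open>ad x\<close> preserves.\<close>

lemma cartan_alg_closed:
  fixes \<g> :: "'a::{alg_closed_field, field_char_0} rmat set"
  assumes g: "rm.subspace \<g>" "\<g> \<subseteq> Mat d"
    and br: "\<And>a b. a \<in> \<g> \<Longrightarrow> b \<in> \<g> \<Longrightarrow> a * b - b * a \<in> \<g>"
    and tr0: "\<And>a b. a \<in> \<g> \<Longrightarrow> b \<in> \<g> \<Longrightarrow> tr (a * b) = 0"
    and x: "x \<in> rm.span {a * b - b * a | a b. a \<in> \<g> \<and> b \<in> \<g>}"
  shows "\<exists>m. x ^ m = 0"
proof -
  have "rm.span {a * b - b * a | a b. a \<in> \<g> \<and> b \<in> \<g>} \<subseteq> \<g>"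
    by (rule rm.span_minimal[OF _ g(1)]) (use br in auto)
  then have xg: "x \<in> \<g>" using x by blast
  then have xM: "x \<in> Mat d" using g by blast
  define e where "e = (Pd d :: 'a rmat)"
  have eM: "e \<in> Mat d" and e1: "\<And>a. a \<in> Mat d \<Longrightarrow> e * a = a" "\<And>a. a \<in> Mat d \<Longrightarrow> a * e = a"
    by (auto simp: e_def Pd_Mat Pd_left Pd_right)
  let ?T = "\<lambda>a. x * a"
  interpret L: rmat_op ?T by unfold_locales (auto simp: distrib_left smul_mult_right)
  interpret A: rmat_op "\<lambda>a. x * a - a * x"
    by unfold_locales (auto simp: algebra_simps smul_mult_left smul_mult_right)
  obtain p where p: "p \<noteq> 0" "L.pev p e = 0"
    using L.pev_exists[OF Mat_fd eM] xM by (auto intro: Mat_closed)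
  have "e \<in> rm.span (\<Union>l. gev ?T l)"
    by (rule gev_decomposition[OF L.rmat_op_axioms p])
  from span_UN_subspaces[OF L.gev_subspace this]
  obtain \<Lambda> E where E: "finite \<Lambda>" "\<And>l. E l \<in> gev ?T l" "e = (\<Sum>l\<in>\<Lambda>. E l)" by blast
  \<comment> \<open>The bicommutant of \<open>x\<close> in \<open>Mat d\<close>. It contains the
    unit and is stable under multiplication by \<open>x\<close>, so it contains every component
    \<open>E l\<close>; hence these commute with \<open>x\<close> and with each other.\<close>
  define S where "S = {a \<in> Mat d. \<forall>b\<in>Mat d. b * x = x * b \<longrightarrow> b * a = a * b}"
  have S: "rm.subspace S" unfolding S_def
    by (rule rm.subspaceI) (auto simp: Mat_closed algebra_simps smul_mult_left smul_mult_right)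
  have ST: "x * a \<in> S" if "a \<in> S" for a
  proof -
    have "b * (x * a) = x * a * b" if b: "b \<in> Mat d" "b * x = x * b" for b
    proof -
      have "b * (x * a) = x * (b * a)" using b(2) by (simp add: mult.assoc[symmetric])
      then show ?thesis using \<open>a \<in> S\<close> b by (simp add: S_def mult.assoc)
    qed
    then show ?thesis using that xM by (simp add: S_def Mat_closed)
  qed
  have "(\<Sum>l\<in>\<Lambda>. E l) \<in> S" unfolding E(3)[symmetric] S_def using eM e1 by auto
  then have ES: "\<And>l. l \<in> \<Lambda> \<Longrightarrow> E l \<in> S"
    using L.gev_components[OF S ST E(1), of E] E(2) by blast
  then have EM: "\<And>l. l \<in> \<Lambda> \<Longrightarrow> E l \<in> Mat d" by (auto simp: S_def)
  have Ex: "x * E l = E l * x" if "l \<in> \<Lambda>" for l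
    using ES[OF that] xM by (auto simp: S_def)
  have EE: "E k * E l = E l * E k" if "k \<in> \<Lambda>" "l \<in> \<Lambda>" for k l
    using ES[OF that(2)] EM[OF that(1)] Ex[OF that(1)] by (auto simp: S_def)
  have shm: "(shift ?T k ^^ m) (a * b) = (shift ?T k ^^ m) a * b" for k m a b
    by (induction m) (auto simp: shift_def left_diff_distrib mult.assoc smul_mult_left)
  \<comment> \<open>The product lies in two different generalised eigenspaces of left
    multiplication. As the \<open>E l\<close> add up to the unit, orthogonality also makes them
    idempotent.\<close>
  have orth: "E k * E l = 0" if "k \<in> \<Lambda>" "l \<in> \<Lambda>" "k \<noteq> l" for k l
  proof -
    obtain m n where mn: "(shift ?T k ^^ m) (E k) = 0" "(shift ?T l ^^ n) (E l) = 0"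
      using E(2)[of k] E(2)[of l] by (auto simp: gev_def)
    have "(shift ?T k ^^ m) (E k * E l) = 0" unfolding shm mn by simp
    moreover have "(shift ?T l ^^ n) (E k * E l) = 0" unfolding EE[OF that(1,2)] shm mn by simp
    ultimately show ?thesis
      using L.shift_coprime[of "{0}" k l m "E k * E l" n] that(3) by simp
  qed
  have idem: "E l * E l = E l" if "l \<in> \<Lambda>" for l
  proof -
    have "E l = (\<Sum>k\<in>\<Lambda>. E k * E l)"
      using e1(1)[OF EM[OF that]] by (simp add: E(3) sum_distrib_right)
    also have "\<dots> = (\<Sum>k\<in>\<Lambda>. if k = l then E l * E l else 0)"
      by (rule sum.cong) (auto simp: orth that)
    finally show ?thesis using E(1) that by simp
  qed
  have all0: "l = 0" if l: "l \<in> \<Lambda>" "E l \<noteq> 0" for l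
  proof (rule ccontr)
    assume "l \<noteq> 0"
    then obtain f :: "'a \<Rightarrow> rat" where f: "f l = 1" "\<And>x y. f (x + y) = f x + f y" "\<And>q x. f (of_rat q * x) = q * f x"
      using rational_functional by blast
    have f0: "f 0 = 0" using f(3)[of 0 0] by simp
    have fs: "f (\<Sum>x\<in>J. h x) = (\<Sum>x\<in>J. f (h x))" for J and h :: "'a \<Rightarrow> 'a"
      by (induction J rule: infinite_finite_induct) (auto simp: f f0)
    have fm: "f (a - b) = f a - f b" for a b using f(2)[of "a - b" b] by simp
    \<comment> \<open>\<open>y\<close> is the semisimple part of \<open>x\<close> with every
      eigenvalue replaced by its rational image.\<close>
    define F where "F k = (of_rat (f k) :: 'a)" for k
    define y where "y = (\<Sum>k\<in>\<Lambda>. smul (F k) (E k))"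
    have yM: "y \<in> Mat d" unfolding y_def by (intro Mat_closed(6) Mat_closed(5) EM)
    \<comment> \<open>\<open>b\<close> splits into eigencomponents \<open>D a\<close> of
      \<open>ad x\<close>, each in \<g> because \<g> is stable under \<open>ad x\<close>. As
      \<open>f\<close> is additive, \<open>ad y\<close> multiplies \<open>D a\<close> by
      \<open>F a\<close>.\<close>
    have yb: "y * b - b * y \<in> \<g>" if b: "b \<in> \<g>" for b
    proof -
      have bM: "b \<in> Mat d" using b g by blast
      define B where "B k l = E k * b * E l" for k l
      define D where "D a = (\<Sum>(k, l)\<in>{p\<in>\<Lambda> \<times> \<Lambda>. fst p - snd p = a}. B k l)" for a
      define I where "I = (\<lambda>p. fst p - snd p) ` (\<Lambda> \<times> \<Lambda>)"
      have finI: "finite I" "finite (\<Lambda> \<times> \<Lambda>)" using E(1) by (auto simp: I_def)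
      have Bgev: "B k l \<in> gev (\<lambda>a. x * a - a * x) (k - l)" if "k \<in> \<Lambda>" "l \<in> \<Lambda>" for k l
      proof -
        obtain m n where mn: "(shift ?T k ^^ m) (E k) = 0" "(shift ?T l ^^ n) (E l) = 0"
          using E(2)[of k] E(2)[of l] by (auto simp: gev_def)
        have 1: "(shift ?T l ^^ n) (E l) = (shift (\<lambda>a. a * x) l ^^ n) (E l) \<and>
            x * (shift ?T l ^^ n) (E l) = (shift ?T l ^^ n) (E l) * x" for n
        proof (induction n)
          case (Suc n)
          let ?a = "(shift ?T l ^^ n) (E l)"
          have xa: "x * ?a = ?a * x" using Suc by blast
          have "x * shift ?T l ?a = shift ?T l ?a * x"
            by (simp add: shift_def left_diff_distrib right_diff_distrib smul_mult_left smul_mult_right mult.assoc)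
              (simp add: xa mult.assoc[symmetric])
          moreover have "shift ?T l ?a = shift (\<lambda>a. a * x) l ?a" by (simp add: shift_def xa)
          ultimately show ?case using Suc by simp
        qed (simp add: Ex[OF that(2)])
        have 2: "(shift (\<lambda>a. a * x) l ^^ n) (a * c) = a * (shift (\<lambda>a. a * x) l ^^ n) c" for n a c
          by (induction n) (auto simp: shift_def right_diff_distrib mult.assoc smul_mult_right)
        have "(shift ?T k ^^ m) (B k l) = 0" by (simp add: B_def mult.assoc shm mn)
        moreover have "(shift (\<lambda>a. a * x) l ^^ n) (B k l) = 0"
          using 1[of n] mn by (simp add: B_def 2)
        ultimately show ?thesis by (rule gev_ad)
      qed
      have Dgev: "D a \<in> gev (\<lambda>a. x * a - a * x) a" for a
        unfolding D_def by (rule rm.subspace_sum[OF A.gev_subspace]) (use Bgev in auto)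
      have group: "(\<Sum>a\<in>I. \<Sum>p\<in>{p\<in>\<Lambda> \<times> \<Lambda>. fst p - snd p = a}. h p) = (\<Sum>p\<in>\<Lambda> \<times> \<Lambda>. h p)" for h :: "'a \<times> 'a \<Rightarrow> 'a rmat"
        using sum.group[OF finI(2) finI(1), of "\<lambda>p. fst p - snd p" h] by (simp add: I_def)
      have "b = e * b * e" using e1 bM by simp
      also have "\<dots> = (\<Sum>k\<in>\<Lambda>. \<Sum>l\<in>\<Lambda>. B k l)"
        unfolding E(3) B_def by (simp add: sum_distrib_left sum_distrib_right) (rule sum.swap)
      also have "\<dots> = (\<Sum>a\<in>I. D a)"
        unfolding D_def group by (simp add: sum.cartesian_product)
      finally have "(\<Sum>a\<in>I. D a) \<in> \<g>" using b by simp
      then have Dg: "\<forall>a\<in>I. D a \<in> \<g>"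
        using A.gev_components[OF g(1) _ finI(1), of D] Dgev br xg by blast
      have "y * b = y * (b * e)" using e1 bM by simp
      also have "\<dots> = (\<Sum>k\<in>\<Lambda>. \<Sum>l\<in>\<Lambda>. smul (F k) (B k l))"
        unfolding E(3) y_def B_def
        by (simp add: sum_distrib_left sum_distrib_right smul_mult_left mult.assoc) (rule sum.swap)
      finally have 1: "y * b = (\<Sum>k\<in>\<Lambda>. \<Sum>l\<in>\<Lambda>. smul (F k) (B k l))" .
      have "b * y = e * b * y" using e1 bM by simp
      also have "\<dots> = (\<Sum>k\<in>\<Lambda>. \<Sum>l\<in>\<Lambda>. smul (F l) (B k l))"
        unfolding E(3) y_def B_def
        by (simp add: sum_distrib_left sum_distrib_right smul_mult_right rm.scale_sum_right) (rule sum.swap)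
      finally have 2: "b * y = (\<Sum>k\<in>\<Lambda>. \<Sum>l\<in>\<Lambda>. smul (F l) (B k l))" .
      have Fm: "F k - F l = F (k - l)" for k l by (simp add: F_def fm of_rat_diff)
      have "y * b - b * y = (\<Sum>p\<in>\<Lambda> \<times> \<Lambda>. smul (F (fst p - snd p)) (B (fst p) (snd p)))"
        unfolding 1 2
        by (simp add: sum_subtractf[symmetric] rm.scale_left_diff_distrib[symmetric] Fm sum.cartesian_product split_def)
      also have "\<dots> = (\<Sum>a\<in>I. smul (F a) (D a))"
        unfolding D_def rm.scale_sum_right
        by (subst group[symmetric]) (auto intro!: sum.cong simp: split_def)
      also have "\<dots> \<in> \<g>"
        by (rule rm.subspace_sum[OF g(1)]) (use Dg rm.subspace_scale[OF g(1)] in blast)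
      finally show ?thesis .
    qed
    \<comment> \<open>Invariance gives tr ([a, b] y) = - tr (a [y, b]), and [y, b] lies in \<g>,
      where the trace form vanishes.\<close>
    have "tr (z * y) = 0 \<and> z \<in> Mat d" if "z \<in> rm.span {a * b - b * a | a b. a \<in> \<g> \<and> b \<in> \<g>}" for z
      using that
    proof (induction rule: rm.span_induct)
      case base
      show ?case by (rule rm.subspaceI)
          (auto simp: Mat_closed distrib_right smul_mult_left tr_add[of _ d] tr_smul[of _ d] yM)
    next
      case (step z)
      then obtain a b where z: "z = a * b - b * a" "a \<in> \<g>" "b \<in> \<g>" by blast
      have M: "a \<in> Mat d" "b \<in> Mat d" using z g by auto
      have "tr (z * y) = tr (a * (b * y)) - tr (b * (a * y))"
        unfolding z(1) left_diff_distrib mult.assoc by (rule tr_diff[of _ d]) (intro Mat_closed(7) M yM)+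
      also have "tr (b * (a * y)) = tr (a * (y * b))"
        by (subst tr_comm[of _ d]) (auto intro!: Mat_closed(7) M yM simp: mult.assoc)
      also have "tr (a * (b * y)) - tr (a * (y * b)) = - tr (a * (y * b - b * y))"
        unfolding right_diff_distrib by (subst tr_diff[of _ d]) (auto intro!: Mat_closed(7) M yM)
      also have "\<dots> = 0" using tr0[OF z(2) yb[OF z(3)]] by simp
      finally show ?case using M z by (auto intro: Mat_closed)
    qed
    then have "tr (x * y) = 0" using x by blast
    \<comment> \<open>The difference of x E_k and k E_k is nilpotent, so its trace is 0.\<close>
    moreover have "tr (x * E k) = k * tr (E k)" if k: "k \<in> \<Lambda>" for k
    proof -
      define z where "z = shift ?T k (E k)"
      have zM: "z \<in> Mat d" unfolding z_def shift_def by (intro Mat_closed(3,5,7) xM EM k)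
      have sE: "(shift ?T k ^^ m) (E k) * E k = (shift ?T k ^^ m) (E k)" for m
        using shm[of m k "E k" "E k"] idem[OF k] by simp
      have Es: "E k * (shift ?T k ^^ m) (E k) = (shift ?T k ^^ m) (E k)" for m
      proof (induction m)
        case (Suc m)
        let ?a = "(shift ?T k ^^ m) (E k)"
        have "E k * (x * ?a) = x * (E k * ?a)" using Ex[OF k] by (simp add: mult.assoc[symmetric])
        then have "E k * shift ?T k ?a = shift ?T k ?a"
          unfolding shift_def[of ?T k ?a] using Suc by (simp add: right_diff_distrib smul_mult_right)
        then show ?case by simp
      qed (simp add: idem[OF k])
      have "z ^ Suc m = (shift ?T k ^^ Suc m) (E k)" for m
      proof (induction m)
        case (Suc m)
        have "z ^ Suc (Suc m) = z * (shift ?T k ^^ Suc m) (E k)" using Suc by simp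
        also have "\<dots> = shift ?T k (E k * (shift ?T k ^^ Suc m) (E k))"
          unfolding z_def using shm[of 1 k "E k"] by simp
        finally show ?case by (simp only: Es) simp
      qed (simp add: z_def)
      moreover obtain m where "(shift ?T k ^^ m) (E k) = 0" using E(2)[of k] by (auto simp: gev_def)
      ultimately have "z ^ Suc m = 0" by (simp add: shift_def)
      then have "tr z = 0" by (rule nilpotent_trace[OF zM])
      then show ?thesis
        unfolding z_def shift_def
        by (subst (asm) tr_diff[of _ d]) (auto intro!: Mat_closed(5,7) xM EM k simp: tr_smul[OF EM[OF k]])
    qed
    moreover have "tr (x * y) = (\<Sum>k\<in>\<Lambda>. F k * tr (x * E k))"
      unfolding y_def sum_distrib_left smul_mult_right
      by (subst tr_sum[of _ _ d]) (auto intro!: Mat_closed(5,7) xM EM sum.cong tr_smul[of _ d])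
    ultimately have s0: "(\<Sum>k\<in>\<Lambda>. F k * (k * tr (E k))) = 0" by simp
    have "\<forall>k\<in>\<Lambda>. \<exists>r::nat. tr (E k) = of_nat r \<and> (r = 0 \<longrightarrow> E k = 0)"
      using idempotent_trace[OF EM idem] by blast
    then obtain r :: "'a \<Rightarrow> nat" where r: "\<And>k. k \<in> \<Lambda> \<Longrightarrow> tr (E k) = of_nat (r k)" "\<And>k. k \<in> \<Lambda> \<Longrightarrow> r k = 0 \<Longrightarrow> E k = 0"
      by metis
    have "(\<Sum>k\<in>\<Lambda>. F k * (k * tr (E k))) = (\<Sum>k\<in>\<Lambda>. of_rat (f k * of_nat (r k)) * k)"
      by (rule sum.cong) (auto simp: F_def r of_rat_mult)
    \<comment> \<open>Applying \<open>f\<close> yields a vanishing sum of nonnegative rationals r_k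
      f(k)^2, although f(l) = 1 and r_l is not 0.\<close>
    then have "0 = f (\<Sum>k\<in>\<Lambda>. of_rat (f k * of_nat (r k)) * k)" using s0 f0 by simp
    also have "\<dots> = (\<Sum>k\<in>\<Lambda>. f k * of_nat (r k) * f k)" by (simp add: fs f(3))
    finally have "(\<Sum>k\<in>\<Lambda>. of_nat (r k) * (f k * f k)) = 0" by (simp add: algebra_simps)
    then have "of_nat (r l) * (f l * f l) = 0"
      by (subst (asm) sum_nonneg_eq_0_iff[OF E(1)]) (use l in auto)
    then show False using f(1) r(2)[OF l(1)] l(2) by simp
  qed
  have "\<exists>m. (shift ?T 0 ^^ m) e = 0"
  proof (cases "0 \<in> \<Lambda>")
    case True
    have "e = (\<Sum>k\<in>\<Lambda>. if k = 0 then E 0 else 0)"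
      unfolding E(3) by (rule sum.cong) (use all0 in auto)
    then have "e = E 0" using E(1) True by simp
    then show ?thesis using E(2)[of 0] by (auto simp: gev_def)
  next
    case False
    have "e = 0" unfolding E(3) by (rule sum.neutral) (use all0 False in auto)
    then show ?thesis by (intro exI[of _ 0]) simp
  qed
  then obtain m where "(shift ?T 0 ^^ m) e = 0" by blast
  moreover have "(shift ?T 0 ^^ m) e = x ^ m * e" for m
    by (induction m) (auto simp: shift_def mult.assoc)
  ultimately have "x ^ m * e * x = 0" by simp
  then have "x ^ Suc m = 0" using e1(1)[OF xM] by (simp add: mult.assoc power_commutes)
  then show ?thesis by blast
qed

section \<open>Descent of Cartan's criterion from the algebraic closure\<close>

lift_definition ac :: "'a::field rmat \<Rightarrow> 'a alg_closure rmat" is "\<lambda>A i j. to_ac (A i j)"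
  by simp

lemma ac_add: "ac (A + B) = ac A + ac B"
  by (rule rmat_eqI) (simp add: ac.rep_eq ent_simps)

lemma ac_diff: "ac (A - B) = ac A - ac B"
  by (rule rmat_eqI) (simp add: ac.rep_eq ent_simps)

lemma ac_zero: "ac 0 = 0"
  by (rule rmat_eqI) (simp add: ac.rep_eq ent_simps)

lemma ac_one: "ac 1 = 1"
  by (rule rmat_eqI) (simp add: ac.rep_eq one_rmat.rep_eq)

lemma ac_smul: "ac (smul c A) = smul (to_ac c) (ac A)"
  by (rule rmat_eqI) (simp add: ac.rep_eq ent_simps)

lemma ac_mult: "ac (A * B) = ac A * ac B"
proof (rule rmat_eqI)
  fix i j
  show "ent (ac (A * B)) i j = ent (ac A * ac B) i j"
    by (simp add: ac.rep_eq times_rmat.rep_eq to_ac_sum)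
qed

lemma ac_power: "ac (A ^ n) = ac A ^ n"
  by (induction n) (auto simp: ac_one ac_mult)

lemma ac_eq_zero: "ac A = 0 \<Longrightarrow> A = 0"
  by (rule rmat_eqI) (metis ac.rep_eq to_ac_eq_0_iff zero_rmat.rep_eq)

lemma ac_Mat: "A \<in> Mat d \<Longrightarrow> ac A \<in> Mat d"
  by (auto simp: Mat_def ac.rep_eq)

lemma tr_ac: "tr (ac A) = to_ac (tr A)"
  by (simp add: tr_def ac.rep_eq to_ac_sum)

theorem cartan_criterion:
  fixes \<g> :: "'a::field_char_0 rmat set"
  assumes g: "rm.subspace \<g>" "\<g> \<subseteq> Mat d"
    and br: "\<And>a b. a \<in> \<g> \<Longrightarrow> b \<in> \<g> \<Longrightarrow> a * b - b * a \<in> \<g>"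
    and tr0: "\<And>a b. a \<in> \<g> \<Longrightarrow> b \<in> \<g> \<Longrightarrow> tr (a * b) = 0"
    and x: "x \<in> rm.span {a * b - b * a | a b. a \<in> \<g> \<and> b \<in> \<g>}"
  shows "\<exists>m. x ^ m = 0"
proof -
  define G where "G = rm.span (ac ` \<g>)"
  have GM: "G \<subseteq> Mat d"
    unfolding G_def by (rule rm.span_minimal[OF _ Mat_subspace]) (use g ac_Mat in blast)
  \<comment> \<open>A property that is linear in each argument need only be checked on the image of
    \<g>. It is used for closure under brackets and for the trace form.\<close>
  have bil: "Q a b"
    if "a \<in> G" "b \<in> G" and base: "\<And>a b. a \<in> \<g> \<Longrightarrow> b \<in> \<g> \<Longrightarrow> Q (ac a) (ac b)"
      and l: "\<And>b. b \<in> G \<Longrightarrow> rm.subspace {a. Q a b}" and r: "\<And>a. a \<in> G \<Longrightarrow> rm.subspace {b. Q a b}" for Q a b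
  proof -
    have 1: "Q (ac a) b" if "a \<in> \<g>" for a
      using \<open>b \<in> G\<close> unfolding G_def
    proof (induction rule: rm.span_induct)
      case base
      show ?case by (rule r) (auto simp: G_def that rm.span_base)
    qed (use that base in auto)
    show ?thesis
      using \<open>a \<in> G\<close> unfolding G_def
    proof (induction rule: rm.span_induct)
      case base
      show ?case by (rule l) (rule that)
    qed (use 1 in auto)
  qed
  have lie: "a * b - b * a \<in> G" if "a \<in> G" "b \<in> G" for a b
  proof (rule bil[OF that])
    show "ac a * ac b - ac b * ac a \<in> G" if "a \<in> \<g>" "b \<in> \<g>" for a b
      using br[OF that] by (simp add: G_def rm.span_base flip: ac_mult ac_diff)
    have s: "c * (a + b) - (a + b) * c = (c * a - a * c) + (c * b - b * c)"
      "(a + b) * c - c * (a + b) = (a * c - c * a) + (b * c - c * b)"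
      "c * smul k a - smul k a * c = smul k (c * a - a * c)"
      "smul k a * c - c * smul k a = smul k (a * c - c * a)" for a b c :: "'a alg_closure rmat" and k
      by (simp_all add: algebra_simps smul_mult_left smul_mult_right)
    show "rm.subspace {a. a * b - b * a \<in> G}" "rm.subspace {b. a * b - b * a \<in> G}" for a b
      by (rule rm.subspaceI; simp add: s; simp add: G_def rm.span_zero rm.span_add rm.span_scale)+
  qed
  have "\<exists>m. ac x ^ m = 0"
  proof (rule cartan_alg_closed[OF _ GM lie])
    show "rm.subspace G" by (simp add: G_def)
    have "a \<in> Mat d \<and> b \<in> Mat d \<and> tr (a * b) = 0" if ab: "a \<in> G" "b \<in> G" for a b
    proof (rule bil[OF ab])
      show "ac a \<in> Mat d \<and> ac b \<in> Mat d \<and> tr (ac a * ac b) = 0" if "a \<in> \<g>" "b \<in> \<g>" for a b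
        using tr0[OF that] that g by (auto simp: tr_ac ac_Mat simp flip: ac_mult)
      show "rm.subspace {a. a \<in> Mat d \<and> b \<in> Mat d \<and> tr (a * b) = 0}"
        "rm.subspace {a. b \<in> Mat d \<and> a \<in> Mat d \<and> tr (b * a) = 0}" if "b \<in> G" for b
        using that GM by (auto intro!: rm.subspaceI
            simp: Mat_closed distrib_right distrib_left smul_mult_left smul_mult_right tr_add[of _ d] tr_smul[of _ d] subset_iff)
    qed
    then show "tr (a * b) = 0" if ab: "a \<in> G" "b \<in> G" for a b
      using ab by blast
    show "ac x \<in> rm.span {a * b - b * a | a b. a \<in> G \<and> b \<in> G}"
      using x
    proof (induction rule: rm.span_induct)
      case base
      show ?case by (rule rm.subspaceI) (auto simp: ac_zero ac_add ac_smul rm.span_zero rm.span_add rm.span_scale)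
    next
      case (step z)
      then obtain a b where "z = a * b - b * a" "a \<in> \<g>" "b \<in> \<g>" by blast
      then show ?case by (auto simp: ac_mult ac_diff G_def intro!: rm.span_base)
    qed
  qed
  then show ?thesis using ac_eq_zero by (metis ac_power)
qed

section \<open>Lie algebras, representations and modules\<close>

definition lin_on :: "('a::field \<Rightarrow> 'w::ab_group_add \<Rightarrow> 'w) \<Rightarrow> 'w set \<Rightarrow> ('w \<Rightarrow> 'w) \<Rightarrow> bool" where
  "lin_on s W f \<longleftrightarrow> (\<forall>w\<in>W. f w \<in> W) \<and> (\<forall>v\<in>W. \<forall>w\<in>W. f (v + w) = f v + f w) \<and> (\<forall>c. \<forall>w\<in>W. f (s c w) = s c (f w))"

text \<open>These six properties are the interface through which modules see matrices; they return
  as the axioms of \<open>fd_lie_module\<close>.\<close>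

lemma (in vector_space) matrix_of_operator:
  assumes "fd scale W"
  obtains d and M :: "('b \<Rightarrow> 'b) \<Rightarrow> 'a rmat" where
    "\<And>f. M f \<in> Mat d"
    "\<And>f g. lin_on scale W f \<Longrightarrow> lin_on scale W g \<Longrightarrow> M (\<lambda>w. f (g w)) = M f * M g"
    "\<And>f g. lin_on scale W f \<Longrightarrow> lin_on scale W g \<Longrightarrow> M (\<lambda>w. f w + g w) = M f + M g"
    "\<And>f c. lin_on scale W f \<Longrightarrow> M (\<lambda>w. scale c (f w)) = smul c (M f)"
    "\<And>f. lin_on scale W f \<Longrightarrow> M f = 0 \<longleftrightarrow> (\<forall>w\<in>W. f w = 0)"
    "\<And>f g. (\<And>w. w \<in> W \<Longrightarrow> f w = g w) \<Longrightarrow> M f = M g"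
proof -
  obtain B where B: "finite B" "independent B" "B \<subseteq> W" "span B = W" "card B = dim W"
    using fd_basis[OF assms] .
  define d where "d = card B"
  obtain b where b: "bij_betw b {..<d} B"
    using ex_bij_betw_nat_finite[OF B(1)] by (auto simp: d_def atLeast0LessThan)
  have bB: "b i \<in> B" if "i < d" for i using b that by (auto simp: bij_betw_def)
  have bW: "b i \<in> W" if "i < d" for i using bB[OF that] B(3) by blast
  define c where "c w i = representation B w (b i)" for w i
  have c_add: "c (v + w) i = c v i + c w i" if "v \<in> W" "w \<in> W" for v w i
    unfolding c_def using representation_add[OF B(2)] that B(4) by simp
  have c_scale: "c (scale k w) i = k * c w i" if "w \<in> W" for k w i
    unfolding c_def using representation_scale[OF B(2)] that B(4) by simp
  have expand: "w = (\<Sum>i<d. scale (c w i) (b i))" if "w \<in> W" for w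
  proof -
    have "w = (\<Sum>x\<in>B. scale (representation B w x) x)"
      using sum_representation_eq[OF B(2) _ B(1) order_refl, of w] that B(4) by simp
    also have "\<dots> = (\<Sum>i<d. scale (c w i) (b i))"
      unfolding c_def by (rule sum.reindex_bij_betw[OF b, symmetric])
    finally show ?thesis .
  qed
  have c_sum: "c (\<Sum>k\<in>A. h k) i = (\<Sum>k\<in>A. c (h k) i)" if "\<And>k. k \<in> A \<Longrightarrow> h k \<in> W" "finite A" for A :: "nat set" and h i
    using that(2,1)
  proof (induction A rule: finite_induct)
    case empty
    then show ?case by (simp add: c_def representation_zero)
  next
    case (insert x F)
    have "sum h F \<in> W" using insert B(4) by (metis insertCI span_sum)
    then show ?case using insert by (simp add: c_add)
  qed
  define M0 where "M0 f = (\<lambda>i j. if i < d \<and> j < d then c (f (b j)) i else 0)" for f :: "'b \<Rightarrow> 'b"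
  define M where "M f = Abs_rmat (M0 f)" for f
  have "{j. M0 f i j \<noteq> 0} \<subseteq> {..<d}" for f i by (auto simp: M0_def)
  then have "finite {j. M0 f i j \<noteq> 0}" for f i by (rule finite_subset) simp
  then have entM: "ent (M f) i j = (if i < d \<and> j < d then c (f (b j)) i else 0)" for f i j
    by (simp add: M_def Abs_rmat_inverse) (simp add: M0_def)
  have MM: "M f \<in> Mat d" for f by (simp add: Mat_def entM)
  have f_sum: "f (\<Sum>k\<in>A. scale (u k) (b k)) = (\<Sum>k\<in>A. scale (u k) (f (b k)))"
    if f: "lin_on scale W f" and A: "A \<subseteq> {..<d}" "finite A" for f A u
    using A(2,1)
  proof (induction A rule: finite_induct)
    case empty
    have "f (scale 0 0) = scale 0 (f 0)" using f B(4) span_zero unfolding lin_on_def by blast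
    then show ?case by simp
  next
    case (insert x F)
    have "(\<Sum>k\<in>F. scale (u k) (b k)) \<in> W" "scale (u x) (b x) \<in> W" "b x \<in> W"
      using insert bW B(4) by (auto intro!: span_sum span_scale)
    then show ?case using insert f by (simp add: lin_on_def)
  qed
  show thesis
  proof (rule that[of M d, OF MM])
    fix f g assume f: "lin_on scale W f" and g: "lin_on scale W g"
    show "M (\<lambda>w. f w + g w) = M f + M g"
      using f g bW by (intro rmat_eqI) (auto simp: entM ent_simps c_add lin_on_def)
    show "M (\<lambda>w. f (g w)) = M f * M g"
    proof (rule rmat_eqI)
      fix i j
      show "ent (M (\<lambda>w. f (g w))) i j = ent (M f * M g) i j"
      proof (cases "i < d \<and> j < d")
        case True
        have gb: "g (b j) \<in> W" using g bW True by (auto simp: lin_on_def)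
        have fb: "f (b k) \<in> W" if "k < d" for k using f bW that by (auto simp: lin_on_def)
        have "f (g (b j)) = (\<Sum>k<d. scale (c (g (b j)) k) (f (b k)))"
          using f_sum[OF f order_refl, of "c (g (b j))"] expand[OF gb] by simp
        then have "c (f (g (b j))) i = (\<Sum>k<d. c (scale (c (g (b j)) k) (f (b k))) i)"
          using c_sum[of "{..<d}" "\<lambda>k. scale (c (g (b j)) k) (f (b k))" i] fb B(4)
          by (metis (no_types, lifting) finite_lessThan lessThan_iff span_scale)
        also have "\<dots> = (\<Sum>k<d. ent (M f) i k * ent (M g) k j)"
          using fb True by (intro sum.cong) (auto simp: c_scale entM)
        finally show ?thesis using True by (simp add: entM Mat_times_ent[OF MM])
      next
        case False
        then show ?thesis using Mat_ent[OF MM] Mat_ent[OF Mat_times[OF MM MM]] by metis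
      qed
    qed
  next
    fix f c' assume f: "lin_on scale W f"
    show "M (\<lambda>w. scale c' (f w)) = smul c' (M f)"
      using f bW by (intro rmat_eqI) (auto simp: entM ent_simps c_scale lin_on_def)
  next
    fix f assume f: "lin_on scale W f"
    show "M f = 0 \<longleftrightarrow> (\<forall>w\<in>W. f w = 0)"
    proof
      assume M0: "M f = 0"
      have fb: "f (b j) = 0" if j: "j < d" for j
      proof -
        have "f (b j) \<in> W" using f bW j by (auto simp: lin_on_def)
        then have "f (b j) = (\<Sum>i<d. scale (ent (M f) i j) (b i))"
          using expand[of "f (b j)"] j by (simp add: entM)
        then show ?thesis by (simp add: M0 ent_simps)
      qed
      show "\<forall>w\<in>W. f w = 0"
      proof
        fix w assume "w \<in> W"
        then have "f w = (\<Sum>k<d. scale (c w k) (f (b k)))"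
          using f_sum[OF f order_refl, of "c w"] expand[of w] by simp
        then show "f w = 0" using fb by simp
      qed
    next
      assume "\<forall>w\<in>W. f w = 0"
      then show "M f = 0" using bW by (intro rmat_eqI) (auto simp: entM ent_simps c_def representation_zero)
    qed
  next
    fix f g :: "'b \<Rightarrow> 'b" assume "\<And>w. w \<in> W \<Longrightarrow> f w = g w"
    then show "M f = M g" using bW by (intro rmat_eqI) (auto simp: entM)
  qed
qed

definition lie_rep :: "('a::field \<Rightarrow> 'v::ab_group_add \<Rightarrow> 'v) \<Rightarrow> 'v set \<Rightarrow> ('v \<Rightarrow> 'v \<Rightarrow> 'v) \<Rightarrow> nat \<Rightarrow> ('v \<Rightarrow> 'a rmat) \<Rightarrow> bool" where
  "lie_rep s L br d \<rho> \<longleftrightarrow> (\<forall>x\<in>L. \<rho> x \<in> Mat d) \<and> (\<forall>x\<in>L. \<forall>y\<in>L. \<rho> (x + y) = \<rho> x + \<rho> y)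
    \<and> (\<forall>c. \<forall>x\<in>L. \<rho> (s c x) = smul c (\<rho> x)) \<and> (\<forall>x\<in>L. \<forall>y\<in>L. \<rho> (br x y) = \<rho> x * \<rho> y - \<rho> y * \<rho> x)"

lemma lie_repD:
  assumes "lie_rep s L br d \<rho>" "x \<in> L" "y \<in> L"
  shows "\<rho> x \<in> Mat d" "\<rho> (x + y) = \<rho> x + \<rho> y" "\<rho> (s c x) = smul c (\<rho> x)"
    "\<rho> (br x y) = \<rho> x * \<rho> y - \<rho> y * \<rho> x"
  using assms unfolding lie_rep_def by blast+

section \<open>Ideals, brackets and solvable chains\<close>

context lie_algebra_on
begin

lemmas V_closed = subspace_0[OF subspace_carrier] subspace_add[OF subspace_carrier]
  subspace_diff[OF subspace_carrier] subspace_neg[OF subspace_carrier]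
  subspace_scale[OF subspace_carrier] subspace_sum[OF subspace_carrier] prd_closed

lemma prd_zero_left [simp]: "x \<in> V \<Longrightarrow> prd 0 x = 0"
  using prd_scale_left[of 0 x 0] V_closed(1) by simp

lemma prd_zero_right [simp]: "x \<in> V \<Longrightarrow> prd x 0 = 0"
  using prd_scale_right[of x 0 0] V_closed(1) by simp

lemma prd_minus_left: "x \<in> V \<Longrightarrow> y \<in> V \<Longrightarrow> prd (- x) y = - prd x y"
  using prd_scale_left[of x y "-1"] by simp

lemma prd_minus_right: "x \<in> V \<Longrightarrow> y \<in> V \<Longrightarrow> prd x (- y) = - prd x y"
  using prd_scale_right[of x y "-1"] by simp

lemma prd_diff_left: "x \<in> V \<Longrightarrow> y \<in> V \<Longrightarrow> z \<in> V \<Longrightarrow> prd (x - y) z = prd x z - prd y z"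
  using prd_add_left[of x "- y" z] by (simp add: prd_minus_left V_closed)

lemma prd_diff_right: "x \<in> V \<Longrightarrow> y \<in> V \<Longrightarrow> z \<in> V \<Longrightarrow> prd x (y - z) = prd x y - prd x z"
  using prd_add_right[of x y "- z"] by (simp add: prd_minus_right V_closed)

lemma antisym: "x \<in> V \<Longrightarrow> y \<in> V \<Longrightarrow> prd y x = - prd x y"
proof -
  assume *: "x \<in> V" "y \<in> V"
  have "0 = prd (x + y) (x + y)" using * alternating V_closed by simp
  also have "\<dots> = prd x y + prd y x"
    using * by (simp add: prd_add_left prd_add_right V_closed) (simp add: alternating)
  finally have "prd x y + prd y x = 0" by simp
  then show ?thesis by (simp add: add_eq_0_iff)
qed

lemma jacobi_left: "x \<in> V \<Longrightarrow> y \<in> V \<Longrightarrow> z \<in> V \<Longrightarrow> prd (prd x y) z = prd x (prd y z) - prd y (prd x z)"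
proof -
  assume *: "x \<in> V" "y \<in> V" "z \<in> V"
  have "prd z (prd x y) = - prd (prd x y) z" "prd y (prd z x) = - prd y (prd x z)"
    using antisym[of "prd x y" z] antisym[of x z] * by (simp_all add: prd_closed prd_minus_right)
  then show ?thesis using jacobi[of x y z] * by (simp add: algebra_simps)
qed

definition lie_ideal :: "'b set \<Rightarrow> bool" where
  "lie_ideal I \<longleftrightarrow> subspace I \<and> I \<subseteq> V \<and> (\<forall>x\<in>V. \<forall>a\<in>I. prd x a \<in> I)"

lemma lie_idealD:
  assumes "lie_ideal I"
  shows "subspace I" "a \<in> I \<Longrightarrow> a \<in> V" "x \<in> V \<Longrightarrow> a \<in> I \<Longrightarrow> prd x a \<in> I" "x \<in> V \<Longrightarrow> a \<in> I \<Longrightarrow> prd a x \<in> I"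
proof -
  show 1: "subspace I" "a \<in> I \<Longrightarrow> a \<in> V" "x \<in> V \<Longrightarrow> a \<in> I \<Longrightarrow> prd x a \<in> I"
    using assms by (auto simp: lie_ideal_def)
  assume "x \<in> V" "a \<in> I"
  then show "prd a x \<in> I"
    using assms antisym[of x a] subspace_neg[OF 1(1)] by (auto simp: lie_ideal_def)
qed

lemma lie_idealI:
  "subspace I \<Longrightarrow> I \<subseteq> V \<Longrightarrow> (\<And>x a. x \<in> V \<Longrightarrow> a \<in> I \<Longrightarrow> prd x a \<in> I) \<Longrightarrow> lie_ideal I"
  by (auto simp: lie_ideal_def)

lemma lie_ideal_span:
  assumes "S \<subseteq> V" "\<And>x a. x \<in> V \<Longrightarrow> a \<in> S \<Longrightarrow> prd x a \<in> span S"
  shows "lie_ideal (span S)"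
proof (rule lie_idealI)
  show sub: "span S \<subseteq> V" using span_minimal[OF assms(1) subspace_carrier] .
  fix x a assume x: "x \<in> V" and "a \<in> span S"
  from this(2) have "a \<in> V \<and> prd x a \<in> span S"
  proof (induction rule: span_induct)
    case base
    show ?case using x by (intro subspaceI)
        (auto simp: V_closed prd_add_right prd_scale_right span_zero span_add span_scale)
  qed (use assms x in auto)
  then show "prd x a \<in> span S" ..
qed simp

lemma lie_ideal_inter: "lie_ideal I \<Longrightarrow> lie_ideal J \<Longrightarrow> lie_ideal (I \<inter> J)"
  by (auto simp: lie_ideal_def subspace_inter)

definition brackets :: "'b set \<Rightarrow> 'b set \<Rightarrow> 'b set" where
  "brackets A B = span {prd x y | x y. x \<in> A \<and> y \<in> B}"

lemma brackets_base: "x \<in> A \<Longrightarrow> y \<in> B \<Longrightarrow> prd x y \<in> brackets A B"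
  unfolding brackets_def by (rule span_base) blast

lemma brackets_minimal: "(\<And>x y. x \<in> A \<Longrightarrow> y \<in> B \<Longrightarrow> prd x y \<in> W) \<Longrightarrow> subspace W \<Longrightarrow> brackets A B \<subseteq> W"
  unfolding brackets_def by (rule span_minimal) auto

lemma lie_ideal_V: "lie_ideal V"
  by (rule lie_idealI) (auto simp: subspace_carrier prd_closed)

lemma lie_ideal_brackets:
  assumes "lie_ideal I" "lie_ideal J"
  shows "lie_ideal (brackets I J)"
  unfolding brackets_def
proof (rule lie_ideal_span)
  note I = lie_idealD[OF assms(1)] and J = lie_idealD[OF assms(2)]
  show "{prd x y |x y. x \<in> I \<and> y \<in> J} \<subseteq> V" using I J prd_closed by blast
  fix x a assume x: "x \<in> V" and "a \<in> {prd x y |x y. x \<in> I \<and> y \<in> J}"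
  then obtain u v where a: "a = prd u v" "u \<in> I" "v \<in> J" by blast
  have "prd x a = prd (prd x u) v + prd u (prd x v)"
    using jacobi_left[of x u v] x a I J by simp
  moreover have "prd x u \<in> I" "prd x v \<in> J" using a x I(3) J(3) by auto
  ultimately show "prd x a \<in> span {prd x y |x y. x \<in> I \<and> y \<in> J}"
    using a by (simp only:) (intro span_add span_base; blast)
qed

text \<open>Solvable ideals, given by a chain of ideals of the whole algebra with abelian quotients.\<close>

inductive solv :: "'b set \<Rightarrow> bool" where
  solv_zero: "solv {0}"
| solv_step: "solv A \<Longrightarrow> lie_ideal B \<Longrightarrow> A \<subseteq> B \<Longrightarrow> (\<And>x y. x \<in> B \<Longrightarrow> y \<in> B \<Longrightarrow> prd x y \<in> A) \<Longrightarrow> solv B"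

lemma solv_ideal: "solv B \<Longrightarrow> lie_ideal B"
proof (induction rule: solv.induct)
  case solv_zero
  show ?case by (rule lie_idealI) (auto simp: V_closed)
qed

lemma rep_subspace:
  assumes "lie_rep scale V prd d \<rho>" "subspace U" "U \<subseteq> V"
  shows "rm.subspace (\<rho> ` U)"
proof (rule rm.subspaceI)
  note r = lie_repD[OF assms(1)]
  have "\<rho> (scale 0 0) = smul 0 (\<rho> 0)" using r(3) V_closed(1) by blast
  then have r0: "\<rho> 0 = 0" by simp
  then show "0 \<in> \<rho> ` U" using subspace_0[OF assms(2)] by (metis imageI)
  show "a + b \<in> \<rho> ` U" if ab: "a \<in> \<rho> ` U" "b \<in> \<rho> ` U" for a b
  proof -
    obtain u v where "a = \<rho> u" "b = \<rho> v" "u \<in> U" "v \<in> U" using ab by blast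
    then show ?thesis using r(2)[of u v] assms(3) subspace_add[OF assms(2), of u v] by (metis imageI subsetD)
  qed
  show "smul c a \<in> \<rho> ` U" if a: "a \<in> \<rho> ` U" for c a
  proof -
    obtain u where "a = \<rho> u" "u \<in> U" using a by blast
    then show ?thesis using r(3)[of u u c] assms(3) subspace_scale[OF assms(2), of u c] by (metis imageI subsetD)
  qed
qed

end

section \<open>Solvable ideals act nilpotently on brackets\<close>

text \<open>Words end in \<open>Pd d\<close>, so that the empty word is the unit of
  \<open>Mat d\<close> and all words stay in \<open>Mat d\<close>.\<close>

inductive_set alg_words :: "'a::field rmat set \<Rightarrow> nat \<Rightarrow> 'a rmat set" for P d where
  "Pd d \<in> alg_words P d"
| "x \<in> P \<Longrightarrow> w \<in> alg_words P d \<Longrightarrow> x * w \<in> alg_words P d"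

definition assoc_span :: "'a::field rmat set \<Rightarrow> nat \<Rightarrow> 'a rmat set" where
  "assoc_span P d = rm.span (alg_words P d)"

text \<open>In characteristic zero this is the Jacobson radical of the associative algebra spanned by \<open>P\<close>.\<close>

definition trace_radical :: "'a::field rmat set \<Rightarrow> nat \<Rightarrow> 'a rmat set" where
  "trace_radical P d = {n \<in> assoc_span P d. \<forall>b\<in>assoc_span P d. tr (n * b) = 0}"

section \<open>Nil ideals and the trace radical\<close>

context
  fixes P :: "'a::field_char_0 rmat set" and d :: nat
  assumes PM: "P \<subseteq> Mat d"
begin

lemma alg_words_Mat: "w \<in> alg_words P d \<Longrightarrow> w \<in> Mat d"
  by (induction rule: alg_words.induct) (use PM in \<open>auto intro: Pd_Mat Mat_closed\<close>)

lemma assoc_span_subspace: "rm.subspace (assoc_span P d)"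
  by (simp add: assoc_span_def)

lemma assoc_span_Mat: "a \<in> assoc_span P d \<Longrightarrow> a \<in> Mat d"
  unfolding assoc_span_def using rm.span_minimal[OF _ Mat_subspace] alg_words_Mat by blast

lemma assoc_span_unit: "Pd d \<in> assoc_span P d"
  unfolding assoc_span_def by (intro rm.span_base alg_words.intros)

lemma assoc_span_base: "x \<in> P \<Longrightarrow> x \<in> assoc_span P d"
  unfolding assoc_span_def using alg_words.intros(2)[OF _ alg_words.intros(1), of x P d] PM Pd_right[of x d]
  by (auto simp: subset_iff intro: rm.span_base)

lemma assoc_span_induct [consumes 1, case_names unit mult zero add smul]:
  assumes "a \<in> assoc_span P d" "Q (Pd d)" "\<And>x w. x \<in> P \<Longrightarrow> w \<in> assoc_span P d \<Longrightarrow> Q w \<Longrightarrow> Q (x * w)"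
    "Q 0" "\<And>a b. Q a \<Longrightarrow> Q b \<Longrightarrow> Q (a + b)" "\<And>c a. Q a \<Longrightarrow> Q (smul c a)"
  shows "Q a"
  using assms(1) unfolding assoc_span_def
proof (induction rule: rm.span_induct)
  case base
  show ?case by (rule rm.subspaceI) (use assms in auto)
next
  case (step w)
  then show ?case
  proof (induction rule: alg_words.induct)
    case (2 x w)
    then show ?case using assms(3)[of x w] rm.span_base[of w] by (auto simp: assoc_span_def)
  qed (use assms in auto)
qed

lemma assoc_span_mult: "a \<in> assoc_span P d \<Longrightarrow> b \<in> assoc_span P d \<Longrightarrow> a * b \<in> assoc_span P d"
proof (induction rule: assoc_span_induct)
  case unit
  then show ?case by (simp add: Pd_left assoc_span_Mat)
next
  case (mult x w)
  have "x * v \<in> assoc_span P d" if "v \<in> assoc_span P d" for v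
    using that unfolding assoc_span_def
  proof (induction rule: rm.span_induct)
    case base
    show ?case by (rule rm.subspaceI) (auto simp: distrib_left smul_mult_right rm.span_zero rm.span_add rm.span_scale)
  next
    case (step w)
    then show ?case using mult(1) by (auto intro: rm.span_base alg_words.intros)
  qed
  then show ?case using mult by (simp add: mult.assoc)
qed (auto simp: distrib_right smul_mult_left rm.subspace_add[OF assoc_span_subspace]
    rm.subspace_scale[OF assoc_span_subspace] rm.subspace_0[OF assoc_span_subspace])

lemma trace_radical_subspace: "rm.subspace (trace_radical P d)"
  unfolding trace_radical_def
  by (rule rm.subspaceI) (auto simp: distrib_right smul_mult_left tr_add[of _ d] tr_smul[of _ d] Mat_closed assoc_span_Mat
    rm.subspace_add[OF assoc_span_subspace] rm.subspace_scale[OF assoc_span_subspace] rm.subspace_0[OF assoc_span_subspace])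

lemma trace_radical_ideal:
  assumes "n \<in> trace_radical P d" "a \<in> assoc_span P d"
  shows "n * a \<in> trace_radical P d" "a * n \<in> trace_radical P d"
proof -
  have n: "n \<in> assoc_span P d" "\<And>b. b \<in> assoc_span P d \<Longrightarrow> tr (n * b) = 0"
    using assms(1) by (auto simp: trace_radical_def)
  show "n * a \<in> trace_radical P d"
    using n assms(2) by (auto simp: trace_radical_def assoc_span_mult mult.assoc)
  have "tr (a * n * b) = 0" if b: "b \<in> assoc_span P d" for b
  proof -
    have "tr (a * (n * b)) = tr ((n * b) * a)"
      by (rule tr_comm[of _ d]) (auto intro: assoc_span_Mat assoc_span_mult n assms(2) b)
    then show ?thesis using n(2) assoc_span_mult[OF b assms(2)] by (simp add: mult.assoc)
  qed
  then show "a * n \<in> trace_radical P d"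
    using n assms(2) by (auto simp: trace_radical_def assoc_span_mult)
qed

lemma power_unit_assoc: "x \<in> assoc_span P d \<Longrightarrow> x ^ n * Pd d \<in> assoc_span P d"
  by (induction n) (auto simp: assoc_span_unit mult.assoc intro: assoc_span_mult)

lemma power_unit:
  assumes "x \<in> Mat d"
  shows "x * (x ^ n * Pd d) = x ^ Suc n"
proof -
  have "x * (x ^ n * Pd d) = x ^ n * (x * Pd d)" by (simp add: mult.assoc[symmetric] power_commutes)
  then show ?thesis by (simp add: Pd_right[OF assms] power_commutes)
qed

lemma trace_radical_nilpotent: "n \<in> trace_radical P d \<Longrightarrow> \<exists>m. n ^ m = 0"
proof -
  assume "n \<in> trace_radical P d"
  then have n: "n \<in> assoc_span P d" "\<And>b. b \<in> assoc_span P d \<Longrightarrow> tr (n * b) = 0"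
    by (auto simp: trace_radical_def)
  show ?thesis
    using nilpotent_if_trace_powers_zero[OF assoc_span_Mat[OF n(1)]] n(2)[OF power_unit_assoc[OF n(1)]]
    by (simp only: power_unit[OF assoc_span_Mat[OF n(1)]])
qed

text \<open>By Engel, long products in \<b> vanish. The associative algebra of \<open>P\<close>
  preserves the filtration of \<b> by \<open>lann_stable\<close>, so b a lowers the level for every
  \<open>a\<close> in that algebra. Thus b a is nilpotent and has trace 0.\<close>

lemma nil_ideal_trace_radical:
  assumes b: "rm.subspace \<b>" "\<b> \<subseteq> P"
    and st: "\<And>x b. x \<in> P \<Longrightarrow> b \<in> \<b> \<Longrightarrow> b * x - x * b \<in> \<b>"
    and nil: "\<And>b. b \<in> \<b> \<Longrightarrow> \<exists>m. b ^ m = 0"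
  shows "\<b> \<subseteq> trace_radical P d"
proof
  fix b assume bb: "b \<in> \<b>"
  have "nilset \<b>"
  proof (rule engel[OF b(1) _ _ nil])
    show "\<b> \<subseteq> Mat d" using b(2) PM by (rule order_trans)
    show "x * y - y * x \<in> \<b>" if "x \<in> \<b>" "y \<in> \<b>" for x y
      by (rule st[OF subsetD[OF b(2) that(2)] that(1)])
  qed
  then obtain q where q: "1 \<in> lann \<b> q" by (auto simp: nilset_def)
  have "tr (b * a) = 0" if a: "a \<in> assoc_span P d" for a
  proof -
    have av: "a * v \<in> lann \<b> k \<and> a \<in> Mat d" if "v \<in> lann \<b> k" "v \<in> Mat d" for v k
      using a
    proof (induction rule: assoc_span_induct)
      case unit
      then show ?case using that Pd_left Pd_Mat by auto
    next
      case (mult x w)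
      then show ?case using lann_stable[OF st, of x] PM by (auto simp: mult.assoc intro: Mat_closed)
    qed (auto simp: distrib_right smul_mult_left lann_add lann_smul lann_zero Mat_closed)
    have aM: "a \<in> Mat d" and bM: "b \<in> Mat d" using a assoc_span_Mat bb b(2) PM by auto
    have step: "(b * a) * v \<in> lann \<b> k" if "v \<in> lann \<b> (Suc k)" "v \<in> Mat d" for v k
      using av[OF that] bb by (auto simp: mult.assoc)
    have "(b * a) ^ k * Pd d \<in> lann \<b> (q - k) \<and> (b * a) ^ k * Pd d \<in> Mat d" if "k \<le> q" for k
      using that
    proof (induction k)
      case 0
      then show ?case using lann_one[OF q] Pd_Mat by simp
    next
      case (Suc k)
      then have "(b * a) ^ k * Pd d \<in> lann \<b> (Suc (q - Suc k))" "(b * a) ^ k * Pd d \<in> Mat d"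
        by (simp_all add: Suc_diff_Suc)
      from step[OF this] this(2) show ?case using aM bM by (auto simp: mult.assoc intro: Mat_closed)
    qed
    from this[of q] have "(b * a) ^ q * Pd d = 0" by simp
    then have "(b * a) ^ Suc q = 0" using power_unit[of "b * a" q] aM bM by (simp add: Mat_closed)
    then show ?thesis by (rule nilpotent_trace[rotated]) (auto intro: Mat_closed aM bM)
  qed
  then show "b \<in> trace_radical P d"
    using bb b(2) assoc_span_base by (auto simp: trace_radical_def)
qed

lemma power_commutes_mod_radical:
  assumes "x \<in> assoc_span P d" "q \<in> assoc_span P d" "q * x - x * q \<in> trace_radical P d"
  shows "q * (x ^ n * Pd d) - (x ^ n * Pd d) * q \<in> trace_radical P d"
proof (induction n)
  case 0
  have "q * Pd d = q" "Pd d * q = q"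
    by (rule Pd_right[OF assoc_span_Mat[OF assms(2)]], rule Pd_left[OF assoc_span_Mat[OF assms(2)]])
  then show ?case using rm.subspace_0[OF trace_radical_subspace] by simp
next
  case (Suc n)
  define y where "y = x ^ n * Pd d"
  have y: "x ^ Suc n * Pd d = x * y" by (simp add: y_def mult.assoc)
  have "q * (x * y) - (x * y) * q = (q * x - x * q) * y + x * (q * y - y * q)"
    by (simp add: algebra_simps)
  also have "\<dots> \<in> trace_radical P d"
    using trace_radical_ideal(1)[OF assms(3) power_unit_assoc[OF assms(1), of n]]
      trace_radical_ideal(2)[OF Suc assms(1)]
    unfolding y_def by (rule rm.subspace_add[OF trace_radical_subspace])
  finally show ?case unfolding y .
qed

end

locale lie_algebra_char_0 = lie_algebra_on scale V prd
  for scale :: "'f::field_char_0 \<Rightarrow> 'v::ab_group_add \<Rightarrow> 'v" and V prd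
begin

text \<open>Cyclicity of the trace: \<open>tr ([l, k]^n)\<close> vanishes when \<open>k\<close> commutes with the other factors up to the radical.\<close>

lemma rep_brackets_nilpotent:
  fixes \<rho> :: "'v \<Rightarrow> 'f rmat"
  assumes rep: "lie_rep scale V prd d \<rho>" and K: "K \<subseteq> V"
    and u: "u \<in> V" "u \<in> brackets V K"
    and c: "\<And>k. k \<in> K \<Longrightarrow> \<rho> k * \<rho> u - \<rho> u * \<rho> k \<in> trace_radical (\<rho> ` V) d"
  shows "\<exists>m. \<rho> u ^ m = 0"
proof -
  note r = lie_repD[OF rep]
  have PM: "\<rho> ` V \<subseteq> Mat d" using r(1) by blast
  note base = assoc_span_base[OF PM, OF imageI]
  show ?thesis
  proof (rule nilpotent_if_trace_powers_zero[OF r(1)[OF u(1) u(1)]])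
    fix n
    let ?y = "\<rho> u ^ n * Pd d"
    have y: "?y \<in> assoc_span (\<rho> ` V) d" by (rule power_unit_assoc[OF PM base[OF u(1)]])
    have yM: "?y \<in> Mat d" by (rule assoc_span_Mat[OF PM y])
    have "v \<in> V \<and> tr (\<rho> v * ?y) = 0" if "v \<in> brackets V K" for v
      using that unfolding brackets_def
    proof (induction rule: span_induct)
      case base
      have "\<rho> (scale 0 0) = smul 0 (\<rho> 0)" using r(3) V_closed(1) by blast
      then have r0: "\<rho> 0 = 0" by simp
      have M: "\<rho> v * ?y \<in> Mat d" if "v \<in> V" for v using r(1) that yM by (blast intro: Mat_closed)
      show ?case
        by (rule subspaceI)
          (use r(2,3) in \<open>auto simp: V_closed r0 distrib_right smul_mult_left tr_add[OF M M] tr_smul[OF M]\<close>)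
    next
      case (step v)
      then obtain l k where v: "v = prd l k" "l \<in> V" "k \<in> K" by blast
      have kV: "k \<in> V" using v K by blast
      have M: "\<rho> l \<in> Mat d" "\<rho> k \<in> Mat d" using r(1) v kV by auto
      have "tr (\<rho> v * ?y) = tr (\<rho> l * (\<rho> k * ?y)) - tr (\<rho> k * (\<rho> l * ?y))"
        unfolding v(1) r(4)[OF v(2) kV] left_diff_distrib mult.assoc[of "\<rho> l"] mult.assoc[of "\<rho> k"]
        by (rule tr_diff[of _ d]) (intro Mat_closed(7) M yM)+
      also have "tr (\<rho> k * (\<rho> l * ?y)) = tr (\<rho> l * ?y * \<rho> k)"
        by (rule tr_comm[of _ d]) (intro Mat_closed(7) M yM)+
      also have "\<dots> = tr (\<rho> l * (?y * \<rho> k))" by (simp only: mult.assoc)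
      also have "tr (\<rho> l * (\<rho> k * ?y)) - tr (\<rho> l * (?y * \<rho> k)) = tr (\<rho> l * (\<rho> k * ?y - ?y * \<rho> k))"
        unfolding right_diff_distrib by (rule tr_diff[of _ d, symmetric]) (intro Mat_closed(7) M yM)+
      also have "\<dots> = tr ((\<rho> k * ?y - ?y * \<rho> k) * \<rho> l)"
        by (rule tr_comm[of _ d]) (intro Mat_closed(7) Mat_closed(3) M yM)+
      also have "\<dots> = 0"
        using power_commutes_mod_radical[OF PM base[OF u(1)] base[OF kV] c[OF v(3)], of n] base[OF v(2)]
        by (auto simp: trace_radical_def)
      finally show ?case using v kV prd_closed by auto
    qed
    then have "tr (\<rho> u * ?y) = 0" using u(2) by blast
    then show "tr (\<rho> u ^ Suc n) = 0" by (simp only: power_unit[OF PM r(1)[OF u(1) u(1)]])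
  qed
qed

lemma ideal_image_bracket:
  assumes rep: "lie_rep scale V prd d \<rho>" and "lie_ideal C" "x \<in> \<rho> ` V" "b \<in> \<rho> ` C"
  shows "b * x - x * b \<in> \<rho> ` C"
proof -
  obtain u v where uv: "x = \<rho> u" "u \<in> V" "b = \<rho> v" "v \<in> C" using assms(3,4) by blast
  have "\<rho> (prd v u) = b * x - x * b"
    using lie_repD(4)[OF rep lie_idealD(2)[OF assms(2) uv(4)] uv(2)] uv by simp
  then show ?thesis using lie_idealD(4)[OF assms(2) uv(2,4)] by (metis imageI)
qed

text \<open>The substitute for Lie's theorem. In a step from \<open>A\<close> to \<open>B\<close>
  let \<open>C\<close> be the intersection of \<open>B\<close> with [V, V], and E = [V, C]. By
  induction the elements of \<open>C\<close> commute modulo the radical, which makes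
  \<open>E\<close> consist of nilpotents and so lie in the radical. Then \<open>C\<close> commutes
  with all of \<open>V\<close> modulo the radical, and the same argument applies to
  \<open>C\<close>.\<close>

theorem solv_trace_radical:
  fixes \<rho> :: "'v \<Rightarrow> 'f rmat"
  assumes rep: "lie_rep scale V prd d \<rho>"
  shows "solv B \<Longrightarrow> \<rho> ` (B \<inter> brackets V V) \<subseteq> trace_radical (\<rho> ` V) d"
proof (induction rule: solv.induct)
  note r = lie_repD[OF rep]
  have PM: "\<rho> ` V \<subseteq> Mat d" using r(1) by blast
  {
    case solv_zero
    have "\<rho> (scale 0 0) = smul 0 (\<rho> 0)" using r(3) V_closed(1) by blast
    then show ?case using rm.subspace_0[OF trace_radical_subspace[OF PM]] by auto
  next
    case (solv_step A B)
    define D where "D = brackets V V"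
    define C where "C = B \<inter> D"
    have D: "lie_ideal D" unfolding D_def by (intro lie_ideal_brackets lie_ideal_V)
    have C: "lie_ideal C" unfolding C_def by (intro lie_ideal_inter solv_step D)
    define E where "E = brackets V C"
    have E: "lie_ideal E" unfolding E_def by (intro lie_ideal_brackets lie_ideal_V C)
    have EC: "E \<subseteq> C" unfolding E_def by (rule brackets_minimal) (use lie_idealD[OF C] in auto)
    note CV = lie_idealD(2)[OF C]
    have CC: "\<rho> x * \<rho> y - \<rho> y * \<rho> x \<in> trace_radical (\<rho> ` V) d" if "x \<in> C" "y \<in> C" for x y
    proof -
      have "prd x y \<in> A \<inter> D"
        using that solv_step.hyps(4) lie_idealD(3)[OF D CV[OF that(1)], of y] by (auto simp: C_def)
      then show ?thesis using solv_step.IH r(4)[OF CV[OF that(1)] CV[OF that(2)]] by (auto simp: D_def)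
    qed
    have E_rad: "\<rho> ` E \<subseteq> trace_radical (\<rho> ` V) d"
    proof (rule nil_ideal_trace_radical[OF PM])
      show "rm.subspace (\<rho> ` E)" "\<rho> ` E \<subseteq> \<rho> ` V"
        using rep_subspace[OF rep] lie_idealD(1,2)[OF E] by blast+
      show "b * x - x * b \<in> \<rho> ` E" if "x \<in> \<rho> ` V" "b \<in> \<rho> ` E" for x b
        by (rule ideal_image_bracket[OF rep E that])
      show "\<exists>m. b ^ m = 0" if b: "b \<in> \<rho> ` E" for b
      proof -
        obtain u where u: "b = \<rho> u" "u \<in> E" using b by blast
        show ?thesis
          unfolding u(1)
        proof (rule rep_brackets_nilpotent[OF rep, of C])
          show "C \<subseteq> V" "u \<in> V" "u \<in> brackets V C" using CV u EC by (auto simp: E_def)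
          show "\<rho> k * \<rho> u - \<rho> u * \<rho> k \<in> trace_radical (\<rho> ` V) d" if "k \<in> C" for k
            by (rule CC) (use that u EC in auto)
        qed
      qed
    qed
    have "\<rho> ` C \<subseteq> trace_radical (\<rho> ` V) d"
    proof (rule nil_ideal_trace_radical[OF PM])
      show "rm.subspace (\<rho> ` C)" "\<rho> ` C \<subseteq> \<rho> ` V"
        using rep_subspace[OF rep] lie_idealD(1,2)[OF C] by blast+
      show "b * x - x * b \<in> \<rho> ` C" if "x \<in> \<rho> ` V" "b \<in> \<rho> ` C" for x b
        by (rule ideal_image_bracket[OF rep C that])
      show "\<exists>m. b ^ m = 0" if b: "b \<in> \<rho> ` C" for b
      proof -
        obtain u where u: "b = \<rho> u" "u \<in> C" using b by blast
        show ?thesis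
          unfolding u(1)
        proof (rule rep_brackets_nilpotent[OF rep, of V])
          show "V \<subseteq> V" "u \<in> V" "u \<in> brackets V V" using CV u by (auto simp: C_def D_def)
          show "\<rho> k * \<rho> u - \<rho> u * \<rho> k \<in> trace_radical (\<rho> ` V) d" if "k \<in> V" for k
            using E_rad brackets_base[OF that u(2)] r(4)[OF that CV[OF u(2)]] unfolding E_def by auto
        qed
      qed
    qed
    then show ?case by (simp add: C_def D_def)
  }
qed

corollary solv_nilset:
  fixes \<rho> :: "'v \<Rightarrow> 'f rmat"
  assumes rep: "lie_rep scale V prd d \<rho>" and B: "solv B"
    and U: "subspace U" "U \<subseteq> B \<inter> brackets V V" "\<And>x y. x \<in> U \<Longrightarrow> y \<in> U \<Longrightarrow> prd x y \<in> U"
  shows "nilset (\<rho> ` U)"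
proof -
  note r = lie_repD[OF rep]
  have PM: "\<rho> ` V \<subseteq> Mat d" using r(1) by blast
  have UV: "U \<subseteq> V" using U(2) solv_ideal[OF B] lie_idealD(2) by blast
  show ?thesis
  proof (rule engel[of _ d])
    show "rm.subspace (\<rho> ` U)" by (rule rep_subspace[OF rep U(1) UV])
    show "\<rho> ` U \<subseteq> Mat d" using PM UV by blast
    show "a * b - b * a \<in> \<rho> ` U" if ab: "a \<in> \<rho> ` U" "b \<in> \<rho> ` U" for a b
    proof -
      obtain u v where "a = \<rho> u" "b = \<rho> v" "u \<in> U" "v \<in> U" using ab by blast
      then show ?thesis using r(4)[of u v] U(3) UV by (metis imageI subsetD)
    qed
    show "\<exists>m. a ^ m = 0" if "a \<in> \<rho> ` U" for a
      using trace_radical_nilpotent[OF PM] solv_trace_radical[OF rep B] that U(2) by blast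
  qed
qed

end

section \<open>Semisimple Lie algebras\<close>

text \<open>The analogue of \<open>lann\<close> for modules; \<open>nilset_vann\<close> and
  \<open>nilset_if_vann\<close> translate between the two.\<close>

primrec vann :: "('x \<Rightarrow> 'v::zero \<Rightarrow> 'v) \<Rightarrow> 'x set \<Rightarrow> nat \<Rightarrow> 'v set" where
  "vann act U 0 = {0}"
| "vann act U (Suc q) = {v. \<forall>x\<in>U. act x v \<in> vann act U q}"

locale lie_module = lie_algebra_char_0 scale V prd + W: vector_space sw
  for scale :: "'f::field_char_0 \<Rightarrow> 'v::ab_group_add \<Rightarrow> 'v" and V prd
    and sw :: "'f \<Rightarrow> 'w::ab_group_add \<Rightarrow> 'w" +
  fixes W :: "'w set" and act :: "'v \<Rightarrow> 'w \<Rightarrow> 'w"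
  assumes W_subspace: "W.subspace W"
    and act_lin: "x \<in> V \<Longrightarrow> lin_on sw W (act x)"
    and act_add: "x \<in> V \<Longrightarrow> y \<in> V \<Longrightarrow> w \<in> W \<Longrightarrow> act (x + y) w = act x w + act y w"
    and act_scale: "x \<in> V \<Longrightarrow> w \<in> W \<Longrightarrow> act (scale c x) w = sw c (act x w)"
    and act_lie: "x \<in> V \<Longrightarrow> y \<in> V \<Longrightarrow> w \<in> W \<Longrightarrow> act (prd x y) w = act x (act y w) - act y (act x w)"
begin

lemma act_closed: "x \<in> V \<Longrightarrow> w \<in> W \<Longrightarrow> act x w \<in> W"
  and act_add_right: "x \<in> V \<Longrightarrow> v \<in> W \<Longrightarrow> w \<in> W \<Longrightarrow> act x (v + w) = act x v + act x w"
  and act_scale_right: "x \<in> V \<Longrightarrow> w \<in> W \<Longrightarrow> act x (sw c w) = sw c (act x w)"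
  using act_lin[of x] unfolding lin_on_def by blast+

lemma act_zero_right: "x \<in> V \<Longrightarrow> act x 0 = 0"
  using act_scale_right[of x 0 0] W.subspace_0[OF W_subspace] by simp

lemma act_zero_left: "w \<in> W \<Longrightarrow> act 0 w = 0"
  using act_scale[of 0 w 0] V_closed(1) by simp

lemma act_diff_right: "x \<in> V \<Longrightarrow> v \<in> W \<Longrightarrow> w \<in> W \<Longrightarrow> act x (v - w) = act x v - act x w"
  using act_add_right[of x "v - w" w] W.subspace_diff[OF W_subspace] by simp

lemma act_diff_left: "x \<in> V \<Longrightarrow> y \<in> V \<Longrightarrow> w \<in> W \<Longrightarrow> act (x - y) w = act x w - act y w"
  using act_add[of "x - y" y w] V_closed by simp

lemma vann_subspace:
  assumes "U \<subseteq> V"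
  shows "W.subspace (W \<inter> vann act U q)"
proof (induction q)
  case 0
  have "W \<inter> {0} = {0}" using W.subspace_0[OF W_subspace] by auto
  then show ?case by simp
next
  case (Suc q)
  note IH = W.subspace_0[OF Suc] W.subspace_add[OF Suc] W.subspace_scale[OF Suc]
  show ?case
  proof (rule W.subspaceI)
    show "0 \<in> W \<inter> vann act U (Suc q)"
      using IH(1) assms act_zero_right W.subspace_0[OF W_subspace] by auto
    show "v + w \<in> W \<inter> vann act U (Suc q)" if "v \<in> W \<inter> vann act U (Suc q)" "w \<in> W \<inter> vann act U (Suc q)" for v w
      using that IH(2) assms act_closed
      by (auto simp: subset_iff act_add_right W.subspace_add[OF W_subspace])
    show "sw c w \<in> W \<inter> vann act U (Suc q)" if "w \<in> W \<inter> vann act U (Suc q)" for c w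
      using that IH(3) assms act_closed
      by (auto simp: subset_iff act_scale_right W.subspace_scale[OF W_subspace])
  qed
qed

end

lemma (in vector_space) lin_on_comp: "lin_on scale W f \<Longrightarrow> lin_on scale W g \<Longrightarrow> lin_on scale W (\<lambda>w. f (g w))"
  by (simp add: lin_on_def)

lemma (in vector_space) lin_on_add: "subspace W \<Longrightarrow> lin_on scale W f \<Longrightarrow> lin_on scale W g \<Longrightarrow> lin_on scale W (\<lambda>w. f w + g w)"
  by (auto simp: lin_on_def subspace_add scale_right_distrib)

lemma (in vector_space) lin_on_scale: "subspace W \<Longrightarrow> lin_on scale W f \<Longrightarrow> lin_on scale W (\<lambda>w. scale c (f w))"
  by (auto simp: lin_on_def subspace_scale scale_right_distrib mult.commute)

lemma (in vector_space) lin_on_zero: "subspace W \<Longrightarrow> lin_on scale W (\<lambda>w. 0)"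
  by (auto simp: lin_on_def subspace_0)

lemma (in vector_space) lin_on_sum:
  "subspace W \<Longrightarrow> (\<And>a. a \<in> A \<Longrightarrow> lin_on scale W (f a)) \<Longrightarrow> lin_on scale W (\<lambda>w. \<Sum>a\<in>A. f a w)"
  by (induction A rule: infinite_finite_induct) (auto simp: lin_on_zero lin_on_add)

lemma (in vector_space) lin_on_power: "lin_on scale W f \<Longrightarrow> lin_on scale W (f ^^ n)"
  by (induction n) (auto simp: lin_on_def)

text \<open>A chosen matrix model \<open>M\<close> of the operators on \<open>W\<close>, so that
  traces and the matrix theorems of Engel and Cartan apply to modules.\<close>

locale fd_lie_module = lie_module scale V prd sw W act
  for scale :: "'f::field_char_0 \<Rightarrow> 'v::ab_group_add \<Rightarrow> 'v" and V prd
    and sw :: "'f \<Rightarrow> 'w::ab_group_add \<Rightarrow> 'w" and W :: "'w set" and act :: "'v \<Rightarrow> 'w \<Rightarrow> 'w" +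
  fixes d :: nat and M :: "('w \<Rightarrow> 'w) \<Rightarrow> 'f rmat"
  assumes M_Mat: "M f \<in> Mat d"
    and M_comp: "lin_on sw W f \<Longrightarrow> lin_on sw W g \<Longrightarrow> M (\<lambda>w. f (g w)) = M f * M g"
    and M_add: "lin_on sw W f \<Longrightarrow> lin_on sw W g \<Longrightarrow> M (\<lambda>w. f w + g w) = M f + M g"
    and M_scale: "lin_on sw W f \<Longrightarrow> M (\<lambda>w. sw c (f w)) = smul c (M f)"
    and M_zero: "lin_on sw W f \<Longrightarrow> M f = 0 \<longleftrightarrow> (\<forall>w\<in>W. f w = 0)"
    and M_cong: "(\<And>w. w \<in> W \<Longrightarrow> f w = g w) \<Longrightarrow> M f = M g"
begin

abbreviation R :: "'v \<Rightarrow> 'f rmat" where "R x \<equiv> M (act x)"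

lemma M_diff: "lin_on sw W f \<Longrightarrow> lin_on sw W g \<Longrightarrow> M (\<lambda>w. f w - g w) = M f - M g"
proof -
  assume *: "lin_on sw W f" "lin_on sw W g"
  have "M (\<lambda>w. f w + sw (-1) (g w)) = M f - M g"
    using M_add[OF *(1) W.lin_on_scale[OF W_subspace *(2), of "-1"]] M_scale[OF *(2), of "-1"] by simp
  then show ?thesis by simp
qed

lemma M_sum: "(\<And>a. a \<in> A \<Longrightarrow> lin_on sw W (f a)) \<Longrightarrow> M (\<lambda>w. \<Sum>a\<in>A. f a w) = (\<Sum>a\<in>A. M (f a))"
proof (induction A rule: infinite_finite_induct)
  case (insert x F)
  then show ?case using M_add[of "f x" "\<lambda>w. \<Sum>a\<in>F. f a w"] W.lin_on_sum[OF W_subspace, of F f] by simp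
qed (use M_zero[OF W.lin_on_zero[OF W_subspace]] in auto)

lemma M_power: "lin_on sw W f \<Longrightarrow> M (f ^^ Suc n) = M f ^ Suc n"
proof (induction n)
  case (Suc n)
  have "f ^^ Suc (Suc n) = (\<lambda>w. f ((f ^^ Suc n) w))" by (simp add: fun_eq_iff)
  then show ?case using M_comp[OF Suc.prems W.lin_on_power[OF Suc.prems, of "Suc n"]] Suc by (simp only: power_Suc)
qed simp

lemma lie_rep_R: "lie_rep scale V prd d R"
  unfolding lie_rep_def
proof (intro conjI ballI allI)
  fix x y assume x: "x \<in> V" and y: "y \<in> V"
  have "R (x + y) = M (\<lambda>w. act x w + act y w)" by (rule M_cong) (rule act_add[OF x y])
  also have "\<dots> = R x + R y" by (rule M_add[OF act_lin[OF x] act_lin[OF y]])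
  finally show "R (x + y) = R x + R y" .
  have "R (prd x y) = M (\<lambda>w. act x (act y w) - act y (act x w))" by (rule M_cong) (rule act_lie[OF x y])
  also have "\<dots> = M (\<lambda>w. act x (act y w)) - M (\<lambda>w. act y (act x w))"
    by (rule M_diff[OF W.lin_on_comp[OF act_lin[OF x] act_lin[OF y]] W.lin_on_comp[OF act_lin[OF y] act_lin[OF x]]])
  also have "\<dots> = R x * R y - R y * R x"
    using M_comp[OF act_lin[OF x] act_lin[OF y]] M_comp[OF act_lin[OF y] act_lin[OF x]] by (simp only:)
  finally show "R (prd x y) = R x * R y - R y * R x" .
next
  fix c x assume x: "x \<in> V"
  have "R (scale c x) = M (\<lambda>w. sw c (act x w))" by (rule M_cong) (rule act_scale[OF x])
  also have "\<dots> = smul c (R x)" by (rule M_scale[OF act_lin[OF x]])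
  finally show "R (scale c x) = smul c (R x)" .
qed (rule M_Mat)

lemmas R_add = lie_repD(2)[OF lie_rep_R] and R_lie = lie_repD(4)[OF lie_rep_R]

lemma R_scale: "x \<in> V \<Longrightarrow> R (scale c x) = smul c (R x)"
  using lie_repD(3)[OF lie_rep_R, of x x] by blast

lemma R_sum: "(\<And>a. a \<in> A \<Longrightarrow> f a \<in> V) \<Longrightarrow> R (\<Sum>a\<in>A. f a) = (\<Sum>a\<in>A. R (f a))"
proof (induction A rule: infinite_finite_induct)
  case (insert x F)
  then show ?case using R_add[of "f x" "\<Sum>a\<in>F. f a"] by (simp add: V_closed)
qed (use R_scale[of 0 0] V_closed(1) in auto)

lemma nilset_vann:
  assumes "nilset (R ` U)" "U \<subseteq> V"
  obtains q where "W \<subseteq> vann act U q"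
proof -
  obtain q where q: "1 \<in> lann (R ` U) q" using assms(1) by (auto simp: nilset_def)
  have "f w \<in> vann act U k" if "lin_on sw W f" "M f \<in> lann (R ` U) k" "w \<in> W" for f w k
    using that
  proof (induction k arbitrary: f w)
    case 0
    then show ?case using M_zero by simp
  next
    case (Suc k)
    have "act x (f w) \<in> vann act U k" if x: "x \<in> U" for x
    proof -
      have xV: "x \<in> V" using x assms(2) by blast
      have "M (\<lambda>w. act x (f w)) \<in> lann (R ` U) k"
        unfolding M_comp[OF act_lin[OF xV] Suc.prems(1)] using Suc.prems(2) x by simp
      from Suc.IH[OF W.lin_on_comp[OF act_lin[OF xV] Suc.prems(1)] this Suc.prems(3)] show ?thesis .
    qed
    then show ?case by simp
  qed
  from this[of "\<lambda>w. w" q] lann_one[OF q] show thesis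
    by (intro that[of q]) (auto simp: lin_on_def)
qed

section \<open>Trace forms of modules\<close>

definition tform :: "'v \<Rightarrow> 'v \<Rightarrow> 'f" where
  "tform x y = tr (R x * R y)"

lemma tform_sym: "tform x y = tform y x"
  unfolding tform_def by (rule tr_comm[OF M_Mat M_Mat])

lemma tform_add_left: "x \<in> V \<Longrightarrow> y \<in> V \<Longrightarrow> tform (x + y) z = tform x z + tform y z"
  unfolding tform_def by (simp add: R_add distrib_right tr_add[of _ d] M_Mat Mat_closed)

lemma tform_scale_left: "x \<in> V \<Longrightarrow> tform (scale c x) z = c * tform x z"
  unfolding tform_def by (simp add: R_scale smul_mult_left tr_smul[of _ d] M_Mat Mat_closed)

lemma tform_add_right: "x \<in> V \<Longrightarrow> y \<in> V \<Longrightarrow> tform z (x + y) = tform z x + tform z y"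
  using tform_add_left tform_sym by simp

lemma tform_scale_right: "x \<in> V \<Longrightarrow> tform z (scale c x) = c * tform z x"
  using tform_scale_left tform_sym by simp

lemma tform_zero_left: "tform 0 x = 0"
  using tform_scale_left[of 0 0 x] V_closed(1) by simp

lemma tform_zero_right: "tform x 0 = 0"
  by (subst tform_sym) (rule tform_zero_left)

lemma tform_diff_left: "x \<in> V \<Longrightarrow> y \<in> V \<Longrightarrow> tform (x - y) z = tform x z - tform y z"
  using tform_add_left[of "x - y" y z] V_closed by simp

lemma tform_minus_left: "x \<in> V \<Longrightarrow> tform (- x) z = - tform x z"
  using tform_scale_left[of x "-1" z] by simp

lemma tform_sum_left: "(\<And>a. a \<in> A \<Longrightarrow> f a \<in> V) \<Longrightarrow> tform (\<Sum>a\<in>A. f a) z = (\<Sum>a\<in>A. tform (f a) z)"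
  by (induction A rule: infinite_finite_induct) (auto simp: tform_zero_left tform_add_left V_closed)

lemma tform_sum_right: "(\<And>a. a \<in> A \<Longrightarrow> f a \<in> V) \<Longrightarrow> tform z (\<Sum>a\<in>A. f a) = (\<Sum>a\<in>A. tform z (f a))"
  using tform_sum_left[of A f z] tform_sym by simp

lemma tform_invariant:
  assumes "x \<in> V" "y \<in> V" "z \<in> V"
  shows "tform (prd x y) z = tform x (prd y z)"
proof -
  have "tform (prd x y) z = tr (R x * (R y * R z)) - tr (R y * (R x * R z))"
    unfolding tform_def R_lie[OF assms(1,2)] left_diff_distrib mult.assoc
    by (rule tr_diff[of _ d]) (intro Mat_closed(7) M_Mat)+
  also have "tr (R y * (R x * R z)) = tr (R x * R z * R y)"
    by (rule tr_comm[of _ d]) (intro Mat_closed(7) M_Mat)+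
  also have "\<dots> = tr (R x * (R z * R y))" by (simp only: mult.assoc)
  also have "tr (R x * (R y * R z)) - tr (R x * (R z * R y)) = tform x (prd y z)"
    unfolding tform_def R_lie[OF assms(2,3)] right_diff_distrib
    by (rule tr_diff[of _ d, symmetric]) (intro Mat_closed(7) M_Mat)+
  finally show ?thesis .
qed

lemma orthogonal_ideal:
  assumes "lie_ideal K"
  shows "lie_ideal {x \<in> V. \<forall>k\<in>K. tform x k = 0}"
proof (rule lie_idealI)
  note K = lie_idealD[OF assms]
  show "subspace {x \<in> V. \<forall>k\<in>K. tform x k = 0}"
    by (rule subspaceI) (auto simp: V_closed tform_add_left tform_scale_left tform_zero_left)
  show "prd x a \<in> {x \<in> V. \<forall>k\<in>K. tform x k = 0}" if "x \<in> V" "a \<in> {x \<in> V. \<forall>k\<in>K. tform x k = 0}" for x a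
  proof -
    have "tform (prd x a) k = 0" if k: "k \<in> K" for k
    proof -
      have "tform (prd x a) k = - tform (prd a x) k"
        using antisym[of a x] \<open>x \<in> V\<close> \<open>a \<in> _\<close> by (simp add: tform_minus_left prd_closed)
      also have "tform (prd a x) k = tform a (prd x k)"
        using \<open>x \<in> V\<close> \<open>a \<in> _\<close> K(2)[OF k] by (intro tform_invariant) auto
      also have "\<dots> = 0" using \<open>a \<in> _\<close> K(3)[OF \<open>x \<in> V\<close> k] by blast
      finally show ?thesis by simp
    qed
    then show ?thesis using that prd_closed by auto
  qed
qed blast

text \<open>Cartan's criterion combined with Engel's theorem.\<close>

lemma isotropic_brackets_vann:
  assumes J: "lie_ideal J" and iso: "\<And>x y. x \<in> J \<Longrightarrow> y \<in> J \<Longrightarrow> tform x y = 0"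
  obtains q where "W \<subseteq> vann act (brackets J J) q"
proof -
  note j = lie_idealD[OF J]
  note rep = lie_rep_R
  have JV: "J \<subseteq> V" using j(2) by blast
  have BJ: "brackets J J \<subseteq> J"
    by (rule brackets_minimal) (use j in auto)
  have B: "lie_ideal (brackets J J)" by (intro lie_ideal_brackets J)
  have sub: "rm.subspace (R ` J)" by (rule rep_subspace[OF rep j(1) JV])
  have cl: "a * b - b * a \<in> R ` J" if "a \<in> R ` J" "b \<in> R ` J" for a b
    using ideal_image_bracket[OF rep J, of b a] that JV by blast
  have nil: "\<exists>m. R x ^ m = 0" if "x \<in> brackets J J" for x
  proof (rule cartan_criterion[OF sub _ cl, of d])
    show "R ` J \<subseteq> Mat d" using M_Mat by blast
    show "tr (a * b) = 0" if "a \<in> R ` J" "b \<in> R ` J" for a b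
      using iso that by (auto simp: tform_def)
    show "R x \<in> rm.span {a * b - b * a |a b. a \<in> R ` J \<and> b \<in> R ` J}"
    proof -
      have "x \<in> V \<and> R x \<in> rm.span {a * b - b * a |a b. a \<in> R ` J \<and> b \<in> R ` J}"
        using that unfolding brackets_def
      proof (induction rule: span_induct)
        case base
        have "R 0 = 0" using R_scale[of 0 0] V_closed(1) by simp
        then show ?case
          by (intro subspaceI) (auto simp: V_closed R_add R_scale rm.span_zero rm.span_add rm.span_scale)
      next
        case (step x)
        then obtain u v where "x = prd u v" "u \<in> J" "v \<in> J" by blast
        then show ?case using j(2) prd_closed R_lie by (auto intro!: rm.span_base)
      qed
      then show ?thesis ..
    qed
  qed
  have "nilset (R ` brackets J J)"
  proof (rule engel[of _ d])
    show "rm.subspace (R ` brackets J J)"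
      using lie_idealD[OF B] by (intro rep_subspace[OF rep]) auto
    show "R ` brackets J J \<subseteq> Mat d" using M_Mat by blast
    show "a * b - b * a \<in> R ` brackets J J" if "a \<in> R ` brackets J J" "b \<in> R ` brackets J J" for a b
      using ideal_image_bracket[OF rep B, of b a] that BJ JV by blast
    show "\<exists>m. a ^ m = 0" if "a \<in> R ` brackets J J" for a using nil that by blast
  qed
  moreover have "brackets J J \<subseteq> V" using BJ JV by blast
  ultimately show thesis using nilset_vann that by blast
qed

end

lemma (in lie_module) fd_lie_module_exists:
  assumes "fd sw W"
  obtains d M where "fd_lie_module scale V prd sw W act d M"
proof (rule W.matrix_of_operator[OF assms], goal_cases)
  case (1 d M)
  have "fd_lie_module scale V prd sw W act d M"
    by unfold_locales (fact 1)+
  then show thesis by (rule that)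
qed

lemma (in lie_algebra_char_0) adjoint_module: "lie_module scale V prd scale V prd"
proof unfold_locales
  show "lin_on scale V (prd x)" if "x \<in> V" for x
    using that by (auto simp: lin_on_def prd_closed prd_add_right prd_scale_right)
qed (auto simp: subspace_carrier prd_add_left prd_scale_left jacobi_left)

section \<open>Ideals of a semisimple Lie algebra\<close>

context lie_algebra_char_0
begin

definition semisimple :: bool where
  "semisimple \<longleftrightarrow> (\<forall>B. lie_ideal B \<longrightarrow> (\<forall>x\<in>B. \<forall>y\<in>B. prd x y = 0) \<longrightarrow> B = {0})"

lemma semisimpleD: "semisimple \<Longrightarrow> lie_ideal B \<Longrightarrow> (\<And>x y. x \<in> B \<Longrightarrow> y \<in> B \<Longrightarrow> prd x y = 0) \<Longrightarrow> B = {0}"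
  unfolding semisimple_def by blast

text \<open>The centre of \<open>J\<close> is an abelian ideal of the whole algebra, hence 0, and
  then every term of the upper central series of \<open>J\<close> is 0.\<close>

lemma semisimple_nilpotent_ideal:
  assumes ss: semisimple and J: "lie_ideal J" and q: "J \<subseteq> vann prd J q"
  shows "J = {0}"
proof -
  note j = lie_idealD[OF J]
  define Z where "Z = {a \<in> J. \<forall>x\<in>J. prd x a = 0}"
  have Z: "lie_ideal Z"
  proof (rule lie_idealI)
    show "subspace Z" unfolding Z_def
      using j(1,2) by (intro subspaceI)
        (auto simp: subspace_0 subspace_add subspace_scale prd_add_right prd_scale_right)
    show "Z \<subseteq> V" using j(2) by (auto simp: Z_def)
    show "prd x a \<in> Z" if x: "x \<in> V" and a: "a \<in> Z" for x a
    proof -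
      have aJ: "a \<in> J" "\<And>y. y \<in> J \<Longrightarrow> prd y a = 0" using a by (auto simp: Z_def)
      have "prd y (prd x a) = 0" if y: "y \<in> J" for y
      proof -
        have "prd (prd y x) a = prd y (prd x a) - prd x (prd y a)"
          by (rule jacobi_left) (use x y aJ j(2) in auto)
        moreover have "prd (prd y x) a = 0" using aJ(2) j(4)[OF x y] by blast
        ultimately show ?thesis using aJ(2)[OF y] x by simp
      qed
      then show ?thesis using j(3)[OF x aJ(1)] by (simp add: Z_def)
    qed
  qed
  have Z0: "Z = {0}" by (rule semisimpleD[OF ss Z]) (auto simp: Z_def)
  have "J \<inter> vann prd J k = {0}" for k
  proof (induction k)
    case 0
    then show ?case using subspace_0[OF j(1)] by auto
  next
    case (Suc k)
    have "v \<in> Z" if v: "v \<in> J \<inter> vann prd J (Suc k)" for v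
    proof -
      have "prd x v \<in> J \<inter> vann prd J k" if "x \<in> J" for x
        using v that j(3)[OF j(2)[OF that], of v] by simp
      then show ?thesis using Suc v by (simp add: Z_def)
    qed
    moreover have "0 \<in> vann prd J (Suc k)" using Suc j(2) by auto
    ultimately show ?case using Z0 subspace_0[OF j(1)] by blast
  qed
  then show ?thesis using q by blast
qed

text \<open>Cartan's criterion makes [J, J] act nilpotently on the algebra. It is then a nilpotent
  ideal, so 0, and \<open>J\<close> is abelian.\<close>

lemma semisimple_isotropic_ideal:
  assumes ss: semisimple and "fd_lie_module scale V prd scale V prd d M" and J: "lie_ideal J"
    and iso: "\<And>x y. x \<in> J \<Longrightarrow> y \<in> J \<Longrightarrow> fd_lie_module.tform prd M x y = 0"
  shows "J = {0}"
proof -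
  interpret ad: fd_lie_module scale V prd scale V prd d M by fact
  note j = lie_idealD[OF J]
  obtain q where q: "V \<subseteq> vann prd (brackets J J) q"
    using ad.isotropic_brackets_vann[OF J iso] .
  have "brackets J J \<subseteq> V" using lie_idealD(2)[OF lie_ideal_brackets[OF J J]] by blast
  then have "brackets J J = {0}"
    using q by (intro semisimple_nilpotent_ideal[OF ss lie_ideal_brackets[OF J J], of q]) blast
  then have "prd x y = 0" if "x \<in> J" "y \<in> J" for x y
    using brackets_base[OF that] by blast
  then show ?thesis by (rule semisimpleD[OF ss J])
qed

text \<open>The complement is the orthogonal space for the Killing form. Its intersection with
  \<open>K\<close> is isotropic, hence 0, so the form is nondegenerate on \<open>K\<close> and the
  dual vectors \<open>Y b\<close> give an orthogonal projection onto \<open>K\<close>.\<close>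

lemma semisimple_complement:
  assumes ss: semisimple and fdV: "fd scale V" and K: "lie_ideal K"
  obtains K' where "lie_ideal K'" "K \<inter> K' = {0}" "\<forall>v\<in>V. \<exists>k\<in>K. v - k \<in> K'"
proof -
  obtain d M where M: "fd_lie_module scale V prd scale V prd d M"
    using lie_module.fd_lie_module_exists[OF adjoint_module fdV] .
  then interpret ad: fd_lie_module scale V prd scale V prd d M .
  note k = lie_idealD[OF K]
  define K' where "K' = {x \<in> V. \<forall>k\<in>K. ad.tform x k = 0}"
  have K': "lie_ideal K'" unfolding K'_def by (rule ad.orthogonal_ideal[OF K])
  have int: "K \<inter> K' = {0}"
    by (rule semisimple_isotropic_ideal[OF ss M lie_ideal_inter[OF K K']]) (auto simp: K'_def)
  have fdK: "fd scale K" using fd_subset[OF fdV k(1)] k(2) by blast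
  obtain B where B: "finite B" "independent B" "B \<subseteq> K" "span B = K" "card B = dim K"
    using fd_basis[OF fdK] .
  have "\<exists>y\<in>span B. \<forall>x\<in>B. ad.tform x y = (if x = b then 1 else 0)" if "b \<in> B" for b
  proof (rule dual_vector_exists[OF B(1,2) that])
    show "ad.tform x (y + z) = ad.tform x y + ad.tform x z" if "x \<in> span B" "y \<in> span B" "z \<in> span B" for x y z
      using that B(4) k(2) by (simp add: ad.tform_add_right)
    show "ad.tform x (scale c y) = c * ad.tform x y" if "x \<in> span B" "y \<in> span B" for x y c
      using that B(4) k(2) by (simp add: ad.tform_scale_right)
    show "y = 0" if y: "y \<in> span B" and 0: "\<And>x. x \<in> B \<Longrightarrow> ad.tform x y = 0" for y
    proof -
      have "x \<in> V \<and> ad.tform y x = 0" if "x \<in> span B" for x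
        using that
      proof (induction rule: span_induct)
        case base
        show ?case by (rule subspaceI)
          (auto simp: V_closed ad.tform_add_right ad.tform_scale_right ad.tform_zero_right)
      next
        case (step x)
        then show ?case using 0[of x] ad.tform_sym[of y x] B(3) k(2) by auto
      qed
      then have "y \<in> K'" using y B(4) k(2) by (auto simp: K'_def)
      then show ?thesis using int y B(4) by blast
    qed
  qed
  then obtain Y where Y: "\<And>b. b \<in> B \<Longrightarrow> Y b \<in> K" "\<And>b x. b \<in> B \<Longrightarrow> x \<in> B \<Longrightarrow> ad.tform x (Y b) = (if x = b then 1 else 0)"
    using B(4) by metis
  have "\<exists>u\<in>K. v - u \<in> K'" if v: "v \<in> V" for v
  proof -
    define u where "u = (\<Sum>b\<in>B. scale (ad.tform v b) (Y b))"
    have YV: "Y b \<in> V" if "b \<in> B" for b using Y(1)[OF that] k(2) by blast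
    have uK: "u \<in> K" unfolding u_def using Y(1) by (intro subspace_sum[OF k(1)] subspace_scale[OF k(1)])
    have uV: "u \<in> V" using uK k(2) by blast
    have b0: "ad.tform (v - u) x = 0" if x: "x \<in> B" for x
    proof -
      have "ad.tform u x = (\<Sum>b\<in>B. ad.tform v b * ad.tform (Y b) x)"
        unfolding u_def by (subst ad.tform_sum_left) (auto simp: V_closed YV ad.tform_scale_left)
      also have "\<dots> = (\<Sum>b\<in>B. if b = x then ad.tform v x else 0)"
        by (rule sum.cong) (use Y(2) x ad.tform_sym in auto)
      finally show ?thesis using B(1) x v uV by (simp add: ad.tform_diff_left)
    qed
    have "x \<in> V \<and> ad.tform (v - u) x = 0" if "x \<in> span B" for x
      using that
    proof (induction rule: span_induct)
      case base
      show ?case by (rule subspaceI)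
        (auto simp: V_closed ad.tform_add_right ad.tform_scale_right ad.tform_zero_right)
    next
      case (step x)
      then show ?case using b0 B(3) k(2) by auto
    qed
    then have "v - u \<in> K'" using v uV B(4) by (auto simp: K'_def V_closed)
    then show ?thesis using uK by blast
  qed
  then show thesis using that K' int by blast
qed

text \<open>A complement of [K, K] meets \<open>K\<close> in an abelian ideal: brackets of its
  elements lie both in [K, K] and in the complement.\<close>

lemma semisimple_ideal_perfect:
  assumes ss: semisimple and fdV: "fd scale V" and K: "lie_ideal K"
  shows "brackets K K = K"
proof -
  note k = lie_idealD[OF K]
  have KK: "lie_ideal (brackets K K)" by (intro lie_ideal_brackets K)
  have sub: "brackets K K \<subseteq> K" by (rule brackets_minimal) (use k in auto)
  obtain K' where K': "lie_ideal K'" "brackets K K \<inter> K' = {0}" "\<forall>v\<in>V. \<exists>k\<in>brackets K K. v - k \<in> K'"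
    using semisimple_complement[OF ss fdV KK] .
  have A: "K \<inter> K' = {0}"
  proof (rule semisimpleD[OF ss lie_ideal_inter[OF K K'(1)]])
    fix x y assume "x \<in> K \<inter> K'" "y \<in> K \<inter> K'"
    then have "prd x y \<in> brackets K K \<inter> K'"
      using brackets_base[of x K y K] lie_idealD(3)[OF K'(1), of x y] k(2) by blast
    then show "prd x y = 0" using K'(2) by blast
  qed
  have "x \<in> brackets K K" if x: "x \<in> K" for x
  proof -
    obtain u where u: "u \<in> brackets K K" "x - u \<in> K'" using K'(3) k(2)[OF x] by blast
    then have "x - u \<in> K \<inter> K'" using x sub subspace_diff[OF k(1)] by blast
    then show ?thesis using A u by simp
  qed
  then show ?thesis using sub by blast
qed

end

text \<open>The Casimir element of the trace form of \<open>W\<close>, which may be degenerate. The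
  kernel \<open>K\<close> of the form is isotropic and perfect, and therefore acts as 0. On a
  complementary ideal \<open>S\<close> the form is nondegenerate, and the trace of the element is
  the dimension of \<open>S\<close>.\<close>

lemma (in fd_lie_module) casimir:
  assumes ss: semisimple and fdV: "fd scale V" and nz: "\<exists>x\<in>V. \<exists>w\<in>W. act x w \<noteq> 0"
  obtains B Y where "finite B" "B \<subseteq> V" "Y ` B \<subseteq> V" "tr (\<Sum>b\<in>B. R b * R (Y b)) \<noteq> 0"
    "\<forall>x\<in>V. R x * (\<Sum>b\<in>B. R b * R (Y b)) = (\<Sum>b\<in>B. R b * R (Y b)) * R x"
proof -
  define K where "K = {x \<in> V. \<forall>y\<in>V. tform x y = 0}"
  have K: "lie_ideal K" unfolding K_def by (rule orthogonal_ideal[OF lie_ideal_V])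
  note k = lie_idealD[OF K]
  have perfect: "brackets K K = K" by (rule semisimple_ideal_perfect[OF ss fdV K])
  have "tform x y = 0" if "x \<in> K" "y \<in> K" for x y
    using that k(2)[OF that(2)] unfolding K_def by blast
  from isotropic_brackets_vann[OF K this] obtain q where q: "W \<subseteq> vann act K q"
    using perfect by auto
  \<comment> \<open>An element of K = [K, K] is built from products of two elements of
    \<open>K\<close> and lowers the level by two, so the number of factors needed can be decreased
    down to one.\<close>
  have down: "W \<subseteq> vann act K (Suc q)" if h: "W \<subseteq> vann act K (Suc (Suc q))" for q
  proof
    fix w assume w: "w \<in> W"
    have "v \<in> V \<and> act v w \<in> W \<inter> vann act K q" if "v \<in> brackets K K" for v
      using that unfolding brackets_def
    proof (induction rule: span_induct)
      case base
      have s: "W.subspace (W \<inter> vann act K q)" by (rule vann_subspace) (use k(2) in blast)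
      show ?case
      proof (rule subspaceI)
        show "0 \<in> {v. v \<in> V \<and> act v w \<in> W \<inter> vann act K q}"
          using W.subspace_0[OF s] V_closed(1) act_zero_left[OF w] by auto
        show "x + y \<in> {v. v \<in> V \<and> act v w \<in> W \<inter> vann act K q}"
          if "x \<in> {v. v \<in> V \<and> act v w \<in> W \<inter> vann act K q}" "y \<in> {v. v \<in> V \<and> act v w \<in> W \<inter> vann act K q}" for x y
          using that W.subspace_add[OF s, of "act x w" "act y w"] V_closed(2) act_add[OF _ _ w] by auto
        show "scale c x \<in> {v. v \<in> V \<and> act v w \<in> W \<inter> vann act K q}"
          if "x \<in> {v. v \<in> V \<and> act v w \<in> W \<inter> vann act K q}" for x c
          using that W.subspace_scale[OF s, of "act x w" c] V_closed(5) act_scale[OF _ w] by auto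
      qed
    next
      case (step v)
      then obtain a b where v: "v = prd a b" "a \<in> K" "b \<in> K" by blast
      have abV: "a \<in> V" "b \<in> V" using v k(2) by auto
      have s: "W.subspace (W \<inter> vann act K q)" by (rule vann_subspace) (use k(2) in blast)
      have "act a (act b w) \<in> W \<inter> vann act K q" "act b (act a w) \<in> W \<inter> vann act K q"
        using subsetD[OF h w] v abV w act_closed by auto
      then have "act a (act b w) - act b (act a w) \<in> W \<inter> vann act K q" by (rule W.subspace_diff[OF s])
      then show ?case using act_lie[OF abV w] v abV prd_closed by auto
    qed
    then show "w \<in> vann act K (Suc q)" using perfect by auto
  qed
  have "W \<subseteq> vann act K 1" if "W \<subseteq> vann act K (Suc q)" for q
    using that by (induction q) (use down in \<open>auto simp del: vann.simps\<close>)
  moreover have "W \<subseteq> vann act K (Suc q)"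
  proof
    fix w assume w: "w \<in> W"
    have "act x w \<in> W" if "x \<in> K" for x using act_closed[OF k(2)[OF that] w] .
    then show "w \<in> vann act K (Suc q)" using q by auto
  qed
  ultimately have W1: "W \<subseteq> vann act K 1" by blast
  have K0: "act x w = 0" if "x \<in> K" "w \<in> W" for x w using subsetD[OF W1 that(2)] that(1) by auto
  have RK: "R x = 0" if "x \<in> K" for x using K0 that M_zero[OF act_lin] k(2) by blast
  obtain S where S: "lie_ideal S" "K \<inter> S = {0}" "\<forall>v\<in>V. \<exists>k\<in>K. v - k \<in> S"
    using semisimple_complement[OF ss fdV K] .
  note s = lie_idealD[OF S(1)]
  have RS: "\<exists>u\<in>S. R u = R v" if v: "v \<in> V" for v
  proof -
    obtain a where a: "a \<in> K" "v - a \<in> S" using S(3) v by blast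
    have "R v = R (v - a) + R a" using R_add[of "v - a" a] v a k(2) V_closed by auto
    then show ?thesis using RK[OF a(1)] a(2) by auto
  qed
  have nd: "y = 0" if y: "y \<in> S" and 0: "\<And>x. x \<in> S \<Longrightarrow> tform x y = 0" for y
  proof -
    have "tform y v = 0" if v: "v \<in> V" for v
    proof -
      obtain u where u: "u \<in> S" "R u = R v" using RS[OF v] by blast
      then show ?thesis using 0[OF u(1)] tform_sym[of u y] by (simp add: tform_def)
    qed
    then have "y \<in> K" using y s(2) by (auto simp: K_def)
    then show ?thesis using S(2) y by blast
  qed
  have fdS: "fd scale S" using fd_subset[OF fdV s(1)] s(2) by blast
  obtain B where B: "finite B" "independent B" "B \<subseteq> S" "span B = S" "card B = dim S"
    using fd_basis[OF fdS] .
  have spanB: "tform x y = 0" if "y \<in> V" "\<And>b. b \<in> B \<Longrightarrow> tform b y = 0" "x \<in> S" for x y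
  proof -
    have "x \<in> V \<and> tform x y = 0" if "x \<in> span B" for x
      using that
    proof (induction rule: span_induct)
      case base
      show ?case by (rule subspaceI)
        (auto simp: V_closed tform_add_left tform_scale_left tform_zero_left)
    next
      case (step x)
      then show ?case using \<open>\<And>b. b \<in> B \<Longrightarrow> tform b y = 0\<close> B(3) s(2) by auto
    qed
    then show ?thesis using \<open>x \<in> S\<close> B(4) by blast
  qed
  have "\<exists>y\<in>span B. \<forall>x\<in>B. tform x y = (if x = b then 1 else 0)" if "b \<in> B" for b
  proof (rule dual_vector_exists[OF B(1,2) that])
    show "tform x (y + z) = tform x y + tform x z" if "x \<in> span B" "y \<in> span B" "z \<in> span B" for x y z
      using that B(4) s(2) by (simp add: tform_add_right)
    show "tform x (scale c y) = c * tform x y" if "x \<in> span B" "y \<in> span B" for x y c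
      using that B(4) s(2) by (simp add: tform_scale_right)
    show "y = 0" if "y \<in> span B" "\<And>x. x \<in> B \<Longrightarrow> tform x y = 0" for y
      using nd[of y] spanB[of y] that B(4) s(2) by auto
  qed
  then obtain Y where Y: "\<And>b. b \<in> B \<Longrightarrow> Y b \<in> S" "\<And>b x. b \<in> B \<Longrightarrow> x \<in> B \<Longrightarrow> tform x (Y b) = (if x = b then 1 else 0)"
    using B(4) by metis
  have BV: "b \<in> V" if "b \<in> B" for b using that B(3) s(2) by blast
  have YV: "Y b \<in> V" if "b \<in> B" for b using Y(1)[OF that] s(2) by blast
  have exp2: "v = (\<Sum>b\<in>B. scale (tform b v) (Y b))" if v: "v \<in> S" for v
  proof -
    define u where "u = (\<Sum>b\<in>B. scale (tform b v) (Y b))"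
    have uS: "u \<in> S" unfolding u_def using Y(1) by (intro subspace_sum[OF s(1)] subspace_scale[OF s(1)])
    have uV: "u \<in> V" "v \<in> V" "v - u \<in> V" "v - u \<in> S" using uS v s(2) subspace_diff[OF s(1)] by blast+
    have "tform x (v - u) = 0" if x: "x \<in> B" for x
    proof -
      have "tform x u = (\<Sum>b\<in>B. tform b v * tform x (Y b))"
        unfolding u_def by (subst tform_sum_right) (auto simp: V_closed YV tform_scale_right)
      also have "\<dots> = (\<Sum>b\<in>B. if b = x then tform x v else 0)"
        by (rule sum.cong) (use Y(2) x in auto)
      finally have "tform x u = tform x v" using B(1) x by simp
      then show ?thesis using tform_diff_left[OF uV(2,1), of x] tform_sym[of x "v - u"] tform_sym[of x u] tform_sym[of x v] by simp
    qed
    then have "v - u = 0" using nd[OF uV(4)] spanB[OF uV(3)] by blast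
    then show ?thesis by (simp add: u_def)
  qed
  have exp1: "v = (\<Sum>b\<in>B. scale (tform v (Y b)) b)" if v: "v \<in> S" for v
  proof -
    define u where "u = (\<Sum>b\<in>B. scale (tform v (Y b)) b)"
    have uS: "u \<in> S" unfolding u_def using B(3) by (intro subspace_sum[OF s(1)] subspace_scale[OF s(1)]) auto
    have uV: "u \<in> V" "v \<in> V" "v - u \<in> V" "v - u \<in> S" using uS v s(2) subspace_diff[OF s(1)] by blast+
    have Yx: "tform (v - u) (Y x) = 0" if x: "x \<in> B" for x
    proof -
      have "tform u (Y x) = (\<Sum>b\<in>B. tform v (Y b) * tform b (Y x))"
        unfolding u_def by (subst tform_sum_left) (auto simp: V_closed BV tform_scale_left)
      also have "\<dots> = (\<Sum>b\<in>B. if b = x then tform v (Y x) else 0)"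
        by (rule sum.cong) (use Y(2) x in auto)
      finally have "tform u (Y x) = tform v (Y x)" using B(1) x by simp
      then show ?thesis using tform_diff_left[OF uV(2,1), of "Y x"] by simp
    qed
    have "tform x (v - u) = 0" if "x \<in> S" for x
    proof -
      have "tform (v - u) x = (\<Sum>b\<in>B. tform b x * tform (v - u) (Y b))"
        by (subst exp2[OF that], subst tform_sum_right) (auto simp: V_closed YV tform_scale_right)
      also have "\<dots> = 0" using Yx by (intro sum.neutral) auto
      finally show ?thesis by (simp only: tform_sym[of x "v - u"])
    qed
    then have "v - u = 0" using nd[OF uV(4)] by blast
    then show ?thesis by (simp add: u_def)
  qed
  define c where "c = (\<Sum>b\<in>B. R b * R (Y b))"
  have "tr c = (\<Sum>b\<in>B. tform b (Y b))"
    unfolding c_def tform_def by (rule tr_sum[of _ _ d]) (intro Mat_closed(7) M_Mat)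
  also have "\<dots> = of_nat (card B)" using Y(2) by simp
  finally have trc: "tr c = of_nat (card B)" .
  have "B \<noteq> {}"
  proof
    assume "B = {}"
    then have "S = {0}" using B(4) by simp
    then have "R v = 0" if "v \<in> V" for v
      using RS[OF that] RK[of 0] subspace_0[OF k(1)] by auto
    then show False using nz M_zero[OF act_lin] by blast
  qed
  then have "tr c \<noteq> 0" using trc B(1) by simp
  moreover have "R l * c = c * R l" if l: "l \<in> V" for l
  proof -
    have lB: "prd l b \<in> S" "prd l b \<in> V" if "b \<in> B" for b using that l BV s(3) B(3) prd_closed by auto
    have lY: "prd l (Y b) \<in> S" "prd l (Y b) \<in> V" if "b \<in> B" for b using that l YV s(3) Y(1) prd_closed by auto
    have 1: "R (prd l b) = (\<Sum>b'\<in>B. smul (tform (prd l b) (Y b')) (R b'))" if b: "b \<in> B" for b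
    proof -
      have "R (prd l b) = R (\<Sum>b'\<in>B. scale (tform (prd l b) (Y b')) b')" using exp1[OF lB(1)[OF b]] by simp
      also have "\<dots> = (\<Sum>b'\<in>B. R (scale (tform (prd l b) (Y b')) b'))"
        by (rule R_sum) (simp add: V_closed BV)
      finally show ?thesis by (simp add: R_scale BV)
    qed
    have 2: "R (prd l (Y b)) = (\<Sum>b'\<in>B. smul (tform b' (prd l (Y b))) (R (Y b')))" if b: "b \<in> B" for b
    proof -
      have "R (prd l (Y b)) = R (\<Sum>b'\<in>B. scale (tform b' (prd l (Y b))) (Y b'))" using exp2[OF lY(1)[OF b]] by simp
      also have "\<dots> = (\<Sum>b'\<in>B. R (scale (tform b' (prd l (Y b))) (Y b')))"
        by (rule R_sum) (simp add: V_closed YV)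
      finally show ?thesis by (simp add: R_scale YV)
    qed
    \<comment> \<open>By invariance \<open>ad l\<close> has negative transposed matrices in the two
      dual bases; this makes the two double sums below cancel.\<close>
    have anti: "tform (prd l b) (Y b') = - tform b (prd l (Y b'))" if "b \<in> B" "b' \<in> B" for b b'
      using tform_invariant[OF BV[OF that(1)] l YV[OF that(2)]] antisym[OF BV[OF that(1)] l]
      by (simp add: tform_minus_left prd_closed BV[OF that(1)] l)
    have "R l * c - c * R l = (\<Sum>b\<in>B. (R l * R b - R b * R l) * R (Y b) + R b * (R l * R (Y b) - R (Y b) * R l))"
      unfolding c_def sum_distrib_left sum_distrib_right sum_subtractf[symmetric]
      by (rule sum.cong) (simp_all add: algebra_simps)
    also have "\<dots> = (\<Sum>b\<in>B. R (prd l b) * R (Y b) + R b * R (prd l (Y b)))"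
      by (rule sum.cong) (use R_lie[OF l] BV YV in auto)
    also have "\<dots> = (\<Sum>b\<in>B. R (prd l b) * R (Y b)) + (\<Sum>b\<in>B. R b * R (prd l (Y b)))"
      by (rule sum.distrib)
    also have "(\<Sum>b\<in>B. R (prd l b) * R (Y b)) = (\<Sum>b\<in>B. \<Sum>b'\<in>B. smul (tform (prd l b) (Y b')) (R b' * R (Y b)))"
      by (rule sum.cong) (simp_all add: 1 sum_distrib_right smul_mult_left)
    also have "\<dots> = (\<Sum>b\<in>B. \<Sum>b'\<in>B. smul (tform (prd l b') (Y b)) (R b * R (Y b')))"
      by (rule sum.swap)
    also have "(\<Sum>b\<in>B. R b * R (prd l (Y b))) = (\<Sum>b\<in>B. \<Sum>b'\<in>B. smul (tform b' (prd l (Y b))) (R b * R (Y b')))"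
      by (rule sum.cong) (simp_all add: 2 sum_distrib_left smul_mult_right)
    also have "(\<Sum>b\<in>B. \<Sum>b'\<in>B. smul (tform (prd l b') (Y b)) (R b * R (Y b')))
        + (\<Sum>b\<in>B. \<Sum>b'\<in>B. smul (tform b' (prd l (Y b))) (R b * R (Y b'))) = 0"
      unfolding sum.distrib[symmetric] by (intro sum.neutral ballI) (simp add: anti)
    finally show ?thesis by simp
  qed
  ultimately show thesis
    using that[of B Y] B(1) BV YV unfolding c_def by blast
qed

text \<open>Weyl's theorem for a trivial action on \<open>W\<close> modulo \<open>U\<close>. If the
  action on \<open>W\<close> is not trivial, the Casimir operator \<open>C\<close> commutes with it
  and maps \<open>W\<close> into \<open>U\<close>. By Fitting, \<open>W\<close> is the sum of the
  null space \<open>W'\<close> of a high power of \<open>C\<close> and an image inside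
  \<open>U\<close>, so \<open>W'\<close> is not inside \<open>U\<close>. As tr C is not 0,
  \<open>W'\<close> is a proper submodule, and induction on the dimension applies.\<close>

lemma (in lie_algebra_char_0) invariant_vector:
  assumes ss: semisimple and fdV: "fd scale V"
  shows "lie_module scale V prd sw W act \<Longrightarrow> fd sw W \<Longrightarrow> module.subspace sw U \<Longrightarrow>
    (\<forall>x\<in>V. \<forall>w\<in>W. act x w \<in> U) \<Longrightarrow> \<not> W \<subseteq> U \<Longrightarrow> \<exists>w\<in>W. w \<notin> U \<and> (\<forall>x\<in>V. act x w = 0)"
proof (induction "vector_space.dim sw W" arbitrary: W rule: less_induct)
  case less
  interpret lie_module scale V prd sw W act by fact
  show ?case
  proof (cases "\<exists>x\<in>V. \<exists>w\<in>W. act x w \<noteq> 0")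
    case False
    then show ?thesis using less.prems(5) by blast
  next
    case True
    obtain d M where dM: "fd_lie_module scale V prd sw W act d M"
      using fd_lie_module_exists[OF less.prems(2)] .
    then interpret m: fd_lie_module scale V prd sw W act d M .
    obtain B Y where BY: "finite B" "B \<subseteq> V" "Y ` B \<subseteq> V" "tr (\<Sum>b\<in>B. m.R b * m.R (Y b)) \<noteq> 0"
      "\<forall>x\<in>V. m.R x * (\<Sum>b\<in>B. m.R b * m.R (Y b)) = (\<Sum>b\<in>B. m.R b * m.R (Y b)) * m.R x"
      using m.casimir[OF ss fdV True] .
    define c where "c = (\<Sum>b\<in>B. m.R b * m.R (Y b))"
    define C where "C w = (\<Sum>b\<in>B. act b (act (Y b) w))" for w
    have t: "lin_on sw W (\<lambda>w. act b (act (Y b) w))" if "b \<in> B" for b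
      using W.lin_on_comp[OF act_lin act_lin, of b "Y b"] that BY(2,3) by auto
    have Clin: "lin_on sw W C"
      unfolding C_def[abs_def] by (rule W.lin_on_sum[OF W_subspace t])
    have MC: "M C = c"
    proof -
      have "M C = (\<Sum>b\<in>B. M (\<lambda>w. act b (act (Y b) w)))"
        unfolding C_def[abs_def] by (rule m.M_sum[OF t])
      also have "\<dots> = c" unfolding c_def
        by (rule sum.cong[OF refl], rule m.M_comp) (use act_lin BY(2,3) in auto)
      finally show ?thesis .
    qed
    have comm: "act x (C w) = C (act x w)" if x: "x \<in> V" and w: "w \<in> W" for x w
    proof -
      have l: "lin_on sw W (\<lambda>w. act x (C w))" "lin_on sw W (\<lambda>w. C (act x w))"
        by (rule W.lin_on_comp[OF act_lin[OF x] Clin], rule W.lin_on_comp[OF Clin act_lin[OF x]])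
      have "lin_on sw W (\<lambda>w. act x (C w) + sw (- 1) (C (act x w)))"
        by (intro W.lin_on_add W.lin_on_scale W_subspace l)
      then have d: "lin_on sw W (\<lambda>w. act x (C w) - C (act x w))" by simp
      have "M (\<lambda>w. act x (C w) - C (act x w)) = m.R x * c - c * m.R x"
        unfolding m.M_diff[OF l] m.M_comp[OF act_lin[OF x] Clin] m.M_comp[OF Clin act_lin[OF x]] MC ..
      also have "\<dots> = 0" using BY(5) x unfolding c_def by simp
      finally show ?thesis using m.M_zero[OF d] w by auto
    qed
    have commn: "act x ((C ^^ n) w) = (C ^^ n) (act x w)" if x: "x \<in> V" and w: "w \<in> W" for x w n
      using w
    proof (induction n)
      case (Suc n)
      have "(C ^^ n) w \<in> W" using W.lin_on_power[OF Clin, of n] Suc by (auto simp: lin_on_def)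
      then show ?case using Suc comm[OF x] by simp
    qed simp
    note Cn = W.lin_on_power[OF Clin]
    have CU: "(C ^^ Suc n) w \<in> U" if w: "w \<in> W" for w n
    proof -
      have "(C ^^ n) w \<in> W" using Cn[of n] w by (auto simp: lin_on_def)
      then have "act b (act (Y b) ((C ^^ n) w)) \<in> U" if "b \<in> B" for b
        using less.prems(4) act_closed BY(2,3) that by blast
      then show ?thesis by (simp add: C_def W.subspace_sum[OF less.prems(3)])
    qed
    define S where "S n = (C ^^ n) ` W" for n
    have Csub: "W.subspace (S n)" for n
    proof (rule W.subspaceI)
      note C = Cn[of n, unfolded lin_on_def]
      have "(C ^^ n) (sw 0 0) = sw 0 ((C ^^ n) 0)" using C W.subspace_0[OF W_subspace] by blast
      then have "(C ^^ n) 0 = 0" by simp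
      then show "0 \<in> S n" unfolding S_def using W.subspace_0[OF W_subspace] by (metis imageI)
      show "x + y \<in> S n" if xy: "x \<in> S n" "y \<in> S n" for x y
      proof -
        obtain u v where "x = (C ^^ n) u" "y = (C ^^ n) v" "u \<in> W" "v \<in> W" using xy by (auto simp: S_def)
        then show ?thesis using C W.subspace_add[OF W_subspace, of u v] unfolding S_def by (metis imageI)
      qed
      show "sw k x \<in> S n" if x: "x \<in> S n" for k x
      proof -
        obtain u where "x = (C ^^ n) u" "u \<in> W" using x by (auto simp: S_def)
        then show ?thesis using C W.subspace_scale[OF W_subspace, of u k] unfolding S_def by (metis imageI)
      qed
    qed
    have CW: "(C ^^ n) w \<in> W" if "w \<in> W" for n w using Cn[of n] that by (auto simp: lin_on_def)
    obtain n where n: "\<And>m. n \<le> m \<Longrightarrow> S m = S n"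
    proof (rule W.fd_chain[OF less.prems(2) Csub])
      show "S n \<subseteq> W" for n using CW by (auto simp: S_def)
      show "S (Suc n) \<subseteq> S n" for n
        unfolding S_def by (auto simp: funpow_swap1 intro!: imageI CW[of _ 1, simplified])
    qed blast
    \<comment> \<open>A positive exponent, so that at least one factor \<open>C\<close> pushes the
      image into \<open>U\<close> and \<open>M_power\<close> applies.\<close>
    define N where "N = Suc n"
    have N: "S (N + N) = S N" using n[of N] n[of "N + N"] by (simp add: N_def)
    define W' where "W' = {w \<in> W. (C ^^ N) w = 0}"
    have W'W: "W' \<subseteq> W" by (auto simp: W'_def)
    have C0: "(C ^^ N) 0 = 0"
    proof -
      have "(C ^^ N) (sw 0 0) = sw 0 ((C ^^ N) 0)"
        using Cn[of N] W.subspace_0[OF W_subspace] unfolding lin_on_def by blast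
      then show ?thesis by simp
    qed
    have W'sub: "W.subspace W'"
      using Cn[of N] W_subspace C0 unfolding W'_def lin_on_def
      by (intro W.subspaceI) (auto simp: W.subspace_0 W.subspace_add W.subspace_scale)
    have W'act: "act x w \<in> W'" if "x \<in> V" "w \<in> W'" for x w
      using that act_closed commn[of x w N, symmetric] act_zero_right by (auto simp: W'_def)
    have W'mod: "lie_module scale V prd sw W' act"
    proof unfold_locales
      show "lin_on sw W' (act x)" if "x \<in> V" for x
        using act_lin[OF that] W'act[OF that] W'W by (auto simp: lin_on_def subset_iff)
    qed (use W'sub W'W act_add act_scale act_lie in auto)
    have neq: "W' \<noteq> W"
    proof
      assume "W' = W"
      then have "M (C ^^ N) = 0" using m.M_zero[OF Cn[of N]] by (auto simp: W'_def)
      then have "c ^ N = 0" using m.M_power[OF Clin, of n] MC by (simp add: N_def del: funpow.simps power_Suc)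
      then have "tr c = 0" using nilpotent_trace[of c d] m.M_Mat MC by metis
      then show False using BY(4) by (simp add: c_def)
    qed
    have "\<not> W' \<subseteq> U"
    proof
      assume sub: "W' \<subseteq> U"
      have "w \<in> U" if w: "w \<in> W" for w
      proof -
        have "(C ^^ N) w \<in> S (N + N)" using w unfolding N by (auto simp: S_def)
        then obtain v where v: "v \<in> W" "(C ^^ N) w = (C ^^ N) ((C ^^ N) v)" by (auto simp: S_def funpow_add)
        have "(C ^^ N) (w - (C ^^ N) v) = 0"
        proof -
          have "(C ^^ N) (w + sw (-1) ((C ^^ N) v)) = (C ^^ N) w + sw (-1) ((C ^^ N) ((C ^^ N) v))"
            using Cn[of N] w CW[OF v(1)] W.subspace_scale[OF W_subspace CW[OF v(1)]] unfolding lin_on_def by metis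
          then show ?thesis using v(2) by simp
        qed
        then have "w - (C ^^ N) v \<in> W'"
          using w CW[OF v(1)] W.subspace_diff[OF W_subspace] by (auto simp: W'_def)
        then have "w - (C ^^ N) v \<in> U" using sub by blast
        then show ?thesis using W.subspace_add[OF less.prems(3) _ CU[OF v(1), of n], of "w - (C ^^ N) v"] by (simp add: N_def del: funpow.simps)
      qed
      then show False using less.prems(5) by blast
    qed
    moreover have "W.dim W' < W.dim W" by (rule W.fd_dim_less[OF less.prems(2) W'sub W'W neq])
    moreover have "fd sw W'" by (rule W.fd_subset[OF less.prems(2) W'sub W'W])
    moreover have "\<forall>x\<in>V. \<forall>w\<in>W'. act x w \<in> U" using less.prems(4) W'W by blast
    ultimately obtain w where "w \<in> W'" "w \<notin> U" "\<forall>x\<in>V. act x w = 0"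
      using less.hyps[OF _ W'mod] less.prems(3) by blast
    then show ?thesis using W'W by blast
  qed
qed

section \<open>Levi decomposition\<close>

text \<open>V / I lives on a complement of \<open>I\<close>, the image of \<open>p\<close>, with
  every bracket followed by \<open>p\<close>.\<close>

locale lie_quotient = lie_algebra_char_0 scale V prd
  for scale :: "'f::field_char_0 \<Rightarrow> 'v::ab_group_add \<Rightarrow> 'v" and V prd +
  fixes I :: "'v set" and p :: "'v \<Rightarrow> 'v"
  assumes I: "lie_ideal I"
    and p_linear: "Vector_Spaces.linear scale scale p"
    and p_closed: "p ` V \<subseteq> V"
    and p_I: "x \<in> I \<Longrightarrow> p x = 0"
    and p_diff: "x \<in> V \<Longrightarrow> x - p x \<in> I"
    and p_idem: "x \<in> V \<Longrightarrow> p (p x) = p x"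
begin

abbreviation C :: "'v set" where "C \<equiv> p ` V"
abbreviation qbr :: "'v \<Rightarrow> 'v \<Rightarrow> 'v" where "qbr x y \<equiv> p (prd x y)"

lemma p_add: "p (x + y) = p x + p y" and p_scale: "p (scale c x) = scale c (p x)"
  using p_linear linear_self_iff by auto

lemma p_sub: "p (x - y) = p x - p y"
  using p_add[of "x - y" y] by simp

lemma p_zero: "p 0 = 0"
  using p_scale[of 0 0] by simp

lemma C_V: "x \<in> C \<Longrightarrow> x \<in> V"
  using p_closed by blast

lemma p_C: "x \<in> C \<Longrightarrow> p x = x"
  using p_idem by auto

lemma p_eq: "x \<in> V \<Longrightarrow> y \<in> V \<Longrightarrow> x - y \<in> I \<Longrightarrow> p x = p y"
  using p_I[of "x - y"] p_sub by simp

lemma p_zero_iff: "x \<in> V \<Longrightarrow> p x = 0 \<longleftrightarrow> x \<in> I"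
  using p_I p_diff[of x] by auto

lemma C_subspace: "subspace C"
proof (rule subspaceI)
  show "0 \<in> C" using V_closed(1) p_zero by (metis imageI)
  show "x + y \<in> C" if "x \<in> C" "y \<in> C" for x y
    using p_C[OF that(1)] p_C[OF that(2)] p_add[of x y] V_closed(2)[OF C_V[OF that(1)] C_V[OF that(2)]] by (metis imageI)
  show "scale c x \<in> C" if "x \<in> C" for c x
    using p_C[OF that] p_scale[of c x] V_closed(5)[OF C_V[OF that]] by (metis imageI)
qed

lemma qbr_right:
  assumes "x \<in> V" "y \<in> V"
  shows "qbr x (p y) = qbr x y"
proof -
  have py: "p y \<in> V" using assms(2) p_closed by blast
  have "prd x y - prd x (p y) = prd x (y - p y)" by (rule prd_diff_right[OF assms py, symmetric])
  also have "\<dots> \<in> I" by (rule lie_idealD(3)[OF I assms(1) p_diff[OF assms(2)]])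
  finally show ?thesis using p_eq[OF prd_closed[OF assms] prd_closed[OF assms(1) py]] by simp
qed

lemma qbr_left:
  assumes "x \<in> V" "y \<in> V"
  shows "qbr (p x) y = qbr x y"
proof -
  have px: "p x \<in> V" using assms(1) p_closed by blast
  have "prd x y - prd (p x) y = prd (x - p x) y" by (rule prd_diff_left[OF assms(1) px assms(2), symmetric])
  also have "\<dots> \<in> I" by (rule lie_idealD(4)[OF I assms(2) p_diff[OF assms(1)]])
  finally show ?thesis using p_eq[OF prd_closed[OF assms] prd_closed[OF px assms(2)]] by simp
qed

lemma qbr_both: "x \<in> V \<Longrightarrow> y \<in> V \<Longrightarrow> qbr (p x) (p y) = qbr x y"
  using qbr_left[of x "p y"] qbr_right[of x y] p_closed by auto

sublocale Q: lie_algebra_char_0 scale C qbr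
proof
  show "subspace C" by (rule C_subspace)
  fix x y z assume x: "x \<in> C" and y: "y \<in> C"
  note xy = C_V[OF x] C_V[OF y]
  show "qbr x y \<in> C" using xy prd_closed by blast
  show "qbr (scale c x) y = scale c (qbr x y)" "qbr x (scale c y) = scale c (qbr x y)" for c
    using xy by (simp_all add: prd_scale_left prd_scale_right p_scale)
  show "qbr x x = 0" using xy by (simp add: alternating p_zero)
  assume z: "z \<in> C"
  note xyz = xy C_V[OF z]
  show "qbr (x + y) z = qbr x z + qbr y z" "qbr x (y + z) = qbr x y + qbr x z"
    using xyz by (simp_all add: prd_add_left prd_add_right p_add)
  have "qbr x (qbr y z) + qbr y (qbr z x) + qbr z (qbr x y) = p (prd x (prd y z) + prd y (prd z x) + prd z (prd x y))"
    using xyz by (simp add: qbr_right prd_closed p_add)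
  then show "qbr x (qbr y z) + qbr y (qbr z x) + qbr z (qbr x y) = 0"
    using jacobi[OF xyz] by (simp add: p_zero)
qed

lemma preimage_ideal:
  assumes "Q.lie_ideal B"
  shows "lie_ideal {x \<in> V. p x \<in> B}" "I \<subseteq> {x \<in> V. p x \<in> B}"
proof -
  note B = Q.lie_idealD[OF assms]
  show "lie_ideal {x \<in> V. p x \<in> B}"
  proof (rule lie_idealI)
    show "subspace {x \<in> V. p x \<in> B}"
      using B(1) by (intro subspaceI) (auto simp: V_closed p_zero p_add p_scale subspace_0 subspace_add subspace_scale)
    show "prd x a \<in> {x \<in> V. p x \<in> B}" if x: "x \<in> V" and a: "a \<in> {x \<in> V. p x \<in> B}" for x a
    proof -
      have "qbr (p x) (p a) \<in> B" using x a by (intro B(3)) auto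
      moreover have "p x \<in> V" using x p_closed by blast
      ultimately show ?thesis using x a by (simp add: qbr_left qbr_right prd_closed)
    qed
  qed auto
  show "I \<subseteq> {x \<in> V. p x \<in> B}"
    using lie_idealD(2)[OF I] p_I subspace_0[OF B(1)] by auto
qed

lemma image_ideal:
  assumes "lie_ideal B"
  shows "Q.lie_ideal (p ` B)"
proof (rule Q.lie_idealI)
  note b = lie_idealD[OF assms]
  show "subspace (p ` B)"
  proof (rule subspaceI)
    show "0 \<in> p ` B" using subspace_0[OF b(1)] p_zero by (metis imageI)
    show "x + y \<in> p ` B" if "x \<in> p ` B" "y \<in> p ` B" for x y
      using that subspace_add[OF b(1)] by (auto simp flip: p_add)
    show "scale c x \<in> p ` B" if "x \<in> p ` B" for c x
      using that subspace_scale[OF b(1)] by (auto simp flip: p_scale)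
  qed
  show "p ` B \<subseteq> C" using b(2) by blast
  show "qbr x a \<in> p ` B" if x: "x \<in> C" and "a \<in> p ` B" for x a
  proof -
    obtain y where y: "a = p y" "y \<in> B" using \<open>a \<in> p ` B\<close> by blast
    then show ?thesis using qbr_right[OF C_V[OF x] b(2)[OF y(2)]] b(3)[OF C_V[OF x] y(2)] by auto
  qed
qed

end

context lie_algebra_char_0
begin

lemma lie_quotient_exists:
  assumes "lie_ideal I"
  obtains p where "lie_quotient scale V prd I p"
proof (rule projection_exists[OF subspace_carrier lie_idealD(1)[OF assms]])
  show "I \<subseteq> V" using lie_idealD(2)[OF assms] by blast
  fix p assume p: "Vector_Spaces.linear scale scale p" "p ` V \<subseteq> V" "\<And>x. x \<in> I \<Longrightarrow> p x = 0"
    "\<And>x. x \<in> V \<Longrightarrow> x - p x \<in> I" "\<And>x. x \<in> V \<Longrightarrow> p (p x) = p x"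
  have "lie_quotient scale V prd I p"
    by (intro lie_quotient.intro lie_algebra_char_0_axioms lie_quotient_axioms.intro) (fact assms p)+
  then show thesis by (rule that)
qed

text \<open>\<open>semisimple_mod I\<close> says that \<open>V / I\<close> is semisimple.\<close>

definition semisimple_mod :: "'v set \<Rightarrow> bool" where
  "semisimple_mod I \<longleftrightarrow> (\<forall>B. lie_ideal B \<longrightarrow> I \<subseteq> B \<longrightarrow> (\<forall>x\<in>B. \<forall>y\<in>B. prd x y \<in> I) \<longrightarrow> B = I)"

lemma semisimple_modD:
  "semisimple_mod I \<Longrightarrow> lie_ideal B \<Longrightarrow> I \<subseteq> B \<Longrightarrow> (\<And>x y. x \<in> B \<Longrightarrow> y \<in> B \<Longrightarrow> prd x y \<in> I) \<Longrightarrow> B = I"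
  unfolding semisimple_mod_def by blast

end

lemma (in lie_quotient) quotient_semisimple:
  assumes "semisimple_mod I"
  shows "Q.semisimple"
  unfolding Q.semisimple_def
proof (intro allI impI)
  fix B assume B: "Q.lie_ideal B" and ab: "\<forall>x\<in>B. \<forall>y\<in>B. qbr x y = 0"
  note b = Q.lie_idealD[OF B]
  have eq: "{x \<in> V. p x \<in> B} = I"
  proof (rule semisimple_modD[OF assms preimage_ideal[OF B]])
    fix x y assume "x \<in> {x \<in> V. p x \<in> B}" "y \<in> {x \<in> V. p x \<in> B}"
    then have xy: "x \<in> V" "p x \<in> B" "y \<in> V" "p y \<in> B" by auto
    have "qbr x y = qbr (p x) (p y)" by (rule qbr_both[OF xy(1,3), symmetric])
    also have "\<dots> = 0" using ab xy by blast
    finally show "prd x y \<in> I" using p_zero_iff xy prd_closed by blast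
  qed
  have "x = 0" if "x \<in> B" for x
  proof -
    have "x \<in> C" using b(2)[OF that] .
    then have "p x = x" "x \<in> V" by (rule p_C, rule C_V)
    then have "x \<in> I" using eq that by auto
    then show ?thesis using p_I \<open>p x = x\<close> by simp
  qed
  then show "B = {0}" using subspace_0[OF b(1)] by blast
qed

text \<open>The hypotheses say that V / I acts on W / N. Both quotients are replaced by complements,
  through \<open>p\<close> and \<open>r\<close>, where \<open>invariant_vector\<close> applies. In
  the Levi argument \<open>I\<close> is an abelian ideal and \<open>N\<close> consists of its
  adjoint operators.\<close>

lemma (in lie_module) invariant_vector_mod:
  assumes ss: "semisimple_mod I" and I: "lie_ideal I" and fdV: "fd scale V" and fdW: "fd sw W"
    and N: "module.subspace sw N" "N \<subseteq> W" "\<And>x w. x \<in> V \<Longrightarrow> w \<in> N \<Longrightarrow> act x w \<in> N"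
      "\<And>x w. x \<in> I \<Longrightarrow> w \<in> W \<Longrightarrow> act x w \<in> N"
    and U: "module.subspace sw U" "N \<subseteq> U" "\<And>x w. x \<in> V \<Longrightarrow> w \<in> W \<Longrightarrow> act x w \<in> U" "\<not> W \<subseteq> U"
  shows "\<exists>w\<in>W. w \<notin> U \<and> (\<forall>x\<in>V. act x w \<in> N)"
proof -
  obtain p where "lie_quotient scale V prd I p" using lie_quotient_exists[OF I] .
  then interpret q: lie_quotient scale V prd I p .
  show ?thesis
  proof (rule W.projection_exists[OF W_subspace N(1,2)])
    fix r assume "Vector_Spaces.linear sw sw r" "r ` W \<subseteq> W" and rN: "\<And>x. x \<in> N \<Longrightarrow> r x = 0"
      and rd: "\<And>x. x \<in> W \<Longrightarrow> x - r x \<in> N" and rr: "\<And>x. x \<in> W \<Longrightarrow> r (r x) = r x"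
    then have r_add: "\<And>x y. r (x + y) = r x + r y" and r_scale: "\<And>c x. r (sw c x) = sw c (r x)"
      and rW: "\<And>x. x \<in> W \<Longrightarrow> r x \<in> W"
      using W.linear_self_iff by auto
    have r_sub: "r (x - y) = r x - r y" for x y using r_add[of "x - y" y] by simp
    have rW': "x \<in> W \<and> r x = x" if "x \<in> r ` W" for x using that rW rr by auto
    have r_eq: "r x = r y" if "x - y \<in> N" for x y using rN[OF that] r_sub by simp
    have sub: "W.subspace (r ` W)"
    proof (rule W.subspaceI)
      show "0 \<in> r ` W" using rN[OF W.subspace_0[OF N(1)]] W.subspace_0[OF W_subspace] by (metis imageI)
      show "x + y \<in> r ` W" if "x \<in> r ` W" "y \<in> r ` W" for x y
        using that W.subspace_add[OF W_subspace] by (auto simp flip: r_add)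
      show "sw c x \<in> r ` W" if "x \<in> r ` W" for c x
        using that W.subspace_scale[OF W_subspace] by (auto simp flip: r_scale)
    qed
    have mod: "lie_module scale q.C q.qbr sw (r ` W) (\<lambda>x w. r (act x w))"
    proof unfold_locales
      show "W.subspace (r ` W)" by (rule sub)
      fix x w assume x: "x \<in> q.C"
      note xV = q.C_V[OF x]
      show "lin_on sw (r ` W) (\<lambda>w. r (act x w))"
        unfolding lin_on_def
      proof (intro conjI ballI allI)
        fix v w assume vw: "v \<in> r ` W" "w \<in> r ` W"
        have vw': "v \<in> W" "w \<in> W" using rW'[OF vw(1)] rW'[OF vw(2)] by auto
        show "r (act x w) \<in> r ` W" using act_closed[OF xV vw'(2)] by blast
        show "r (act x (v + w)) = r (act x v) + r (act x w)"
          using act_add_right[OF xV vw'] r_add by simp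
        show "r (act x (sw c w)) = sw c (r (act x w))" for c
          using act_scale_right[OF xV vw'(2)] r_scale by simp
      qed
      assume w: "w \<in> r ` W"
      have wW: "w \<in> W" "r w = w" using rW'[OF w] by auto
      show "r (act (scale c x) w) = sw c (r (act x w))" for c
        using act_scale[OF xV wW(1)] r_scale by simp
      fix y assume y: "y \<in> q.C"
      note yV = q.C_V[OF y]
      show "r (act (x + y) w) = r (act x w) + r (act y w)"
        using act_add[OF xV yV wW(1)] r_add by simp
      have 1: "r (act (p (prd x y)) w) = r (act (prd x y) w)"
      proof (rule r_eq)
        have pV: "p (prd x y) \<in> V" "prd x y \<in> V" using prd_closed[OF xV yV] q.p_closed by blast+
        have "act (p (prd x y) - prd x y) w \<in> N"
          using subspace_neg[OF lie_idealD(1)[OF I] q.p_diff[OF pV(2)]] wW(1) by (intro N(4)) auto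
        then show "act (p (prd x y)) w - act (prd x y) w \<in> N"
          using act_diff_left[OF pV wW(1)] by simp
      qed
      have 2: "r (act x (r u)) = r (act x u)" if xV: "x \<in> V" and u: "u \<in> W" for x u
      proof (rule r_eq)
        have "act x (u - r u) \<in> N" by (rule N(3)[OF xV rd[OF u]])
        then have "act x u - act x (r u) \<in> N" using act_diff_right[OF xV u rW[OF u]] by simp
        then show "act x (r u) - act x u \<in> N" using W.subspace_neg[OF N(1)] by fastforce
      qed
      show "r (act (p (prd x y)) w) = r (act x (r (act y w))) - r (act y (r (act x w)))"
        using 1 2[OF xV act_closed[OF yV wW(1)]] 2[OF yV act_closed[OF xV wW(1)]] act_lie[OF xV yV wW(1)] r_sub by simp
    qed
    have rU: "r w \<in> U \<longleftrightarrow> w \<in> U" if w: "w \<in> W" for w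
    proof -
      have d: "w - r w \<in> U" using rd[OF w] U(2) by blast
      show ?thesis using W.subspace_add[OF U(1) d, of "r w"] W.subspace_diff[OF U(1) _ d, of w] by auto
    qed
    have "\<exists>w\<in>r ` W. w \<notin> U \<and> (\<forall>x\<in>q.C. r (act x w) = 0)"
    proof (rule q.Q.invariant_vector[OF q.quotient_semisimple[OF ss] _ mod _ U(1)])
      show "fd scale q.C" by (rule fd_subset[OF fdV q.C_subspace q.p_closed])
      show "fd sw (r ` W)" by (rule W.fd_subset[OF fdW sub]) (use rW in auto)
      show "\<forall>x\<in>q.C. \<forall>w\<in>r ` W. r (act x w) \<in> U"
        using rU act_closed U(3) q.C_V rW' by blast
      show "\<not> r ` W \<subseteq> U" using U(4) rU by blast
    qed
    then obtain w where w: "w \<in> W" "w \<notin> U" "\<And>x. x \<in> q.C \<Longrightarrow> r (act x w) = 0" using rW' by blast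
    have "act x w \<in> N" if x: "x \<in> V" for x
    proof -
      have px: "p x \<in> V" "p x \<in> q.C" using x q.p_closed by auto
      have "act (p x) w - r (act (p x) w) \<in> N" using rd act_closed[OF px(1) w(1)] by blast
      then have "act (p x) w \<in> N" using w(3)[OF px(2)] by simp
      moreover have "act (x - p x) w \<in> N" using N(4)[OF q.p_diff[OF x] w(1)] .
      ultimately have "act (p x) w + act (x - p x) w \<in> N" using W.subspace_add[OF N(1)] by blast
      then show ?thesis using act_diff_left[OF x px(1) w(1)] by simp
    qed
    then show ?thesis using w by blast
  qed
qed

context lie_algebra_char_0
begin

definition lie_subalg :: "'v set \<Rightarrow> bool" where
  "lie_subalg H \<longleftrightarrow> subspace H \<and> H \<subseteq> V \<and> (\<forall>x\<in>H. \<forall>y\<in>H. prd x y \<in> H)"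

lemma lie_subalgD:
  assumes "lie_subalg H"
  shows "subspace H" "x \<in> H \<Longrightarrow> x \<in> V" "x \<in> H \<Longrightarrow> y \<in> H \<Longrightarrow> prd x y \<in> H"
  using assms by (auto simp: lie_subalg_def)

lemma lie_subalg_algebra:
  assumes "lie_subalg H"
  shows "lie_algebra_char_0 scale H prd"
proof unfold_locales
  note h = lie_subalgD[OF assms]
  show "subspace H" by (rule h(1))
qed (use lie_subalgD[OF assms] in
  \<open>auto simp: prd_add_left prd_add_right prd_scale_left prd_scale_right alternating jacobi\<close>)

text \<open>For an abelian ideal \<open>R\<close>, an endomorphism \<open>\<phi>\<close> into \<open>R\<close> that is scalar on \<open>R\<close> and commutes
  with \<open>ad\<close> modulo \<open>ad R\<close> has a stabiliser (or, if \<open>R\<close> is central, a kernel) that supplements \<open>R\<close>.\<close>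

lemma levi_minimal:
  assumes fdV: "fd scale V" and R: "lie_ideal R" and ab: "\<And>x y. x \<in> R \<Longrightarrow> y \<in> R \<Longrightarrow> prd x y = 0"
    and R0: "R \<noteq> {0}" and min: "\<And>A. lie_ideal A \<Longrightarrow> A \<subseteq> R \<Longrightarrow> A = {0} \<or> A = R"
    and ss: "semisimple_mod R"
  obtains H where "lie_subalg H" "H \<noteq> V" "\<forall>v\<in>V. \<exists>r\<in>R. v - r \<in> H"
proof -
  note r = lie_idealD[OF R]
  obtain d M where "fd_lie_module scale V prd scale V prd d M"
    using lie_module.fd_lie_module_exists[OF adjoint_module fdV] .
  then interpret ad: fd_lie_module scale V prd scale V prd d M .
  \<comment> \<open>\<Phi>0 has codimension one in \<Phi>, and commutators with \<open>ad x\<close>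
    map \<Phi> into \<Phi>0. This is the situation of \<open>invariant_vector_mod\<close>, which
    produces an element outside \<Phi>0 that is invariant modulo the operators ad R.\<close>
  define \<Phi> where "\<Phi> = {\<phi>. lin_on scale V \<phi> \<and> (\<forall>v\<in>V. \<phi> v \<in> R) \<and> (\<exists>c. \<forall>r\<in>R. \<phi> r = scale c r)}"
  define \<Phi>0 where "\<Phi>0 = {\<phi>\<in>\<Phi>. \<forall>r\<in>R. \<phi> r = 0}"
  define A where "A x m = ad.R x * m - m * ad.R x" for x m
  have AM: "A x (M \<phi>) = M (\<lambda>v. prd x (\<phi> v) - \<phi> (prd x v))" if "x \<in> V" "lin_on scale V \<phi>" for x \<phi>
    unfolding A_def ad.M_comp[OF ad.act_lin[OF that(1)] that(2), symmetric] ad.M_comp[OF that(2) ad.act_lin[OF that(1)], symmetric]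
    by (rule ad.M_diff[symmetric]) (rule lin_on_comp[OF ad.act_lin[OF that(1)] that(2)] lin_on_comp[OF that(2) ad.act_lin[OF that(1)]])+
  have lin_diff: "lin_on scale V (\<lambda>v. f v - g v)" if "lin_on scale V f" "lin_on scale V g" for f g
    using that subspace_carrier by (auto simp: lin_on_def subspace_diff scale_right_diff_distrib)
  have \<Phi>I: "\<phi> \<in> \<Phi>" if "lin_on scale V \<phi>" "\<And>v. v \<in> V \<Longrightarrow> \<phi> v \<in> R" "\<And>r. r \<in> R \<Longrightarrow> \<phi> r = scale c r" for \<phi> c
    using that unfolding \<Phi>_def by blast
  have sub\<Phi>: "rm.subspace (M ` \<Phi>)" "rm.subspace (M ` \<Phi>0)"
  proof -
    have z: "(\<lambda>v. 0) \<in> \<Phi>0" unfolding \<Phi>0_def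
      using lin_on_zero[OF subspace_carrier] subspace_0[OF r(1)] by (auto intro!: \<Phi>I[of _ 0])
    have a: "(\<lambda>v. \<phi> v + \<psi> v) \<in> \<Phi> \<and> M (\<lambda>v. \<phi> v + \<psi> v) = M \<phi> + M \<psi>" if "\<phi> \<in> \<Phi>" "\<psi> \<in> \<Phi>" for \<phi> \<psi>
    proof -
      obtain c c' where *: "lin_on scale V \<phi>" "\<forall>v\<in>V. \<phi> v \<in> R" "\<forall>r\<in>R. \<phi> r = scale c r"
        "lin_on scale V \<psi>" "\<forall>v\<in>V. \<psi> v \<in> R" "\<forall>r\<in>R. \<psi> r = scale c' r" using \<open>\<phi> \<in> \<Phi>\<close> \<open>\<psi> \<in> \<Phi>\<close> by (auto simp: \<Phi>_def)
      then show ?thesis using lin_on_add[OF subspace_carrier *(1,4)] subspace_add[OF r(1)] ad.M_add[OF *(1,4)]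
        by (auto intro!: \<Phi>I[of _ "c + c'"] simp: scale_left_distrib)
    qed
    have s: "(\<lambda>v. scale k (\<phi> v)) \<in> \<Phi> \<and> M (\<lambda>v. scale k (\<phi> v)) = smul k (M \<phi>)" if \<phi>: "\<phi> \<in> \<Phi>" for k \<phi>
    proof -
      obtain c where *: "lin_on scale V \<phi>" "\<forall>v\<in>V. \<phi> v \<in> R" "\<forall>r\<in>R. \<phi> r = scale c r" using \<phi> by (auto simp: \<Phi>_def)
      then show ?thesis using lin_on_scale[OF subspace_carrier *(1)] subspace_scale[OF r(1)] ad.M_scale[OF *(1)]
        by (auto intro!: \<Phi>I[of _ "k * c"])
    qed
    have Mz: "M (\<lambda>v. 0) = 0" using ad.M_zero[OF lin_on_zero[OF subspace_carrier]] by simp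
    show "rm.subspace (M ` \<Phi>)"
    proof (rule rm.subspaceI)
      show "0 \<in> M ` \<Phi>" using z Mz unfolding \<Phi>0_def by (metis (no_types, lifting) imageI mem_Collect_eq)
      show "x + y \<in> M ` \<Phi>" if xy: "x \<in> M ` \<Phi>" "y \<in> M ` \<Phi>" for x y
      proof -
        obtain \<phi> \<psi> where *: "x = M \<phi>" "y = M \<psi>" "\<phi> \<in> \<Phi>" "\<psi> \<in> \<Phi>" using xy by blast
        then show ?thesis using a[of \<phi> \<psi>] by (metis (no_types, lifting) imageI)
      qed
      show "smul k x \<in> M ` \<Phi>" if x: "x \<in> M ` \<Phi>" for k x
      proof -
        obtain \<phi> where *: "x = M \<phi>" "\<phi> \<in> \<Phi>" using x by blast
        then show ?thesis using s[of \<phi> k] by (metis (no_types, lifting) imageI)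
      qed
    qed
    show "rm.subspace (M ` \<Phi>0)"
    proof (rule rm.subspaceI)
      show "0 \<in> M ` \<Phi>0" using z Mz by (metis (no_types, lifting) imageI)
      show "x + y \<in> M ` \<Phi>0" if xy: "x \<in> M ` \<Phi>0" "y \<in> M ` \<Phi>0" for x y
      proof -
        obtain \<phi> \<psi> where *: "x = M \<phi>" "y = M \<psi>" "\<phi> \<in> \<Phi>0" "\<psi> \<in> \<Phi>0" using xy by blast
        then have "(\<lambda>v. \<phi> v + \<psi> v) \<in> \<Phi>0" using a[of \<phi> \<psi>] by (auto simp: \<Phi>0_def)
        moreover have "x + y = M (\<lambda>v. \<phi> v + \<psi> v)" using a[of \<phi> \<psi>] * by (auto simp: \<Phi>0_def)
        ultimately show ?thesis by blast
      qed
      show "smul k x \<in> M ` \<Phi>0" if x: "x \<in> M ` \<Phi>0" for k x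
      proof -
        obtain \<phi> where *: "x = M \<phi>" "\<phi> \<in> \<Phi>0" using x by blast
        then have "(\<lambda>v. scale k (\<phi> v)) \<in> \<Phi>0" using s[of \<phi> k] by (auto simp: \<Phi>0_def)
        moreover have "smul k x = M (\<lambda>v. scale k (\<phi> v))" using s[of \<phi> k] * by (auto simp: \<Phi>0_def)
        ultimately show ?thesis by blast
      qed
    qed
  qed
  have stable: "A x (M \<phi>) \<in> M ` \<Phi>0" if x: "x \<in> V" and \<phi>: "\<phi> \<in> \<Phi>" for x \<phi>
  proof -
    obtain c where *: "lin_on scale V \<phi>" "\<forall>v\<in>V. \<phi> v \<in> R" "\<forall>r\<in>R. \<phi> r = scale c r" using \<phi> by (auto simp: \<Phi>_def)
    define \<psi> where "\<psi> v = prd x (\<phi> v) - \<phi> (prd x v)" for v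
    have "lin_on scale V \<psi>" unfolding \<psi>_def[abs_def]
      by (rule lin_diff[OF lin_on_comp[OF ad.act_lin[OF x] *(1)] lin_on_comp[OF *(1) ad.act_lin[OF x]]])
    moreover have "\<psi> v \<in> R" if "v \<in> V" for v
      unfolding \<psi>_def using * r(3)[OF x] that prd_closed[OF x that] by (intro subspace_diff[OF r(1)]) auto
    moreover have "\<psi> u = 0" if "u \<in> R" for u
      unfolding \<psi>_def using *(3) r(3)[OF x that] r(2)[OF that] that x by (simp add: prd_scale_right)
    ultimately have "\<psi> \<in> \<Phi>0" unfolding \<Phi>0_def by (auto intro!: \<Phi>I[of _ 0])
    then show ?thesis using AM[OF x *(1)] unfolding \<psi>_def[abs_def] by auto
  qed
  have \<Phi>0\<Phi>: "M ` \<Phi>0 \<subseteq> M ` \<Phi>" by (auto simp: \<Phi>0_def)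
  have mod: "lie_module scale V prd smul (M ` \<Phi>) A"
  proof unfold_locales
    show "rm.subspace (M ` \<Phi>)" by (rule sub\<Phi>)
    show "lin_on smul (M ` \<Phi>) (A x)" if x: "x \<in> V" for x
      unfolding lin_on_def
    proof (intro conjI ballI allI)
      show "A x w \<in> M ` \<Phi>" if "w \<in> M ` \<Phi>" for w using stable[OF x] that \<Phi>0\<Phi> by blast
    qed (simp_all add: A_def algebra_simps smul_mult_left smul_mult_right)
    fix x y w assume x: "x \<in> V" and y: "y \<in> V"
    show "A (x + y) w = A x w + A y w" "A (prd x y) w = A x (A y w) - A y (A x w)"
      unfolding A_def ad.R_add[OF x y] ad.R_lie[OF x y] by (simp_all add: algebra_simps)
  next
    fix x w c assume x: "x \<in> V"
    show "A (scale c x) w = smul c (A x w)"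
      unfolding A_def ad.R_scale[OF x] by (simp add: rm.scale_right_diff_distrib smul_mult_left smul_mult_right)
  qed
  have adR: "prd u \<in> \<Phi>0" if u: "u \<in> R" for u
    unfolding \<Phi>0_def using ad.act_lin[OF r(2)[OF u]] r(4)[OF _ u] ab[OF u] by (auto intro!: \<Phi>I[of _ 0])
  have ex: "\<exists>w\<in>M ` \<Phi>. w \<notin> M ` \<Phi>0 \<and> (\<forall>x\<in>V. A x w \<in> ad.R ` R)"
  proof (rule lie_module.invariant_vector_mod[OF mod ss R fdV])
    show "fd smul (M ` \<Phi>)" by (rule rm.fd_subset[OF Mat_fd sub\<Phi>(1)]) (use ad.M_Mat in blast)
    show "rm.subspace (ad.R ` R)" by (rule rep_subspace[OF ad.lie_rep_R r(1)]) (use r(2) in blast)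
    show "ad.R ` R \<subseteq> M ` \<Phi>" "ad.R ` R \<subseteq> M ` \<Phi>0" using adR \<Phi>0\<Phi> by blast+
    show "rm.subspace (M ` \<Phi>0)" by (rule sub\<Phi>)
    show "A x w \<in> M ` \<Phi>0" if "x \<in> V" "w \<in> M ` \<Phi>" for x w using stable that by blast
    show "A x w \<in> ad.R ` R" if "x \<in> V" "w \<in> ad.R ` R" for x w
    proof -
      obtain u where u: "w = ad.R u" "u \<in> R" using \<open>w \<in> ad.R ` R\<close> by blast
      then have "A x w = ad.R (prd x u)" unfolding A_def using ad.R_lie[OF that(1) r(2)[OF u(2)]] by simp
      then show ?thesis using r(3)[OF that(1) u(2)] by blast
    qed
    show "A x w \<in> ad.R ` R" if x: "x \<in> R" and "w \<in> M ` \<Phi>" for x w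
    proof -
      obtain \<phi> where w: "w = M \<phi>" "\<phi> \<in> \<Phi>" using \<open>w \<in> M ` \<Phi>\<close> by blast
      obtain c where *: "lin_on scale V \<phi>" "\<forall>v\<in>V. \<phi> v \<in> R" "\<forall>r\<in>R. \<phi> r = scale c r" using w by (auto simp: \<Phi>_def)
      have "A x w = M (\<lambda>v. prd x (\<phi> v) - \<phi> (prd x v))" unfolding w(1) by (rule AM[OF r(2)[OF x] *(1)])
      \<comment> \<open>For \<open>x\<close> in \<open>R\<close> the first term vanishes because
        \<open>R\<close> is abelian, and \<phi> multiplies [x, v] by \<open>c\<close>.\<close>
      also have "\<dots> = ad.R (scale (- c) x)"
      proof (rule ad.M_cong)
        fix v assume v: "v \<in> V"
        have "prd x v \<in> R" using r(4)[OF v x] .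
        then show "prd x (\<phi> v) - \<phi> (prd x v) = prd (scale (- c) x) v"
          using ab[OF x] * v r(2)[OF x] prd_scale_left[of x v "- c"] by simp
      qed
      finally show ?thesis using subspace_scale[OF r(1) x] by blast
    qed
    show "\<not> M ` \<Phi> \<subseteq> M ` \<Phi>0"
    proof (rule projection_exists[OF subspace_carrier r(1)])
      show "R \<subseteq> V" using r(2) by blast
      fix p assume p: "Vector_Spaces.linear scale scale p" "p ` V \<subseteq> V" "\<And>x. x \<in> R \<Longrightarrow> p x = 0"
        "\<And>x. x \<in> V \<Longrightarrow> x - p x \<in> R"
      have lp: "lin_on scale V (\<lambda>v. v - p v)"
      proof (rule lin_diff)
        show "lin_on scale V (\<lambda>v. v)" by (simp add: lin_on_def)
        show "lin_on scale V p" using p(1,2) unfolding lin_on_def linear_self_iff by blast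
      qed
      \<comment> \<open>The projection of \<open>V\<close> onto \<open>R\<close> is the identity on
        \<open>R\<close>, so it shows that \<Phi>0 is a proper part.\<close>
      have p\<Phi>: "(\<lambda>v. v - p v) \<in> \<Phi>" by (rule \<Phi>I[OF lp p(4), of 1]) (use p(3) in auto)
      obtain u where u: "u \<in> R" "u \<noteq> 0" using R0 subspace_0[OF r(1)] by blast
      have "M (\<lambda>v. v - p v) \<noteq> M \<psi>" if \<psi>: "\<psi> \<in> \<Phi>0" for \<psi>
      proof
        assume eq: "M (\<lambda>v. v - p v) = M \<psi>"
        have l\<psi>: "lin_on scale V \<psi>" using \<psi> by (simp add: \<Phi>0_def \<Phi>_def)
        have "M (\<lambda>v. (v - p v) - \<psi> v) = 0" using ad.M_diff[OF lp l\<psi>] eq by simp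
        then have "(u - p u) - \<psi> u = 0" using ad.M_zero[OF lin_diff[OF lp l\<psi>]] r(2)[OF u(1)] by blast
        then show False using u p(3) \<psi> by (simp add: \<Phi>0_def)
      qed
      then show ?thesis using p\<Phi> by blast
    qed
  qed
  then obtain \<phi> where \<phi>: "\<phi> \<in> \<Phi>" "M \<phi> \<notin> M ` \<Phi>0" "\<And>x. x \<in> V \<Longrightarrow> A x (M \<phi>) \<in> ad.R ` R" by blast
  obtain c where l\<phi>: "lin_on scale V \<phi>" and \<phi>R: "\<And>v. v \<in> V \<Longrightarrow> \<phi> v \<in> R" and \<phi>c: "\<And>r. r \<in> R \<Longrightarrow> \<phi> r = scale c r"
    using \<phi>(1) by (auto simp: \<Phi>_def)
  have \<phi>_add: "\<phi> (v + w) = \<phi> v + \<phi> w" and \<phi>_scale: "\<phi> (scale k v) = scale k (\<phi> v)" if "v \<in> V" "w \<in> V" for v w k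
    using l\<phi> that by (auto simp: lin_on_def)
  have \<phi>_diff: "\<phi> (v - w) = \<phi> v - \<phi> w" if "v \<in> V" "w \<in> V" for v w
    using \<phi>_add[of "v - w" w] that V_closed by simp
  have \<phi>0: "\<phi> 0 = 0" using \<phi>_scale[of 0 0 0] V_closed(1) by simp
  have \<phi>V: "\<phi> v \<in> V" if "v \<in> V" for v using \<phi>R[OF that] r(2) by blast
  have c0: "c \<noteq> 0"
  proof
    assume "c = 0"
    then have "\<phi> \<in> \<Phi>0" using \<phi>(1) \<phi>c by (simp add: \<Phi>0_def)
    then show False using \<phi>(2) by blast
  qed
  have comm: "\<exists>u\<in>R. \<forall>v\<in>V. prd x (\<phi> v) - \<phi> (prd x v) = prd u v" if x: "x \<in> V" for x
  proof -
    obtain u where u: "u \<in> R" "A x (M \<phi>) = ad.R u" using \<phi>(3)[OF x] by blast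
    have l: "lin_on scale V (\<lambda>v. prd x (\<phi> v) - \<phi> (prd x v))"
      by (rule lin_diff[OF lin_on_comp[OF ad.act_lin[OF x] l\<phi>] lin_on_comp[OF l\<phi> ad.act_lin[OF x]]])
    have lu: "lin_on scale V (prd u)" by (rule ad.act_lin[OF r(2)[OF u(1)]])
    have "M (\<lambda>v. prd x (\<phi> v) - \<phi> (prd x v)) = M (prd u)"
      using AM[OF x l\<phi>] u(2) by simp
    then have "M (\<lambda>v. (prd x (\<phi> v) - \<phi> (prd x v)) - prd u v) = 0" using ad.M_diff[OF l lu] by simp
    then have "\<forall>v\<in>V. (prd x (\<phi> v) - \<phi> (prd x v)) - prd u v = 0" using ad.M_zero[OF lin_diff[OF l lu]] by blast
    then show ?thesis using u(1) by auto
  qed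
  define Z where "Z = {u \<in> R. \<forall>v\<in>V. prd v u = 0}"
  have Z: "lie_ideal Z"
  proof (rule lie_idealI)
    show "subspace Z" unfolding Z_def using r(1,2)
      by (intro subspaceI) (auto simp: subspace_0 subspace_add subspace_scale prd_add_right prd_scale_right)
    show "Z \<subseteq> V" using r(2) by (auto simp: Z_def)
    show "prd x a \<in> Z" if "x \<in> V" "a \<in> Z" for x a using that subspace_0[OF r(1)] by (auto simp: Z_def)
  qed
  have "Z = {0} \<or> Z = R" by (rule min[OF Z]) (auto simp: Z_def)
  \<comment> \<open>By minimality the central part of \<open>R\<close> is 0 or \<open>R\<close>. In
    the first case the stabiliser of \<phi> is proper. In the second it would be everything, since
    ad R = 0, so the kernel of \<phi> takes its place.\<close>
  then show thesis
  proof
    assume Z0: "Z = {0}"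
    define H where "H = {x \<in> V. \<forall>v\<in>V. prd x (\<phi> v) = \<phi> (prd x v)}"
    have "lie_subalg H"
      unfolding lie_subalg_def
    proof (intro conjI ballI)
      show "subspace H" unfolding H_def
        by (rule subspaceI)
          (auto simp: V_closed prd_add_left prd_scale_left \<phi>_add \<phi>_scale[OF _ V_closed(1)] \<phi>V \<phi>0 prd_closed)
      show "H \<subseteq> V" by (auto simp: H_def)
      fix x y assume "x \<in> H" "y \<in> H"
      then have xy: "x \<in> V" "y \<in> V" "\<And>v. v \<in> V \<Longrightarrow> prd x (\<phi> v) = \<phi> (prd x v)" "\<And>v. v \<in> V \<Longrightarrow> prd y (\<phi> v) = \<phi> (prd y v)"
        by (auto simp: H_def)
      have "prd (prd x y) (\<phi> v) = \<phi> (prd (prd x y) v)" if "v \<in> V" for v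
        using that xy by (simp add: jacobi_left \<phi>V prd_closed \<phi>_diff)
      then show "prd x y \<in> H" using xy prd_closed by (auto simp: H_def)
    qed
    moreover have "H \<noteq> V"
    proof
      assume HV: "H = V"
      have "u \<in> Z" if u: "u \<in> R" for u
      proof -
        have "prd v u = 0" if v: "v \<in> V" for v
        proof -
          have "prd u (\<phi> v) = \<phi> (prd u v)" using HV r(2)[OF u] v by (auto simp: H_def)
          then have "scale c (prd u v) = 0" using ab[OF u \<phi>R[OF v]] \<phi>c[OF r(4)[OF v u]] by simp
          then show ?thesis using c0 antisym[OF r(2)[OF u] v] by simp
        qed
        then show ?thesis using u by (simp add: Z_def)
      qed
      then show False using Z0 R0 subspace_0[OF r(1)] by blast
    qed
    moreover have "\<exists>u\<in>R. x - u \<in> H" if x: "x \<in> V" for x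
    proof -
      obtain u where u: "u \<in> R" "\<forall>v\<in>V. prd x (\<phi> v) - \<phi> (prd x v) = prd u v" using comm[OF x] by blast
      \<comment> \<open>The commutator of \<open>ad u'\<close> with \<phi> is - c ad u', so this
        multiple of \<open>u\<close> cancels the defect \<open>ad u\<close> of
        \<open>x\<close>.\<close>
      define u' where "u' = scale (- 1 / c) u"
      have "u' \<in> R" unfolding u'_def by (rule subspace_scale[OF r(1) u(1)])
      then have u': "u' \<in> R" "u' \<in> V" using r(2) by auto
      have "prd (x - u') (\<phi> v) = \<phi> (prd (x - u') v)" if v: "v \<in> V" for v
      proof -
        have "prd (x - u') (\<phi> v) = prd x (\<phi> v)"
          using ab[OF u'(1) \<phi>R[OF v]] prd_diff_left[OF x u'(2) \<phi>V[OF v]] by simp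
        also have "\<dots> = \<phi> (prd x v) + prd u v" using u(2) v by (simp add: algebra_simps)
        also have "prd u v = - \<phi> (prd u' v)"
        proof -
          have "prd u' v = scale (- 1 / c) (prd u v)"
            unfolding u'_def by (rule prd_scale_left[OF r(2)[OF u(1)] v])
          then show ?thesis using \<phi>c[OF r(4)[OF v u'(1)]] c0 by simp
        qed
        also have "\<phi> (prd x v) + - \<phi> (prd u' v) = \<phi> (prd (x - u') v)"
          using x u' v by (simp add: prd_diff_left \<phi>_diff prd_closed)
        finally show ?thesis .
      qed
      then have "x - u' \<in> H" using x u'(2) V_closed by (simp add: H_def)
      then show ?thesis using u'(1) by blast
    qed
    ultimately show thesis by (intro that) auto
  next
    assume ZR: "Z = R"
    have cen: "prd v u = 0" "prd u v = 0" if "u \<in> R" "v \<in> V" for u v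
      using that ZR antisym[of v u] r(2) by (auto simp: Z_def)
    have \<phi>b: "\<phi> (prd x v) = 0" if "x \<in> V" "v \<in> V" for x v
      using comm[OF that(1)] cen \<phi>R that by auto
    define H where "H = {x \<in> V. \<phi> x = 0}"
    have "lie_subalg H"
      unfolding lie_subalg_def
    proof (intro conjI ballI)
      show "subspace H" unfolding H_def
        by (rule subspaceI) (auto simp: V_closed \<phi>_add \<phi>_scale[OF _ V_closed(1)] \<phi>0)
    qed (auto simp: H_def \<phi>b prd_closed)
    moreover have "H \<noteq> V"
    proof
      assume HV: "H = V"
      obtain u where u: "u \<in> R" "u \<noteq> 0" using R0 subspace_0[OF r(1)] by blast
      have "\<phi> u = 0" using HV r(2)[OF u(1)] unfolding H_def by blast
      then have "scale c u = 0" using \<phi>c[OF u(1)] by simp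
      then show False using c0 u by simp
    qed
    moreover have "\<exists>u\<in>R. x - u \<in> H" if x: "x \<in> V" for x
    proof -
      define u where "u = scale (1 / c) (\<phi> x)"
      have u: "u \<in> R" using \<phi>R[OF x] subspace_scale[OF r(1)] by (simp add: u_def)
      have "\<phi> (x - u) = \<phi> x - scale c u" using \<phi>_diff[OF x r(2)[OF u]] \<phi>c[OF u] by simp
      also have "\<dots> = 0" using c0 by (simp add: u_def)
      finally have "x - u \<in> H" using x r(2)[OF u] V_closed by (simp add: H_def)
      then show ?thesis using u by blast
    qed
    ultimately show thesis by (intro that) auto
  qed
qed

text \<open>An ideal \<open>A\<close> maximal among those properly inside \<open>I\<close> makes I /
  A minimal, and \<open>sol\<close> makes it abelian, so \<open>levi_minimal\<close> applies to V /
  A. Solvability enters in the form \<open>sol\<close> because \<open>solv\<close> speaks of ideals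
  of one fixed algebra, whereas this lemma is used inside a subalgebra.\<close>

lemma levi_step:
  assumes fdV: "fd scale V" and I: "lie_ideal I" and I0: "I \<noteq> {0}" and ss: "semisimple_mod I"
    and sol: "\<And>A. lie_ideal A \<Longrightarrow> A \<subseteq> I \<Longrightarrow> (\<And>x. x \<in> I \<Longrightarrow> \<exists>y\<in>brackets I I. x - y \<in> A) \<Longrightarrow> A = I"
  obtains H where "lie_subalg H" "H \<noteq> V" "\<forall>v\<in>V. \<exists>r\<in>I. v - r \<in> H"
proof -
  note i = lie_idealD[OF I]
  have "lie_ideal {0}" by (rule lie_idealI) (auto simp: V_closed)
  then have P0: "lie_ideal {0} \<and> {0} \<subseteq> I \<and> {0} \<noteq> I" using I0 subspace_0[OF i(1)] by auto
  obtain A where A: "lie_ideal A \<and> A \<subseteq> I \<and> A \<noteq> I"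
    "\<And>A'. lie_ideal A' \<and> A' \<subseteq> I \<and> A' \<noteq> I \<Longrightarrow> A \<subseteq> A' \<Longrightarrow> A' = A"
    by (rule fd_maximal[of V "\<lambda>A. lie_ideal A \<and> A \<subseteq> I \<and> A \<noteq> I", OF fdV P0]) (use lie_idealD in blast)+
  note a = lie_idealD[OF conjunct1[OF A(1)]]
  obtain p where "lie_quotient scale V prd A p" using lie_quotient_exists A(1) by blast
  then interpret q: lie_quotient scale V prd A p .
  have pI: "p x \<in> p ` I \<longleftrightarrow> x \<in> I" if x: "x \<in> V" for x
  proof
    assume "p x \<in> p ` I"
    then obtain y where y: "y \<in> I" "p x = p y" by blast
    then have "x - y \<in> A" using q.p_zero_iff[of "x - y"] q.p_sub x i(2) V_closed by simp
    then have "x - y \<in> I" using A(1) by blast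
    then show "x \<in> I" using subspace_add[OF i(1) _ y(1), of "x - y"] by simp
  qed blast
  define J where "J = {x + y | x y. x \<in> brackets I I \<and> y \<in> A}"
  have B: "lie_ideal (brackets I I)" by (intro lie_ideal_brackets I)
  note b = lie_idealD[OF B]
  have JI: "lie_ideal J"
  proof (rule lie_idealI)
    show "subspace J" unfolding J_def by (rule subspace_sums[OF b(1) a(1)])
    show "J \<subseteq> V" unfolding J_def using a(2) b(2) V_closed(2) by blast
    show "prd x z \<in> J" if x: "x \<in> V" and z: "z \<in> J" for x z
    proof -
      obtain u v where "z = u + v" "u \<in> brackets I I" "v \<in> A" using z by (auto simp: J_def)
      then have "prd x z = prd x u + prd x v" "prd x u \<in> brackets I I" "prd x v \<in> A"
        using prd_add_right[OF x, of u v] a(2) b(2) a(3)[OF x] b(3)[OF x] by simp_all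
      then show ?thesis unfolding J_def by blast
    qed
  qed
  have bI: "brackets I I \<subseteq> I" by (rule brackets_minimal) (use i in auto)
  have JsubI: "J \<subseteq> I" unfolding J_def using bI A(1) subspace_add[OF i(1)] by blast
  have AJ: "A \<subseteq> J"
  proof
    fix x assume "x \<in> A"
    then have "0 + x \<in> J" unfolding J_def using subspace_0[OF b(1)] by blast
    then show "x \<in> J" by simp
  qed
  have JA: "J = A"
  proof (cases "J = I")
    case True
    have "A = I"
    proof (rule sol)
      show "\<exists>y\<in>brackets I I. x - y \<in> A" if "x \<in> I" for x
      proof -
        have "x \<in> J" using that True by simp
        then obtain u v where "x = u + v" "u \<in> brackets I I" "v \<in> A" unfolding J_def by blast
        then show ?thesis by (intro bexI[of _ u]) simp_all
      qed
    qed (use A(1) in auto)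
    then show ?thesis using A(1) by blast
  next
    case False
    show ?thesis by (rule A(2)) (use False JI JsubI AJ in simp_all)
  qed
  have II: "prd x y \<in> A" if "x \<in> I" "y \<in> I" for x y
  proof -
    have "prd x y + 0 \<in> J" unfolding J_def using brackets_base[OF that] subspace_0[OF a(1)] by blast
    then show ?thesis unfolding JA by simp
  qed
  have im: "B = p ` {x \<in> V. p x \<in> B}" if B: "q.Q.lie_ideal B" for B
  proof
    show "B \<subseteq> p ` {x \<in> V. p x \<in> B}"
    proof
      fix x assume x: "x \<in> B"
      then have "x \<in> q.C" using q.Q.lie_idealD(2)[OF B] by blast
      then have "x \<in> V" "p x = x" by (rule q.C_V, rule q.p_C)
      then show "x \<in> p ` {x \<in> V. p x \<in> B}" using x by (intro image_eqI[of _ _ x]) simp_all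
    qed
  qed blast
  obtain H' where H': "q.Q.lie_subalg H'" "H' \<noteq> q.C" "\<forall>v\<in>q.C. \<exists>r\<in>p ` I. v - r \<in> H'"
  proof (rule q.Q.levi_minimal)
    show "fd scale q.C" by (rule fd_subset[OF fdV q.C_subspace q.p_closed])
    show "q.Q.lie_ideal (p ` I)" by (rule q.image_ideal[OF I])
    show "q.qbr x y = 0" if xy: "x \<in> p ` I" "y \<in> p ` I" for x y
    proof -
      obtain u where u: "x = p u" "u \<in> I" using xy(1) by blast
      obtain v where v: "y = p v" "v \<in> I" using xy(2) by blast
      note uv = u(1) v(1) u(2) v(2)
      have "q.qbr x y = q.qbr u v" unfolding uv(1,2) by (rule q.qbr_both[OF i(2)[OF uv(3)] i(2)[OF uv(4)]])
      then show ?thesis using q.p_I[OF II[OF uv(3,4)]] by simp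
    qed
    show "p ` I \<noteq> {0}"
    proof
      assume "p ` I = {0}"
      then have z: "p x = 0" if "x \<in> I" for x using that by blast
      have "x \<in> A" if "x \<in> I" for x using z[OF that] q.p_zero_iff[OF i(2)[OF that]] by simp
      then show False using A(1) by blast
    qed
    show "B = {0} \<or> B = p ` I" if B: "q.Q.lie_ideal B" "B \<subseteq> p ` I" for B
    proof -
      let ?B = "{x \<in> V. p x \<in> B}"
      note im = im[OF B(1)]
      have "?B \<subseteq> I" using B(2) pI by blast
      moreover have "?B = A" if "?B \<noteq> I"
        by (rule A(2)) (use that \<open>?B \<subseteq> I\<close> q.preimage_ideal[OF B(1)] in simp_all)
      ultimately have "?B = A \<or> ?B = I" by blast
      then show ?thesis
      proof
        assume "?B = A"
        then have "B = p ` A" using im by simp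
        then have "B \<subseteq> {0}" using q.p_I by auto
        then show ?thesis using subspace_0[OF q.Q.lie_idealD(1)[OF B(1)]] by blast
      next
        assume "?B = I"
        then show ?thesis using im by simp
      qed
    qed
    show "q.Q.semisimple_mod (p ` I)"
      unfolding q.Q.semisimple_mod_def
    proof (intro allI impI)
      fix B assume B: "q.Q.lie_ideal B" "p ` I \<subseteq> B" "\<forall>x\<in>B. \<forall>y\<in>B. q.qbr x y \<in> p ` I"
      let ?B = "{x \<in> V. p x \<in> B}"
      note im = im[OF B(1)]
      have "?B = I"
      proof (rule semisimple_modD[OF ss q.preimage_ideal(1)[OF B(1)]])
        show "I \<subseteq> ?B" using B(2) i(2) by blast
        fix x y assume "x \<in> ?B" "y \<in> ?B"
        then have xy: "x \<in> V" "y \<in> V" "p x \<in> B" "p y \<in> B" by auto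
        have "q.qbr x y \<in> p ` I" unfolding q.qbr_both[OF xy(1,2), symmetric] using B(3) xy by blast
        then show "prd x y \<in> I" using pI[OF prd_closed[OF xy(1,2)]] by blast
      qed
      then show "B = p ` I" using im by simp
    qed
  qed
  note h' = q.Q.lie_subalgD[OF H'(1)]
  define H where "H = {x \<in> V. p x \<in> H'}"
  have "lie_subalg H"
    unfolding lie_subalg_def
  proof (intro conjI ballI)
    show "subspace H" unfolding H_def
      using h'(1) by (intro subspaceI) (auto simp: V_closed q.p_zero q.p_add q.p_scale subspace_0 subspace_add subspace_scale)
    show "H \<subseteq> V" by (auto simp: H_def)
    fix x y assume "x \<in> H" "y \<in> H"
    then have xy: "x \<in> V" "y \<in> V" "p x \<in> H'" "p y \<in> H'" by (auto simp: H_def)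
    have "q.qbr x y \<in> H'" unfolding q.qbr_both[OF xy(1,2), symmetric] by (rule h'(3)[OF xy(3,4)])
    then show "prd x y \<in> H" using xy prd_closed by (simp add: H_def)
  qed
  moreover have "H \<noteq> V"
  proof
    assume HV: "H = V"
    have "x \<in> H'" if "x \<in> q.C" for x
    proof -
      have "x \<in> H" using q.C_V[OF that] HV by simp
      then show ?thesis using q.p_C[OF that] by (simp add: H_def)
    qed
    then show False using H'(2) h'(2) by blast
  qed
  moreover have "\<exists>r\<in>I. v - r \<in> H" if v: "v \<in> V" for v
  proof -
    obtain r where r: "r \<in> I" "p v - p r \<in> H'" using H'(3) v by blast
    then have "v - r \<in> H" using v i(2) V_closed by (simp add: H_def q.p_sub)
    then show ?thesis using r by blast
  qed
  ultimately show thesis by (intro that) auto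
qed

text \<open>As \<open>I\<close> lies in [I, I] + A, containment in B + A implies containment in B0 +
  A for the next smaller term \<open>B0\<close> of the chain, and the chain ends at 0. The chain
  consists of ideals of the whole algebra, while \<open>A\<close> is an ideal of the subalgebra
  \<open>M\<close> only.\<close>

lemma solvable_descent:
  assumes M: "lie_subalg M" and A: "subspace A" "A \<subseteq> M" "\<And>x a. x \<in> M \<Longrightarrow> a \<in> A \<Longrightarrow> prd x a \<in> A"
    and I: "I \<subseteq> M" "\<And>x. x \<in> I \<Longrightarrow> \<exists>y\<in>brackets I I. x - y \<in> A"
  shows "solv B \<Longrightarrow> (\<And>x. x \<in> I \<Longrightarrow> \<exists>b\<in>B. x - b \<in> A) \<Longrightarrow> I \<subseteq> A"
proof (induction rule: solv.induct)
  case solv_zero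
  then show ?case by force
next
  case (solv_step B0 B)
  note m = lie_subalgD[OF M]
  note b = lie_idealD[OF solv_step.hyps(2)]
  have A': "prd a x \<in> A" if "x \<in> M" "a \<in> A" for x a
    using A(3)[OF that] antisym[of x a] subspace_neg[OF A(1)] m(2) that A(2) by auto
  have s: "subspace {x + y |x y. x \<in> B0 \<and> y \<in> A}"
    by (rule subspace_sums[OF lie_idealD(1)[OF solv_ideal[OF solv_step.hyps(1)]] A(1)])
  have "brackets I I \<subseteq> {x + y |x y. x \<in> B0 \<and> y \<in> A}"
  proof (rule brackets_minimal[OF _ s])
    fix x y assume xy: "x \<in> I" "y \<in> I"
    obtain u where u: "u \<in> B" "x - u \<in> A" using solv_step.prems[OF xy(1)] by blast
    obtain v where v: "v \<in> B" "y - v \<in> A" using solv_step.prems[OF xy(2)] by blast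
    have M: "x \<in> M" "y \<in> M" using xy I(1) by auto
    have uM: "u \<in> M" using subspace_diff[OF m(1) M(1), of "x - u"] u A(2) by auto
    have V: "x \<in> V" "y \<in> V" "u \<in> V" "v \<in> V" using M m(2) b(2) u v by auto
    have "prd x y = prd u v + (prd u (y - v) + prd (x - u) y)"
      using V by (simp add: prd_diff_left prd_diff_right)
    moreover have "prd u v \<in> B0" using solv_step.hyps(4) u v by blast
    moreover have "prd u (y - v) + prd (x - u) y \<in> A"
      using A(3)[OF uM v(2)] A'[OF M(2) u(2)] by (rule subspace_add[OF A(1)])
    ultimately show "prd x y \<in> {x + y |x y. x \<in> B0 \<and> y \<in> A}" by blast
  qed
  then have "\<exists>b\<in>B0. x - b \<in> A" if x: "x \<in> I" for x
  proof -
    obtain y where y: "y \<in> brackets I I" "x - y \<in> A" using I(2)[OF x] by blast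
    then obtain u v where uv: "y = u + v" "u \<in> B0" "v \<in> A"
      using \<open>brackets I I \<subseteq> _\<close> by blast
    have "x - u = (x - y) + v" using uv by simp
    then show ?thesis using subspace_add[OF A(1) y(2) uv(3)] uv(2) by (metis)
  qed
  then show ?case by (rule solv_step.IH)
qed

text \<open>A minimal subalgebra \<open>M\<close> with M + R = V is a complement: if it met
  \<open>R\<close> in a nonzero \<open>I\<close>, then \<open>levi_step\<close> inside
  \<open>M\<close> would give a smaller one.\<close>

theorem levi:
  assumes fdV: "fd scale V" and R: "solv R" and ss: "semisimple_mod R"
  obtains S where "lie_subalg S" "S \<inter> R = {0}" "\<forall>v\<in>V. \<exists>r\<in>R. v - r \<in> S"
proof -
  note r = lie_idealD[OF solv_ideal[OF R]]
  define P where "P M \<longleftrightarrow> lie_subalg M \<and> (\<forall>v\<in>V. \<exists>r\<in>R. v - r \<in> M)" for M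
  have PV: "P V"
    unfolding P_def lie_subalg_def
    using subspace_carrier prd_closed subspace_0[OF r(1)] by (auto intro!: bexI[of _ 0])
  obtain M where M: "P M" "\<And>M'. P M' \<Longrightarrow> M' \<subseteq> M \<Longrightarrow> M' = M"
    by (rule fd_minimal[of V P, OF fdV PV]) (use lie_subalgD in \<open>auto simp: P_def\<close>)
  have sub: "lie_subalg M" and sup: "\<forall>v\<in>V. \<exists>r\<in>R. v - r \<in> M" using M(1) by (auto simp: P_def)
  note m = lie_subalgD[OF sub]
  interpret m: lie_algebra_char_0 scale M prd by (rule lie_subalg_algebra[OF sub])
  define I where "I = M \<inter> R"
  have I: "m.lie_ideal I"
    by (rule m.lie_idealI) (use r m in \<open>auto simp: I_def subspace_inter\<close>)
  have "I = {0}"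
  proof (rule ccontr)
    assume I0: "I \<noteq> {0}"
    \<comment> \<open>In effect M / I is V / R: an ideal of \<open>M\<close> that is abelian modulo
      \<open>I\<close> becomes, after adding \<open>R\<close>, an ideal of \<open>V\<close> that is
      abelian modulo \<open>R\<close>.\<close>
    have ssI: "m.semisimple_mod I"
      unfolding m.semisimple_mod_def
    proof (intro allI impI)
      fix B assume B: "m.lie_ideal B" "I \<subseteq> B" "\<forall>x\<in>B. \<forall>y\<in>B. prd x y \<in> I"
      note b = m.lie_idealD[OF B(1)]
      define D where "D = {x + y |x y. x \<in> B \<and> y \<in> R}"
      have D: "lie_ideal D"
      proof (rule lie_idealI)
        show "subspace D" unfolding D_def by (rule subspace_sums[OF b(1) r(1)])
        show "D \<subseteq> V" unfolding D_def using b(2) m(2) r(2) V_closed(2) by blast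
        show "prd x z \<in> D" if x: "x \<in> V" and z: "z \<in> D" for x z
        proof -
          obtain u v where uv: "z = u + v" "u \<in> B" "v \<in> R" using z by (auto simp: D_def)
          obtain w where w: "w \<in> R" "x - w \<in> M" using sup x by blast
          have V: "u \<in> V" "v \<in> V" "w \<in> V" using uv w b(2) m(2) r(2) by auto
          have "prd x z = prd (x - w) u + (prd w u + prd x v)"
            unfolding uv(1) using V x by (simp add: prd_add_right prd_diff_left)
          moreover have "prd (x - w) u \<in> B" by (rule b(3)[OF w(2) uv(2)])
          moreover have "prd w u + prd x v \<in> R"
            using subspace_add[OF r(1) r(4)[OF V(1) w(1)] r(3)[OF x uv(3)]] .
          ultimately show ?thesis unfolding D_def by blast
        qed
      qed
      have RD: "R \<subseteq> D"
      proof
        fix x assume "x \<in> R"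
        then have "0 + x \<in> D" unfolding D_def using subspace_0[OF b(1)] by blast
        then show "x \<in> D" by simp
      qed
      have DR: "D = R"
      proof (rule semisimple_modD[OF ss D RD])
        fix x y assume "x \<in> D" "y \<in> D"
        then obtain u v u' v' where uv: "x = u + v" "u \<in> B" "v \<in> R" "y = u' + v'" "u' \<in> B" "v' \<in> R"
          by (auto simp: D_def)
        have V: "u \<in> V" "v \<in> V" "u' \<in> V" "v' \<in> V" using uv b(2) m(2) r(2) by auto
        have "prd x y = prd u u' + (prd u v' + prd v (u' + v'))"
          unfolding uv(1,4) using V by (simp add: prd_add_right prd_add_left V_closed)
        moreover have "prd u u' \<in> R" using B(3) uv by (auto simp: I_def)
        ultimately show "prd x y \<in> R"
          using r(3)[OF V(1) uv(6)] r(4)[OF V_closed(2)[OF V(3,4)] uv(3)] subspace_add[OF r(1)] by simp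
      qed
      have "x \<in> I" if x: "x \<in> B" for x
      proof -
        have "x + 0 \<in> D" unfolding D_def using x subspace_0[OF r(1)] by blast
        then show ?thesis using DR b(2)[OF x] by (simp add: I_def)
      qed
      then show "B = I" using B(2) by blast
    qed
    have fdM: "fd scale M" using fd_subset[OF fdV m(1)] m(2) by blast
    obtain H where H: "m.lie_subalg H" "H \<noteq> M" "\<forall>v\<in>M. \<exists>r\<in>I. v - r \<in> H"
    proof (rule m.levi_step[OF fdM I I0 ssI])
      fix A assume A: "m.lie_ideal A" "A \<subseteq> I" "\<And>x. x \<in> I \<Longrightarrow> \<exists>y\<in>brackets I I. x - y \<in> A"
      note a = m.lie_idealD[OF A(1)]
      have "I \<subseteq> A"
      proof (rule solvable_descent[OF sub a(1) _ a(3) _ _ R])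
        show "A \<subseteq> M" "I \<subseteq> M" using a(2) by (auto simp: I_def)
        show "\<exists>y\<in>brackets I I. x - y \<in> A" if "x \<in> I" for x by (rule A(3)[OF that])
        show "\<exists>b\<in>R. x - b \<in> A" if "x \<in> I" for x
          using that subspace_0[OF a(1)] by (intro bexI[of _ x]) (auto simp: I_def)
      qed
      then show "A = I" using A(2) by blast
    qed
    note h = m.lie_subalgD[OF H(1)]
    have "P H"
      unfolding P_def lie_subalg_def
    proof (intro conjI ballI)
      show "subspace H" "H \<subseteq> V" using h m(2) by auto
      show "prd x y \<in> H" if "x \<in> H" "y \<in> H" for x y by (rule h(3)[OF that])
      fix v assume "v \<in> V"
      then obtain u where u: "u \<in> R" "v - u \<in> M" using sup by blast
      then obtain w where w: "w \<in> I" "v - u - w \<in> H" using H(3) by blast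
      have "u + w \<in> R" using u w subspace_add[OF r(1)] by (auto simp: I_def)
      then show "\<exists>r\<in>R. v - r \<in> H" using w(2) by (metis diff_diff_eq)
    qed
    then show False using M(2) H(2) h(2) by blast
  qed
  then show thesis using that sub sup unfolding I_def by blast
qed

lemma radical_exists:
  assumes "fd scale V"
  obtains R where "solv R" "semisimple_mod R"
proof -
  obtain R where R: "solv R" "\<And>R'. solv R' \<Longrightarrow> R \<subseteq> R' \<Longrightarrow> R' = R"
    by (rule fd_maximal[of V solv, OF assms solv_zero]) (use solv_ideal lie_idealD in blast)+
  have "semisimple_mod R"
    unfolding semisimple_mod_def
  proof (intro allI impI)
    fix B assume "lie_ideal B" "R \<subseteq> B" "\<forall>x\<in>B. \<forall>y\<in>B. prd x y \<in> R"
    then have "solv B" by (intro solv_step[OF R(1)]) auto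
    then show "B = R" by (rule R(2)) fact
  qed
  then show thesis by (rule that[OF R(1)])
qed

end

section \<open>Extending representations along a semidirect sum\<close>

lemma fd_bilinear_span:
  fixes s1 :: "'a::field \<Rightarrow> 'k::ab_group_add \<Rightarrow> 'k" and s2 :: "'a \<Rightarrow> 'g::ab_group_add \<Rightarrow> 'g"
    and s3 :: "'a \<Rightarrow> 'h::ab_group_add \<Rightarrow> 'h"
  assumes "vector_space s1" "vector_space s2" "vector_space s3" and fd: "fd s1 K" "fd s2 G"
    and l_add: "\<And>k k' g. k \<in> K \<Longrightarrow> k' \<in> K \<Longrightarrow> g \<in> G \<Longrightarrow> \<beta> (k + k') g = \<beta> k g + \<beta> k' g"
    and l_scale: "\<And>c k g. k \<in> K \<Longrightarrow> g \<in> G \<Longrightarrow> \<beta> (s1 c k) g = s3 c (\<beta> k g)"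
    and r_add: "\<And>k g g'. k \<in> K \<Longrightarrow> g \<in> G \<Longrightarrow> g' \<in> G \<Longrightarrow> \<beta> k (g + g') = \<beta> k g + \<beta> k g'"
    and r_scale: "\<And>c k g. k \<in> K \<Longrightarrow> g \<in> G \<Longrightarrow> \<beta> k (s2 c g) = s3 c (\<beta> k g)"
  shows "fd s3 (module.span s3 {\<beta> k g | k g. k \<in> K \<and> g \<in> G})"
proof -
  interpret v1: vector_space s1 by fact
  interpret v2: vector_space s2 by fact
  interpret v3: vector_space s3 by fact
  obtain B1 where B1: "finite B1" "B1 \<subseteq> K" "v1.span B1 = K" using v1.fd_basis[OF fd(1)] .
  obtain B2 where B2: "finite B2" "B2 \<subseteq> G" "v2.span B2 = G" using v2.fd_basis[OF fd(2)] .
  let ?T = "v3.span ((\<lambda>(k, g). \<beta> k g) ` (B1 \<times> B2))"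
  note K = v1.fd_subspaceD[OF fd(1)] and G = v2.fd_subspaceD[OF fd(2)]
  have 1: "\<beta> k g \<in> ?T" if k: "k \<in> K" and g: "g \<in> B2" for k g
  proof -
    have gG: "g \<in> G" using g B2 by blast
    have "\<beta> 0 g = 0" using l_scale[of 0 g 0] v1.subspace_0[OF K] gG by simp
    then have "v1.subspace {k \<in> K. \<beta> k g \<in> ?T}"
      using K gG by (intro v1.subspaceI)
        (auto simp: v1.subspace_0 v1.subspace_add v1.subspace_scale l_add l_scale v3.span_zero v3.span_add v3.span_scale)
    moreover have "B1 \<subseteq> {k \<in> K. \<beta> k g \<in> ?T}" using B1 g by (auto intro!: v3.span_base)
    ultimately show ?thesis using v1.span_minimal[of B1] B1(3) k by blast
  qed
  have 2: "\<beta> k g \<in> ?T" if k: "k \<in> K" and g: "g \<in> G" for k g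
  proof -
    have "\<beta> k 0 = 0" using r_scale[of k 0 0] v2.subspace_0[OF G] k by simp
    then have "v2.subspace {g \<in> G. \<beta> k g \<in> ?T}"
      using G k by (intro v2.subspaceI)
        (auto simp: v2.subspace_0 v2.subspace_add v2.subspace_scale r_add r_scale v3.span_zero v3.span_add v3.span_scale)
    moreover have "B2 \<subseteq> {g \<in> G. \<beta> k g \<in> ?T}" using B2 k 1 by blast
    ultimately show ?thesis using v2.span_minimal[of B2] B2(3) g by blast
  qed
  then have "v3.span {\<beta> k g | k g. k \<in> K \<and> g \<in> G} \<subseteq> ?T"
    by (intro v3.span_minimal) auto
  then show ?thesis using B1(1) B2(1) by (intro v3.fdI[of _ "(\<lambda>(k, g). \<beta> k g) ` (B1 \<times> B2)"]) auto
qed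

definition fsmul :: "'a::field \<Rightarrow> ('b \<Rightarrow> 'a rmat) \<Rightarrow> 'b \<Rightarrow> 'a rmat" where
  "fsmul c f = (\<lambda>w. smul c (f w))"

lemma fsmul_apply: "fsmul c f w = smul c (f w)"
  by (simp add: fsmul_def)

global_interpretation fs: vector_space fsmul
  by unfold_locales (auto simp: fsmul_def fun_eq_iff rm.scale_right_distrib rm.scale_left_distrib)

lemma (in fd_lie_module) nilset_if_vann:
  assumes "U \<subseteq> V" "W \<subseteq> vann act U q"
  shows "nilset (R ` U)"
proof -
  have *: "M f \<in> lann (R ` U) k" if "lin_on sw W f" "\<And>w. w \<in> W \<Longrightarrow> f w \<in> vann act U k" for f k
    using that
  proof (induction k arbitrary: f)
    case 0
    then show ?case using M_zero by simp
  next
    case (Suc k)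
    have "R x * M f \<in> lann (R ` U) k" if x: "x \<in> U" for x
    proof -
      have xV: "x \<in> V" using x assms(1) by blast
      show ?thesis unfolding M_comp[OF act_lin[OF xV] Suc.prems(1), symmetric]
        by (rule Suc.IH[OF W.lin_on_comp[OF act_lin[OF xV] Suc.prems(1)]]) (use Suc.prems(2) x in simp)
    qed
    then show ?case by simp
  qed
  have "R x \<in> lann (R ` U) q" if x: "x \<in> U" for x
  proof -
    have xV: "x \<in> V" using x assms(1) by blast
    show ?thesis by (rule *[OF act_lin[OF xV]]) (use act_closed[OF xV] assms(2) in blast)
  qed
  then have "1 \<in> lann (R ` U) (Suc q)" by simp
  then show ?thesis unfolding nilset_def by blast
qed

lemma (in fd_lie_module) nilpotent_if_locally:
  assumes fdW: "fd sw W" and x: "x \<in> V" and loc: "\<And>w. w \<in> W \<Longrightarrow> \<exists>n. (act x ^^ n) w = 0"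
  shows "\<exists>m. R x ^ m = 0"
proof -
  obtain B where B: "finite B" "B \<subseteq> W" "W.span B = W" using W.fd_basis[OF fdW] .
  obtain n where n: "\<And>w. w \<in> W \<Longrightarrow> (act x ^^ n w) w = 0" using loc by metis
  have lin: "lin_on sw W (act x ^^ m)" for m by (rule W.lin_on_power[OF act_lin[OF x]])
  have zero: "(act x ^^ m) 0 = 0" for m by (induction m) (simp_all add: act_zero_right[OF x])
  define m where "m = Max (insert 0 (n ` B))"
  have "W.subspace {w \<in> W. (act x ^^ Suc m) w = 0}"
    using W_subspace lin[of "Suc m"] zero[of "Suc m"] by (intro W.subspaceI)
      (auto simp del: funpow.simps simp: W.subspace_0 W.subspace_add W.subspace_scale lin_on_def)
  moreover have "B \<subseteq> {w \<in> W. (act x ^^ Suc m) w = 0}"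
  proof
    fix b assume b: "b \<in> B"
    then have "n b \<le> Suc m" unfolding m_def using B(1) by (intro le_SucI Max_ge) auto
    then have "Suc m = (Suc m - n b) + n b" by simp
    then have "(act x ^^ Suc m) b = (act x ^^ (Suc m - n b)) ((act x ^^ n b) b)"
      by (metis comp_apply funpow_add)
    also have "\<dots> = 0" using n[of b] b B(2) zero by auto
    finally show "b \<in> {w \<in> W. (act x ^^ Suc m) w = 0}" using b B(2) by blast
  qed
  ultimately have "W \<subseteq> {w \<in> W. (act x ^^ Suc m) w = 0}" using W.span_minimal B(3) by metis
  then have "M (act x ^^ Suc m) = 0" unfolding M_zero[OF lin] by blast
  then have "R x ^ Suc m = 0" unfolding M_power[OF act_lin[OF x]] .
  then show ?thesis by blast
qed

text \<open>A function \<open>f\<close> on lists over \<open>S\<close> stands for a linear map on the enveloping algebra of \<open>S\<close>,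
  the list \<open>[x, y, z]\<close> for the product \<open>z y x\<close>.\<close>

definition lshift :: "'v \<Rightarrow> ('v list \<Rightarrow> 'r) \<Rightarrow> 'v list \<Rightarrow> 'r" where
  "lshift x f = (\<lambda>w. f (x # w))"

section \<open>The coinduced module as functions on words\<close>

locale semidirect = lie_algebra_char_0 scale V prd
  for scale :: "'f::field_char_0 \<Rightarrow> 'v::ab_group_add \<Rightarrow> 'v" and V prd +
  fixes S K I :: "'v set" and d :: nat and \<rho> :: "'v \<Rightarrow> 'f rmat"
  assumes fdK: "fd scale K" and S: "lie_subalg S" and K: "lie_subalg K" and I: "subspace I" "I \<subseteq> K"
    and SK: "x \<in> S \<Longrightarrow> k \<in> K \<Longrightarrow> prd x k \<in> I" and KI: "k \<in> K \<Longrightarrow> i \<in> I \<Longrightarrow> prd k i \<in> I"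
    and disj: "S \<inter> K = {0}" and rep: "lie_rep scale K prd d \<rho>" and nil: "nilset (\<rho> ` I)"
begin

lemmas S_sub = lie_subalgD(1)[OF S] and S_V = lie_subalgD(2)[OF S] and S_prd = lie_subalgD(3)[OF S]
lemmas K_sub = lie_subalgD(1)[OF K] and K_V = lie_subalgD(2)[OF K] and K_prd = lie_subalgD(3)[OF K]
lemmas rho_add = lie_repD(2)[OF rep] and rho_lie = lie_repD(4)[OF rep]

lemma rho_Mat: "k \<in> K \<Longrightarrow> \<rho> k \<in> Mat d"
  using lie_repD(1)[OF rep] by blast

lemma rho_scale: "k \<in> K \<Longrightarrow> \<rho> (scale c k) = smul c (\<rho> k)"
  using lie_repD(3)[OF rep] by blast

lemma SK_K: "x \<in> S \<Longrightarrow> k \<in> K \<Longrightarrow> prd x k \<in> K"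
  using SK I(2) by blast

text \<open>The coinduced action (k f)(u) = f(u k), evaluated with f(k u) = \<rho>(k) f(u): for u =
  w x the factor \<open>k\<close> moves left by w x k = w [x, k] + w k x. A first letter outside
  \<open>S\<close> has no meaning; multiplication by \<rho>(k) is a default under which
  \<open>L\<close> is linear and a representation on all functions.\<close>

primrec kact :: "'v list \<Rightarrow> 'v \<Rightarrow> ('v list \<Rightarrow> 'f rmat) \<Rightarrow> 'f rmat" where
  "kact [] k f = \<rho> k * f []"
| "kact (x # w) k f = (if x \<in> S then kact w (prd x k) f + kact w k (lshift x f) else \<rho> k * f (x # w))"

definition L :: "'v \<Rightarrow> ('v list \<Rightarrow> 'f rmat) \<Rightarrow> 'v list \<Rightarrow> 'f rmat" where
  "L k f = (\<lambda>w. kact w k f)"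

lemma L_Nil: "L k f [] = \<rho> k * f []"
  by (simp add: L_def)

lemma lshift_L: "x \<in> S \<Longrightarrow> lshift x (L k f) = L (prd x k) f + L k (lshift x f)"
  by (simp add: L_def lshift_def fun_eq_iff)

lemma lshift_add: "lshift x (f + g) = lshift x f + lshift x g"
  by (simp add: lshift_def fun_eq_iff)

lemma lshift_diff: "lshift x (f - g) = lshift x f - lshift x (g :: _ \<Rightarrow> 'f rmat)"
  by (simp add: lshift_def fun_eq_iff)

lemma lshift_zero: "lshift x (0 :: _ \<Rightarrow> 'f rmat) = 0"
  by (simp add: lshift_def fun_eq_iff)

lemma lshift_scale: "lshift x (fsmul c f) = fsmul c (lshift x f)"
  by (simp add: lshift_def fun_eq_iff fsmul_def)

lemma L_add_right: "L k (f + g) = L k f + L k g"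
proof -
  have "kact w k (f + g) = kact w k f + kact w k g" for w
    by (induction w arbitrary: k f g) (simp_all add: distrib_left lshift_add add.assoc add.left_commute)
  then show ?thesis by (simp add: L_def fun_eq_iff)
qed

lemma L_scale_right: "L k (fsmul c f) = fsmul c (L k f)"
proof -
  have "kact w k (fsmul c f) = smul c (kact w k f)" for w
    by (induction w arbitrary: k f) (simp_all add: smul_mult_right lshift_scale fsmul_apply rm.scale_right_distrib)
  then show ?thesis by (simp add: L_def fsmul_def fun_eq_iff)
qed

lemma L_zero_right: "L k 0 = 0"
  using L_scale_right[of k 0 0] by simp

lemma L_add_left:
  assumes "k \<in> K" "k' \<in> K"
  shows "L (k + k') f = L k f + L k' f"
proof -
  have "kact w (k + k') f = kact w k f + kact w k' f" for w
    using assms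
  proof (induction w arbitrary: k k' f)
    case Nil
    then show ?case by (simp add: rho_add distrib_right)
  next
    case (Cons x w)
    then show ?case using prd_add_right[of x k k'] S_V K_V SK_K by (simp add: rho_add distrib_right)
  qed
  then show ?thesis by (simp add: L_def fun_eq_iff)
qed

lemma L_scale_left:
  assumes "k \<in> K"
  shows "L (scale c k) f = fsmul c (L k f)"
proof -
  have "kact w (scale c k) f = smul c (kact w k f)" for w
    using assms
  proof (induction w arbitrary: k f)
    case Nil
    then show ?case by (simp add: rho_scale smul_mult_left)
  next
    case (Cons x w)
    then show ?case using prd_scale_right[of x k c] S_V K_V SK_K
      by (simp add: rm.scale_right_distrib rho_scale smul_mult_left)
  qed
  then show ?thesis by (simp add: L_def fun_eq_iff fsmul_def)
qed

lemma L_diff_left: "k \<in> K \<Longrightarrow> k' \<in> K \<Longrightarrow> L (k - k') f = L k f - L k' f"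
  using L_add_left[of "k - k'" k' f] subspace_diff[OF K_sub] by simp

lemma L_diff_right: "L k (f - g) = L k f - L k g"
  using L_add_right[of k "f - g" g] by simp

lemma L_lie:
  assumes "k \<in> K" "k' \<in> K"
  shows "L (prd k k') f = L k (L k' f) - L k' (L k f)"
proof -
  have "L (prd k k') f w = L k (L k' f) w - L k' (L k f) w" for w
    using assms
  proof (induction w arbitrary: k k' f)
    case Nil
    then show ?case by (simp add: L_Nil rho_lie left_diff_distrib mult.assoc)
  next
    case (Cons x w)
    show ?case
    proof (cases "x \<in> S")
      case True
      note xk = SK_K[OF True Cons.prems(1)] SK_K[OF True Cons.prems(2)]
      have L_Cons: "L k f (x # w) = L (prd x k) f w + L k (lshift x f) w" for k f
        using True by (simp add: L_def)
      have "prd x (prd k k') = prd (prd x k) k' + prd k (prd x k')"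
        using jacobi_left[of x k k'] S_V[OF True] K_V Cons.prems by simp
      then have "L (prd x (prd k k')) f = L (prd (prd x k) k') f + L (prd k (prd x k')) f"
        using L_add_left K_prd xk Cons.prems by simp
      then show ?thesis
        using Cons.IH[OF xk(1) Cons.prems(2), of f] Cons.IH[OF Cons.prems(1) xk(2), of f]
          Cons.IH[OF Cons.prems, of "lshift x f"]
        by (simp add: L_Cons lshift_L[OF True] L_add_right)
    next
      case False
      then show ?thesis using Cons.prems by (simp add: L_def rho_lie left_diff_distrib mult.assoc)
    qed
  qed
  then show ?thesis by (simp add: fun_eq_iff)
qed

text \<open>The relations of the enveloping algebra of \<open>S\<close>, tested at the first letter
  only; \<open>C\<close> imposes them after every shift along \<open>S\<close>, hence at later
  positions too. Functions on words subject to these relations replace linear maps on the enveloping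
  algebra, so no Poincare-Birkhoff-Witt basis enters.\<close>

definition compat :: "('v list \<Rightarrow> 'f rmat) \<Rightarrow> bool" where
  "compat f \<longleftrightarrow> (\<forall>w. f w \<in> Mat d) \<and> (\<forall>x\<in>S. \<forall>y\<in>S. lshift (x + y) f = lshift x f + lshift y f) \<and>
    (\<forall>c. \<forall>x\<in>S. lshift (scale c x) f = fsmul c (lshift x f)) \<and>
    (\<forall>x\<in>S. \<forall>y\<in>S. lshift (prd x y) f = lshift x (lshift y f) - lshift y (lshift x f))"

primrec shifts :: "'v list \<Rightarrow> ('v list \<Rightarrow> 'f rmat) \<Rightarrow> 'v list \<Rightarrow> 'f rmat" where
  "shifts [] f = f"
| "shifts (x # u) f = shifts u (lshift x f)"

definition C :: "('v list \<Rightarrow> 'f rmat) set" where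
  "C = {f. \<forall>u\<in>lists S. compat (shifts u f)}"

definition Lm :: "'f rmat \<Rightarrow> ('v list \<Rightarrow> 'f rmat) \<Rightarrow> 'v list \<Rightarrow> 'f rmat" where
  "Lm b f = (\<lambda>w. b * f w)"

lemma Lm_add: "Lm b (f + g) = Lm b f + Lm b g" "Lm (b + c) f = Lm b f + Lm c f"
  by (simp_all add: Lm_def fun_eq_iff distrib_left distrib_right)

lemma Lm_diff: "Lm b (f - g) = Lm b f - Lm b g"
  by (simp add: Lm_def fun_eq_iff right_diff_distrib)

lemma Lm_scale: "Lm b (fsmul c f) = fsmul c (Lm b f)" "Lm (smul c b) f = fsmul c (Lm b f)"
  by (simp_all add: Lm_def fsmul_def fun_eq_iff smul_mult_left smul_mult_right)

lemma Lm_zero: "Lm b 0 = 0"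
  by (simp add: Lm_def fun_eq_iff)

lemma Lm_mult: "Lm b (Lm c f) = Lm (b * c) f"
  by (simp add: Lm_def mult.assoc)

lemma lshift_Lm: "lshift x (Lm b f) = Lm b (lshift x f)"
  by (simp add: Lm_def lshift_def)

lemma compat_zero: "compat 0"
  by (simp add: compat_def lshift_zero Mat_closed)

lemma compat_add: "compat f \<Longrightarrow> compat g \<Longrightarrow> compat (f + g)"
  unfolding compat_def by (auto simp: lshift_add Mat_closed fs.scale_right_distrib)

lemma compat_scale: "compat f \<Longrightarrow> compat (fsmul c f)"
  unfolding compat_def
  by (auto simp: lshift_scale fsmul_apply Mat_closed fs.scale_right_distrib fs.scale_right_diff_distrib fs.scale_left_commute)

lemma compat_Lm: "compat f \<Longrightarrow> b \<in> Mat d \<Longrightarrow> compat (Lm b f)"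
  unfolding compat_def by (auto simp: lshift_Lm Lm_add Lm_diff Lm_scale) (simp add: Lm_def Mat_closed)

lemma L_Mat:
  assumes "\<And>w. f w \<in> Mat d" "k \<in> K"
  shows "L k f w \<in> Mat d"
  unfolding L_def using assms
proof (induction w arbitrary: k f)
  case Nil
  then show ?case by (simp add: Mat_closed rho_Mat)
next
  case (Cons x w)
  have "lshift x f w \<in> Mat d" for w using Cons.prems(1) by (simp add: lshift_def)
  then show ?case using Cons SK_K by (simp add: Mat_closed rho_Mat)
qed

lemma compat_L:
  assumes f: "compat f" and k: "k \<in> K"
  shows "compat (L k f)"
  unfolding compat_def
proof (intro conjI ballI allI)
  have f1: "\<And>w. f w \<in> Mat d" "\<And>x y. x \<in> S \<Longrightarrow> y \<in> S \<Longrightarrow> lshift (x + y) f = lshift x f + lshift y f"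
    "\<And>c x. x \<in> S \<Longrightarrow> lshift (scale c x) f = fsmul c (lshift x f)"
    "\<And>x y. x \<in> S \<Longrightarrow> y \<in> S \<Longrightarrow> lshift (prd x y) f = lshift x (lshift y f) - lshift y (lshift x f)"
    using f unfolding compat_def by blast+
  show "L k f w \<in> Mat d" for w by (rule L_Mat[OF f1(1) k])
  note kV = K_V[OF k]
  fix x assume x: "x \<in> S"
  note xk = SK_K[OF x k]
  show "lshift (scale c x) (L k f) = fsmul c (lshift x (L k f))" for c
    using x subspace_scale[OF S_sub x, of c] S_V[OF x] kV xk
    by (simp add: lshift_L prd_scale_left L_scale_left f1 L_scale_right fs.scale_right_distrib)
  fix y assume y: "y \<in> S"
  note yk = SK_K[OF y k]
  show "lshift (x + y) (L k f) = lshift x (L k f) + lshift y (L k f)"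
    using x y subspace_add[OF S_sub x y] S_V[OF x] S_V[OF y] kV xk yk
    by (simp add: lshift_L prd_add_left L_add_left f1 L_add_right)
  have "prd (prd x y) k = prd x (prd y k) - prd y (prd x k)"
    by (rule jacobi_left[OF S_V[OF x] S_V[OF y] kV])
  then show "lshift (prd x y) (L k f) = lshift x (lshift y (L k f)) - lshift y (lshift x (L k f))"
    using SK_K[OF x yk] SK_K[OF y xk]
    by (simp add: lshift_L x y S_prd lshift_add L_diff_left L_diff_right f1)
qed

lemma shifts_add: "shifts u (f + g) = shifts u f + shifts u g"
  by (induction u arbitrary: f g) (simp_all add: lshift_add)

lemma shifts_zero: "shifts u 0 = 0"
  by (induction u) (simp_all only: shifts.simps lshift_zero)

lemma shifts_scale: "shifts u (fsmul c f) = fsmul c (shifts u f)"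
  by (induction u arbitrary: f) (simp_all add: lshift_scale)

lemma shifts_Lm: "shifts u (Lm b f) = Lm b (shifts u f)"
  by (induction u arbitrary: f) (simp_all add: lshift_Lm)

lemma C_subspace: "fs.subspace C"
  by (intro fs.subspaceI)
    (auto simp: C_def shifts_zero shifts_add shifts_scale intro: compat_zero compat_add compat_scale)

lemma C_Lm: "f \<in> C \<Longrightarrow> b \<in> Mat d \<Longrightarrow> Lm b f \<in> C"
  by (simp add: C_def shifts_Lm compat_Lm)

lemma C_shifts: "f \<in> C \<Longrightarrow> u \<in> lists S \<Longrightarrow> compat (shifts u f)"
  by (simp add: C_def)

lemma C_compat: "f \<in> C \<Longrightarrow> compat f"
  using C_shifts[of f "[]"] by simp

lemma C_shift:
  assumes "f \<in> C" "x \<in> S"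
  shows "lshift x f \<in> C"
proof -
  have "compat (shifts (x # u) f)" if "u \<in> lists S" for u
    by (rule C_shifts[OF assms(1)]) (use that assms(2) in simp)
  then show ?thesis by (simp add: C_def)
qed

lemma C_L:
  assumes "f \<in> C" "k \<in> K"
  shows "L k f \<in> C"
proof -
  have "compat (shifts u (L k f))" if "u \<in> lists S" for u
    using that assms
  proof (induction u arbitrary: k f)
    case Nil
    then show ?case by (simp only: shifts.simps compat_L C_compat)
  next
    case (Cons x u)
    then have "x \<in> S" by simp
    moreover from this have "compat (shifts u (L (prd x k) f) + shifts u (L k (lshift x f)))"
      using Cons by (intro compat_add Cons.IH) (simp_all add: C_shift SK_K)
    ultimately show ?case by (simp only: shifts.simps lshift_L shifts_add)
  qed
  then show ?thesis by (simp add: C_def)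
qed

section \<open>The filtration of the coinduced module by levels\<close>

definition lev :: "nat \<Rightarrow> ('v list \<Rightarrow> 'f rmat) set" where
  "lev q = {f. \<forall>w. f w \<in> Mat d \<inter> lann (\<rho> ` I) q}"

lemma lev_subspace: "fs.subspace (lev q)"
  by (intro fs.subspaceI) (auto simp: lev_def fsmul_def Mat_closed lann_zero lann_add lann_smul)

lemma lev_shift: "f \<in> lev q \<Longrightarrow> lshift x f \<in> lev q"
  by (simp add: lev_def lshift_def)

text \<open>Moving \<open>i\<close> through a word only produces brackets [x, i], which lie in
  \<open>I\<close> again, and in the end each of them multiplies a value by some \<rho>(i'), which
  lowers the level.\<close>

lemma lev_L_ideal:
  assumes "f \<in> lev (Suc q)" "i \<in> I"
  shows "L i f \<in> lev q"
proof -
  have "L i f w \<in> lann (\<rho> ` I) q" for w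
    unfolding L_def using assms
  proof (induction w arbitrary: i f)
    case Nil
    then show ?case by (simp add: lev_def)
  next
    case (Cons x w)
    have "kact w (prd x i) f \<in> lann (\<rho> ` I) q" if x: "x \<in> S"
      using Cons.IH[OF Cons.prems(1) SK[OF x]] Cons.prems(2) I(2) by blast
    moreover have "kact w i (lshift x f) \<in> lann (\<rho> ` I) q"
      by (rule Cons.IH[OF lev_shift[OF Cons.prems(1)] Cons.prems(2)])
    moreover have "\<rho> i * f (x # w) \<in> lann (\<rho> ` I) q" using Cons.prems by (simp add: lev_def)
    ultimately show ?case by (simp add: lann_add)
  qed
  moreover have "L i f w \<in> Mat d" for w
    by (rule L_Mat) (use assms I(2) in \<open>auto simp: lev_def\<close>)
  ultimately show ?thesis by (simp add: lev_def)
qed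

text \<open>The correction terms come from brackets [x, k]; these lie in \<open>I\<close>, so
  \<open>lev_L_ideal\<close> puts them one level lower.\<close>

lemma lev_L_diff:
  assumes "f \<in> lev (Suc q)" "k \<in> K"
  shows "L k f - Lm (\<rho> k) f \<in> lev q"
proof -
  have fM: "\<And>w. f w \<in> Mat d" using assms by (auto simp: lev_def)
  have "L k f w - \<rho> k * f w \<in> lann (\<rho> ` I) q" for w
    using assms
  proof (induction w arbitrary: k f)
    case Nil
    then show ?case by (simp add: L_Nil lann_zero)
  next
    case (Cons x w)
    show ?case
    proof (cases "x \<in> S")
      case True
      have "L (prd x k) f w \<in> lann (\<rho> ` I) q"
        using lev_L_ideal[OF Cons.prems(1) SK[OF True Cons.prems(2)]] by (simp add: lev_def)
      from lann_add[OF this Cons.IH[OF lev_shift[OF Cons.prems(1)] Cons.prems(2), of x]]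
      show ?thesis using True by (simp add: L_def lshift_def add_diff_eq)
    next
      case False
      then show ?thesis by (simp add: L_def lann_zero)
    qed
  qed
  moreover have "L k f w - \<rho> k * f w \<in> Mat d" for w
    by (intro Mat_closed L_Mat fM rho_Mat assms)
  ultimately show ?thesis by (simp add: lev_def Lm_def)
qed

text \<open>The finite dimensional algebra of matrices that respect all levels. It contains every
  \<rho>(k), so saturation under \<open>E\<close> gives stability under pointwise multiplication by
  \<rho>(K).\<close>

definition E :: "'f rmat set" where
  "E = {b \<in> Mat d. \<forall>q. \<forall>a\<in>lann (\<rho> ` I) q. b * a \<in> lann (\<rho> ` I) q}"

lemma E_subspace: "rm.subspace E"
  by (rule rm.subspaceI)
    (auto simp: E_def Mat_closed lann_zero distrib_right smul_mult_left intro: lann_add lann_smul)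

lemma E_fd: "fd smul E"
  by (rule rm.fd_subset[OF Mat_fd E_subspace, of d]) (auto simp: E_def)

lemma E_Mat: "b \<in> E \<Longrightarrow> b \<in> Mat d"
  by (simp add: E_def)

lemma E_mult: "b \<in> E \<Longrightarrow> c \<in> E \<Longrightarrow> b * c \<in> E"
  by (auto simp: E_def Mat_closed mult.assoc)

lemma E_rho:
  assumes k: "k \<in> K"
  shows "\<rho> k \<in> E"
proof -
  have "h * \<rho> k - \<rho> k * h \<in> \<rho> ` I" if h: "h \<in> \<rho> ` I" for h
  proof -
    obtain i where i: "i \<in> I" "h = \<rho> i" using h by blast
    have iK: "i \<in> K" using i I by blast
    have "h * \<rho> k - \<rho> k * h = \<rho> (prd i k)" unfolding i(2) by (rule rho_lie[OF iK k, symmetric])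
    moreover have "prd i k = - prd k i" by (rule antisym[OF K_V[OF k] K_V[OF iK]])
    ultimately show ?thesis using subspace_neg[OF I(1) KI[OF k i(1)]] by simp
  qed
  from lann_stable[OF this] show ?thesis by (simp add: E_def rho_Mat k)
qed

lemma E_one: "Pd d \<in> E"
proof -
  have "Pd d * a \<in> lann (\<rho> ` I) q" if "a \<in> lann (\<rho> ` I) q" for a q
  proof (cases q)
    case 0
    then show ?thesis using that by simp
  next
    case (Suc p)
    have "\<rho> i * (Pd d * a) \<in> lann (\<rho> ` I) p" if "i \<in> I" for i
      using \<open>a \<in> _\<close> that Suc Pd_right[OF rho_Mat, of i] I(2) by (auto simp: mult.assoc[symmetric])
    then show ?thesis by (simp add: Suc)
  qed
  then show ?thesis by (simp add: E_def Pd_Mat)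
qed

lemma lev_Lm: "f \<in> lev q \<Longrightarrow> b \<in> E \<Longrightarrow> Lm b f \<in> lev q"
  by (auto simp: lev_def Lm_def E_def Mat_closed)

text \<open>The values of \<open>L k g - Lm (\<rho> k) g\<close> and of \<open>L i g\<close> lie one level below those of \<open>g\<close>.\<close>

lemma finite_submodule:
  assumes "fd fsmul G" "G \<subseteq> lev q" "\<And>x g. x \<in> S \<Longrightarrow> g \<in> G \<Longrightarrow> lshift x g \<in> G"
  shows "\<exists>Y. fd fsmul Y \<and> G \<subseteq> Y \<and> (\<forall>x\<in>S. \<forall>y\<in>Y. lshift x y \<in> Y) \<and> (\<forall>k\<in>K. \<forall>y\<in>Y. L k y \<in> Y) \<and>
    (\<forall>H. fs.subspace H \<longrightarrow> G \<subseteq> H \<longrightarrow> (\<forall>k\<in>K. \<forall>f\<in>H. L k f \<in> H) \<longrightarrow> (\<forall>b\<in>E. \<forall>f\<in>H. Lm b f \<in> H) \<longrightarrow> Y \<subseteq> H)"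
  using assms
proof (induction q arbitrary: G)
  case 0
  have "f = 0" if "f \<in> lev 0" for f using that by (auto simp: lev_def fun_eq_iff)
  then have "g = 0" if "g \<in> G" for g using that 0 by blast
  then have "G = {0}" using fs.subspace_0[OF fs.fd_subspaceD[OF 0(1)]] by blast
  then show ?case using 0(1) by (intro exI[of _ G]) (simp only: lshift_zero L_zero_right singleton_iff ball_simps, blast)
next
  case (Suc q)
  \<comment> \<open>Saturation under \<open>E\<close>. As \<open>Lm\<close> commutes with shifts,
    stability under \<open>S\<close> survives.\<close>
  define G' where "G' = fs.span {Lm b g | b g. b \<in> E \<and> g \<in> G}"
  have G'fd: "fd fsmul G'" unfolding G'_def
    by (rule fd_bilinear_span[OF rm.vector_space_axioms fs.vector_space_axioms fs.vector_space_axioms E_fd Suc.prems(1)])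
      (simp_all add: Lm_add Lm_scale)
  have G'sub: "fs.subspace G'" by (simp add: G'_def)
  have G'Lm: "Lm b g \<in> G'" if b: "b \<in> E" and g: "g \<in> G'" for b g
  proof -
    have "fs.subspace {g. Lm b g \<in> G'}"
      by (rule fs.subspaceI) (auto simp: Lm_zero Lm_add Lm_scale fs.subspace_0[OF G'sub] fs.subspace_add[OF G'sub] fs.subspace_scale[OF G'sub])
    moreover have "{Lm b g | b g. b \<in> E \<and> g \<in> G} \<subseteq> {g. Lm b g \<in> G'}"
    proof clarify
      fix c g assume "c \<in> E" "g \<in> G"
      then show "Lm b (Lm c g) \<in> G'" unfolding Lm_mult G'_def using E_mult[OF b] by (intro fs.span_base) blast
    qed
    ultimately show ?thesis using g fs.span_minimal unfolding G'_def by blast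
  qed
  have G'lev: "G' \<subseteq> lev (Suc q)" unfolding G'_def
  proof (rule fs.span_minimal[OF _ lev_subspace], clarify)
    fix b g assume "b \<in> E" "g \<in> G"
    then show "Lm b g \<in> lev (Suc q)" using Suc.prems(2) lev_Lm by blast
  qed
  have G'lshift: "lshift x g \<in> G'" if x: "x \<in> S" and g: "g \<in> G'" for x g
  proof -
    have "fs.subspace {g. lshift x g \<in> G'}"
      by (rule fs.subspaceI) (auto simp: lshift_zero lshift_add lshift_scale fs.subspace_0[OF G'sub] fs.subspace_add[OF G'sub] fs.subspace_scale[OF G'sub])
    moreover have "{Lm b g | b g. b \<in> E \<and> g \<in> G} \<subseteq> {g. lshift x g \<in> G'}"
    proof clarify
      fix c g assume "c \<in> E" "g \<in> G"
      then show "lshift x (Lm c g) \<in> G'" unfolding lshift_Lm G'_def using Suc.prems(3)[OF x] by (intro fs.span_base) blast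
    qed
    ultimately show ?thesis using g fs.span_minimal unfolding G'_def by blast
  qed
  have GG': "G \<subseteq> G'"
  proof
    fix g assume g: "g \<in> G"
    then have "Lm (Pd d) g = g" using Suc.prems(2) Pd_left by (force simp: lev_def Lm_def fun_eq_iff)
    moreover have "Lm (Pd d) g \<in> G'" unfolding G'_def using g E_one by (intro fs.span_base) blast
    ultimately show "g \<in> G'" by simp
  qed
  \<comment> \<open>The errors of replacing the action of \<open>K\<close> by multiplication with
    \<rho>. They are bilinear in two finite dimensional arguments, so their span \<open>D\<close> is
    finite dimensional. \<open>D2\<close> is needed because shifting an error by \<open>x\<close>
    produces \<open>L (prd x k) g\<close> with [x, k] in \<open>I\<close>.\<close>
  define D1 where "D1 = {L k g - Lm (\<rho> k) g | k g. k \<in> K \<and> g \<in> G'}"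
  define D2 where "D2 = {L i g | i g. i \<in> I \<and> g \<in> G'}"
  define D where "D = fs.span (D1 \<union> D2)"
  have Dsub: "fs.subspace D" by (simp add: D_def)
  have "fd fsmul (fs.span D1)" unfolding D1_def
    by (rule fd_bilinear_span[OF vector_space_axioms fs.vector_space_axioms fs.vector_space_axioms fdK G'fd])
      (simp_all add: L_add_left L_add_right L_scale_left L_scale_right Lm_add Lm_scale rho_add rho_scale
        fs.scale_right_diff_distrib)
  moreover have "fd fsmul (fs.span D2)" unfolding D2_def
    by (rule fd_bilinear_span[OF vector_space_axioms fs.vector_space_axioms fs.vector_space_axioms fd_subset[OF fdK I] G'fd])
      (use I(2) in \<open>auto simp add: L_add_left L_add_right L_scale_left L_scale_right subset_iff\<close>)
  ultimately have Dfd: "fd fsmul D" using fs.fd_sum by (simp add: D_def fs.span_Un)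
  have Dlev: "D \<subseteq> lev q" unfolding D_def
  proof (rule fs.span_minimal[OF _ lev_subspace])
    show "D1 \<union> D2 \<subseteq> lev q" using lev_L_diff lev_L_ideal G'lev unfolding D1_def D2_def by blast
  qed
  have Dshift: "lshift x g \<in> D" if x: "x \<in> S" and g: "g \<in> D" for x g
  proof -
    have "fs.subspace {g. lshift x g \<in> D}"
      by (rule fs.subspaceI) (auto simp: lshift_zero lshift_add lshift_scale fs.subspace_0[OF Dsub] fs.subspace_add[OF Dsub] fs.subspace_scale[OF Dsub])
    moreover have "lshift x (L i g) \<in> D" if i: "i \<in> I" and g: "g \<in> G'" for i g
    proof -
      have "L (prd x i) g \<in> D2" "L i (lshift x g) \<in> D2" unfolding D2_def using i g SK[OF x] I(2) G'lshift[OF x] by blast+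
      then show ?thesis unfolding lshift_L[OF x] by (intro fs.subspace_add[OF Dsub]) (simp_all add: D_def fs.span_base)
    qed
    moreover have "lshift x (L k g - Lm (\<rho> k) g) \<in> D" if k: "k \<in> K" and g: "g \<in> G'" for k g
    proof -
      have "L (prd x k) g \<in> D2" "L k (lshift x g) - Lm (\<rho> k) (lshift x g) \<in> D1"
        unfolding D1_def D2_def using k g SK[OF x] G'lshift[OF x] by blast+
      then have "L (prd x k) g + (L k (lshift x g) - Lm (\<rho> k) (lshift x g)) \<in> D"
        by (intro fs.subspace_add[OF Dsub]) (simp_all add: D_def fs.span_base)
      then show ?thesis by (simp add: lshift_diff lshift_L[OF x] lshift_Lm add_diff_eq)
    qed
    ultimately have "D \<subseteq> {g. lshift x g \<in> D}"
      unfolding D_def by (intro fs.span_minimal) (auto simp: D1_def D2_def)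
    then show ?thesis using g by blast
  qed
  obtain Y' where Y': "fd fsmul Y'" "D \<subseteq> Y'" "\<And>x y. x \<in> S \<Longrightarrow> y \<in> Y' \<Longrightarrow> lshift x y \<in> Y'"
    "\<And>k y. k \<in> K \<Longrightarrow> y \<in> Y' \<Longrightarrow> L k y \<in> Y'"
    "\<And>H. fs.subspace H \<Longrightarrow> D \<subseteq> H \<Longrightarrow> \<forall>k\<in>K. \<forall>f\<in>H. L k f \<in> H \<Longrightarrow> \<forall>b\<in>E. \<forall>f\<in>H. Lm b f \<in> H \<Longrightarrow> Y' \<subseteq> H"
    using Suc.IH[OF Dfd Dlev Dshift] by metis
  have Y'sub: "fs.subspace Y'" by (rule fs.fd_subspaceD[OF Y'(1)])
  define Y where "Y = {u + v | u v. u \<in> G' \<and> v \<in> Y'}"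
  have Ysub: "fs.subspace Y" unfolding Y_def by (rule fs.subspace_sums[OF G'sub Y'sub])
  have G'Y: "G' \<subseteq> Y"
  proof
    fix g assume "g \<in> G'"
    then have "g + 0 \<in> Y" unfolding Y_def using fs.subspace_0[OF Y'sub] by blast
    then show "g \<in> Y" by simp
  qed
  have Y'Y: "Y' \<subseteq> Y"
  proof
    fix g assume "g \<in> Y'"
    then have "0 + g \<in> Y" unfolding Y_def using fs.subspace_0[OF G'sub] by blast
    then show "g \<in> Y" by simp
  qed
  show ?case
  proof (intro exI[of _ Y] conjI ballI allI impI)
    show "fd fsmul Y" unfolding Y_def by (rule fs.fd_sum[OF G'fd Y'(1)])
    show "G \<subseteq> Y" using GG' G'Y by blast
    show "lshift x y \<in> Y" if x: "x \<in> S" and y: "y \<in> Y" for x y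
    proof -
      obtain u v where uv: "y = u + v" "u \<in> G'" "v \<in> Y'" using y unfolding Y_def by blast
      have "lshift x y = lshift x u + lshift x v" unfolding uv(1) by (rule lshift_add)
      then show ?thesis unfolding Y_def using G'lshift[OF x uv(2)] Y'(3)[OF x uv(3)] by blast
    qed
    show "L k y \<in> Y" if k: "k \<in> K" and y: "y \<in> Y" for k y
    proof -
      obtain u v where uv: "y = u + v" "u \<in> G'" "v \<in> Y'" using y unfolding Y_def by blast
      have "L k u - Lm (\<rho> k) u \<in> D" unfolding D_def using k uv(2) by (intro fs.span_base) (auto simp: D1_def)
      then have 1: "L k u - Lm (\<rho> k) u + L k v \<in> Y'"
        using Y'(2,4) k uv(3) fs.subspace_add[OF Y'sub] by blast
      have "L k y = L k u + L k v" unfolding uv(1) by (rule L_add_right)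
      then have "L k y = Lm (\<rho> k) u + (L k u - Lm (\<rho> k) u + L k v)" by (simp only: diff_add_eq add_diff_eq add_diff_cancel_left')
      then show ?thesis unfolding Y_def using G'Lm[OF E_rho[OF k] uv(2)] 1 by blast
    qed
    \<comment> \<open>This clause is the induction principle for \<open>Y\<close>. Later it gives
      both that \<open>Y\<close> lies in \<open>C\<close> and that certain shifts are locally
      nilpotent on \<open>Y\<close>.\<close>
    fix H assume H: "fs.subspace H" "G \<subseteq> H" "\<forall>k\<in>K. \<forall>f\<in>H. L k f \<in> H" "\<forall>b\<in>E. \<forall>f\<in>H. Lm b f \<in> H"
    have 1: "G' \<subseteq> H" unfolding G'_def by (rule fs.span_minimal[OF _ H(1)]) (use H in blast)
    have "D \<subseteq> H" unfolding D_def
    proof (rule fs.span_minimal[OF _ H(1)])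
      show "D1 \<union> D2 \<subseteq> H" unfolding D1_def D2_def
        using 1 H(3,4) E_rho fs.subspace_diff[OF H(1)] I(2) by blast
    qed
    from Y'(5)[OF H(1) this H(3,4)] show "Y \<subseteq> H"
      unfolding Y_def using 1 fs.subspace_add[OF H(1)] by blast
  qed
qed

end

section \<open>The representation of the semidirect sum\<close>

context semidirect
begin

definition sdir :: "'v set" where
  "sdir = {x + k | x k. x \<in> S \<and> k \<in> K}"

definition Sc :: "'v \<Rightarrow> 'v" where
  "Sc v = (SOME x. x \<in> S \<and> v - x \<in> K)"

definition act :: "'v \<Rightarrow> ('v list \<Rightarrow> 'f rmat) \<Rightarrow> 'v list \<Rightarrow> 'f rmat" where
  "act v f = lshift (Sc v) f + L (v - Sc v) f"

lemma sdirI: "x \<in> S \<Longrightarrow> k \<in> K \<Longrightarrow> x + k \<in> sdir"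
  unfolding sdir_def by blast

lemma sdirE:
  assumes "v \<in> sdir"
  obtains x k where "v = x + k" "x \<in> S" "k \<in> K"
  using assms unfolding sdir_def by blast

lemma K_sdir: "k \<in> K \<Longrightarrow> k \<in> sdir"
  using sdirI[of 0 k] subspace_0[OF S_sub] by simp

lemma S_sdir: "x \<in> S \<Longrightarrow> x \<in> sdir"
  using sdirI[of x 0] subspace_0[OF K_sub] by simp

lemma Sc_eq:
  assumes x: "x \<in> S" and k: "k \<in> K"
  shows "Sc (x + k) = x"
proof -
  have "x \<in> S \<and> (x + k) - x \<in> K" using assms by simp
  then have s: "Sc (x + k) \<in> S \<and> (x + k) - Sc (x + k) \<in> K" unfolding Sc_def by (rule someI)
  then have "x - Sc (x + k) \<in> S" using subspace_diff[OF S_sub x] by blast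
  moreover have "((x + k) - Sc (x + k)) - k \<in> K" using subspace_diff[OF K_sub _ k] s by blast
  moreover have "((x + k) - Sc (x + k)) - k = x - Sc (x + k)" by simp
  ultimately have "x - Sc (x + k) \<in> S \<inter> K" by simp
  then show ?thesis using disj by simp
qed

lemma act_eq: "x \<in> S \<Longrightarrow> k \<in> K \<Longrightarrow> act (x + k) f = lshift x f + L k f"
  unfolding act_def by (simp only: Sc_eq add_diff_cancel_left')

lemma sdir_prd:
  assumes "x \<in> S" "k \<in> K" "y \<in> S" "l \<in> K"
  shows "prd (x + k) (y + l) = prd x y + (prd x l - prd y k + prd k l)"
proof -
  note V = S_V[OF assms(1)] K_V[OF assms(2)] S_V[OF assms(3)] K_V[OF assms(4)]
  have "prd (x + k) (y + l) = (prd x y + prd x l) + (prd k y + prd k l)"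
    using V by (simp add: prd_add_left prd_add_right V_closed)
  then show ?thesis using antisym[OF V(3,2)] by simp
qed

lemma sdir_K:
  assumes "x \<in> S" "k \<in> K" "y \<in> S" "l \<in> K"
  shows "prd x l - prd y k + prd k l \<in> K"
  using assms by (intro subspace_add[OF K_sub] subspace_diff[OF K_sub] SK_K K_prd)

lemma sdir_subalg: "lie_subalg sdir"
  unfolding lie_subalg_def
proof (intro conjI ballI)
  show "subspace sdir" unfolding sdir_def by (rule subspace_sums[OF S_sub K_sub])
  show "sdir \<subseteq> V" unfolding sdir_def using S_V K_V V_closed(2) by blast
  fix v w assume "v \<in> sdir" "w \<in> sdir"
  then obtain x k y l where *: "v = x + k" "x \<in> S" "k \<in> K" "w = y + l" "y \<in> S" "l \<in> K"
    by (elim sdirE) blast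
  show "prd v w \<in> sdir" unfolding *(1,4) sdir_prd[OF *(2,3,5,6)]
    by (rule sdirI[OF S_prd[OF *(2,5)] sdir_K[OF *(2,3,5,6)]])
qed

text \<open>Functions supported on the empty word, the unit of the enveloping algebra.
  \<open>S\<close> kills them, and evaluation at the empty word returns their values compatibly with
  \<open>K\<close>; this keeps the old representation visible in the new one.\<close>

definition ini :: "'f rmat \<Rightarrow> 'v list \<Rightarrow> 'f rmat" where
  "ini v = (\<lambda>w. if w = [] then v else 0)"

lemma lshift_ini: "lshift x (ini v) = 0"
  by (simp add: ini_def lshift_def fun_eq_iff)

lemma ini_C:
  assumes "v \<in> Mat d"
  shows "ini v \<in> C"
proof -
  have "compat (shifts u (ini v))" for u
  proof (cases u)
    case Nil
    have "ini v w \<in> Mat d" for w using assms by (simp add: ini_def Mat_closed)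
    moreover have "lshift x 0 = (0 :: 'v list \<Rightarrow> 'f rmat)" for x :: 'v by (rule lshift_zero)
    ultimately have "compat (ini v)" unfolding compat_def by (simp only: lshift_ini fs.scale_zero_right) simp
    then show ?thesis using Nil by simp
  next
    case (Cons x u')
    then show ?thesis using compat_zero by (simp only: shifts.simps lshift_ini shifts_zero)
  qed
  then show ?thesis by (simp add: C_def)
qed

lemma ini_add: "ini (v + w) = ini v + ini w"
  by (simp add: ini_def fun_eq_iff)

lemma ini_scale: "ini (smul c v) = fsmul c (ini v)"
  by (simp add: ini_def fsmul_def fun_eq_iff)

lemma ini_fd: "fd fsmul (ini ` Mat d)"
proof -
  have z: "ini 0 = 0" by (simp add: ini_def fun_eq_iff)
  have sub: "fs.subspace (ini ` Mat d)"
  proof (rule fs.subspaceI)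
    show "0 \<in> ini ` Mat d" unfolding z[symmetric] by (rule imageI[OF Mat_closed(1)])
    fix f assume "f \<in> ini ` Mat d"
    then obtain v where v: "f = ini v" "v \<in> Mat d" by blast
    show "fsmul c f \<in> ini ` Mat d" for c
      unfolding v(1) ini_scale[symmetric] by (rule imageI[OF Mat_closed(5)[OF v(2)]])
    fix g assume "g \<in> ini ` Mat d"
    then obtain w where w: "g = ini w" "w \<in> Mat d" by blast
    show "f + g \<in> ini ` Mat d"
      unfolding v(1) w(1) ini_add[symmetric] by (rule imageI[OF Mat_closed(2)[OF v(2) w(2)]])
  qed
  obtain B where B: "finite B" "B \<subseteq> Mat d" "rm.span B = (Mat d :: 'f rmat set)" using rm.fd_basis[OF Mat_fd] .
  have "rm.subspace {v. ini v \<in> fs.span (ini ` B)}"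
    by (rule rm.subspaceI) (simp_all only: mem_Collect_eq z ini_add ini_scale fs.span_zero fs.span_add fs.span_scale)
  then have "Mat d \<subseteq> {v. ini v \<in> fs.span (ini ` B)}"
    unfolding B(3)[symmetric] by (intro rm.span_minimal) (auto intro: fs.span_base)
  then show ?thesis using B(1) by (intro fs.fdI[OF sub, of "ini ` B"]) auto
qed

text \<open>Nilpotency on \<open>I\<close> is read off from the levels, nonvanishing from the value
  at the empty word. The last clause serves enlargements inside a nilpotent ideal, where the added
  element must act nilpotently as well.\<close>

theorem extension:
  obtains d' \<rho>' where "lie_rep scale {x + k | x k. x \<in> S \<and> k \<in> K} prd d' \<rho>'" "nilset (\<rho>' ` I)"
    "\<forall>k\<in>K. \<rho> k \<noteq> 0 \<longrightarrow> \<rho>' k \<noteq> 0"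
    "\<forall>x\<in>S. (\<forall>k\<in>K. \<exists>n. (prd x ^^ n) k = 0) \<longrightarrow> (\<exists>m. \<rho>' x ^ m = 0)"
proof -
  obtain q where q: "1 \<in> lann (\<rho> ` I) q" using nil by (auto simp: nilset_def)
  have all: "a \<in> lann (\<rho> ` I) q" for a by (rule lann_one[OF q])
  have "ini v \<in> lev q" if "v \<in> Mat d" for v
    using that all Mat_closed(1) by (auto simp: lev_def ini_def)
  then have Glev: "ini ` Mat d \<subseteq> lev q" by blast
  have Gshift: "lshift x g \<in> ini ` Mat d" if "g \<in> ini ` Mat d" for x g
  proof -
    obtain v where "g = ini v" using \<open>g \<in> ini ` Mat d\<close> by blast
    then have "lshift x g = 0" by (simp only: lshift_ini)
    then show ?thesis using fs.subspace_0[OF fs.fd_subspaceD[OF ini_fd]] by simp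
  qed
  obtain Y where Y0: "fd fsmul Y \<and> ini ` Mat d \<subseteq> Y \<and> (\<forall>x\<in>S. \<forall>y\<in>Y. lshift x y \<in> Y) \<and> (\<forall>k\<in>K. \<forall>y\<in>Y. L k y \<in> Y) \<and>
    (\<forall>H. fs.subspace H \<longrightarrow> ini ` Mat d \<subseteq> H \<longrightarrow> (\<forall>k\<in>K. \<forall>f\<in>H. L k f \<in> H) \<longrightarrow> (\<forall>b\<in>E. \<forall>f\<in>H. Lm b f \<in> H) \<longrightarrow> Y \<subseteq> H)"
    using finite_submodule[OF ini_fd Glev Gshift] by (rule exE)
  have Y: "fd fsmul Y" "ini ` Mat d \<subseteq> Y" "\<And>x y. x \<in> S \<Longrightarrow> y \<in> Y \<Longrightarrow> lshift x y \<in> Y"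
    "\<And>k y. k \<in> K \<Longrightarrow> y \<in> Y \<Longrightarrow> L k y \<in> Y"
    "\<And>H. fs.subspace H \<Longrightarrow> ini ` Mat d \<subseteq> H \<Longrightarrow> \<forall>k\<in>K. \<forall>f\<in>H. L k f \<in> H \<Longrightarrow> \<forall>b\<in>E. \<forall>f\<in>H. Lm b f \<in> H \<Longrightarrow> Y \<subseteq> H"
    using Y0 by simp_all
  note Ysub = fs.fd_subspaceD[OF Y(1)]
  have "Y \<subseteq> C"
    by (rule Y(5)[OF C_subspace]) (use ini_C C_L C_Lm E_Mat in blast)+
  then have comp: "compat y" if "y \<in> Y" for y using C_compat that by blast
  have sh_add: "lshift (x + y) f = lshift x f + lshift y f"
    and sh_prd: "lshift (prd x y) f = lshift x (lshift y f) - lshift y (lshift x f)"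
    if "f \<in> Y" "x \<in> S" "y \<in> S" for f x y
    using comp[OF that(1)] that(2,3) unfolding compat_def by blast+
  have sh_scale: "lshift (scale c x) f = fsmul c (lshift x f)" if "f \<in> Y" "x \<in> S" for c f x
    using comp[OF that(1)] that(2) unfolding compat_def by blast
  interpret A: lie_algebra_char_0 scale sdir prd by (rule lie_subalg_algebra[OF sdir_subalg])
  interpret Y: lie_module scale sdir prd fsmul Y act
  proof (intro lie_module.intro lie_module_axioms.intro)
    show "lie_algebra_char_0 scale sdir prd" by (rule A.lie_algebra_char_0_axioms)
    show "vector_space (fsmul :: 'f \<Rightarrow> ('v list \<Rightarrow> 'f rmat) \<Rightarrow> _)" by (rule fs.vector_space_axioms)
    show "fs.subspace Y" by (rule Ysub)
    fix v assume "v \<in> sdir"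
    then obtain x k where v: "v = x + k" "x \<in> S" "k \<in> K" by (rule sdirE)
    show "lin_on fsmul Y (act v)" unfolding lin_on_def v(1) act_eq[OF v(2,3)]
    proof (intro conjI ballI allI)
      show "lshift x w + L k w \<in> Y" if "w \<in> Y" for w
        using that by (intro fs.subspace_add[OF Ysub] Y v)
      show "lshift x (f + g) + L k (f + g) = lshift x f + L k f + (lshift x g + L k g)" for f g
        unfolding lshift_add L_add_right by (simp only: ac_simps)
      show "lshift x (fsmul c f) + L k (fsmul c f) = fsmul c (lshift x f + L k f)" for c f
        unfolding lshift_scale L_scale_right by (simp only: fs.scale_right_distrib)
    qed
    show "act (scale c v) f = fsmul c (act v f)" if "f \<in> Y" for c f
      unfolding v(1) scale_right_distrib act_eq[OF v(2,3)]
        act_eq[OF subspace_scale[OF S_sub v(2)] subspace_scale[OF K_sub v(3)]]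
        sh_scale[OF that v(2)] L_scale_left[OF v(3)] fs.scale_right_distrib ..
    fix w assume "w \<in> sdir"
    then obtain y l where w: "w = y + l" "y \<in> S" "l \<in> K" by (rule sdirE)
    fix f assume f: "f \<in> Y"
    have "v + w = (x + y) + (k + l)" by (simp add: v(1) w(1) ac_simps)
    then have "act (v + w) f = lshift (x + y) f + L (k + l) f"
      using act_eq[OF subspace_add[OF S_sub v(2) w(2)] subspace_add[OF K_sub v(3) w(3)]] by simp
    also have "\<dots> = act v f + act w f"
      unfolding v(1) w(1) act_eq[OF v(2,3)] act_eq[OF w(2,3)] sh_add[OF f v(2) w(2)] L_add_left[OF v(3) w(3)]
      by (simp only: ac_simps)
    finally show "act (v + w) f = act v f + act w f" .
    note xl = SK_K[OF v(2) w(3)] and yk = SK_K[OF w(2) v(3)] and kl = K_prd[OF v(3) w(3)]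
    have "act (prd v w) f = lshift (prd x y) f + L (prd x l - prd y k + prd k l) f"
      unfolding v(1) w(1) sdir_prd[OF v(2,3) w(2,3)]
      by (rule act_eq[OF S_prd[OF v(2) w(2)] sdir_K[OF v(2,3) w(2,3)]])
    also have "\<dots> = (lshift x (lshift y f) - lshift y (lshift x f)) + (L (prd x l) f - L (prd y k) f + (L k (L l f) - L l (L k f)))"
      by (simp only: sh_prd[OF f v(2) w(2)] L_add_left[OF subspace_diff[OF K_sub xl yk] kl] L_diff_left[OF xl yk] L_lie[OF v(3) w(3)])
    also have "\<dots> = act v (act w f) - act w (act v f)"
      unfolding v(1) w(1) act_eq[OF v(2,3)] act_eq[OF w(2,3)] lshift_add L_add_right lshift_L[OF v(2)] lshift_L[OF w(2)]
      by (simp only: algebra_simps)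
    finally show "act (prd v w) f = act v (act w f) - act w (act v f)" .
  qed
  obtain d' M where "fd_lie_module scale sdir prd fsmul Y act d' M"
    by (rule Y.fd_lie_module_exists[OF Y(1)])
  then interpret F: fd_lie_module scale sdir prd fsmul Y act d' M .
  have zK: "0 \<in> K" and zS: "0 \<in> S" using subspace_0 K_sub S_sub by blast+
  have shift0: "lshift 0 f = 0" if "f \<in> Y" for f
    using sh_scale[OF that zS, of 0] by simp
  have actK: "act k f = L k f" if "k \<in> K" "f \<in> Y" for k f
    using act_eq[OF zS that(1), of f] shift0[OF that(2)] by simp
  have L0: "L 0 f = 0" for f using L_scale_left[OF zK, of 0 f] by simp
  have actS: "act x f = lshift x f" if "x \<in> S" for x f
    using act_eq[OF that zK, of f] L0 by simp
  show thesis
  proof (rule that)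
    show "lie_rep scale {x + k | x k. x \<in> S \<and> k \<in> K} prd d' F.R"
      using F.lie_rep_R unfolding sdir_def .
    show "nilset (F.R ` I)"
    proof (rule F.nilset_if_vann)
      show "I \<subseteq> sdir" using I(2) K_sdir by blast
      have "f \<in> vann act I p" if "f \<in> lev p" "f \<in> Y" for f p
        using that
      proof (induction p arbitrary: f)
        case 0
        then show ?case by (auto simp: lev_def fun_eq_iff)
      next
        case (Suc p)
        have "act i f \<in> vann act I p" if i: "i \<in> I" for i
        proof -
          have iK: "i \<in> K" using i I(2) by blast
          show ?thesis unfolding actK[OF iK Suc.prems(2)]
            by (rule Suc.IH[OF lev_L_ideal[OF Suc.prems(1) i] Y(4)[OF iK Suc.prems(2)]])
        qed
        then show ?case by simp
      qed
      moreover have "f \<in> lev q" if "f \<in> Y" for f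
        using comp[OF that] all by (simp add: compat_def lev_def)
      ultimately show "Y \<subseteq> vann act I q" by blast
    qed
    show "\<forall>k\<in>K. \<rho> k \<noteq> 0 \<longrightarrow> F.R k \<noteq> 0"
    proof (intro ballI impI)
      fix k assume k: "k \<in> K" and nz: "\<rho> k \<noteq> 0"
      have y: "ini (Pd d) \<in> Y" using Y(2) Pd_Mat by blast
      have "L k (ini (Pd d)) [] = \<rho> k" unfolding L_Nil by (simp add: ini_def Pd_right[OF rho_Mat[OF k]])
      then have "act k (ini (Pd d)) \<noteq> 0" unfolding actK[OF k y] using nz by auto
      then show "F.R k \<noteq> 0" using F.M_zero[OF Y.act_lin[OF K_sdir[OF k]]] y by blast
    qed
    show "\<forall>x\<in>S. (\<forall>k\<in>K. \<exists>n. (prd x ^^ n) k = 0) \<longrightarrow> (\<exists>m. F.R x ^ m = 0)"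
    proof (intro ballI impI)
      fix x assume x: "x \<in> S" and loc: "\<forall>k\<in>K. \<exists>n. (prd x ^^ n) k = 0"
      \<comment> \<open>The functions on which the shift by \<open>x\<close> is locally nilpotent.
        The induction principle of \<open>finite_submodule\<close> shows that they include all of
        \<open>Y\<close>.\<close>
      define H where "H = {f :: 'v list \<Rightarrow> 'f rmat. \<exists>n. (lshift x ^^ n) f = 0}"
      have pz: "(lshift x ^^ n) 0 = (0 :: 'v list \<Rightarrow> 'f rmat)" for n
        by (induction n) (simp_all only: funpow.simps id_apply comp_apply lshift_zero)
      have pa: "(lshift x ^^ n) (f + g) = (lshift x ^^ n) f + (lshift x ^^ n) g" for n and f g :: "'v list \<Rightarrow> 'f rmat"
        by (induction n) (simp_all only: funpow.simps id_apply comp_apply lshift_add)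
      have ps: "(lshift x ^^ n) (fsmul c f) = fsmul c ((lshift x ^^ n) f)" for n c f
        by (induction n) (simp_all only: funpow.simps id_apply comp_apply lshift_scale)
      have pm: "(lshift x ^^ m) f = 0" if "(lshift x ^^ n) f = 0" "n \<le> m" for n m and f :: "'v list \<Rightarrow> 'f rmat"
      proof -
        have "(lshift x ^^ ((m - n) + n)) f = (lshift x ^^ (m - n)) ((lshift x ^^ n) f)"
          by (simp only: funpow_add comp_apply)
        then show ?thesis using that pz by simp
      qed
      have Hs: "fs.subspace H"
      proof (rule fs.subspaceI)
        show "0 \<in> H" unfolding H_def using pz by blast
        show "fsmul c f \<in> H" if "f \<in> H" for c f
          using that unfolding H_def mem_Collect_eq ps by force
        fix f g assume "f \<in> H" "g \<in> H"
        then obtain m n where "(lshift x ^^ m) f = 0" "(lshift x ^^ n) g = 0" unfolding H_def by blast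
        then have "(lshift x ^^ (m + n)) f = 0" "(lshift x ^^ (m + n)) g = 0" using pm by (meson le_add1 le_add2)+
        then have "(lshift x ^^ (m + n)) (f + g) = 0" unfolding pa by simp
        then show "f + g \<in> H" unfolding H_def by blast
      qed
      \<comment> \<open>The Leibniz rule: shifting L k f by \<open>x\<close> gives L [x, k] f plus L
        k applied to the shifted \<open>f\<close>, so a + b shifts exhaust both arguments.\<close>
      have HL: "(lshift x ^^ (a + b)) (L k f) = 0"
        if "(prd x ^^ a) k = 0" "(lshift x ^^ b) f = 0" "k \<in> K" for a b k f
        using that
      proof (induction "a + b" arbitrary: a b k f)
        case 0
        then show ?case using L0 by simp
      next
        case (Suc n)
        show ?case
        proof (cases "a = 0 \<or> b = 0")
          case True
          then have "L k f = 0" using Suc.prems L0 L_zero_right by auto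
          then show ?thesis using pz by simp
        next
          case False
          then obtain a' b' where ab: "a = Suc a'" "b = Suc b'" by (meson not0_implies_Suc)
          have 1: "(lshift x ^^ (a' + b)) (L (prd x k) f) = 0"
            using Suc.prems SK_K[OF x] Suc.hyps(2)
            by (intro Suc.hyps(1)) (simp_all add: ab funpow_swap1)
          have 2: "(lshift x ^^ (a + b')) (L k (lshift x f)) = 0"
            using Suc.prems Suc.hyps(2)
            by (intro Suc.hyps(1)) (simp_all add: ab funpow_swap1)
          have "(lshift x ^^ (a + b)) (L k f) = (lshift x ^^ (a' + b)) (lshift x (L k f))"
            by (simp add: ab funpow_swap1)
          also have "\<dots> = (lshift x ^^ (a' + b)) (L (prd x k) f) + (lshift x ^^ (a' + b)) (L k (lshift x f))"
            unfolding lshift_L[OF x] by (rule pa)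
          also have "a' + b = a + b'" by (simp add: ab)
          then have "(lshift x ^^ (a' + b)) (L (prd x k) f) + (lshift x ^^ (a' + b)) (L k (lshift x f)) = 0"
            unfolding 1 using 2 by (simp only: add_0)
          finally show ?thesis .
        qed
      qed
      have "Y \<subseteq> H"
      proof (rule Y(5)[OF Hs])
        show "ini ` Mat d \<subseteq> H"
        proof
          fix f assume "f \<in> ini ` Mat d"
          then obtain v where "f = ini v" by blast
          then have "(lshift x ^^ 1) f = 0" using lshift_ini by simp
          then show "f \<in> H" unfolding H_def by blast
        qed
        show "\<forall>k\<in>K. \<forall>f\<in>H. L k f \<in> H" unfolding H_def using loc HL by blast
        have c: "(lshift x ^^ n) (Lm b f) = Lm b ((lshift x ^^ n) f)" for n b f
          by (induction n) (simp_all only: funpow.simps id_apply comp_apply lshift_Lm)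
        show "\<forall>b\<in>E. \<forall>f\<in>H. Lm b f \<in> H"
        proof (intro ballI)
          fix b f assume "f \<in> H"
          then obtain n where "(lshift x ^^ n) f = 0" unfolding H_def by blast
          then have "(lshift x ^^ n) (Lm b f) = 0" by (simp only: c Lm_zero)
          then show "Lm b f \<in> H" unfolding H_def by blast
        qed
      qed
      moreover have "(act x ^^ n) f = (lshift x ^^ n) f" for n f
        by (induction n) (simp_all only: funpow.simps id_apply comp_apply actS[OF x])
      ultimately have "\<exists>n. (act x ^^ n) f = 0" if "f \<in> Y" for f
        using that unfolding H_def by auto
      from F.nilpotent_if_locally[OF Y(1) S_sdir[OF x] this] show "\<exists>m. F.R x ^ m = 0" .
    qed
  qed
qed

end

section \<open>Ado's theorem\<close>

context lie_algebra_char_0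
begin

text \<open>The property carried along the chain of enlargements from the line of \<open>z\<close>
  up to the radical.\<close>

definition unipotent_rep :: "'v \<Rightarrow> 'v set \<Rightarrow> 'v set \<Rightarrow> bool" where
  "unipotent_rep z N K \<longleftrightarrow> (\<exists>d \<rho>. lie_rep scale K prd d \<rho> \<and> \<rho> z \<noteq> 0 \<and> nilset (\<rho> ` (K \<inter> N)))"

text \<open>The multiple c z acts as c times \<open>Eu 0 1\<close>, whose square is 0.\<close>

lemma unipotent_rep_line:
  assumes z: "z \<in> V" "z \<noteq> 0"
  shows "unipotent_rep z N (span {z})"
proof -
  define cf where "cf v = (SOME c. v = scale c z)" for v
  have cf: "cf (scale c z) = c" for c
  proof -
    have "scale c z = scale (cf (scale c z)) z" unfolding cf_def by (rule someI) (rule refl)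
    then show ?thesis using z(2) by (metis scale_cancel_right)
  qed
  define \<rho> where "\<rho> v = smul (cf v) (Eu 0 1)" for v
  have rho: "\<rho> (scale c z) = smul c (Eu 0 1)" for c by (simp add: \<rho>_def cf)
  have E2: "(Eu 0 1 :: 'f rmat) * Eu 0 1 = 0"
    by (rule rmat_eqI, subst ent_times[of "{1}"]) (auto simp: Eu.rep_eq zero_rmat.rep_eq)
  have rr: "\<rho> v * \<rho> w = 0" for v w unfolding \<rho>_def smul_mult_left smul_mult_right E2 by simp
  have line: "\<exists>c. v = scale c z" if "v \<in> span {z}" for v
    using that by (auto simp: span_singleton)
  have "lie_rep scale (span {z}) prd 2 \<rho>"
    unfolding lie_rep_def
  proof (intro conjI ballI allI)
    have "Eu 0 1 \<in> Mat 2" by (auto simp: Mat_def Eu.rep_eq)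
    then show "\<rho> v \<in> Mat 2" for v unfolding \<rho>_def by (rule Mat_closed(5))
    fix v assume "v \<in> span {z}"
    then obtain a where a: "v = scale a z" using line by blast
    show "\<rho> (scale c v) = smul c (\<rho> v)" for c unfolding a by (simp add: rho)
    fix w assume "w \<in> span {z}"
    then obtain b where b: "w = scale b z" using line by blast
    show "\<rho> (v + w) = \<rho> v + \<rho> w"
      unfolding a b scale_left_distrib[symmetric] rho by (rule rm.scale_left_distrib)
    have "prd v w = scale 0 z" unfolding a b using z(1) alternating by (simp add: prd_scale_left prd_scale_right V_closed)
    then show "\<rho> (prd v w) = \<rho> v * \<rho> w - \<rho> w * \<rho> v" using rho[of 0] by (simp add: rr)
  qed
  moreover have "\<rho> z \<noteq> 0"
  proof
    assume "\<rho> z = 0"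
    then have "ent (Eu 0 1 :: 'f rmat) 0 1 = 0" using rho[of 1] by (simp add: zero_rmat.rep_eq)
    then show False by (simp add: Eu.rep_eq)
  qed
  moreover have "1 \<in> lann (\<rho> ` (span {z} \<inter> N)) (Suc (Suc 0))" by (auto simp: rr)
  ultimately show ?thesis unfolding unipotent_rep_def nilset_def by blast
qed

text \<open>If \<open>K\<close> already contains \<open>N\<close>, the part inside \<open>N\<close>
  does not grow. If \<open>K\<close> is still inside \<open>N\<close>, the new element must act
  nilpotently too; the last clause of \<open>extension\<close> supplies this, and
  \<open>nilset_extend\<close> adjoins the element.\<close>

lemma unipotent_rep_step:
  assumes fdV: "fd scale V" and z: "z \<in> K" and N: "lie_ideal N" and K: "lie_subalg K"
    and rep: "unipotent_rep z N K" and x: "x \<in> V" "x \<notin> K" and xK: "\<And>k. k \<in> K \<Longrightarrow> prd x k \<in> K \<inter> N"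
    and cases: "N \<subseteq> K \<or> K \<subseteq> N \<and> x \<in> N \<and> (\<forall>v\<in>V. \<exists>n. (prd x ^^ n) v = 0)"
  shows "lie_subalg {s + k | s k. s \<in> span {x} \<and> k \<in> K} \<and> unipotent_rep z N {s + k | s k. s \<in> span {x} \<and> k \<in> K}"
proof -
  note n = lie_idealD[OF N] and kk = lie_subalgD[OF K]
  obtain d \<rho> where r: "lie_rep scale K prd d \<rho>" "\<rho> z \<noteq> 0" "nilset (\<rho> ` (K \<inter> N))"
    using rep unfolding unipotent_rep_def by blast
  have spV: "span {x} \<subseteq> V" using span_minimal[of "{x}" V] x(1) subspace_carrier by simp
  have line: "\<exists>c. v = scale c x" if "v \<in> span {x}" for v
    using that by (auto simp: span_singleton)
  have KN: "subspace (K \<inter> N)" by (rule subspace_inter[OF kk(1) n(1)])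
  interpret semidirect scale V prd "span {x}" K "K \<inter> N" d \<rho>
  proof (intro semidirect.intro semidirect_axioms.intro)
    show "lie_algebra_char_0 scale V prd" by (rule lie_algebra_char_0_axioms)
    show "fd scale K" by (rule fd_subset[OF fdV kk(1)]) (use kk(2) in blast)
    show "lie_subalg (span {x})" unfolding lie_subalg_def
    proof (intro conjI ballI subspace_span spV)
      fix v w assume "v \<in> span {x}" "w \<in> span {x}"
      then obtain a b where "v = scale a x" "w = scale b x" using line by blast
      then have "prd v w = 0" using x(1) alternating by (simp add: prd_scale_left prd_scale_right V_closed)
      then show "prd v w \<in> span {x}" using span_zero by simp
    qed
    show "prd v k \<in> K \<inter> N" if v: "v \<in> span {x}" and k: "k \<in> K" for v k
    proof -
      obtain c where "v = scale c x" using line[OF v] by blast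
      then have "prd v k = scale c (prd x k)" using prd_scale_left[OF x(1) kk(2)[OF k]] by simp
      then show ?thesis using subspace_scale[OF KN xK[OF k]] by simp
    qed
    show "prd k i \<in> K \<inter> N" if "k \<in> K" "i \<in> K \<inter> N" for k i
      using kk(2,3) n(3) that by blast
    show "span {x} \<inter> K = {0}"
    proof -
      have "v = 0" if v: "v \<in> span {x}" "v \<in> K" for v
      proof (rule ccontr)
        assume v0: "v \<noteq> 0"
        obtain c where c: "v = scale c x" using line[OF v(1)] by blast
        then have "c \<noteq> 0" using v0 by auto
        then have "x = scale (inverse c) v" by (simp add: c)
        then show False using subspace_scale[OF kk(1) v(2)] x(2) by simp
      qed
      then show ?thesis using span_zero subspace_0[OF kk(1)] by blast
    qed
  qed (use K KN r in auto)
  let ?K = "{s + k | s k. s \<in> span {x} \<and> k \<in> K}"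
  obtain d' \<rho>' where e: "lie_rep scale ?K prd d' \<rho>'" "nilset (\<rho>' ` (K \<inter> N))"
    "\<forall>k\<in>K. \<rho> k \<noteq> 0 \<longrightarrow> \<rho>' k \<noteq> 0"
    "\<forall>x'\<in>span {x}. (\<forall>k\<in>K. \<exists>n. (prd x' ^^ n) k = 0) \<longrightarrow> (\<exists>m. \<rho>' x' ^ m = 0)"
    by (rule extension)
  have sub: "lie_subalg ?K" using sdir_subalg unfolding sdir_def .
  have xs: "x \<in> span {x}" by (simp add: span_base)
  have K_K: "k \<in> ?K" if "k \<in> K" for k using K_sdir[OF that] unfolding sdir_def .
  have x_K: "x \<in> ?K" using S_sdir[OF xs] unfolding sdir_def .
  have "nilset (\<rho>' ` (?K \<inter> N))"
    using cases
  proof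
    assume "N \<subseteq> K"
    then have "?K \<inter> N \<subseteq> K \<inter> N" by blast
    then show ?thesis by (rule nilset_subset[OF e(2) image_mono])
  next
    assume KN: "K \<subseteq> N \<and> x \<in> N \<and> (\<forall>v\<in>V. \<exists>n. (prd x ^^ n) v = 0)"
    then have KN': "K \<inter> N = K" by blast
    obtain m where m: "\<rho>' x ^ m = 0" using e(4) xs KN kk(2) by blast
    have cl: "h * \<rho>' x - \<rho>' x * h \<in> \<rho>' ` K" if h: "h \<in> \<rho>' ` K" for h
    proof -
      obtain k where k: "h = \<rho>' k" "k \<in> K" using h by blast
      have "prd k x = - prd x k" by (rule antisym[OF x(1) kk(2)[OF k(2)]])
      then have "prd k x \<in> K" using xK[OF k(2)] subspace_neg[OF kk(1), of "prd x k"] by simp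
      moreover have "h * \<rho>' x - \<rho>' x * h = \<rho>' (prd k x)"
        unfolding k(1) by (rule lie_repD(4)[OF e(1) K_K[OF k(2)] x_K, symmetric])
      ultimately show ?thesis by blast
    qed
    have nl: "nilset {h + smul c (\<rho>' x) | h c. h \<in> \<rho>' ` K}"
      by (rule nilset_extend[OF cl e(2)[unfolded KN'] m])
    have "\<rho>' ` ?K \<subseteq> {h + smul c (\<rho>' x) | h c. h \<in> \<rho>' ` K}"
    proof
      fix a assume "a \<in> \<rho>' ` ?K"
      then obtain s k where sk: "a = \<rho>' (s + k)" "s \<in> span {x}" "k \<in> K" by blast
      obtain c where c: "s = scale c x" using line[OF sk(2)] by blast
      have "scale c x \<in> ?K" using lie_subalgD(1)[OF sub] x_K by (rule subspace_scale)
      then have "a = smul c (\<rho>' x) + \<rho>' k"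
        unfolding sk(1) c using lie_repD(2)[OF e(1) _ K_K[OF sk(3)], of "scale c x"]
          lie_repD(3)[OF e(1) x_K x_K, of c] by simp
      then have "a = \<rho>' k + smul c (\<rho>' x)" by (simp only: add.commute)
      then show "a \<in> {h + smul c (\<rho>' x) | h c. h \<in> \<rho>' ` K}" using sk(3) by blast
    qed
    then show ?thesis by (intro nilset_subset[OF nl]) blast
  qed
  moreover have "\<rho>' z \<noteq> 0" using e(3) z r(2) by blast
  ultimately show ?thesis using sub e(1) unfolding unipotent_rep_def by blast
qed

lemma central_rep:
  assumes fdV: "fd scale V" and z: "z \<in> V" "z \<noteq> 0" "\<And>x. x \<in> V \<Longrightarrow> prd x z = 0"
  obtains d \<rho> where "lie_rep scale V prd d \<rho>" "\<rho> z \<noteq> 0"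
proof -
  obtain R where R: "solv R" "semisimple_mod R" by (rule radical_exists[OF fdV])
  note RI = solv_ideal[OF R(1)]
  note r = lie_idealD[OF RI]
  have line: "\<exists>c. v = scale c z" if "v \<in> span {z}" for v
    using that by (auto simp: span_singleton)
  have zl: "prd x v = 0" "prd v x = 0" "v \<in> V" if x: "x \<in> V" and v: "v \<in> span {z}" for x v
  proof -
    obtain c where c: "v = scale c z" using line[OF v] by blast
    then show 1: "v \<in> V" using z(1) V_closed(5) by simp
    show 2: "prd x v = 0" unfolding c using z(1,3) x by (simp add: prd_scale_right)
    show "prd v x = 0" using antisym[OF x 1] 2 by simp
  qed
  have add_line: "lie_ideal {u + v | u v. u \<in> A \<and> v \<in> span {z}}" if A: "lie_ideal A" for A
  proof (rule lie_idealI)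
    note a = lie_idealD[OF A]
    show "subspace {u + v | u v. u \<in> A \<and> v \<in> span {z}}" by (rule subspace_sums[OF a(1) subspace_span])
    show "{u + v | u v. u \<in> A \<and> v \<in> span {z}} \<subseteq> V" using a(2) zl(3)[OF z(1)] V_closed(2) by blast
    fix x w assume x: "x \<in> V" and "w \<in> {u + v | u v. u \<in> A \<and> v \<in> span {z}}"
    then obtain u v where uv: "w = u + v" "u \<in> A" "v \<in> span {z}" by blast
    have "prd x w = prd x u + 0"
      unfolding uv(1) prd_add_right[OF x a(2)[OF uv(2)] zl(3)[OF x uv(3)]] zl(1)[OF x uv(3)] ..
    then show "prd x w \<in> {u + v | u v. u \<in> A \<and> v \<in> span {z}}"
      using a(3)[OF x uv(2)] span_zero by blast
  qed
  \<comment> \<open>Adding a central line to \<open>R\<close> gives an ideal that is abelian modulo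
    \<open>R\<close>; as V / R is semisimple, \<open>z\<close> lies in \<open>R\<close>.\<close>
  have "{u + v | u v. u \<in> R \<and> v \<in> span {z}} = R"
  proof (rule semisimple_modD[OF R(2) add_line[OF RI]])
    show "R \<subseteq> {u + v | u v. u \<in> R \<and> v \<in> span {z}}"
    proof
      fix u assume "u \<in> R"
      then have "u + 0 \<in> {u + v | u v. u \<in> R \<and> v \<in> span {z}}" using span_zero by blast
      then show "u \<in> {u + v | u v. u \<in> R \<and> v \<in> span {z}}" by simp
    qed
    fix x y assume "x \<in> {u + v | u v. u \<in> R \<and> v \<in> span {z}}" "y \<in> {u + v | u v. u \<in> R \<and> v \<in> span {z}}"
    then obtain u v u' v' where uv: "x = u + v" "u \<in> R" "v \<in> span {z}" "y = u' + v'" "u' \<in> R" "v' \<in> span {z}" by blast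
    note uV = r(2)[OF uv(2)] r(2)[OF uv(5)] zl(3)[OF z(1) uv(3)] zl(3)[OF z(1) uv(6)]
    have "prd x y = prd u u'"
      unfolding uv(1,4) using uV zl(1,2) uv(3,6) by (simp add: prd_add_left prd_add_right V_closed)
    then show "prd x y \<in> R" using r(3)[OF uV(1) uv(5)] by simp
  qed
  moreover have "0 + z \<in> {u + v | u v. u \<in> R \<and> v \<in> span {z}}"
    using subspace_0[OF r(1)] span_base[of z "{z}"] by blast
  ultimately have zR: "z \<in> R" by simp
  define B where "B = brackets V R"
  have BI: "lie_ideal B" unfolding B_def by (rule lie_ideal_brackets[OF lie_ideal_V RI])
  note b = lie_idealD[OF BI]
  define N where "N = {u + v | u v. u \<in> B \<and> v \<in> span {z}}"
  have NI: "lie_ideal N" unfolding N_def by (rule add_line[OF BI])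
  note n = lie_idealD[OF NI]
  have BR: "B \<subseteq> R" unfolding B_def by (rule brackets_minimal) (use r in auto)
  have spR: "span {z} \<subseteq> R" using span_minimal[of "{z}" R] zR r(1) by simp
  have NR: "N \<subseteq> R" unfolding N_def using BR spR subspace_add[OF r(1)] by blast
  have BN: "B \<subseteq> N"
  proof
    fix u assume "u \<in> B"
    then have "u + 0 \<in> N" unfolding N_def using span_zero by blast
    then show "u \<in> N" by simp
  qed
  have spN: "span {z} \<subseteq> N"
  proof
    fix u assume "u \<in> span {z}"
    then have "0 + u \<in> N" unfolding N_def using subspace_0[OF b(1)] by blast
    then show "u \<in> N" by simp
  qed
  have VR: "prd x y \<in> N" if "x \<in> V" "y \<in> R" for x y
    using brackets_base[OF that] BN unfolding B_def by blast
  \<comment> \<open>The adjoint action of [V, R] is nilpotent by \<open>solv_nilset\<close>, and the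
    added central line acts as 0.\<close>
  obtain q where q: "V \<subseteq> vann prd N q"
  proof -
    interpret A: lie_module scale V prd scale V prd by (rule adjoint_module)
    obtain d M where "fd_lie_module scale V prd scale V prd d M" by (rule A.fd_lie_module_exists[OF fdV])
    then interpret F: fd_lie_module scale V prd scale V prd d M .
    have "nilset (F.R ` B)"
    proof (rule solv_nilset[OF F.lie_rep_R R(1) b(1)])
      have "B \<subseteq> brackets V V" unfolding B_def
        by (rule brackets_minimal) (use r(2) brackets_base in \<open>auto simp: brackets_def\<close>)
      then show "B \<subseteq> R \<inter> brackets V V" using BR by blast
    qed (use b in blast)
    moreover have "B \<subseteq> V" using b(2) by blast
    ultimately obtain q where q: "V \<subseteq> vann prd B q" by (rule F.nilset_vann)
    have "w \<in> vann prd N j" if "w \<in> V" "w \<in> vann prd B j" for w j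
      using that
    proof (induction j arbitrary: w)
      case (Suc j)
      have "prd x w \<in> vann prd N j" if "x \<in> N" for x
      proof -
        obtain u v where uv: "x = u + v" "u \<in> B" "v \<in> span {z}" using \<open>x \<in> N\<close> unfolding N_def by blast
        have "prd x w = prd u w" unfolding uv(1)
          using prd_add_left[OF b(2)[OF uv(2)] zl(3)[OF z(1) uv(3)] Suc.prems(1)] zl(2)[OF Suc.prems(1) uv(3)] by simp
        moreover have "prd u w \<in> vann prd N j"
          by (rule Suc.IH[OF prd_closed[OF b(2)[OF uv(2)] Suc.prems(1)]]) (use Suc.prems(2) uv(2) in simp)
        ultimately show ?thesis by simp
      qed
      then show ?case by simp
    qed simp
    then show thesis using q that by blast
  qed
  have adnil: "\<exists>j. (prd x ^^ j) v = 0" if x: "x \<in> N" and v: "v \<in> V" for x v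
  proof -
    have "(prd x ^^ j) w = 0" if "w \<in> vann prd N j" for w j
      using that
    proof (induction j arbitrary: w)
      case (Suc j)
      then have "(prd x ^^ j) (prd x w) = 0" using x by simp
      then show ?case by (simp add: funpow_swap1)
    qed simp
    then show ?thesis using q v by blast
  qed
  \<comment> \<open>The chain is made to pass through \<open>N\<close>, because
    \<open>unipotent_rep_step\<close> needs \<open>K\<close> to be comparable with
    \<open>N\<close>.\<close>
  define P where "P K \<longleftrightarrow> lie_subalg K \<and> z \<in> K \<and> K \<subseteq> R \<and> (K \<subseteq> N \<or> N \<subseteq> K) \<and> unipotent_rep z N K" for K
  have sz: "lie_subalg (span {z})" unfolding lie_subalg_def
  proof (intro conjI ballI subspace_span subsetI)
    show "v \<in> V" if "v \<in> span {z}" for v by (rule zl(3)[OF z(1) that])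
    fix v w assume v: "v \<in> span {z}" and w: "w \<in> span {z}"
    show "prd v w \<in> span {z}" unfolding zl(1)[OF zl(3)[OF z(1) v] w] by (rule span_zero)
  qed
  have Psub: "subspace U \<and> U \<subseteq> V" if "P U" for U
    using that unfolding P_def lie_subalg_def by blast
  have P0: "P (span {z})" unfolding P_def
    using sz unipotent_rep_line[OF z(1,2)] spR spN span_base[of z "{z}"] by blast
  obtain K where K: "P K" "\<And>K'. P K' \<Longrightarrow> K \<subseteq> K' \<Longrightarrow> K' = K"
    by (rule fd_maximal[of V P, OF fdV P0 Psub], assumption, blast)
  have Ks: "lie_subalg K" "z \<in> K" "K \<subseteq> R" "K \<subseteq> N \<or> N \<subseteq> K" "unipotent_rep z N K" using K(1) unfolding P_def by blast+
  note kk = lie_subalgD[OF Ks(1)]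
  have KR: "K = R"
  proof (rule ccontr)
    assume KR: "K \<noteq> R"
    have "\<exists>x. x \<in> R \<and> x \<notin> K \<and> (\<forall>k\<in>K. prd x k \<in> K \<inter> N) \<and> (N \<subseteq> K \<or> K \<subseteq> N \<and> x \<in> N)"
    proof (cases "N \<subseteq> K")
      case True
      obtain x where x: "x \<in> R" "x \<notin> K" using Ks(3) KR by blast
      have "prd x k \<in> K \<inter> N" if "k \<in> K" for k
        using VR[OF r(2)[OF x(1)], of k] that Ks(3) True by blast
      then show ?thesis using x True by blast
    next
      case False
      then have KN: "K \<subseteq> N" using Ks(4) by blast
      \<comment> \<open>An element of \<open>N\<close> outside \<open>K\<close> of least level in
        the adjoint filtration has all its brackets with \<open>K\<close> at a lower level, hence in
        \<open>K\<close>; so it normalises \<open>K\<close> and can be added.\<close>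
      define Q where "Q j \<longleftrightarrow> (\<exists>x\<in>N. x \<notin> K \<and> x \<in> vann prd N j)" for j
      obtain x0 where "x0 \<in> N" "x0 \<notin> K" using False by blast
      then have "Q q" unfolding Q_def using q n(2) by blast
      then have Q: "Q (LEAST j. Q j)" by (rule LeastI)
      obtain x where x: "x \<in> N" "x \<notin> K" "x \<in> vann prd N (LEAST j. Q j)" using Q unfolding Q_def by blast
      obtain j where j: "(LEAST j. Q j) = Suc j"
        using x(2,3) subspace_0[OF kk(1)] by (cases "LEAST j. Q j") auto
      have nQ: "\<not> Q j" using not_less_Least[of j Q] j by simp
      have "prd x k \<in> K \<inter> N" if k: "k \<in> K" for k
      proof -
        have kN: "k \<in> N" using KN k by blast
        have "prd k x \<in> vann prd N j" using x(3) kN unfolding j by simp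
        moreover have "prd k x \<in> N" by (rule n(3)[OF n(2)[OF kN] x(1)])
        ultimately have "prd k x \<in> K" using nQ unfolding Q_def by blast
        moreover have "prd x k = - prd k x" by (rule antisym[OF n(2)[OF kN] n(2)[OF x(1)]])
        ultimately show ?thesis using subspace_neg[OF kk(1)] KN by auto
      qed
      then show ?thesis using x KN NR by blast
    qed
    then obtain x where x: "x \<in> R" "x \<notin> K" "\<forall>k\<in>K. prd x k \<in> K \<inter> N" "N \<subseteq> K \<or> K \<subseteq> N \<and> x \<in> N" by blast
    let ?K = "{s + k | s k. s \<in> span {x} \<and> k \<in> K}"
    have step: "lie_subalg ?K \<and> unipotent_rep z N ?K"
    proof (rule unipotent_rep_step[OF fdV Ks(2) NI Ks(1,5) r(2)[OF x(1)] x(2)])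
      show "prd x k \<in> K \<inter> N" if "k \<in> K" for k using x(3) that by blast
      show "N \<subseteq> K \<or> K \<subseteq> N \<and> x \<in> N \<and> (\<forall>v\<in>V. \<exists>n. (prd x ^^ n) v = 0)" using x(4) adnil by blast
    qed
    have KK: "K \<subseteq> ?K"
    proof
      fix k assume "k \<in> K"
      then have "0 + k \<in> ?K" using span_zero by blast
      then show "k \<in> ?K" by simp
    qed
    have sx: "span {x} \<subseteq> W" if "subspace W" "x \<in> W" for W
      by (rule span_minimal[OF _ that(1)]) (use that in simp)
    have "?K \<subseteq> R" using sx[OF r(1) x(1)] Ks(3) subspace_add[OF r(1)] by blast
    moreover have "?K \<subseteq> N \<or> N \<subseteq> ?K"
      using x(4)
    proof
      assume "K \<subseteq> N \<and> x \<in> N"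
      then show ?thesis using sx[OF n(1)] subspace_add[OF n(1)] by blast
    qed (use KK in blast)
    ultimately have "P ?K" unfolding P_def using step KK Ks(2) by blast
    from K(2)[OF this KK] have "?K = K" .
    moreover have "x + 0 \<in> ?K" using span_base[of x "{x}"] subspace_0[OF kk(1)] by blast
    ultimately show False using x(2) by simp
  qed
  obtain d \<rho> where rho: "lie_rep scale R prd d \<rho>" "\<rho> z \<noteq> 0" "nilset (\<rho> ` (R \<inter> N))"
    using Ks(5) unfolding KR unipotent_rep_def by blast
  have RN: "R \<inter> N = N" using NR by blast
  obtain S where lv: "lie_subalg S" "S \<inter> R = {0}" "\<forall>v\<in>V. \<exists>r\<in>R. v - r \<in> S" by (rule levi[OF fdV R])
  \<comment> \<open>\<open>N\<close> can play the part of the ideal because it contains [V, R] and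
    hence [S, R].\<close>
  interpret semidirect scale V prd S R N d \<rho>
  proof (intro semidirect.intro semidirect_axioms.intro)
    show "lie_algebra_char_0 scale V prd" by (rule lie_algebra_char_0_axioms)
    show "fd scale R" by (rule fd_subset[OF fdV r(1)]) (use r(2) in blast)
    show "lie_subalg R" using Ks(1) KR by simp
    show "prd x k \<in> N" if "x \<in> S" "k \<in> R" for x k by (rule VR[OF lie_subalgD(2)[OF lv(1) that(1)] that(2)])
    show "prd x k \<in> N" if "x \<in> R" "k \<in> N" for x k by (rule n(3)[OF r(2)[OF that(1)] that(2)])
    show "nilset (\<rho> ` N)" using rho(3) RN by simp
  qed (fact lv n(1) NR rho)+
  obtain d' \<rho>' where e: "lie_rep scale {s + k | s k. s \<in> S \<and> k \<in> R} prd d' \<rho>'"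
    "\<forall>k\<in>R. \<rho> k \<noteq> 0 \<longrightarrow> \<rho>' k \<noteq> 0"
    by (rule extension)
  have "V \<subseteq> {s + k | s k. s \<in> S \<and> k \<in> R}"
  proof
    fix v assume "v \<in> V"
    then obtain k where k: "k \<in> R" "v - k \<in> S" using lv(3) by blast
    have "v = (v - k) + k" by simp
    then show "v \<in> {s + k | s k. s \<in> S \<and> k \<in> R}" using k by blast
  qed
  then have "V = {s + k | s k. s \<in> S \<and> k \<in> R}"
    using lie_subalgD(2)[OF lv(1)] r(2) V_closed(2) by blast
  then have "lie_rep scale V prd d' \<rho>'" using e(1) by simp
  moreover have "\<rho>' z \<noteq> 0" using e(2) zR rho(2) by blast
  ultimately show thesis by (rule that)
qed

lemma separating_rep:
  assumes fdV: "fd scale V" and x: "x \<in> V" "x \<noteq> 0"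
  obtains d \<rho> where "lie_rep scale V prd d \<rho>" "\<rho> x \<noteq> 0"
proof (cases "\<forall>y\<in>V. prd y x = 0")
  case True
  obtain d \<rho> where "lie_rep scale V prd d \<rho>" "\<rho> x \<noteq> 0"
    by (rule central_rep[OF fdV x]) (use True in blast)
  then show thesis by (rule that)
next
  case False
  then obtain y where y: "y \<in> V" "prd y x \<noteq> 0" by blast
  interpret A: lie_module scale V prd scale V prd by (rule adjoint_module)
  obtain d M where "fd_lie_module scale V prd scale V prd d M" by (rule A.fd_lie_module_exists[OF fdV])
  then interpret F: fd_lie_module scale V prd scale V prd d M .
  have "prd x y \<noteq> 0" using antisym[OF x(1) y(1)] y(2) by simp
  then have "F.R x \<noteq> 0" using F.M_zero[OF A.act_lin[OF x(1)]] y(1) by blast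
  then show thesis by (rule that[OF F.lie_rep_R])
qed

text \<open>A finite family with minimal common kernel separates points, since any vector left over
  would be detected by one more representation. Keeping a family avoids block sums; a common size is
  reached by viewing small matrices as larger ones with zero entries.\<close>

lemma faithful_family:
  assumes fdV: "fd scale V"
  obtains d F where "finite F" "\<And>\<rho>. \<rho> \<in> F \<Longrightarrow> lie_rep scale V prd d \<rho>"
    "\<And>x. x \<in> V \<Longrightarrow> (\<And>\<rho>. \<rho> \<in> F \<Longrightarrow> \<rho> x = 0) \<Longrightarrow> x = 0"
proof -
  define P where "P U \<longleftrightarrow> (\<exists>F d. finite F \<and> (\<forall>\<rho>\<in>F. lie_rep scale V prd d \<rho>) \<and> U = {x \<in> V. \<forall>\<rho>\<in>F. \<rho> x = 0})" for U
  have mono: "lie_rep scale V prd (d + e) \<rho>" if "lie_rep scale V prd d \<rho>" for d e \<rho>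
    using that Mat_mono[of d "d + e", OF le_add1] unfolding lie_rep_def by blast
  have Psub: "subspace U \<and> U \<subseteq> V" if PU: "P U" for U
  proof -
    obtain F d where F: "\<forall>\<rho>\<in>F. lie_rep scale V prd d \<rho>" "U = {x \<in> V. \<forall>\<rho>\<in>F. \<rho> x = 0}"
      using PU unfolding P_def by blast
    have "subspace U" unfolding F(2)
    proof (rule subspaceI)
      have "\<rho> 0 = 0" if "\<rho> \<in> F" for \<rho>
        using lie_repD(3)[OF F(1)[rule_format, OF that] V_closed(1) V_closed(1), of 0] by simp
      then show "0 \<in> {x \<in> V. \<forall>\<rho>\<in>F. \<rho> x = 0}" using V_closed(1) by simp
      fix x assume x: "x \<in> {x \<in> V. \<forall>\<rho>\<in>F. \<rho> x = 0}"
      then have xV: "x \<in> V" by blast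
      have "\<rho> (scale c x) = 0" if r: "\<rho> \<in> F" for \<rho> c
        using lie_repD(3)[OF F(1)[rule_format, OF r] xV xV, of c] x r by simp
      then show "scale c x \<in> {x \<in> V. \<forall>\<rho>\<in>F. \<rho> x = 0}" for c using V_closed(5)[OF xV] by simp
      fix y assume y: "y \<in> {x \<in> V. \<forall>\<rho>\<in>F. \<rho> x = 0}"
      then have yV: "y \<in> V" by blast
      have "\<rho> (x + y) = 0" if r: "\<rho> \<in> F" for \<rho>
      proof -
        have "\<rho> x = 0" "\<rho> y = 0" using x y r by blast+
        then show ?thesis using lie_repD(2)[OF F(1)[rule_format, OF r] xV yV] by simp
      qed
      then show "x + y \<in> {x \<in> V. \<forall>\<rho>\<in>F. \<rho> x = 0}" using V_closed(2)[OF xV yV] by simp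
    qed
    then show ?thesis using F(2) by blast
  qed
  have PV: "P V" unfolding P_def by (rule exI[of _ "{}"]) simp
  obtain U where U: "P U" "\<And>U'. P U' \<Longrightarrow> U' \<subseteq> U \<Longrightarrow> U' = U"
    by (rule fd_minimal[of V P V, OF fdV PV Psub], assumption, blast)
  obtain F d where F: "finite F" "\<forall>\<rho>\<in>F. lie_rep scale V prd d \<rho>" "U = {x \<in> V. \<forall>\<rho>\<in>F. \<rho> x = 0}"
    using U(1) unfolding P_def by blast
  have "x = 0" if x: "x \<in> V" and k: "\<And>\<rho>. \<rho> \<in> F \<Longrightarrow> \<rho> x = 0" for x
  proof (rule ccontr)
    assume "x \<noteq> 0"
    then obtain e \<sigma> where s: "lie_rep scale V prd e \<sigma>" "\<sigma> x \<noteq> 0" by (rule separating_rep[OF fdV x])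
    let ?U = "{x \<in> V. \<forall>\<rho>\<in>insert \<sigma> F. \<rho> x = 0}"
    have "lie_rep scale V prd (d + e) \<rho>" if "\<rho> \<in> insert \<sigma> F" for \<rho>
      using that mono[of d \<rho> e] mono[OF s(1), of d] F(2) by (auto simp: add.commute)
    then have "P ?U" unfolding P_def using F(1)
      by (intro exI[of _ "insert \<sigma> F"] exI[of _ "d + e"]) auto
    moreover have "?U \<subseteq> U" unfolding F(3) by blast
    ultimately have "?U = U" by (rule U(2))
    moreover have "x \<in> U" unfolding F(3) using x k by blast
    ultimately have "x \<in> ?U" by (rule ssubst)
    then show False using s(2) by blast
  qed
  then show thesis using F(1,2) by (intro that[of F d]) auto
qed

end

section \<open>The graded algebra of matrix-valued functions on the semigroup\<close>

lemma fun_sum_apply: "(\<Sum>x\<in>A. f x) q = (\<Sum>x\<in>A. f x q)"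
  by (induction A rule: infinite_finite_induct) simp_all

text \<open>Convolution in the semigroup variable and pointwise in \<open>j\<close>: a product,
  indexed by \<open>j\<close>, of semigroup algebras with matrix coefficients. The sum runs over all
  pairs with a condition because s t = u cannot be solved for t in a semigroup.\<close>

definition gmul :: "('t::{finite,semigroup_mult} \<times> 'j \<Rightarrow> 'a::field rmat) \<Rightarrow> ('t \<times> 'j \<Rightarrow> 'a rmat) \<Rightarrow> 't \<times> 'j \<Rightarrow> 'a rmat" where
  "gmul a b = (\<lambda>(u, j). \<Sum>s\<in>UNIV. \<Sum>t\<in>UNIV. if s * t = u then a (s, j) * b (t, j) else 0)"

text \<open>Vanishing off a finite \<open>F\<close> makes the space finite dimensional although the
  index type of \<open>j\<close> may be infinite.\<close>

definition Mfun :: "'j set \<Rightarrow> nat \<Rightarrow> ('t \<times> 'j \<Rightarrow> 'a::field rmat) set" where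
  "Mfun F d = {a. \<forall>t j. (j \<in> F \<longrightarrow> a (t, j) \<in> Mat d) \<and> (j \<notin> F \<longrightarrow> a (t, j) = 0)}"

definition gcomp :: "'j set \<Rightarrow> nat \<Rightarrow> 't \<Rightarrow> ('t \<times> 'j \<Rightarrow> 'a::field rmat) set" where
  "gcomp F d t = {a \<in> Mfun F d. \<forall>s j. s \<noteq> t \<longrightarrow> a (s, j) = 0}"

lemma Mfun_subspace: "fs.subspace (Mfun F d)"
  by (rule fs.subspaceI) (auto simp: Mfun_def fsmul_def Mat_closed)

lemma gcomp_subspace: "fs.subspace (gcomp F d t)"
  by (rule fs.subspaceI)
    (auto simp: gcomp_def fsmul_def fs.subspace_0[OF Mfun_subspace] fs.subspace_add[OF Mfun_subspace]
      intro: fs.subspace_scale[OF Mfun_subspace, unfolded fsmul_def])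

lemma Mfun_fd:
  assumes "finite F"
  shows "fd fsmul (Mfun F d :: ('t::finite \<times> 'j \<Rightarrow> 'a::field rmat) set)"
proof -
  define e where "e p v = (\<lambda>q. if q = p then v else 0)" for p :: "'t \<times> 'j" and v :: "'a rmat"
  obtain B where B: "finite B" "B \<subseteq> Mat d" "rm.span B = (Mat d :: 'a rmat set)" using rm.fd_basis[OF Mat_fd] .
  let ?J = "(UNIV :: 't set) \<times> F"
  let ?B = "(\<lambda>(p, v). e p v) ` (?J \<times> B)"
  have 1: "e p v \<in> fs.span ?B" if p: "p \<in> ?J" and v: "v \<in> Mat d" for p v
  proof -
    have "e p 0 = 0" "e p (v + w) = e p v + e p w" "e p (smul c v) = fsmul c (e p v)" for v w c
      by (simp_all add: e_def fsmul_def fun_eq_iff)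
    then have "rm.subspace {v. e p v \<in> fs.span ?B}"
      by (intro rm.subspaceI) (simp_all only: mem_Collect_eq fs.span_zero fs.span_add fs.span_scale)
    moreover have "B \<subseteq> {v. e p v \<in> fs.span ?B}" using p by (auto intro!: fs.span_base)
    ultimately show ?thesis using rm.span_minimal[of B] v unfolding B(3) by blast
  qed
  show ?thesis
  proof (rule fs.fdI[OF Mfun_subspace, of ?B])
    show "finite ?B" using assms B(1) by simp
    show "Mfun F d \<subseteq> fs.span ?B"
    proof
      fix a assume a: "a \<in> (Mfun F d :: ('t \<times> 'j \<Rightarrow> 'a rmat) set)"
      have fin: "finite ?J" using assms by simp
      have aq: "a q = (\<Sum>p\<in>?J. e p (a p) q)" for q
      proof (cases "q \<in> ?J")
        case True
        then show ?thesis using fin by (simp add: e_def sum.delta)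
      next
        case False
        then have "a q = 0" using a by (cases q) (auto simp: Mfun_def)
        moreover have "(\<Sum>p\<in>?J. e p (a p) q) = 0" using False by (intro sum.neutral) (auto simp: e_def)
        ultimately show ?thesis by simp
      qed
      have ae: "a = (\<Sum>p\<in>?J. e p (a p))"
      proof (rule ext)
        show "a q = (\<Sum>p\<in>?J. e p (a p)) q" for q unfolding fun_sum_apply by (rule aq)
      qed
      have m: "(\<Sum>p\<in>?J. e p (a p)) \<in> fs.span ?B"
        using a by (intro fs.span_sum 1) (auto simp: Mfun_def)
      show "a \<in> fs.span ?B" by (subst ae) (rule m)
    qed
  qed
qed

lemma gmul_apply: "gmul a b (u, j) = (\<Sum>s\<in>UNIV. \<Sum>t\<in>UNIV. if s * t = u then a (s, j) * b (t, j) else 0)"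
  by (simp add: gmul_def)

text \<open>Both sides become a sum over triples with p q t = u. The intermediate product
  \<open>s\<close> is carried as an extra index with a delta, so that the sums can be exchanged
  freely.\<close>

lemma gmul_assoc: "gmul (gmul a b) c = gmul a (gmul b c)"
proof (rule ext, clarify)
  fix u j
  have "gmul (gmul a b) c (u, j) = (\<Sum>s\<in>UNIV. \<Sum>t\<in>UNIV. \<Sum>p\<in>UNIV. \<Sum>q\<in>UNIV.
      if s = p * q then (if s * t = u then a (p, j) * b (q, j) * c (t, j) else 0) else 0)"
    unfolding gmul_apply
  proof (intro sum.cong refl)
    fix s t
    show "(if s * t = u then (\<Sum>p\<in>UNIV. \<Sum>q\<in>UNIV. if p * q = s then a (p, j) * b (q, j) else 0) * c (t, j) else 0) =
      (\<Sum>p\<in>UNIV. \<Sum>q\<in>UNIV. if s = p * q then (if s * t = u then a (p, j) * b (q, j) * c (t, j) else 0) else 0)"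
      by (cases "s * t = u") (auto simp: sum_distrib_right intro!: sum.cong sum.neutral)
  qed
  also have "\<dots> = (\<Sum>t\<in>UNIV. \<Sum>p\<in>UNIV. \<Sum>q\<in>UNIV. \<Sum>s\<in>UNIV.
      if s = p * q then (if s * t = u then a (p, j) * b (q, j) * c (t, j) else 0) else 0)"
    by (subst sum.swap, rule sum.cong[OF refl], subst sum.swap, rule sum.cong[OF refl], subst sum.swap) simp
  also have "\<dots> = (\<Sum>t\<in>UNIV. \<Sum>p\<in>UNIV. \<Sum>q\<in>UNIV. if p * q * t = u then a (p, j) * b (q, j) * c (t, j) else 0)"
    by (simp add: sum.delta)
  also have "\<dots> = (\<Sum>p\<in>UNIV. \<Sum>q\<in>UNIV. \<Sum>t\<in>UNIV. if p * q * t = u then a (p, j) * b (q, j) * c (t, j) else 0)"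
    by (subst sum.swap, rule sum.cong[OF refl], subst sum.swap) simp
  also have "\<dots> = (\<Sum>p\<in>UNIV. \<Sum>q\<in>UNIV. \<Sum>t\<in>UNIV. \<Sum>s\<in>UNIV.
      if s = q * t then (if p * s = u then a (p, j) * (b (q, j) * c (t, j)) else 0) else 0)"
    by (simp add: sum.delta mult.assoc cong: if_cong)
  also have "\<dots> = (\<Sum>p\<in>UNIV. \<Sum>s\<in>UNIV. \<Sum>q\<in>UNIV. \<Sum>t\<in>UNIV.
      if s = q * t then (if p * s = u then a (p, j) * (b (q, j) * c (t, j)) else 0) else 0)"
    by (rule sum.cong[OF refl], subst sum.swap[of _ UNIV UNIV], subst (2) sum.swap) simp
  also have "\<dots> = gmul a (gmul b c) (u, j)"
    unfolding gmul_apply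
  proof (intro sum.cong refl)
    fix p s
    show "(\<Sum>q\<in>UNIV. \<Sum>t\<in>UNIV. if s = q * t then (if p * s = u then a (p, j) * (b (q, j) * c (t, j)) else 0) else 0) =
      (if p * s = u then a (p, j) * (\<Sum>q\<in>UNIV. \<Sum>t\<in>UNIV. if q * t = s then b (q, j) * c (t, j) else 0) else 0)"
      by (cases "p * s = u") (auto simp: sum_distrib_left intro!: sum.cong sum.neutral)
  qed
  finally show "gmul (gmul a b) c (u, j) = gmul a (gmul b c) (u, j)" .
qed

lemma Mfun_assoc_algebra:
  "assoc_algebra_on fsmul (Mfun F d) (gmul :: ('t::{finite,semigroup_mult} \<times> 'j \<Rightarrow> 'a::field rmat) \<Rightarrow> _)"
proof unfold_locales
  show "fs.subspace (Mfun F d)" by (rule Mfun_subspace)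
  fix a b c :: "'t \<times> 'j \<Rightarrow> 'a rmat" and k
  show "gmul (gmul a b) c = gmul a (gmul b c)" by (rule gmul_assoc)
  show "gmul (a + b) c = gmul a c + gmul b c" "gmul a (b + c) = gmul a b + gmul a c"
    by (auto simp: gmul_def fun_eq_iff distrib_left distrib_right sum.distrib[symmetric] intro!: sum.cong)
  show "gmul (fsmul k a) b = fsmul k (gmul a b)" "gmul a (fsmul k b) = fsmul k (gmul a b)"
    by (auto simp: gmul_def fsmul_def fun_eq_iff smul_mult_left smul_mult_right rm.scale_sum_right intro!: sum.cong)
  assume a: "a \<in> Mfun F d" and b: "b \<in> Mfun F d"
  have "(j \<in> F \<longrightarrow> gmul a b (u, j) \<in> Mat d) \<and> (j \<notin> F \<longrightarrow> gmul a b (u, j) = 0)" for u j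
  proof (cases "j \<in> F")
    case True
    then have "a (s, j) \<in> Mat d" "b (s, j) \<in> Mat d" for s using a b by (auto simp: Mfun_def)
    then have "gmul a b (u, j) \<in> Mat d" unfolding gmul_apply by (intro Mat_closed(6)) (simp add: Mat_closed)
    then show ?thesis using True by simp
  next
    case False
    then have "a (s, j) = 0" for s using a by (auto simp: Mfun_def)
    then show ?thesis using False by (simp add: gmul_apply cong: if_cong)
  qed
  then show "gmul a b \<in> Mfun F d" unfolding Mfun_def by blast
qed

lemma Mfun_graded_algebra:
  "graded_algebra_on fsmul (Mfun F d) (gmul :: ('t::{finite,semigroup_mult} \<times> 'j \<Rightarrow> 'a::field rmat) \<Rightarrow> _) (gcomp F d)"
proof (intro graded_algebra_on.intro graded_algebra_on_axioms.intro)
  interpret A: assoc_algebra_on fsmul "Mfun F d" "gmul :: ('t \<times> 'j \<Rightarrow> 'a rmat) \<Rightarrow> _" by (rule Mfun_assoc_algebra)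
  show "algebra_on fsmul (Mfun F d) (gmul :: ('t \<times> 'j \<Rightarrow> 'a rmat) \<Rightarrow> _)" by (rule A.algebra_on_axioms)
  show "fs.subspace (gcomp F d t)" for t :: 't by (rule gcomp_subspace)
  show "gcomp F d t \<subseteq> Mfun F d" for t :: 't by (auto simp: gcomp_def)
  show "\<exists>!x. (\<forall>t. x t \<in> gcomp F d t) \<and> v = (\<Sum>t\<in>UNIV. x t)"
    if v: "v \<in> Mfun F d" for v :: "'t \<times> 'j \<Rightarrow> 'a rmat"
  proof (rule ex1I)
    let ?x = "\<lambda>t (s, j). if s = t then v (s, j) else 0"
    show "(\<forall>t. ?x t \<in> gcomp F d t) \<and> v = (\<Sum>t\<in>UNIV. ?x t)"
      using v by (auto simp: gcomp_def Mfun_def fun_eq_iff fun_sum_apply Mat_closed(1))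
    fix y assume y: "(\<forall>t. y t \<in> gcomp F d t) \<and> v = (\<Sum>t\<in>UNIV. y t)"
    have "v (s, j) = y s (s, j)" for s j
    proof -
      have "v (s, j) = (\<Sum>t\<in>UNIV. y t (s, j))" using y by (simp add: fun_sum_apply)
      also have "\<dots> = (\<Sum>t\<in>UNIV. if t = s then y s (s, j) else 0)"
        using y by (intro sum.cong refl) (auto simp: gcomp_def)
      finally show ?thesis by simp
    qed
    then show "y = ?x" using y by (auto simp: fun_eq_iff gcomp_def)
  qed
  fix a b :: "'t \<times> 'j \<Rightarrow> 'a rmat" and s t
  assume a: "a \<in> gcomp F d s" and b: "b \<in> gcomp F d t"
  have "gmul a b (u, j) = 0" if u: "u \<noteq> s * t" for u j
    unfolding gmul_apply
  proof (intro sum.neutral ballI)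
    fix p q
    have "a (p, j) * b (q, j) = 0" if "p * q = u"
    proof -
      have "p \<noteq> s \<or> q \<noteq> t" using that u by blast
      then have "a (p, j) = 0 \<or> b (q, j) = 0" using a b unfolding gcomp_def by blast
      then show ?thesis by auto
    qed
    then show "(if p * q = u then a (p, j) * b (q, j) else 0) = 0" by simp
  qed
  moreover have "gmul a b \<in> Mfun F d" using a b A.prd_closed by (simp add: gcomp_def)
  ultimately show "gmul a b \<in> gcomp F d (s * t)" by (simp add: gcomp_def)
qed

section \<open>Transport to coordinates\<close>

lemma (in vector_space) coordinates_exist:
  assumes "fd scale W"
  obtains \<phi> :: "'b \<Rightarrow> nat \<Rightarrow> 'a" where "\<And>v w. v \<in> W \<Longrightarrow> w \<in> W \<Longrightarrow> \<phi> (v + w) = \<phi> v + \<phi> w"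
    "\<And>c v. v \<in> W \<Longrightarrow> \<phi> (scale c v) = fun_scale c (\<phi> v)" "inj_on \<phi> W"
proof -
  obtain B where B: "finite B" "independent B" "B \<subseteq> W" "span B = W" using fd_basis[OF assms] .
  obtain b where b: "bij_betw b {..<card B} B"
    using ex_bij_betw_nat_finite[OF B(1)] by (auto simp: atLeast0LessThan)
  define \<phi> where "\<phi> w = (\<lambda>i. if i < card B then representation B w (b i) else 0)" for w
  show thesis
  proof (rule that)
    fix v assume v: "v \<in> W"
    show "\<phi> (scale c v) = fun_scale c (\<phi> v)" for c
      using v B(4) by (simp add: \<phi>_def fun_scale_def fun_eq_iff representation_scale[OF B(2)])
    fix w assume "w \<in> W"
    then show "\<phi> (v + w) = \<phi> v + \<phi> w"
      using v B(4) by (simp add: \<phi>_def fun_eq_iff representation_add[OF B(2)])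
  next
    show "inj_on \<phi> W"
    proof (rule inj_onI)
      fix v w assume vw: "v \<in> W" "w \<in> W" "\<phi> v = \<phi> w"
      have r: "representation B v x = representation B w x" if "x \<in> B" for x
      proof -
        have "x \<in> b ` {..<card B}" using b that by (simp add: bij_betw_def)
        then obtain i where "x = b i" "i < card B" by blast
        then show ?thesis using fun_cong[OF vw(3), of i] by (simp add: \<phi>_def)
      qed
      have e: "u = (\<Sum>x\<in>B. scale (representation B u x) x)" if "u \<in> W" for u
        using sum_representation_eq[OF B(2) _ B(1) order_refl, of u] that B(4) by simp
      have "v = (\<Sum>x\<in>B. scale (representation B w x) x)"
        by (subst e[OF vw(1)]) (simp add: r)
      then show "v = w" using e[OF vw(2)] by simp
    qed
  qed
qed

global_interpretation fn: vector_space fun_scale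
  by (rule vector_space_fun_scale)

text \<open>The statement asks for an algebra on functions from \<open>nat\<close>. A coordinate map
  injective on \<open>W\<close> carries the structure over, and \<open>inv_into\<close> defines the
  product on its image.\<close>

lemma graded_algebra_transport:
  fixes s :: "'a::field \<Rightarrow> 'w::ab_group_add \<Rightarrow> 'w" and G :: "'t::{finite,semigroup_mult} \<Rightarrow> 'w set"
  assumes assoc: "assoc_algebra_on s W m" and grad: "graded_algebra_on s W m G" and fd: "fd s W"
  obtains \<phi> :: "'w \<Rightarrow> nat \<Rightarrow> 'a" and m' where
    "assoc_algebra_on fun_scale (\<phi> ` W) m'" "graded_algebra_on fun_scale (\<phi> ` W) m' (\<lambda>t. \<phi> ` G t)"
    "finite_dimensional_on fun_scale (\<phi> ` W)" "inj_on \<phi> W"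
    "\<And>v w. v \<in> W \<Longrightarrow> w \<in> W \<Longrightarrow> \<phi> (v + w) = \<phi> v + \<phi> w"
    "\<And>c v. v \<in> W \<Longrightarrow> \<phi> (s c v) = fun_scale c (\<phi> v)"
    "\<And>v w. v \<in> W \<Longrightarrow> w \<in> W \<Longrightarrow> m' (\<phi> v) (\<phi> w) = \<phi> (m v w)"
proof -
  interpret A: assoc_algebra_on s W m by fact
  interpret G: graded_algebra_on s W m G by fact
  obtain \<phi> :: "'w \<Rightarrow> nat \<Rightarrow> 'a" where \<phi>: "\<And>v w. v \<in> W \<Longrightarrow> w \<in> W \<Longrightarrow> \<phi> (v + w) = \<phi> v + \<phi> w"
    "\<And>c v. v \<in> W \<Longrightarrow> \<phi> (s c v) = fun_scale c (\<phi> v)" "inj_on \<phi> W"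
    by (rule A.coordinates_exist[OF fd]) blast
  define m' where "m' a b = \<phi> (m (inv_into W \<phi> a) (inv_into W \<phi> b))" for a b
  note cl = A.subspace_0[OF A.subspace_carrier] A.subspace_add[OF A.subspace_carrier] A.subspace_scale[OF A.subspace_carrier]
    A.prd_closed
  have m': "m' (\<phi> v) (\<phi> w) = \<phi> (m v w)" if "v \<in> W" "w \<in> W" for v w
    using that \<phi>(3) by (simp add: m'_def)
  have \<phi>0: "\<phi> 0 = 0" using \<phi>(2)[OF cl(1), of 0] by simp
  have sub: "fn.subspace (\<phi> ` U)" if U: "A.subspace U" "U \<subseteq> W" for U
  proof (rule fn.subspaceI)
    show "0 \<in> \<phi> ` U" using \<phi>0 A.subspace_0[OF U(1)] by (metis imageI)
    fix a assume "a \<in> \<phi> ` U"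
    then obtain v where v: "a = \<phi> v" "v \<in> U" by blast
    have vW: "v \<in> W" using v U(2) by blast
    show "fun_scale c a \<in> \<phi> ` U" for c
      unfolding v(1) \<phi>(2)[OF vW, symmetric] by (rule imageI[OF A.subspace_scale[OF U(1) v(2)]])
    fix b assume "b \<in> \<phi> ` U"
    then obtain w where w: "b = \<phi> w" "w \<in> U" by blast
    have wW: "w \<in> W" using w U(2) by blast
    show "a + b \<in> \<phi> ` U"
      unfolding v(1) w(1) \<phi>(1)[OF vW wW, symmetric] by (rule imageI[OF A.subspace_add[OF U(1) v(2) w(2)]])
  qed
  have alg: "algebra_on fun_scale (\<phi> ` W) m'"
  proof (intro algebra_on.intro algebra_on_axioms.intro)
    show "vector_space (fun_scale :: 'a \<Rightarrow> _)" by (rule vector_space_fun_scale)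
    show "fn.subspace (\<phi> ` W)" by (rule sub[OF A.subspace_carrier order_refl])
    fix a b assume "a \<in> \<phi> ` W" "b \<in> \<phi> ` W"
    then obtain v w where vw: "a = \<phi> v" "b = \<phi> w" "v \<in> W" "w \<in> W" by blast
    show "m' a b \<in> \<phi> ` W" unfolding vw(1,2) m'[OF vw(3,4)] by (rule imageI[OF cl(4)[OF vw(3,4)]])
    show "m' (fun_scale c a) b = fun_scale c (m' a b)" "m' a (fun_scale c b) = fun_scale c (m' a b)" for c
      using vw(3,4) by (simp_all add: vw(1,2) \<phi>(2)[symmetric] m' cl A.prd_scale_left A.prd_scale_right)
    fix e assume "e \<in> \<phi> ` W"
    then obtain x where x: "e = \<phi> x" "x \<in> W" by blast
    show "m' (a + b) e = m' a e + m' b e" "m' a (b + e) = m' a b + m' a e"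
      using vw(3,4) x(2) by (simp_all add: vw(1,2) x(1) \<phi>(1)[symmetric] m' cl A.prd_add_left A.prd_add_right)
  qed
  have assoc': "assoc_algebra_on fun_scale (\<phi> ` W) m'"
  proof (intro assoc_algebra_on.intro assoc_algebra_on_axioms.intro alg)
    fix a b e assume "a \<in> \<phi> ` W" "b \<in> \<phi> ` W" "e \<in> \<phi> ` W"
    then obtain v w x where "a = \<phi> v" "b = \<phi> w" "e = \<phi> x" "v \<in> W" "w \<in> W" "x \<in> W" by blast
    then show "m' (m' a b) e = m' a (m' b e)" by (simp add: m' cl A.prd_assoc)
  qed
  have sum\<phi>: "\<phi> (\<Sum>t\<in>T. x t) = (\<Sum>t\<in>T. \<phi> (x t)) \<and> (\<Sum>t\<in>T. x t) \<in> W" if "\<And>t. x t \<in> W" for x and T :: "'t set"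
    using finite[of T] by (induction T rule: finite_induct) (simp_all add: \<phi>0 \<phi>(1) cl that)
  have grad': "graded_algebra_on fun_scale (\<phi> ` W) m' (\<lambda>t. \<phi> ` G t)"
  proof (intro graded_algebra_on.intro graded_algebra_on_axioms.intro alg)
    show "fn.subspace (\<phi> ` G t)" for t by (rule sub[OF G.subspace_component G.component_subset])
    show "\<phi> ` G t \<subseteq> \<phi> ` W" for t using G.component_subset by blast
    show "\<exists>!x. (\<forall>t. x t \<in> \<phi> ` G t) \<and> v = (\<Sum>t\<in>UNIV. x t)" if v: "v \<in> \<phi> ` W" for v
    proof -
      obtain u where u: "v = \<phi> u" "u \<in> W" using v by blast
      obtain x where x: "\<forall>t. x t \<in> G t" "u = (\<Sum>t\<in>UNIV. x t)"
        and un: "\<And>y. (\<forall>t. y t \<in> G t) \<Longrightarrow> u = (\<Sum>t\<in>UNIV. y t) \<Longrightarrow> y = x"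
        using G.direct_sum[OF u(2)] by metis
      have GW: "y t \<in> W" if "\<forall>t. y t \<in> G t" for y t using that G.component_subset by blast
      show ?thesis
      proof (rule ex1I)
        show "(\<forall>t. \<phi> (x t) \<in> \<phi> ` G t) \<and> v = (\<Sum>t\<in>UNIV. \<phi> (x t))"
          using x sum\<phi>[OF GW[OF x(1)], where T = UNIV] u(1) by simp
        fix y assume y: "(\<forall>t. y t \<in> \<phi> ` G t) \<and> v = (\<Sum>t\<in>UNIV. y t)"
        then have "\<forall>t. \<exists>z. z \<in> G t \<and> y t = \<phi> z" by blast
        then obtain z where z: "\<forall>t. z t \<in> G t \<and> y t = \<phi> (z t)" by (rule choice[THEN exE])
        then have zG: "\<forall>t. z t \<in> G t" and yz: "y = (\<lambda>t. \<phi> (z t))" by auto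
        have "\<phi> u = \<phi> (\<Sum>t\<in>UNIV. z t)" using y u(1) sum\<phi>[OF GW[OF zG], where T = UNIV] by (simp add: yz)
        then have "u = (\<Sum>t\<in>UNIV. z t)" by (rule inj_onD[OF \<phi>(3) _ u(2) conjunct2[OF sum\<phi>[OF GW[OF zG]]]])
        then show "y = (\<lambda>t. \<phi> (x t))" using un[OF zG] yz by simp
      qed
    qed
    fix a b p q assume "a \<in> \<phi> ` G p" "b \<in> \<phi> ` G q"
    then obtain v w where vw: "a = \<phi> v" "b = \<phi> w" "v \<in> G p" "w \<in> G q" by blast
    then have "v \<in> W" "w \<in> W" using G.component_subset by blast+
    then show "m' a b \<in> \<phi> ` G (p * q)" unfolding vw(1,2) by (simp only: m' imageI G.prd_component vw(3,4))
  qed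
  obtain B where B: "finite B" "B \<subseteq> W" "A.span B = W" using A.fd_basis[OF fd] .
  have "A.subspace {v \<in> W. \<phi> v \<in> fn.span (\<phi> ` B)}"
    by (rule A.subspaceI) (auto simp: cl \<phi>0 \<phi>(1,2) fn.span_zero fn.span_add fn.span_scale)
  then have "W \<subseteq> {v \<in> W. \<phi> v \<in> fn.span (\<phi> ` B)}"
    using A.span_minimal[of B "{v \<in> W. \<phi> v \<in> fn.span (\<phi> ` B)}"] B(2,3) by (auto intro: fn.span_base)
  then have "fd fun_scale (\<phi> ` W)"
    using B(1) by (intro fn.fdI[OF sub[OF A.subspace_carrier order_refl], of "\<phi> ` B"]) auto
  then have "finite_dimensional_on fun_scale (\<phi> ` W)" by (simp add: fn.fd_iff)
  then show thesis by (rule that[OF assoc' grad' _ \<phi>(3,1,2) m'])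
qed

theorem theorem2p3:
  fixes scale :: "'f::field_char_0 \<Rightarrow> 'l::ab_group_add \<Rightarrow> 'l"
    and L :: "'l set"
    and bracket :: "'l \<Rightarrow> 'l \<Rightarrow> 'l"
    and GL :: "'t::{finite,ab_semigroup_mult} \<Rightarrow> 'l set"
  assumes "lie_algebra_on scale L bracket"
    and "finite_dimensional_on scale L"
    and "graded_algebra_on scale L bracket GL"
  shows "\<exists>(A :: (nat \<Rightarrow> 'f) set) mult (GA :: 't \<Rightarrow> (nat \<Rightarrow> 'f) set) \<rho>.
    assoc_algebra_on fun_scale A mult \<and>
    finite_dimensional_on fun_scale A \<and>
    graded_algebra_on fun_scale A mult GA \<and>
    lie_algebra_hom_on scale L bracket fun_scale A (commutator mult) \<rho> \<and>
    inj_on \<rho> L \<and>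
    (\<forall>t. \<rho> ` GL t \<subseteq> GA t)"
proof -
  interpret L: lie_algebra_on scale L bracket by fact
  interpret G: graded_algebra_on scale L bracket GL by fact
  interpret L0: lie_algebra_char_0 scale L bracket by (intro lie_algebra_char_0.intro assms(1))
  have fdL: "fd scale L" using assms(2) by (simp add: L.fd_iff)
  obtain d F where F: "finite F" "\<And>r. r \<in> F \<Longrightarrow> lie_rep scale L bracket d r"
    and faith: "\<And>x. x \<in> L \<Longrightarrow> (\<And>r. r \<in> F \<Longrightarrow> r x = 0) \<Longrightarrow> x = 0"
    by (rule L0.faithful_family[OF fdL]) blast
  have F_Mat: "r x \<in> Mat d" and F_scale: "r (scale c x) = smul c (r x)" if "r \<in> F" "x \<in> L" for r x c
    using lie_repD(1,3)[OF F(2)[OF that(1)] that(2) that(2)] by blast+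
  have F_add: "r (x + y) = r x + r y" and F_lie: "r (bracket x y) = r x * r y - r y * r x"
    if "r \<in> F" "x \<in> L" "y \<in> L" for r x y
    using lie_repD(2,4)[OF F(2)[OF that(1)] that(2,3)] by blast+
  have F_zero: "r 0 = 0" if "r \<in> F" for r
    using F_scale[OF that L.V_closed(1), of 0] by simp
  have F_sum: "r (\<Sum>a\<in>A. f a) = (\<Sum>a\<in>A. r (f a))" if r: "r \<in> F" and f: "\<And>a. a \<in> A \<Longrightarrow> f a \<in> L"
    for r f and A :: "'t set"
    using finite[of A] f by (induction A rule: finite_induct) (simp_all add: F_zero r F_add L.V_closed)
  \<comment> \<open>The homogeneous components; \<open>c_eq\<close> turns uniqueness of the
    decomposition into a rule for computing them.\<close>
  define c where "c v = (SOME x. (\<forall>t. x t \<in> GL t) \<and> v = (\<Sum>t\<in>UNIV. x t))" for v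
  have c: "(\<forall>t. c v t \<in> GL t) \<and> v = (\<Sum>t\<in>UNIV. c v t)" if "v \<in> L" for v
    unfolding c_def using G.direct_sum[OF that] by (rule someI_ex[OF ex1_implies_ex])
  have cG: "c v t \<in> GL t" and c_sum: "(\<Sum>t\<in>UNIV. c v t) = v" if "v \<in> L" for v t
    using c[OF that] by simp_all
  have cL: "c v t \<in> L" if "v \<in> L" for v t using cG[OF that] G.component_subset by blast
  have c_eq: "c v = x" if "\<forall>t. x t \<in> GL t" "v = (\<Sum>t\<in>UNIV. x t)" for v x
  proof -
    have "v \<in> L" unfolding that(2) using that(1) G.component_subset by (intro L.V_closed(6)) blast
    from G.direct_sum[OF this] show ?thesis using c[OF \<open>v \<in> L\<close>] that by (metis (mono_tags, lifting))
  qed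
  note Gs = G.subspace_component
  have c_add: "c (v + w) = (\<lambda>t. c v t + c w t)" if "v \<in> L" "w \<in> L" for v w
    by (rule c_eq) (use that in \<open>simp_all add: L.subspace_add[OF Gs] cG sum.distrib c_sum\<close>)
  have c_scale: "c (scale k v) = (\<lambda>t. scale k (c v t))" if "v \<in> L" for v k
    by (rule c_eq) (use that in \<open>simp_all add: L.subspace_scale[OF Gs] cG c_sum L.scale_sum_right[symmetric]\<close>)
  have c_comp: "c v = (\<lambda>s. if s = t then v else 0)" if "v \<in> GL t" for v t
    by (rule c_eq) (use that in \<open>simp_all add: L.subspace_0[OF Gs]\<close>)
  have br_sum_right: "bracket x (\<Sum>a\<in>A. f a) = (\<Sum>a\<in>A. bracket x (f a))"
    and br_sum_left: "bracket (\<Sum>a\<in>A. f a) x = (\<Sum>a\<in>A. bracket (f a) x)"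
    if "x \<in> L" "\<And>a. f a \<in> L" for x f and A :: "'t set"
    using finite[of A] that
    by (induction A rule: finite_induct) (simp_all add: L.prd_add_left L.prd_add_right L.V_closed)
  have c_br: "c (bracket x y) = (\<lambda>u. \<Sum>s\<in>UNIV. \<Sum>t\<in>UNIV. if s * t = u then bracket (c x s) (c y t) else 0)"
    if x: "x \<in> L" and y: "y \<in> L" for x y
  proof (rule c_eq)
    show "\<forall>u. (\<Sum>s\<in>UNIV. \<Sum>t\<in>UNIV. if s * t = u then bracket (c x s) (c y t) else 0) \<in> GL u"
    proof
      fix u
      have "(if s * t = u then bracket (c x s) (c y t) else 0) \<in> GL u" for s t
        using G.prd_component[OF cG[OF x] cG[OF y], of s t] L.subspace_0[OF Gs] by auto
      then show "(\<Sum>s\<in>UNIV. \<Sum>t\<in>UNIV. if s * t = u then bracket (c x s) (c y t) else 0) \<in> GL u"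
        by (intro L.subspace_sum[OF Gs])
    qed
    have "bracket x y = bracket (\<Sum>s\<in>UNIV. c x s) (\<Sum>t\<in>UNIV. c y t)" using x y by (simp add: c_sum)
    also have "\<dots> = (\<Sum>s\<in>UNIV. \<Sum>t\<in>UNIV. bracket (c x s) (c y t))"
    proof -
      have "(\<Sum>t\<in>UNIV. c y t) \<in> L" using y by (simp add: c_sum)
      from br_sum_left[OF this cL[OF x]] show ?thesis unfolding br_sum_right[OF cL[OF x] cL[OF y]] .
    qed
    also have "\<dots> = (\<Sum>s\<in>UNIV. \<Sum>t\<in>UNIV. \<Sum>u\<in>UNIV. if s * t = u then bracket (c x s) (c y t) else 0)"
      by (simp add: sum.delta')
    also have "\<dots> = (\<Sum>s\<in>UNIV. \<Sum>u\<in>UNIV. \<Sum>t\<in>UNIV. if s * t = u then bracket (c x s) (c y t) else 0)"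
      by (rule sum.cong[OF refl]) (rule sum.swap)
    also have "\<dots> = (\<Sum>u\<in>UNIV. \<Sum>s\<in>UNIV. \<Sum>t\<in>UNIV. if s * t = u then bracket (c x s) (c y t) else 0)"
      by (rule sum.swap)
    finally show "bracket x y = (\<Sum>u\<in>UNIV. \<Sum>s\<in>UNIV. \<Sum>t\<in>UNIV. if s * t = u then bracket (c x s) (c y t) else 0)" .
  qed
  define h where "h x = (\<lambda>(t, r). if r \<in> F then r (c x t) else 0)" for x
  have h_apply: "h x (t, r) = (if r \<in> F then r (c x t) else 0)" for x t r by (simp add: h_def)
  have hM: "h x \<in> Mfun F d" if "x \<in> L" for x
    using that by (simp add: Mfun_def h_apply F_Mat cL)
  have hG: "h x \<in> gcomp F d t" if x: "x \<in> GL t" for x t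
  proof -
    have "x \<in> L" using x G.component_subset by blast
    then show ?thesis by (simp add: gcomp_def hM h_apply c_comp[OF x] F_zero)
  qed
  have h_add: "h (x + y) = h x + h y" if "x \<in> L" "y \<in> L" for x y
    using that by (simp add: h_def fun_eq_iff c_add F_add cL)
  have h_scale: "h (scale k x) = fsmul k (h x)" if "x \<in> L" for x k
    using that by (simp add: h_def fun_eq_iff fsmul_def c_scale F_scale cL)
  \<comment> \<open>Written without subtraction, so that additivity of the coordinate map transfers
    it directly.\<close>
  have h_br: "h (bracket x y) + gmul (h y) (h x) = gmul (h x) (h y)" if x: "x \<in> L" and y: "y \<in> L" for x y
  proof (rule ext, clarify)
    fix u and r :: "'l \<Rightarrow> 'f rmat"
    show "(h (bracket x y) + gmul (h y) (h x)) (u, r) = gmul (h x) (h y) (u, r)"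
    proof (cases "r \<in> F")
      case True
      have "r (c (bracket x y) u) = (\<Sum>s\<in>UNIV. \<Sum>t\<in>UNIV. r (if s * t = u then bracket (c x s) (c y t) else 0))"
      proof -
        have 1: "(if s * t = u then bracket (c x s) (c y t) else 0) \<in> L" for s t
          using x y by (simp add: cL L.V_closed)
        then have 2: "(\<Sum>t\<in>UNIV. if s * t = u then bracket (c x s) (c y t) else 0) \<in> L" for s
          by (intro L.V_closed(6))
        show ?thesis unfolding c_br[OF x y] F_sum[OF True 2] F_sum[OF True 1] ..
      qed
      also have "\<dots> = (\<Sum>s\<in>UNIV. \<Sum>t\<in>UNIV. if s * t = u then r (c x s) * r (c y t) else 0)
          - (\<Sum>s\<in>UNIV. \<Sum>t\<in>UNIV. if s * t = u then r (c y t) * r (c x s) else 0)"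
        unfolding sum_subtractf[symmetric] using x y True by (intro sum.cong refl) (simp add: F_zero F_lie cL)
      \<comment> \<open>Commutativity of the semigroup enters here: exchanging the summation
        variables turns the condition s t = u into t s = u.\<close>
      also have "(\<Sum>s\<in>UNIV. \<Sum>t\<in>UNIV. if s * t = u then r (c y t) * r (c x s) else 0) = gmul (h y) (h x) (u, r)"
        unfolding gmul_apply h_apply by (subst sum.swap) (simp add: True mult.commute cong: if_cong)
      finally show ?thesis using True by (simp add: h_apply gmul_apply cong: if_cong)
    next
      case False
      then show ?thesis by (simp add: h_apply gmul_apply cong: if_cong)
    qed
  qed
  \<comment> \<open>Summing the values of \<open>h x\<close> at \<open>r\<close> over the semigroup
    gives back r x, so faithfulness of the family suffices.\<close>
  have h_inj: "x = y" if xy: "x \<in> L" "y \<in> L" "h x = h y" for x y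
  proof -
    have "x - y = 0"
    proof (rule faith)
      show "x - y \<in> L" using xy by (simp add: L.V_closed)
      fix r assume r: "r \<in> F"
      have "r (c x t) = r (c y t)" for t using fun_cong[OF xy(3), of "(t, r)"] r by (simp add: h_apply)
      then have "r x = r y"
        using F_sum[OF r, of UNIV "c x"] F_sum[OF r, of UNIV "c y"] xy cL c_sum by simp
      moreover have "r x = r (x - y) + r y" using F_add[OF r, of "x - y" y] xy by (simp add: L.V_closed)
      ultimately show "r (x - y) = 0" by simp
    qed
    then show ?thesis by simp
  qed
  let ?W = "Mfun F d :: ('t \<times> ('l \<Rightarrow> 'f rmat) \<Rightarrow> 'f rmat) set"
  obtain \<phi> :: "('t \<times> ('l \<Rightarrow> 'f rmat) \<Rightarrow> 'f rmat) \<Rightarrow> nat \<Rightarrow> 'f" and m where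
    A: "assoc_algebra_on fun_scale (\<phi> ` ?W) m" "graded_algebra_on fun_scale (\<phi> ` ?W) m (\<lambda>t. \<phi> ` gcomp F d t)"
    "finite_dimensional_on fun_scale (\<phi> ` ?W)" "inj_on \<phi> ?W"
    and \<phi>: "\<And>v w. v \<in> ?W \<Longrightarrow> w \<in> ?W \<Longrightarrow> \<phi> (v + w) = \<phi> v + \<phi> w"
    "\<And>c v. v \<in> ?W \<Longrightarrow> \<phi> (fsmul c v) = fun_scale c (\<phi> v)"
    "\<And>v w. v \<in> ?W \<Longrightarrow> w \<in> ?W \<Longrightarrow> m (\<phi> v) (\<phi> w) = \<phi> (gmul v w)"
    by (rule graded_algebra_transport[OF Mfun_assoc_algebra Mfun_graded_algebra Mfun_fd[OF F(1)]]) blast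
  have gW: "gmul (h x) (h y) \<in> ?W" if "x \<in> L" "y \<in> L" for x y
    by (rule algebra_on.prd_closed[OF assoc_algebra_on.axioms(1)[OF Mfun_assoc_algebra] hM[OF that(1)] hM[OF that(2)]])
  have hom: "lie_algebra_hom_on scale L bracket fun_scale (\<phi> ` ?W) (commutator m) (\<lambda>x. \<phi> (h x))"
  proof (intro lie_algebra_hom_on.intro lie_algebra_hom_on_axioms.intro assms(1))
    show "lie_algebra_on fun_scale (\<phi> ` ?W) (commutator m)" by (rule assoc_algebra_on.lie_algebra_commutator[OF A(1)])
    fix x assume x: "x \<in> L"
    show "\<phi> (h x) \<in> \<phi> ` ?W" by (rule imageI[OF hM[OF x]])
    show "\<phi> (h (scale k x)) = fun_scale k (\<phi> (h x))" for k unfolding h_scale[OF x] by (rule \<phi>(2)[OF hM[OF x]])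
    fix y assume y: "y \<in> L"
    show "\<phi> (h (x + y)) = \<phi> (h x) + \<phi> (h y)" unfolding h_add[OF x y] by (rule \<phi>(1)[OF hM[OF x] hM[OF y]])
    have "\<phi> (h (bracket x y)) + \<phi> (gmul (h y) (h x)) = \<phi> (gmul (h x) (h y))"
      unfolding \<phi>(1)[OF hM[OF L.prd_closed[OF x y]] gW[OF y x], symmetric] h_br[OF x y] ..
    then show "\<phi> (h (bracket x y)) = commutator m (\<phi> (h x)) (\<phi> (h y))"
      unfolding commutator_def \<phi>(3)[OF hM[OF x] hM[OF y]] \<phi>(3)[OF hM[OF y] hM[OF x]]
      by (rule eq_diff_eq[THEN iffD2])
  qed
  have inj: "inj_on (\<lambda>x. \<phi> (h x)) L"
    by (rule inj_onI) (use h_inj inj_onD[OF A(4)] hM in blast)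
  have "(\<lambda>x. \<phi> (h x)) ` GL t \<subseteq> \<phi> ` gcomp F d t" for t using hG by blast
  then show ?thesis using A(1,2,3) hom inj
    by (intro exI[of _ "\<phi> ` ?W"] exI[of _ m] exI[of _ "\<lambda>t. \<phi> ` gcomp F d t"] exI[of _ "\<lambda>x. \<phi> (h x)"]) blast
qed

end
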